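(* There is an algorithm that, given an $n\times n$ symmetric matrix $M$ over a finite alphabet $A$ and an integer $d$, runs in time $\mathcal O_{d,|A|}(n^2\log n)$ and either correctly reports that the twin-width of $M$ is larger than $d$, or outputs a $D$-sequence for $M$ with $D=\exp(\exp(\exp(\mathcal O_{|A|}(d^4))))$.
   Context: A matrix over $A$ with row set $R$ and column set $C$ is identified with the ordered binary structure on $R\uplus C$ with a unary relation for rows, a total order extending the row and column orders with rows before columns, and for each $a\in A$ a binary relation $E_a(r,c)$ holding iff $r\in R$, $c\in C$ and the entry is $a$. A contraction sequence is a sequence of partitions of the domain from singletons to a single part, each obtained from the previous one by merging two parts; distinct parts $X,Y$ are red-adjacent if there are $u,u'\in X$, $v,v'\in Y$ with $(u,v)$ and $(u',v')$ of different atomic types (which unary relations contain each element, which binary relations contain $(u,v)$ and $(v,u)$). A $D$-sequence is a contraction sequence in which at every step each part is red-adjacent to at most $D$ other parts; the twin-width is the least $D$ admitting a $D$-sequence. $\mathcal O_{d,|A|}$ hides factors depending only on $d$ and $|A|$; $\mathcal O_{|A|}$ hides factors depending only on $|A|$. *)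

theory Defs
  imports Complex_Main "HOL-Library.Disjoint_Sets" "Jordan_Normal_Form.Matrix"
begin

section \<open>Relational structures and twin-width\<close>

record ('v, 'i, 'b) bin_structure =
  universe :: "'v set"
  unary :: "'i \<Rightarrow> 'v set"
  binary :: "'b \<Rightarrow> ('v \<times> 'v) set"

definition same_atomic_type ::
  "('v, 'i, 'b) bin_structure \<Rightarrow> 'v \<times> 'v \<Rightarrow> 'v \<times> 'v \<Rightarrow> bool" where
  "same_atomic_type S = (\<lambda>(u, v) (u', v').
     (\<forall>i. (u \<in> unary S i \<longleftrightarrow> u' \<in> unary S i) \<and> (v \<in> unary S i \<longleftrightarrow> v' \<in> unary S i)) \<and>
     (\<forall>b. ((u, v) \<in> binary S b \<longleftrightarrow> (u', v') \<in> binary S b) \<and>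
          ((v, u) \<in> binary S b \<longleftrightarrow> (v', u') \<in> binary S b)))"

definition red_adjacent :: "('v, 'i, 'b) bin_structure \<Rightarrow> 'v set \<Rightarrow> 'v set \<Rightarrow> bool" where
  "red_adjacent S X Y \<longleftrightarrow> X \<noteq> Y \<and>
     (\<exists>u\<in>X. \<exists>u'\<in>X. \<exists>v\<in>Y. \<exists>v'\<in>Y. \<not> same_atomic_type S (u, v) (u', v'))"

definition contraction_step :: "'v set set \<Rightarrow> 'v set set \<Rightarrow> bool" where
  "contraction_step P Q \<longleftrightarrow>
     (\<exists>X\<in>P. \<exists>Y\<in>P. X \<noteq> Y \<and> Q = insert (X \<union> Y) (P - {X, Y}))"

definition contraction_sequence :: "'v set \<Rightarrow> 'v set set list \<Rightarrow> bool" where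
  "contraction_sequence V Ps \<longleftrightarrow>
     Ps \<noteq> [] \<and> (\<forall>P\<in>set Ps. partition_on V P) \<and>
     hd Ps = (\<lambda>v. {v}) ` V \<and> last Ps = {V} \<and>
     (\<forall>t. Suc t < length Ps \<longrightarrow> contraction_step (Ps ! t) (Ps ! Suc t))"

definition D_sequence :: "('v, 'i, 'b) bin_structure \<Rightarrow> nat \<Rightarrow> 'v set set list \<Rightarrow> bool" where
  "D_sequence S D Ps \<longleftrightarrow> contraction_sequence (universe S) Ps \<and>
     (\<forall>P\<in>set Ps. \<forall>X\<in>P. card {Y\<in>P. red_adjacent S X Y} \<le> D)"

text \<open>Meaningful for structures with a finite nonempty universe, for which a contraction
  sequence exists.\<close>

definition twin_width :: "('v, 'i, 'b) bin_structure \<Rightarrow> nat" where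
  "twin_width S = (LEAST D. \<exists>Ps. D_sequence S D Ps)"

section \<open>Matrices as ordered binary structures\<close>

text \<open>Row \<open>i\<close> is the element \<open>Inl i\<close> and column \<open>j\<close> the element \<open>Inr j\<close>.  In the total order
  an element with row count \<open>m\<close> has position \<open>vertex_index m\<close>; the same number names it in the
  output of an algorithm.\<close>

fun vertex_index :: "nat \<Rightarrow> nat + nat \<Rightarrow> nat" where
  "vertex_index m (Inl i) = i"
| "vertex_index m (Inr j) = m + j"

definition matrix_universe :: "'a mat \<Rightarrow> (nat + nat) set" where
  "matrix_universe M = {..<dim_row M} <+> {..<dim_col M}"

text \<open>The binary relation \<open>None\<close> is the order and \<open>Some a\<close> is \<open>E\<^sub>a\<close>.  Symbols \<open>a\<close> that do not
  occur in \<open>M\<close> have an empty relation, which has no influence on atomic types, so the alphabet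
  is not a parameter.\<close>

definition matrix_structure :: "'a mat \<Rightarrow> (nat + nat, unit, 'a option) bin_structure" where
  "matrix_structure M = \<lparr>
     universe = matrix_universe M,
     unary = (\<lambda>_. Inl ` {..<dim_row M}),
     binary = (\<lambda>b. case b of
         None \<Rightarrow> {(u, v). u \<in> matrix_universe M \<and> v \<in> matrix_universe M \<and>
                    vertex_index (dim_row M) u \<le> vertex_index (dim_row M) v}
       | Some a \<Rightarrow> {(Inl r, Inr c) | r c. r < dim_row M \<and> c < dim_col M \<and> M $$ (r, c) = a}) \<rparr>"

section \<open>Random access machines\<close>

text \<open>A unit-cost RAM with integer registers and an integer-addressed memory.  Words are
  unbounded in the semantics; \<open>words_bounded\<close> below restricts a run to words of bounded size.\<close>

datatype instr =
    Const nat int        \<comment> \<open>\<open>r := k\<close>\<close>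
  | Move nat nat         \<comment> \<open>\<open>r := s\<close>\<close>
  | Add nat nat nat      \<comment> \<open>\<open>r := s + t\<close>\<close>
  | Sub nat nat nat      \<comment> \<open>\<open>r := s - t\<close>\<close>
  | Mul nat nat nat      \<comment> \<open>\<open>r := s * t\<close>\<close>
  | Div nat nat nat      \<comment> \<open>\<open>r := s div t\<close>, rounding down, with \<open>s div 0 = 0\<close>\<close>
  | Load nat nat         \<comment> \<open>\<open>r := mem[s]\<close>\<close>
  | Store nat nat        \<comment> \<open>\<open>mem[r] := s\<close>\<close>
  | Jump nat             \<comment> \<open>\<open>goto l\<close>\<close>
  | Jump_less nat nat nat \<comment> \<open>\<open>if r < s then goto l\<close>\<close>

type_synonym program = "instr list"

record config =
  pc :: nat
  reg :: "nat \<Rightarrow> int"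
  mem :: "int \<Rightarrow> int"

fun exec_instr :: "instr \<Rightarrow> config \<Rightarrow> config" where
  "exec_instr (Const r k) c = c\<lparr>pc := pc c + 1, reg := (reg c)(r := k)\<rparr>"
| "exec_instr (Move r s) c = c\<lparr>pc := pc c + 1, reg := (reg c)(r := reg c s)\<rparr>"
| "exec_instr (Add r s t) c = c\<lparr>pc := pc c + 1, reg := (reg c)(r := reg c s + reg c t)\<rparr>"
| "exec_instr (Sub r s t) c = c\<lparr>pc := pc c + 1, reg := (reg c)(r := reg c s - reg c t)\<rparr>"
| "exec_instr (Mul r s t) c = c\<lparr>pc := pc c + 1, reg := (reg c)(r := reg c s * reg c t)\<rparr>"
| "exec_instr (Div r s t) c = c\<lparr>pc := pc c + 1, reg := (reg c)(r := reg c s div reg c t)\<rparr>"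
| "exec_instr (Load r s) c = c\<lparr>pc := pc c + 1, reg := (reg c)(r := mem c (reg c s))\<rparr>"
| "exec_instr (Store r s) c = c\<lparr>pc := pc c + 1, mem := (mem c)(reg c r := reg c s)\<rparr>"
| "exec_instr (Jump l) c = c\<lparr>pc := l\<rparr>"
| "exec_instr (Jump_less r s l) c = c\<lparr>pc := (if reg c r < reg c s then l else pc c + 1)\<rparr>"

definition halted :: "program \<Rightarrow> config \<Rightarrow> bool" where
  "halted p c \<longleftrightarrow> length p \<le> pc c"

definition step :: "program \<Rightarrow> config \<Rightarrow> config" where
  "step p c = (if halted p c then c else exec_instr (p ! pc c) c)"

definition run :: "program \<Rightarrow> nat \<Rightarrow> config \<Rightarrow> config" where
  "run p t c = (step p ^^ t) c"

definition words_bounded :: "real \<Rightarrow> config \<Rightarrow> bool" where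
  "words_bounded B c \<longleftrightarrow>
     (\<forall>r. real_of_int \<bar>reg c r\<bar> \<le> B) \<and> (\<forall>a. real_of_int \<bar>mem c a\<bar> \<le> B)"

section \<open>Input and output conventions\<close>

text \<open>Registers 0, 1, 2 hold the dimension, the size \<open>k\<close> of the alphabet and the parameter \<open>d\<close>;
  the matrix is stored row by row from address 0, its symbols being encoded by \<open>code\<close>.\<close>

definition input_config :: "nat \<Rightarrow> ('a \<Rightarrow> nat) \<Rightarrow> 'a mat \<Rightarrow> int \<Rightarrow> config" where
  "input_config k code M d = \<lparr>
     pc = 0,
     reg = (\<lambda>r. if r = 0 then int (dim_row M) else if r = 1 then int k
                else if r = 2 then d else 0),
     mem = (\<lambda>a. if 0 \<le> a \<and> a < int (dim_row M * dim_col M)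
                then int (code (M $$ (nat a div dim_col M, nat a mod dim_col M))) else 0) \<rparr>"

text \<open>A contraction sequence is output as a list of pairs of elements: the pair \<open>(u, v)\<close> stands
  for merging the part that contains \<open>u\<close> with the part that contains \<open>v\<close>.\<close>

definition merge_parts :: "'v \<Rightarrow> 'v \<Rightarrow> 'v set set \<Rightarrow> 'v set set" where
  "merge_parts u v P =
     insert (\<Union>{X\<in>P. u \<in> X \<or> v \<in> X}) (P - {X\<in>P. u \<in> X \<or> v \<in> X})"

fun merge_sequence :: "'v set set \<Rightarrow> ('v \<times> 'v) list \<Rightarrow> 'v set set list" where
  "merge_sequence P [] = [P]"
| "merge_sequence P ((u, v) # es) = P # merge_sequence (merge_parts u v P) es"

definition outputs_sequence :: "'a mat \<Rightarrow> config \<Rightarrow> (nat + nat) set set list \<Rightarrow> bool" where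
  "outputs_sequence M c Ps \<longleftrightarrow> reg c 0 = 1 \<and>
     (\<exists>es. set es \<subseteq> matrix_universe M \<times> matrix_universe M \<and>
        (\<forall>t<length es.
           mem c (2 * int t) = int (vertex_index (dim_row M) (fst (es ! t))) \<and>
           mem c (2 * int t + 1) = int (vertex_index (dim_row M) (snd (es ! t)))) \<and>
        Ps = merge_sequence ((\<lambda>v. {v}) ` matrix_universe M) es)"

definition reports_larger :: "config \<Rightarrow> bool" where
  "reports_larger c \<longleftrightarrow> reg c 0 = 0"

end

theory Submission imports Defs "HOL-Library.FuncSet" begin

text \<open>Rows and columns share one division of \<open>{0..<n}\<close> into intervals, at first into
  singletons.  For a set \<open>C\<close> of columns the rows are cut greedily into segments with at most
  \<open>k ^ (d + 1)\<close> distinct rows on \<open>C\<close>, and two consecutive parts are merged as long as the cuts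
  for their union hit at most \<open>maxhit\<close> parts.  If this gets stuck with two parts or more, there is
  no \<open>d\<close>-sequence: at the first time when one of its parts \<open>Z\<close> meets three blocks of the division,
  a middle block lies between two elements of \<open>Z\<close>, hence meets at most \<open>d + 1\<close> parts, and apart from
  the few blocks met by their red neighbours it has at most \<open>k ^ (d + 1)\<close> distinct rows there, so
  it has few hits.  Otherwise only few parts are bad for a given part, that is, see many distinct
  rows of it; two rows of a part are identified as soon as they agree on all parts that are not bad.
  Every part then consists of a bounded number of classes, and a class can be red-adjacent only to
  classes in the same part or in the boundedly many bad parts: the identifications are the output.

  A row of the matrix is stored for each part as a label, with equal labels for equal rows, and
  labels for a union of two parts are found by one look-up per row in a table indexed by pairs of
  labels; so a merge takes linear time and the total time is quadratic.  The program is written in a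
  small imperative language with a verified compiler to the random access machine.\<close>

section \<open>An imperative language\<close>

text \<open>One inequality fixes the constants: over k symbols, r distinct columns allow at most k^r
  distinct rows. By symmetry a column is again a row, so the single count \<open>rows\<close> serves
  both directions. Two classes are homogeneous to each other only if their parts look simple in both
  directions, and simplicity passes to the other direction at exponential cost. Hence two
  thresholds: below \<open>thr\<close> one way forces below \<open>big\<close> the other way. As
  \<open>thr\<close> is exponential in d and stands in an exponent of \<open>big\<close>, the degree
  is doubly exponential in d.

  The case d = 0 shapes the development. There the required bound is exp(exp(exp 0)) whatever the
  alphabet, while the general degree grows with k. Twin-width 0 forces a constant matrix, which is
  recognised while the input is copied; on a constant matrix the same merging has one class per part
  and no bad parts, so degree 2. For this reason the main loop is verified against abstract bounds
  on classes and bad parts, instantiated once in general and once for constant matrices.\<close>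

datatype expr = N nat | V nat | Plus expr expr | Minus expr expr | Times expr expr | Rd nat expr expr
datatype cond = Lt expr expr | Eq expr expr
datatype cmd = Skip | Set nat expr | Put nat expr expr expr | Seq cmd cmd (infixr ";;" 60)
  | Ifte cond cmd cmd | Loop cond cmd

record st =
  var :: "nat \<Rightarrow> nat"
  arr :: "nat \<Rightarrow> nat \<Rightarrow> nat \<Rightarrow> nat"
  clk :: nat

fun val :: "expr \<Rightarrow> st \<Rightarrow> nat" where
  "val (N c) s = c"
| "val (V v) s = var s v"
| "val (Plus a b) s = val a s + val b s"
| "val (Minus a b) s = val a s - val b s"
| "val (Times a b) s = val a s * val b s"
| "val (Rd a i j) s = arr s a (val i s) (val j s)"

text \<open>Expressions compile to straight-line code, so one number is both the length of the code
  and its running time. Array 0 has no second coordinate to compute, which makes its access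
  cheaper.\<close>

fun ecost :: "expr \<Rightarrow> nat" where
  "ecost (N c) = 1"
| "ecost (V v) = 1"
| "ecost (Plus a b) = ecost a + ecost b + 1"
| "ecost (Minus a b) = ecost a + ecost b + 1"
| "ecost (Times a b) = ecost a + ecost b + 1"
| "ecost (Rd a i j) = (if a = 0 then ecost i + 1 else ecost i + ecost j + 7)"

fun holds :: "cond \<Rightarrow> st \<Rightarrow> bool" where
  "holds (Lt a b) s \<longleftrightarrow> val a s < val b s"
| "holds (Eq a b) s \<longleftrightarrow> val a s = val b s"

text \<open>Every test ends in exactly two jumps, which account for the 2.\<close>

fun ccost :: "cond \<Rightarrow> nat" where
  "ccost (Lt a b) = ecost a + ecost b + 2"
| "ccost (Eq a b) = ecost a + ecost b + 2"

text \<open>Array 0 is one-dimensional: row length 1 leaves 0 as its only second index.\<close>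

definition width :: "nat \<Rightarrow> nat \<Rightarrow> nat" where
  "width S a = (if a = 0 then 1 else S)"

definition TB :: nat where "TB = 50"
definition SR :: nat where "SR = 3"

text \<open>Array 0 lives at the nonnegative addresses (it is the input and output area); the
  two-dimensional arrays 1 to 7, with row length \<open>S\<close> (kept in register \<open>SR\<close>), are interleaved at the negative ones.\<close>

definition addr :: "nat \<Rightarrow> nat \<Rightarrow> nat \<Rightarrow> nat \<Rightarrow> int" where
  "addr S a i j = (if a = 0 then int i else (int i * int S + int j) * (-8) + - int a)"

text \<open>No run-time check guards the machine: \<open>okE\<close> collects the conditions under which the
  compiled code stays within its words and arrays and truncated subtraction is exact.\<close>

fun okE :: "nat \<Rightarrow> nat \<Rightarrow> expr \<Rightarrow> st \<Rightarrow> bool" where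
  "okE S B (N c) s \<longleftrightarrow> c \<le> B"
| "okE S B (V v) s \<longleftrightarrow> v < TB"
| "okE S B (Plus a b) s \<longleftrightarrow> okE S B a s \<and> okE S B b s \<and> val a s + val b s \<le> B"
| "okE S B (Minus a b) s \<longleftrightarrow> okE S B a s \<and> okE S B b s \<and> val b s \<le> val a s"
| "okE S B (Times a b) s \<longleftrightarrow> okE S B a s \<and> okE S B b s \<and> val a s * val b s \<le> B"
| "okE S B (Rd a i j) s \<longleftrightarrow> a < 8 \<and> okE S B i s \<and> okE S B j s \<and> val i s \<le> B \<and> val j s < width S a"

fun okC :: "nat \<Rightarrow> nat \<Rightarrow> cond \<Rightarrow> st \<Rightarrow> bool" where
  "okC S B (Lt a b) s \<longleftrightarrow> okE S B a s \<and> okE S B b s"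
| "okC S B (Eq a b) s \<longleftrightarrow> okE S B a s \<and> okE S B b s"

definition tick :: "nat \<Rightarrow> st \<Rightarrow> st" where "tick k s = s\<lparr>clk := clk s + k\<rparr>"
definition setv :: "nat \<Rightarrow> nat \<Rightarrow> st \<Rightarrow> st" where "setv v x s = s\<lparr>var := (var s)(v := x)\<rparr>"
definition put :: "nat \<Rightarrow> nat \<Rightarrow> nat \<Rightarrow> nat \<Rightarrow> st \<Rightarrow> st" where
  "put a i j x s = s\<lparr>arr := (arr s)(a := (arr s a)(i := (arr s a i)(j := x)))\<rparr>"

lemma st_simps [simp]:
  "var (tick k s) = var s" "arr (tick k s) = arr s" "clk (tick k s) = clk s + k"
  "var (setv v x s) = (var s)(v := x)" "arr (setv v x s) = arr s" "clk (setv v x s) = clk s"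
  "var (put a i j x s) = var s" "clk (put a i j x s) = clk s"
  "arr (put a i j x s) = (arr s)(a := (arr s a)(i := (arr s a i)(j := x)))"
  by (auto simp: tick_def setv_def put_def)

text \<open>The premises \<open>okE\<close> and \<open>okC\<close> make a derivation certify
  termination and safety at once. Clock charges are upper bounds for the compiled code; the flat 10
  of \<open>Put\<close> covers the address computation and the store. \<open>SR\<close> is never
  assigned because all addresses of the two-dimensional arrays depend on it.\<close>

inductive exec :: "nat \<Rightarrow> nat \<Rightarrow> cmd \<Rightarrow> st \<Rightarrow> st \<Rightarrow> bool" for S B where
  Skip: "exec S B Skip s s"
| Set: "okE S B e s \<Longrightarrow> v < TB \<Longrightarrow> v \<noteq> SR \<Longrightarrow>
    exec S B (Set v e) s (tick (ecost e + 1) (setv v (val e s) s))"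
| Put: "okE S B i s \<Longrightarrow> okE S B j s \<Longrightarrow> okE S B e s \<Longrightarrow> a < 8 \<Longrightarrow>
    val i s \<le> B \<Longrightarrow> val j s < width S a \<Longrightarrow>
    exec S B (Put a i j e) s (tick (ecost i + ecost j + ecost e + 10) (put a (val i s) (val j s) (val e s) s))"
| Seq: "exec S B c1 s s' \<Longrightarrow> exec S B c2 s' s'' \<Longrightarrow> exec S B (c1 ;; c2) s s''"
| IfT: "okC S B b s \<Longrightarrow> holds b s \<Longrightarrow> exec S B c1 (tick (ccost b + 1) s) s' \<Longrightarrow> exec S B (Ifte b c1 c2) s s'"
| IfF: "okC S B b s \<Longrightarrow> \<not> holds b s \<Longrightarrow> exec S B c2 (tick (ccost b + 1) s) s' \<Longrightarrow> exec S B (Ifte b c1 c2) s s'"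
| LoopT: "okC S B b s \<Longrightarrow> holds b s \<Longrightarrow> exec S B c (tick (ccost b + 1) s) s' \<Longrightarrow>
    exec S B (Loop b c) s' s'' \<Longrightarrow> exec S B (Loop b c) s s''"
| LoopF: "okC S B b s \<Longrightarrow> \<not> holds b s \<Longrightarrow> exec S B (Loop b c) s (tick (ccost b + 1) s)"

section \<open>Compilation to the random access machine\<close>

text \<open>Expects i in register t and j in t+1. Once j has been added, t+1 is free to hold the
  constants -8 and -a, since arithmetic takes only registers.\<close>

fun cadr :: "nat \<Rightarrow> nat \<Rightarrow> instr list" where
  "cadr a t = [Mul t t SR, Add t t (t+1), Const (t+1) (-8), Mul t t (t+1), Const (t+1) (- int a), Add t t (t+1)]"

fun compE :: "expr \<Rightarrow> nat \<Rightarrow> instr list" where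
  "compE (N c) t = [Const t (int c)]"
| "compE (V v) t = [Move t v]"
| "compE (Plus a b) t = compE a t @ compE b (t+1) @ [Add t t (t+1)]"
| "compE (Minus a b) t = compE a t @ compE b (t+1) @ [Sub t t (t+1)]"
| "compE (Times a b) t = compE a t @ compE b (t+1) @ [Mul t t (t+1)]"
| "compE (Rd a i j) t = (if a = 0 then compE i t @ [Load t t]
     else compE i t @ compE j (t+1) @ cadr a t @ [Load t t])"

text \<open>Falling through means that the test holds. There is no equality jump: two strict
  comparisons leave for the exit l when either one succeeds. For \<open>Lt\<close> a successful
  comparison skips the unconditional exit.\<close>

fun compB :: "cond \<Rightarrow> nat \<Rightarrow> nat \<Rightarrow> instr list" where
  "compB (Lt a b) pos l = compE a TB @ compE b (TB+1) @ [Jump_less TB (TB+1) (pos + ecost a + ecost b + 2), Jump l]"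
| "compB (Eq a b) pos l = compE a TB @ compE b (TB+1) @ [Jump_less TB (TB+1) l, Jump_less (TB+1) TB l]"

text \<open>Jump targets are absolute, so the size of a command has to be known before the code
  around it is generated.\<close>

fun csize :: "cmd \<Rightarrow> nat" where
  "csize Skip = 0"
| "csize (Set v e) = ecost e + 1"
| "csize (Put a i j e) = (if a = 0 then ecost i + ecost e + 1 else ecost i + ecost j + 6 + ecost e + 1)"
| "csize (c1 ;; c2) = csize c1 + csize c2"
| "csize (Ifte b c1 c2) = ccost b + csize c1 + 1 + csize c2"
| "csize (Loop b c) = ccost b + csize c + 1"

fun compC :: "cmd \<Rightarrow> nat \<Rightarrow> instr list" where
  "compC Skip pos = []"
| "compC (Set v e) pos = compE e TB @ [Move v TB]"
| "compC (Put a i j e) pos = (if a = 0 then compE i TB @ compE e (TB+1) @ [Store TB (TB+1)]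
     else compE i TB @ compE j (TB+1) @ cadr a TB @ compE e (TB+1) @ [Store TB (TB+1)])"
| "compC (c1 ;; c2) pos = compC c1 pos @ compC c2 (pos + csize c1)"
| "compC (Ifte b c1 c2) pos = compB b pos (pos + ccost b + csize c1 + 1) @ compC c1 (pos + ccost b) @
     [Jump (pos + ccost b + csize c1 + 1 + csize c2)] @ compC c2 (pos + ccost b + csize c1 + 1)"
| "compC (Loop b c) pos = compB b pos (pos + ccost b + csize c + 1) @ compC c (pos + ccost b) @ [Jump pos]"

lemma length_cadr: "length (cadr a t) = 6" by simp

lemma length_compE [simp]: "length (compE e t) = ecost e"
  by (induction e arbitrary: t) auto

lemma length_compB [simp]: "length (compB b pos l) = ccost b"
  by (cases b) auto

lemma length_compC [simp]: "length (compC c pos) = csize c"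
  by (induction c arbitrary: pos) auto

definition code_at :: "program \<Rightarrow> nat \<Rightarrow> instr list \<Rightarrow> bool" where
  "code_at p pos xs \<longleftrightarrow> (\<exists>ys zs. p = ys @ xs @ zs \<and> length ys = pos)"

lemma code_at_append [simp]:
  "code_at p pos (xs @ ys) \<longleftrightarrow> code_at p pos xs \<and> code_at p (pos + length xs) ys"
proof
  assume "code_at p pos xs \<and> code_at p (pos + length xs) ys"
  then obtain a b c e where h: "p = a @ xs @ b" "length a = pos" "p = c @ ys @ e" "length c = pos + length xs"
    unfolding code_at_def by (elim conjE exE)
  then have "(a @ xs) @ b = c @ (ys @ e)" and "length (a @ xs) = length c" by auto
  then have "a @ xs = c \<and> b = ys @ e" by (metis append_eq_append_conv)
  then show "code_at p pos (xs @ ys)" unfolding code_at_def using h by (metis append.assoc)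
next
  assume "code_at p pos (xs @ ys)"
  then obtain a b where h: "p = a @ (xs @ ys) @ b" "length a = pos" unfolding code_at_def by auto
  have "p = a @ xs @ (ys @ b)" "p = (a @ xs) @ ys @ b" "length (a @ xs) = pos + length xs" using h by auto
  then show "code_at p pos xs \<and> code_at p (pos + length xs) ys" unfolding code_at_def using h(2) by blast
qed

lemma code_at_Cons: "code_at p pos (x # xs) \<longleftrightarrow> pos < length p \<and> p ! pos = x \<and> code_at p (Suc pos) xs"
proof -
  have "code_at p pos [x] \<longleftrightarrow> pos < length p \<and> p ! pos = x"
    unfolding code_at_def
  proof
    assume "pos < length p \<and> p ! pos = x"
    then show "\<exists>ys zs. p = ys @ [x] @ zs \<and> length ys = pos"
      by (intro exI[of _ "take pos p"] exI[of _ "drop (Suc pos) p"]) (auto simp: id_take_nth_drop)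
  qed (auto simp: nth_append)
  then show ?thesis using code_at_append[of p pos "[x]" xs] by simp
qed

lemma code_at_Nil: "code_at p pos [] \<longleftrightarrow> pos \<le> length p"
  unfolding code_at_def
proof
  assume "pos \<le> length p"
  then show "\<exists>ys zs. p = ys @ [] @ zs \<and> length ys = pos"
    by (intro exI[of _ "take pos p"] exI[of _ "drop pos p"]) auto
qed auto

text \<open>The final claim bounds the words of every configuration on the way, so this bound is
  composed together with the run.\<close>

definition reach :: "program \<Rightarrow> real \<Rightarrow> nat \<Rightarrow> config \<Rightarrow> config \<Rightarrow> bool" where
  "reach p W t c c' \<longleftrightarrow> run p t c = c' \<and> (\<forall>s\<le>t. words_bounded W (run p s c))"

lemma run_add: "run p (s + t) c = run p t (run p s c)"
  unfolding run_def by (induction s arbitrary: c) (auto simp: funpow_swap1)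

lemma reach_trans:
  assumes "reach p W t c c'" "reach p W u c' c''"
  shows "reach p W (t + u) c c''"
  unfolding reach_def
proof (intro conjI allI impI)
  show "run p (t + u) c = c''" using assms by (simp add: reach_def run_add)
  fix s assume "s \<le> t + u"
  show "words_bounded W (run p s c)"
  proof (cases "s \<le> t")
    case False
    then have "s = t + (s - t)" "s - t \<le> u" using \<open>s \<le> t + u\<close> by auto
    then show ?thesis using assms unfolding reach_def by (metis run_add)
  qed (use assms in \<open>auto simp: reach_def\<close>)
qed

lemma reach_refl: "words_bounded W c \<Longrightarrow> reach p W 0 c c"
  by (simp add: reach_def run_def)

lemma reach_Suc:
  assumes "reach p W t c c'" "pc c' < length p" "exec_instr (p ! pc c') c' = c''" "words_bounded W c''"
  shows "reach p W (Suc t) c c''"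
proof -
  have "run p 1 c' = c''" using assms by (simp add: run_def step_def halted_def)
  then have "reach p W 1 c' c''"
    unfolding reach_def using assms by (auto simp: le_Suc_eq run_def reach_def)
  from reach_trans[OF assms(1) this] show ?thesis by simp
qed

text \<open>The relation between machine and language states; the registers from \<open>TB\<close> on are scratch.\<close>

definition simst :: "nat \<Rightarrow> real \<Rightarrow> st \<Rightarrow> config \<Rightarrow> bool" where
  "simst S W s c \<longleftrightarrow> words_bounded W c \<and> (\<forall>v<TB. reg c v = int (var s v)) \<and> reg c SR = int S \<and>
     (\<forall>a<8. \<forall>i j. j < width S a \<longrightarrow> mem c (addr S a i j) = int (arr s a i j))"

text \<open>Array 0 is separated from the others by the sign. On the negative side the residue
  modulo 8 recovers the array, and the quotient is a number in base S with last digit j.\<close>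

lemma addr_inj:
  assumes "addr S a i j = addr S a' i' j'" "a < 8" "a' < 8" "j < width S a" "j' < width S a'"
  shows "a = a' \<and> i = i' \<and> j = j'"
proof -
  consider "a = 0" "a' = 0" | "a = 0" "a' > 0" | "a > 0" "a' = 0" | "a > 0" "a' > 0" by auto
  then show ?thesis
  proof cases
    case 1 then show ?thesis using assms by (auto simp: addr_def width_def)
  next
    case 2
    have "0 \<le> int i' * int S + int j'" by simp
    then have "addr S a' i' j' < 0" using 2 unfolding addr_def by (simp; linarith)
    then show ?thesis using assms(1) 2 by (simp add: addr_def)
  next
    case 3
    have "0 \<le> int i * int S + int j" by simp
    then have "addr S a i j < 0" using 3 unfolding addr_def by (simp; linarith)
    then show ?thesis using assms(1) 3 by (simp add: addr_def)
  next
    case 4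
    have e: "8 * (int i * int S + int j) + int a = 8 * (int i' * int S + int j') + int a'"
      using assms(1) 4 by (simp add: addr_def)
    have j: "j < S" "j' < S" using assms 4 by (auto simp: width_def)
    have "int (8 * (i * S + j) + a) = int (8 * (i' * S + j') + a')"
      using e by (simp only: of_nat_add of_nat_mult of_nat_numeral)
    then have "8 * (i * S + j) + a = 8 * (i' * S + j') + a'" by (simp only: of_nat_eq_iff)
    then have a: "a = a'" and ij: "i * S + j = i' * S + j'" using assms by presburger+
    have "(i * S + j) div S = i" "(i' * S + j') div S = i'" using j by auto
    then have "i = i'" using ij by metis
    then show ?thesis using a ij by simp
  qed
qed

text \<open>\<open>B\<close> bounds the values of the language, \<open>W\<close> the words of the machine.\<close>

definition fits :: "nat \<Rightarrow> nat \<Rightarrow> real \<Rightarrow> bool" where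
  "fits S B W \<longleftrightarrow> real (8 * (B * S + S) + 8) \<le> W \<and> real B \<le> W"

lemma words_bounded_reg:
  "words_bounded W c \<Longrightarrow> real_of_int \<bar>x\<bar> \<le> W \<Longrightarrow> words_bounded W (c\<lparr>pc := l, reg := (reg c)(r := x)\<rparr>)"
  by (auto simp: words_bounded_def)

lemma words_bounded_mem:
  "words_bounded W c \<Longrightarrow> real_of_int \<bar>x\<bar> \<le> W \<Longrightarrow> words_bounded W (c\<lparr>pc := l, mem := (mem c)(a := x)\<rparr>)"
  by (auto simp: words_bounded_def)

lemma words_bounded_pc [simp]: "words_bounded W (c\<lparr>pc := l\<rparr>) = words_bounded W c"
  by (auto simp: words_bounded_def)

lemma simst_val_bound: "simst S W s c \<Longrightarrow> v < TB \<Longrightarrow> real (var s v) \<le> W"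
  unfolding simst_def words_bounded_def by (metis abs_of_nat of_int_of_nat_eq)

text \<open>Only constants, sums and products are bounded through \<open>B\<close>. A value fetched
  from a variable or an array is bounded because the simulated machine already holds it in a word,
  and subtraction only lowers a value.\<close>

lemma val_bound:
  assumes "simst S W s c" "okE S B e s" "fits S B W"
  shows "real (val e s) \<le> W"
  using assms(2)
proof (induction e)
  case (N x) then show ?case using assms(3) by (auto simp: fits_def)
next
  case (V x) then show ?case using simst_val_bound[OF assms(1)] by auto
next
  case (Plus e1 e2) then show ?case using assms(3) unfolding fits_def okE.simps val.simps by (meson dual_order.trans of_nat_mono)
next
  case (Times e1 e2) then show ?case using assms(3) unfolding fits_def okE.simps val.simps by (meson dual_order.trans of_nat_mono)
next
  case (Minus e1 e2) then show ?case using assms(3) by (auto simp: fits_def)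
next
  case (Rd a i j)
  then have "real_of_int \<bar>int (arr s a (val i s) (val j s))\<bar> \<le> W"
    using assms(1) unfolding simst_def words_bounded_def by (metis okE.simps(6))
  then show ?case by simp
qed

lemma reach_instr:
  assumes "reach p W n c c'" "code_at p (pc c') (x # xs)"
    "exec_instr x c' = c'\<lparr>pc := pc c' + 1, reg := (reg c')(r := k)\<rparr>" "real_of_int \<bar>k\<bar> \<le> W"
  shows "\<exists>c''. reach p W (Suc n) c c'' \<and> c'' = c'\<lparr>pc := pc c' + 1, reg := (reg c')(r := k)\<rparr>"
proof -
  have "words_bounded W (c'\<lparr>pc := pc c' + 1, reg := (reg c')(r := k)\<rparr>)"
    using assms by (intro words_bounded_reg) (auto simp: reach_def)
  then show ?thesis using reach_Suc[OF assms(1)] assms(2,3) by (auto simp: code_at_Cons)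
qed

text \<open>Only registers from t on may change. Raising t for the right operand therefore preserves
  the left one.\<close>

definition evals :: "program \<Rightarrow> real \<Rightarrow> nat \<Rightarrow> nat \<Rightarrow> int \<Rightarrow> config \<Rightarrow> bool" where
  "evals p W n t x c \<longleftrightarrow> (\<exists>c'. reach p W n c c' \<and> pc c' = pc c + n \<and> reg c' t = x \<and>
     mem c' = mem c \<and> (\<forall>r<t. reg c' r = reg c r))"

lemma simst_frame:
  assumes "simst S W s c" "reach p W n c c'" "mem c' = mem c" "\<forall>r<t. reg c' r = reg c r" "TB \<le> t"
  shows "simst S W s c'"
proof -
  have "words_bounded W c'" using assms(2) unfolding reach_def by auto
  moreover have "SR < t" using assms(5) by (simp add: SR_def TB_def)
  ultimately show ?thesis using assms unfolding simst_def by auto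
qed

text \<open>The second operand starts from whatever configuration the first one leaves, so this
  premise can be met by an induction hypothesis as well as by a lone \<open>Const\<close>.\<close>

lemma evals_bin:
  assumes 1: "evals p W n t x c"
    and 2: "\<And>c'. reach p W n c c' \<Longrightarrow> pc c' = pc c + n \<Longrightarrow> mem c' = mem c \<Longrightarrow> \<forall>r<t. reg c' r = reg c r \<Longrightarrow>
       evals p W m (t+1) y c'"
    and code: "code_at p (pc c + n + m) (i # xs)"
    and i: "\<And>c'. exec_instr i c' = c'\<lparr>pc := pc c' + 1, reg := (reg c')(t := f (reg c' t) (reg c' (t+1)))\<rparr>"
    and b: "real_of_int \<bar>f x y\<bar> \<le> W"
  shows "evals p W (n + m + 1) t (f x y) c"
proof -
  obtain c1 where c1: "reach p W n c c1" "pc c1 = pc c + n" "reg c1 t = x" "mem c1 = mem c" "\<forall>r<t. reg c1 r = reg c r"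
    using 1 unfolding evals_def by blast
  from 2[OF c1(1,2,4,5)]
  obtain c2 where c2: "reach p W m c1 c2" "pc c2 = pc c1 + m" "reg c2 (t+1) = y" "mem c2 = mem c1"
    "\<forall>r<t+1. reg c2 r = reg c1 r"
    unfolding evals_def by blast
  have r: "reach p W (n + m) c c2" using reach_trans c1(1) c2(1) by blast
  let ?c = "c2\<lparr>pc := pc c2 + 1, reg := (reg c2)(t := f (reg c2 t) (reg c2 (t+1)))\<rparr>"
  have "reg c2 t = x" using c2(5) c1(3) by simp
  then have "\<exists>c''. reach p W (Suc (n + m)) c c'' \<and> c'' = ?c"
    using code c1(2) c2(2,3) b by (intro reach_instr[OF r _ i]) auto
  then have "reach p W (Suc (n + m)) c ?c" by simp
  then show ?thesis unfolding evals_def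
    using c1 c2 \<open>reg c2 t = x\<close> by (intro exI[of _ ?c]) auto
qed

lemma evals_Const:
  assumes "words_bounded W c" "code_at p (pc c) (Const t k # xs)" "real_of_int \<bar>k\<bar> \<le> W"
  shows "evals p W 1 t k c"
  using reach_instr[OF reach_refl[OF assms(1)] assms(2), of t k] assms(3)
  unfolding evals_def by auto

lemma reach_wb: "reach p W n c c' \<Longrightarrow> words_bounded W c'"
  by (auto simp: reach_def)

lemma cadr_evals:
  assumes s: "simst S W s c" and w: "fits S B W" and code: "code_at p (pc c) (cadr a t)" and t: "TB \<le> t"
    and i: "reg c t = int i" "i \<le> B" and j: "reg c (t+1) = int j" "j < S" and a: "0 < a" "a < 8"
  shows "evals p W 6 t (addr S a i j) c"
proof -
  have tr: "t \<noteq> SR" "Suc t \<noteq> SR" "SR < t" using t by (auto simp: TB_def SR_def)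
  have S: "reg c SR = int S" using s by (simp add: simst_def)
  have iS: "i * S \<le> B * S" using i by simp
  have n1: "i * S + j \<le> B * S + S" using iS j by linarith
  \<comment> \<open>The constant in \<open>fits\<close> dominates every intermediate result of the
    address computation, as i <= B, j < S and a < 8.\<close>
  have bd: "x \<le> 8 * (B * S + S) + 8 \<Longrightarrow> real x \<le> W" for x
    using w unfolding fits_def by (meson dual_order.trans of_nat_mono)
  have b1: "real_of_int \<bar>int i * int S\<bar> \<le> W" using bd[of "i * S"] iS by (simp add: abs_mult)
  have b2: "real_of_int \<bar>int i * int S + int j\<bar> \<le> W"
  proof -
    have "\<bar>int i * int S + int j\<bar> = int (i * S + j)" by simp
    then show ?thesis using bd[of "i * S + j"] n1 by (metis add_leD1 le_add1 linorder_not_le mult.commute mult_le_mono2 nat_mult_1_right of_int_of_nat_eq order.trans one_le_numeral)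
  qed
  have b3: "real_of_int \<bar>- 8\<bar> \<le> W" using bd[of 8] by simp
  have b4: "real_of_int \<bar>(int i * int S + int j) * - 8\<bar> \<le> W"
  proof -
    have "\<bar>(int i * int S + int j) * - 8\<bar> = int (8 * (i * S + j))"
      by (simp only: abs_mult of_nat_mult of_nat_add) simp
    then show ?thesis using bd[of "8 * (i * S + j)"] n1 by simp
  qed
  have b5: "real_of_int \<bar>- int a\<bar> \<le> W" using bd[of a] a by simp
  have b6: "real_of_int \<bar>(int i * int S + int j) * - 8 + - int a\<bar> \<le> W"
  proof -
    have "\<bar>(int i * int S + int j) * - 8 + - int a\<bar> = int (8 * (i * S + j) + a)"
    proof -
      have "(int i * int S + int j) * - 8 + - int a = - int (8 * (i * S + j) + a)" by simp
      then show ?thesis by (simp only: abs_minus_cancel abs_of_nat)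
    qed
    then show ?thesis using bd[of "8 * (i * S + j) + a"] n1 a by simp
  qed
  have wb: "words_bounded W c" using s by (simp add: simst_def)
  obtain c1 where r1: "reach p W (Suc 0) c c1" and c1: "c1 = c\<lparr>pc := pc c + 1, reg := (reg c)(t := int i * int S)\<rparr>"
    using reach_instr[OF reach_refl[OF wb], of p "Mul t t SR"] code b1 i S by auto
  have cd1: "code_at p (pc c1) (tl (cadr a t))" using code unfolding c1 by (simp add: code_at_Cons)
  obtain c2 where r2: "reach p W 2 c c2" and
    c2: "c2 = c1\<lparr>pc := pc c1 + 1, reg := (reg c1)(t := int i * int S + int j)\<rparr>"
  proof -
    have "reg c1 t = int i * int S" "reg c1 (t+1) = int j" using j unfolding c1 by auto
    then have "exec_instr (Add t t (t+1)) c1 = c1\<lparr>pc := pc c1 + 1, reg := (reg c1)(t := int i * int S + int j)\<rparr>"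
      by simp
    from reach_instr[OF r1 _ this b2] cd1 show ?thesis using that by (auto simp: numeral_2_eq_2)
  qed
  have e2: "evals p W 2 t (int i * int S + int j) c"
    unfolding evals_def using r2 by (intro exI[of _ c2]) (auto simp: c1 c2)
  have cd: "code_at p (pc c + 2) (Const (t+1) (-8) # [Mul t t (t+1)])" "code_at p (pc c + 2 + 1) (Mul t t (t+1) # [])"
    "code_at p (pc c + 4) (Const (t+1) (- int a) # [Add t t (t+1)])" "code_at p (pc c + 4 + 1) (Add t t (t+1) # [])"
    using code by (auto simp: code_at_Cons code_at_Nil numeral_eq_Suc)
  have n4: "(2::nat) + 1 + 1 = 4" and n6: "(4::nat) + 1 + 1 = 6" by simp_all
  have e3: "evals p W (2 + 1 + 1) t ((int i * int S + int j) * - 8) c"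
  proof (rule evals_bin[OF e2 _ cd(2), where f = times])
    fix c' assume "reach p W 2 c c'" "pc c' = pc c + 2"
    then show "evals p W 1 (t+1) (- 8) c'" using evals_Const[OF reach_wb] cd(1) b3 by metis
  next
    show "real_of_int \<bar>(int i * int S + int j) * - 8\<bar> \<le> W" by (rule b4)
  qed simp
  then have e3: "evals p W 4 t ((int i * int S + int j) * - 8) c" unfolding n4 .
  have e4: "evals p W (4 + 1 + 1) t ((int i * int S + int j) * - 8 + - int a) c"
  proof (rule evals_bin[OF e3 _ cd(4), where f = "(+)"])
    fix c' assume "reach p W 4 c c'" "pc c' = pc c + 4"
    then show "evals p W 1 (t+1) (- int a) c'" using evals_Const[OF reach_wb] cd(3) b5 by metis
  next
    show "real_of_int \<bar>(int i * int S + int j) * - 8 + - int a\<bar> \<le> W" by (rule b6)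
  qed simp
  have "addr S a i j = (int i * int S + int j) * - 8 + - int a" using a by (simp add: addr_def)
  then show ?thesis using e4 unfolding n6 by metis
qed

lemma cadr_after:
  assumes s: "simst S W s c" and w: "fits S B W" and t: "TB \<le> t" and i: "evals p W n t (int i) c"
    and j: "\<And>c'. reach p W n c c' \<Longrightarrow> pc c' = pc c + n \<Longrightarrow> mem c' = mem c \<Longrightarrow> \<forall>r<t. reg c' r = reg c r \<Longrightarrow>
       evals p W m (t+1) (int j) c'"
    and code: "code_at p (pc c + n + m) (cadr a t)" and "i \<le> B" "j < S" "0 < a" "a < 8"
  shows "evals p W (n + m + 6) t (addr S a i j) c"
proof -
  obtain c1 where c1: "reach p W n c c1" "pc c1 = pc c + n" "reg c1 t = int i" "mem c1 = mem c" "\<forall>r<t. reg c1 r = reg c r"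
    using i unfolding evals_def by blast
  from j[OF c1(1,2,4,5)]
  obtain c2 where c2: "reach p W m c1 c2" "pc c2 = pc c1 + m" "reg c2 (t+1) = int j" "mem c2 = mem c1"
    "\<forall>r<t+1. reg c2 r = reg c1 r"
    unfolding evals_def by blast
  have r: "reach p W (n + m) c c2" using reach_trans c1(1) c2(1) by blast
  have "simst S W s c2" by (rule simst_frame[OF s r _ _ t]) (use c1 c2 in auto)
  then have "evals p W 6 t (addr S a i j) c2"
    by (rule cadr_evals[OF _ w]) (use assms c1 c2 in auto)
  then obtain c3 where c3: "reach p W 6 c2 c3" "pc c3 = pc c2 + 6" "reg c3 t = addr S a i j" "mem c3 = mem c2"
    "\<forall>r<t. reg c3 r = reg c2 r" unfolding evals_def by blast
  show ?thesis unfolding evals_def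
    using reach_trans[OF r c3(1)] c1 c2 c3 by (intro exI[of _ c3]) auto
qed

lemma compE_evals:
  assumes "simst S W s c" "fits S B W" "okE S B e s" "code_at p (pc c) (compE e t)" "TB \<le> t"
  shows "evals p W (ecost e) t (int (val e s)) c"
  using assms
proof (induction e arbitrary: c t)
  case (N x)
  have "evals p W 1 t (int x) c"
    by (rule evals_Const[where xs = "[]"]) (use N in \<open>auto simp: fits_def simst_def\<close>)
  then show ?case by simp
next
  case (V v)
  have "\<exists>c''. reach p W (Suc 0) c c'' \<and> c'' = c\<lparr>pc := pc c + 1, reg := (reg c)(t := int (var s v))\<rparr>"
    by (rule reach_instr[OF reach_refl, of W c p "Move t v" "[]"])
      (use V simst_val_bound[OF V(1)] in \<open>auto simp: simst_def\<close>)
  then show ?case by (auto simp: evals_def)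
next
  case (Plus a b)
  have ca: "code_at p (pc c) (compE a t)" and cb: "code_at p (pc c + ecost a) (compE b (t+1))"
    and ci: "code_at p (pc c + ecost a + ecost b) (Add t t (t+1) # [])" using Plus.prems(4) by auto
  have "evals p W (ecost a + ecost b + 1) t (int (val a s) + int (val b s)) c"
  proof (rule evals_bin[OF Plus.IH(1)[OF Plus.prems(1,2) _ ca Plus.prems(5)] _ ci, where f = "(+)"])
    fix c' assume h: "reach p W (ecost a) c c'" "pc c' = pc c + ecost a" "mem c' = mem c" "\<forall>r<t. reg c' r = reg c r"
    show "evals p W (ecost b) (t + 1) (int (val b s)) c'"
      by (rule Plus.IH(2)[OF simst_frame[OF Plus.prems(1) h(1,3,4) Plus.prems(5)]]) (use Plus.prems cb h in auto)
  qed (use Plus.prems val_bound[OF Plus.prems(1,3,2)] in auto)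
  then show ?case by simp
next
  case (Minus a b)
  have ca: "code_at p (pc c) (compE a t)" and cb: "code_at p (pc c + ecost a) (compE b (t+1))"
    and ci: "code_at p (pc c + ecost a + ecost b) (Sub t t (t+1) # [])" using Minus.prems(4) by auto
  have "evals p W (ecost a + ecost b + 1) t (int (val a s) - int (val b s)) c"
  proof (rule evals_bin[OF Minus.IH(1)[OF Minus.prems(1,2) _ ca Minus.prems(5)] _ ci, where f = "(-)"])
    fix c' assume h: "reach p W (ecost a) c c'" "pc c' = pc c + ecost a" "mem c' = mem c" "\<forall>r<t. reg c' r = reg c r"
    show "evals p W (ecost b) (t + 1) (int (val b s)) c'"
      by (rule Minus.IH(2)[OF simst_frame[OF Minus.prems(1) h(1,3,4) Minus.prems(5)]]) (use Minus.prems cb h in auto)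
  qed (use Minus.prems val_bound[OF Minus.prems(1,3,2)] in \<open>auto simp: of_nat_diff\<close>)
  then show ?case using Minus.prems by (simp add: of_nat_diff)
next
  case (Times a b)
  have ca: "code_at p (pc c) (compE a t)" and cb: "code_at p (pc c + ecost a) (compE b (t+1))"
    and ci: "code_at p (pc c + ecost a + ecost b) (Mul t t (t+1) # [])" using Times.prems(4) by auto
  have "evals p W (ecost a + ecost b + 1) t (int (val a s) * int (val b s)) c"
  proof (rule evals_bin[OF Times.IH(1)[OF Times.prems(1,2) _ ca Times.prems(5)] _ ci, where f = times])
    fix c' assume h: "reach p W (ecost a) c c'" "pc c' = pc c + ecost a" "mem c' = mem c" "\<forall>r<t. reg c' r = reg c r"
    show "evals p W (ecost b) (t + 1) (int (val b s)) c'"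
      by (rule Times.IH(2)[OF simst_frame[OF Times.prems(1) h(1,3,4) Times.prems(5)]]) (use Times.prems cb h in auto)
  qed (use Times.prems val_bound[OF Times.prems(1,3,2)] in \<open>auto simp: abs_mult\<close>)
  then show ?case by simp
next
  case (Rd a i j)
  have b: "real_of_int \<bar>int (arr s a (val i s) (val j s))\<bar> \<le> W"
    using val_bound[OF Rd.prems(1,3,2)] by simp
  have m: "mem c (addr S a (val i s) (val j s)) = int (arr s a (val i s) (val j s))"
    using Rd.prems(1,3) unfolding simst_def by simp
  define n where "n = (if a = 0 then ecost i else ecost i + ecost j + 6)"
  have "evals p W n t (addr S a (val i s) (val j s)) c"
  proof (cases "a = 0")
    case True
    then show ?thesis using Rd.IH(1)[OF Rd.prems(1,2) _ _ Rd.prems(5)] Rd.prems by (auto simp: n_def addr_def)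
  next
    case False
    have ci: "code_at p (pc c) (compE i t)" and cj: "code_at p (pc c + ecost i) (compE j (t+1))"
      and ca: "code_at p (pc c + ecost i + ecost j) (cadr a t)" using Rd.prems(4) False by (auto simp del: cadr.simps)
    have o: "okE S B i s" "okE S B j s" "val i s \<le> B" "val j s < S" "0 < a" "a < 8"
      using Rd.prems(3) False by (auto simp: width_def)
    have ei: "evals p W (ecost i) t (int (val i s)) c" by (rule Rd.IH(1)[OF Rd.prems(1,2) o(1) ci Rd.prems(5)])
    have "evals p W (ecost i + ecost j + 6) t (addr S a (val i s) (val j s)) c"
    proof (rule cadr_after[OF Rd.prems(1,2,5) ei _ ca o(3-6)])
      fix c' assume h: "reach p W (ecost i) c c'" "pc c' = pc c + ecost i" "mem c' = mem c" "\<forall>r<t. reg c' r = reg c r"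
      show "evals p W (ecost j) (t + 1) (int (val j s)) c'"
        by (rule Rd.IH(2)[OF simst_frame[OF Rd.prems(1) h(1,3,4) Rd.prems(5)] Rd.prems(2) o(2)])
          (use Rd.prems(5) cj h(2) in simp_all)
    qed
    then show ?thesis using False by (simp add: n_def)
  qed
  then obtain c1 where c1: "reach p W n c c1" "pc c1 = pc c + n" "reg c1 t = addr S a (val i s) (val j s)"
    "mem c1 = mem c" "\<forall>r<t. reg c1 r = reg c r" unfolding evals_def by blast
  have cl: "code_at p (pc c1) (Load t t # [])" using Rd.prems(4) c1(2) by (cases "a = 0") (auto simp: n_def add.assoc simp del: cadr.simps simp: length_cadr)
  have "exec_instr (Load t t) c1 = c1\<lparr>pc := pc c1 + 1, reg := (reg c1)(t := int (arr s a (val i s) (val j s)))\<rparr>"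
    using c1(3,4) m by simp
  from reach_instr[OF c1(1) cl this b] obtain c2 where c2: "reach p W (Suc n) c c2"
    "c2 = c1\<lparr>pc := pc c1 + 1, reg := (reg c1)(t := int (arr s a (val i s) (val j s)))\<rparr>" by blast
  have "evals p W (Suc n) t (int (arr s a (val i s) (val j s))) c"
    unfolding evals_def using c1 c2(1) by (intro exI[of _ c2]) (simp add: c2(2))
  moreover have "ecost (Rd a i j) = Suc n" by (simp add: n_def)
  ultimately show ?case by simp
qed

lemma simst_tick [simp]: "simst S W (tick k s) c = simst S W s c"
  by (simp add: simst_def)

lemma simst_pc [simp]: "simst S W s (c\<lparr>pc := l\<rparr>) = simst S W s c"
  by (simp add: simst_def)

lemma okE_tick [simp]: "okE S B e (tick k s) = okE S B e s" "val e (tick k s) = val e s"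
  by (induction e) auto

lemma compE_sim:
  assumes "simst S W s c" "fits S B W" "okE S B e s" "code_at p (pc c) (compE e t)" "TB \<le> t"
  obtains c' where "reach p W (ecost e) c c'" "pc c' = pc c + ecost e" "simst S W s c'"
    "reg c' t = int (val e s)" "\<forall>r<t. reg c' r = reg c r"
proof -
  obtain c' where c': "reach p W (ecost e) c c'" "pc c' = pc c + ecost e" "reg c' t = int (val e s)"
     "mem c' = mem c" "\<forall>r<t. reg c' r = reg c r"
    using compE_evals[OF assms] unfolding evals_def by blast
  then show thesis using that simst_frame[OF assms(1) c'(1,4,5) assms(5)] by blast
qed

lemma compE2_sim:
  assumes s: "simst S W s c" "fits S B W" and a: "okE S B a s" and b: "okE S B b s"
    and code: "code_at p (pc c) (compE a TB @ compE b (TB+1))"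
  obtains c' where "reach p W (ecost a + ecost b) c c'" "pc c' = pc c + ecost a + ecost b" "simst S W s c'"
    "reg c' TB = int (val a s)" "reg c' (TB+1) = int (val b s)"
proof -
  have ca: "code_at p (pc c) (compE a TB)" and cb: "code_at p (pc c + ecost a) (compE b (TB+1))"
    using code by auto
  obtain c1 where c1: "reach p W (ecost a) c c1" "pc c1 = pc c + ecost a" "simst S W s c1" "reg c1 TB = int (val a s)"
    using compE_sim[OF s a ca] by blast
  have cb: "code_at p (pc c1) (compE b (TB+1))" using cb c1(2) by simp
  obtain c2 where c2: "reach p W (ecost b) c1 c2" "pc c2 = pc c1 + ecost b" "simst S W s c2"
    "reg c2 (TB+1) = int (val b s)" "\<forall>r<TB+1. reg c2 r = reg c1 r"
    using compE_sim[OF c1(3) s(2) b cb] by auto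
  show thesis by (rule that[of c2]) (use reach_trans[OF c1(1) c2(1)] c1 c2 in auto)
qed

lemma reach_jump:
  assumes "reach p W n c c'" "simst S W s c'" "code_at p (pc c') (x # xs)" "exec_instr x c' = c'\<lparr>pc := l\<rparr>"
  obtains c'' where "reach p W (Suc n) c c''" "simst S W s c''" "pc c'' = l" "reg c'' = reg c'"
proof -
  have "reach p W (Suc n) c (c'\<lparr>pc := l\<rparr>)"
    by (rule reach_Suc[OF assms(1)]) (use assms reach_wb[OF assms(1)] in \<open>auto simp: code_at_Cons\<close>)
  then show thesis using that assms(2) by simp
qed

lemma compB_sim:
  assumes s: "simst S W s c" "fits S B W" and ok: "okC S B b s" and code: "code_at p (pc c) (compB b (pc c) l)"
  obtains c' n where "reach p W n c c'" "n \<le> ccost b" "simst S W s c'"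
    "pc c' = (if holds b s then pc c + ccost b else l)"
proof (cases b)
  case (Lt x y)
  have oks: "okE S B x s" "okE S B y s" and cd: "code_at p (pc c) (compE x TB @ compE y (TB+1))"
    "code_at p (pc c + ecost x + ecost y) (Jump_less TB (TB+1) (pc c + ecost x + ecost y + 2) # [Jump l])"
    "code_at p (pc c + ecost x + ecost y + 1) (Jump l # [])"
    using ok code Lt by (auto simp: code_at_Cons)
  obtain c1 where c1: "reach p W (ecost x + ecost y) c c1" "pc c1 = pc c + ecost x + ecost y" "simst S W s c1"
    "reg c1 TB = int (val x s)" "reg c1 (TB+1) = int (val y s)" by (rule compE2_sim[OF s oks cd(1)])
  have cd': "code_at p (pc c1) (Jump_less TB (TB+1) (pc c + ecost x + ecost y + 2) # [Jump l])" using cd(2) c1(2) by simp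
  show thesis
  proof (cases "val x s < val y s")
    case True
    have "exec_instr (Jump_less TB (TB+1) (pc c + ecost x + ecost y + 2)) c1 = c1\<lparr>pc := pc c + ecost x + ecost y + 2\<rparr>"
      using True c1 by simp
    then obtain c2 where "reach p W (Suc (ecost x + ecost y)) c c2" "simst S W s c2" "pc c2 = pc c + ecost x + ecost y + 2"
      by (rule reach_jump[OF c1(1,3) cd'])
    then show thesis using that True Lt by auto
  next
    case False
    have "exec_instr (Jump_less TB (TB+1) (pc c + ecost x + ecost y + 2)) c1 = c1\<lparr>pc := pc c + ecost x + ecost y + 1\<rparr>"
      using False c1 by simp
    then obtain c2 where c2: "reach p W (Suc (ecost x + ecost y)) c c2" "simst S W s c2" "pc c2 = pc c + ecost x + ecost y + 1"
      by (rule reach_jump[OF c1(1,3) cd'])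
    have "code_at p (pc c2) (Jump l # [])" using cd(3) c2(3) by simp
    then obtain c3 where "reach p W (Suc (Suc (ecost x + ecost y))) c c3" "simst S W s c3" "pc c3 = l"
      by (rule reach_jump[OF c2(1,2)]) simp
    then show thesis using that False Lt by auto
  qed
next
  case (Eq x y)
  have oks: "okE S B x s" "okE S B y s" and cd: "code_at p (pc c) (compE x TB @ compE y (TB+1))"
    "code_at p (pc c + ecost x + ecost y) (Jump_less TB (TB+1) l # [Jump_less (TB+1) TB l])"
    "code_at p (pc c + ecost x + ecost y + 1) (Jump_less (TB+1) TB l # [])"
    using ok code Eq by (auto simp: code_at_Cons)
  obtain c1 where c1: "reach p W (ecost x + ecost y) c c1" "pc c1 = pc c + ecost x + ecost y" "simst S W s c1"
    "reg c1 TB = int (val x s)" "reg c1 (TB+1) = int (val y s)" by (rule compE2_sim[OF s oks cd(1)])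
  have cd': "code_at p (pc c1) (Jump_less TB (TB+1) l # [Jump_less (TB+1) TB l])" using cd(2) c1(2) by simp
  show thesis
  proof (cases "val x s < val y s")
    case True
    have "exec_instr (Jump_less TB (TB+1) l) c1 = c1\<lparr>pc := l\<rparr>" using True c1 by simp
    then obtain c2 where "reach p W (Suc (ecost x + ecost y)) c c2" "simst S W s c2" "pc c2 = l"
      by (rule reach_jump[OF c1(1,3) cd'])
    then show thesis using that True Eq by auto
  next
    case False
    have "exec_instr (Jump_less TB (TB+1) l) c1 = c1\<lparr>pc := pc c + ecost x + ecost y + 1\<rparr>"
      using False c1 by simp
    then obtain c2 where c2: "reach p W (Suc (ecost x + ecost y)) c c2" "simst S W s c2"
        "pc c2 = pc c + ecost x + ecost y + 1" "reg c2 = reg c1"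
      by (rule reach_jump[OF c1(1,3) cd'])
    have cd2: "code_at p (pc c2) (Jump_less (TB+1) TB l # [])" using cd(3) c2(3) by simp
    have "exec_instr (Jump_less (TB+1) TB l) c2 =
       c2\<lparr>pc := (if val y s < val x s then l else pc c + ecost x + ecost y + 2)\<rparr>"
      using c1 c2 by simp
    then obtain c3 where "reach p W (Suc (Suc (ecost x + ecost y))) c c3" "simst S W s c3"
       "pc c3 = (if val y s < val x s then l else pc c + ecost x + ecost y + 2)"
      by (rule reach_jump[OF c2(1,2) cd2])
    then show thesis using that False Eq by auto
  qed
qed

lemma simst_setv:
  assumes "simst S W s c" "v < TB" "v \<noteq> SR" "real x \<le> W"
  shows "simst S W (setv v x s) (c\<lparr>pc := l, reg := (reg c)(v := int x)\<rparr>)"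
  using assms words_bounded_reg[of W c "int x"] by (auto simp: simst_def)

lemma simst_put:
  assumes "simst S W s c" "a < 8" "j < width S a" "real x \<le> W"
  shows "simst S W (put a i j x s) (c\<lparr>pc := l, mem := (mem c)(addr S a i j := int x)\<rparr>)"
  using assms words_bounded_mem[of W c "int x"] addr_inj[of S _ _ _ a i j] by (auto simp: simst_def)

text \<open>Induction on the derivation rather than on the program makes a loop round a plain case.
  The last conjunct lets the clock of the language stand in for machine time from here on.\<close>

lemma compC_sim:
  assumes "exec S B cm s s'" "simst S W s c" "fits S B W" "code_at p (pc c) (compC cm (pc c))"
  shows "\<exists>n c'. reach p W n c c' \<and> simst S W s' c' \<and> pc c' = pc c + csize cm \<and> n + clk s \<le> clk s'"
  using assms
proof (induction arbitrary: c rule: exec.induct)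
  case (Skip s)
  then show ?case by (auto simp: simst_def intro!: exI[of _ 0] exI[of _ c] reach_refl)
next
  case (Set e s v)
  have cd: "code_at p (pc c) (compE e TB)" "code_at p (pc c + ecost e) (Move v TB # [])" using Set.prems by auto
  obtain c1 where c1: "reach p W (ecost e) c c1" "pc c1 = pc c + ecost e" "simst S W s c1" "reg c1 TB = int (val e s)"
    using compE_sim[OF Set.prems(1,2) Set.hyps(1) cd(1)] by blast
  let ?c = "c1\<lparr>pc := Suc (pc c1), reg := (reg c1)(v := int (val e s))\<rparr>"
  have s: "simst S W (setv v (val e s) s) ?c"
    using simst_setv[OF c1(3)] Set val_bound[OF Set.prems(1) Set.hyps(1) Set.prems(2)] by simp
  have "reach p W (Suc (ecost e)) c ?c"
    by (rule reach_Suc[OF c1(1)]) (use cd(2) c1 s in \<open>auto simp: code_at_Cons simst_def\<close>)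
  then show ?case using s c1 by (intro exI[of _ "Suc (ecost e)"] exI[of _ ?c]) auto
next
  case (Put i s j e a)
  define m where "m = (if a = 0 then 0 else ecost j + 6)"
  have cd: "code_at p (pc c + ecost i + m) (compE e (TB+1))" "code_at p (pc c + ecost i + m + ecost e) (Store TB (TB+1) # [])"
    using Put.prems(3) by (auto simp: m_def length_cadr add.assoc simp del: cadr.simps split: if_splits)
  obtain c1 where c1: "reach p W (ecost i + m) c c1" "pc c1 = pc c + ecost i + m" "simst S W s c1"
    "reg c1 TB = addr S a (val i s) (val j s)"
  proof (cases "a = 0")
    case True
    then have "code_at p (pc c) (compE i TB)" using Put.prems(3) by simp
    from compE_sim[OF Put.prems(1,2) Put.hyps(1) this] that show thesis using True by (auto simp: m_def addr_def)
  next
    case False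
    have cd: "code_at p (pc c) (compE i TB @ compE j (TB+1))" "code_at p (pc c + ecost i + ecost j) (cadr a TB)"
      using Put.prems(3) False by (auto simp: add.assoc simp del: cadr.simps)
    obtain c1 where c1: "reach p W (ecost i + ecost j) c c1" "pc c1 = pc c + ecost i + ecost j" "simst S W s c1"
      "reg c1 TB = int (val i s)" "reg c1 (TB+1) = int (val j s)" by (rule compE2_sim[OF Put.prems(1,2) Put.hyps(1,2) cd(1)])
    have "evals p W 6 TB (addr S a (val i s) (val j s)) c1"
      by (rule cadr_evals[OF c1(3) Put.prems(2) _ order_refl c1(4) _ c1(5)])
        (use cd(2) c1(2) Put.hyps False in \<open>auto simp: width_def simp del: cadr.simps\<close>)
    then obtain c2 where c2: "reach p W 6 c1 c2" "pc c2 = pc c1 + 6" "reg c2 TB = addr S a (val i s) (val j s)"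
      "mem c2 = mem c1" "\<forall>r<TB. reg c2 r = reg c1 r" unfolding evals_def by blast
    have "simst S W s c2" by (rule simst_frame[OF c1(3) c2(1,4,5) order_refl])
    then show thesis using that[of c2] False c1(2) c2 reach_trans[OF c1(1) c2(1)] by (simp add: m_def add.assoc)
  qed
  have cd1: "code_at p (pc c1) (compE e (TB+1))" using cd(1) c1(2) by simp
  obtain c2 where c2: "reach p W (ecost e) c1 c2" "pc c2 = pc c1 + ecost e" "simst S W s c2"
    "reg c2 (TB+1) = int (val e s)" "\<forall>r<TB+1. reg c2 r = reg c1 r"
    using compE_sim[OF c1(3) Put.prems(2) Put.hyps(3) cd1] by auto
  let ?c = "c2\<lparr>pc := Suc (pc c2), mem := (mem c2)(addr S a (val i s) (val j s) := int (val e s))\<rparr>"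
  have s: "simst S W (put a (val i s) (val j s) (val e s) s) ?c"
    using simst_put[OF c2(3)] Put val_bound[OF Put.prems(1) Put.hyps(3) Put.prems(2)] by simp
  have "reach p W (Suc (ecost i + m + ecost e)) c ?c"
    by (rule reach_Suc[OF reach_trans[OF c1(1) c2(1)]]) (use cd(2) c1 c2 s in \<open>auto simp: code_at_Cons simst_def\<close>)
  then show ?case using s c1 c2
    by (intro exI[of _ "Suc (ecost i + m + ecost e)"] exI[of _ ?c]) (auto simp: m_def)
next
  case (Seq c1 s s' c2 s'')
  have "code_at p (pc c) (compC c1 (pc c))" using Seq.prems by simp
  from Seq.IH(1)[OF Seq.prems(1,2) this]
  obtain n d where d: "reach p W n c d" "simst S W s' d" "pc d = pc c + csize c1" "n + clk s \<le> clk s'" by blast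
  have "code_at p (pc d) (compC c2 (pc d))" using Seq.prems d by simp
  from Seq.IH(2)[OF d(2) Seq.prems(2) this]
  obtain n' d' where d': "reach p W n' d d'" "simst S W s'' d'" "pc d' = pc d + csize c2" "n' + clk s' \<le> clk s''" by blast
  show ?case using reach_trans[OF d(1) d'(1)] d d' by (intro exI[of _ "n + n'"] exI[of _ d']) auto
next
  case (IfT b s c1 s' c2)
  let ?l = "pc c + ccost b + csize c1 + 1"
  have cd: "code_at p (pc c) (compB b (pc c) ?l)" "code_at p (pc c + ccost b) (compC c1 (pc c + ccost b))"
    "code_at p (pc c + ccost b + csize c1) (Jump (?l + csize c2) # [])"
    using IfT.prems by (auto simp: code_at_Cons code_at_Nil)
  obtain c3 n where c3: "reach p W n c c3" "n \<le> ccost b" "simst S W s c3" "pc c3 = pc c + ccost b"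
    using compB_sim[OF IfT.prems(1,2) IfT.hyps(1) cd(1)] IfT.hyps(2) by simp blast
  have "simst S W (tick (ccost b + 1) s) c3" "code_at p (pc c3) (compC c1 (pc c3))" using c3 cd(2) by auto
  from IfT.IH[OF this(1) IfT.prems(2) this(2)]
  obtain m d where d: "reach p W m c3 d" "simst S W s' d" "pc d = pc c3 + csize c1" "m + clk s + ccost b + 1 \<le> clk s'" by auto
  have cj: "code_at p (pc d) (Jump (?l + csize c2) # [])" using cd(3) c3(4) d(3) by simp
  obtain d' where "reach p W (Suc (n + m)) c d'" "simst S W s' d'" "pc d' = ?l + csize c2"
    by (rule reach_jump[OF reach_trans[OF c3(1) d(1)] d(2) cj]) auto
  then show ?case using c3(2) d(4) by (intro exI[of _ "Suc (n + m)"] exI[of _ d']) auto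
next
  case (IfF b s c2 s' c1)
  let ?l = "pc c + ccost b + csize c1 + 1"
  have cd: "code_at p (pc c) (compB b (pc c) ?l)" "code_at p ?l (compC c2 ?l)"
    using IfF.prems by (auto simp: code_at_Cons)
  obtain c3 n where c3: "reach p W n c c3" "n \<le> ccost b" "simst S W s c3" "pc c3 = ?l"
    using compB_sim[OF IfF.prems(1,2) IfF.hyps(1) cd(1)] IfF.hyps(2) by simp blast
  have "simst S W (tick (ccost b + 1) s) c3" "code_at p (pc c3) (compC c2 (pc c3))" using c3 cd(2) by auto
  from IfF.IH[OF this(1) IfF.prems(2) this(2)]
  obtain m d where d: "reach p W m c3 d" "simst S W s' d" "pc d = pc c3 + csize c2" "m + clk s + ccost b + 1 \<le> clk s'" by auto
  show ?case using reach_trans[OF c3(1) d(1)] c3 d by (intro exI[of _ "n + m"] exI[of _ d]) auto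
next
  case (LoopT b s cm s' s'')
  let ?l = "pc c + ccost b + csize cm + 1"
  have cd: "code_at p (pc c) (compB b (pc c) ?l)" "code_at p (pc c + ccost b) (compC cm (pc c + ccost b))"
    "code_at p (pc c + ccost b + csize cm) (Jump (pc c) # [])"
    using LoopT.prems by auto
  obtain c3 n where c3: "reach p W n c c3" "n \<le> ccost b" "simst S W s c3" "pc c3 = pc c + ccost b"
    using compB_sim[OF LoopT.prems(1,2) LoopT.hyps(1) cd(1)] LoopT.hyps(2) by simp blast
  have "simst S W (tick (ccost b + 1) s) c3" "code_at p (pc c3) (compC cm (pc c3))" using c3 cd(2) by auto
  from LoopT.IH(1)[OF this(1) LoopT.prems(2) this(2)]
  obtain m d where d: "reach p W m c3 d" "simst S W s' d" "pc d = pc c3 + csize cm" "m + clk s + ccost b + 1 \<le> clk s'" by auto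
  have cj: "code_at p (pc d) (Jump (pc c) # [])" using cd(3) c3(4) d(3) by simp
  obtain d' where d': "reach p W (Suc (n + m)) c d'" "simst S W s' d'" "pc d' = pc c"
    by (rule reach_jump[OF reach_trans[OF c3(1) d(1)] d(2) cj]) auto
  \<comment> \<open>After the back jump the same code lies at the same position, so the second
    induction hypothesis covers the remaining rounds.\<close>
  have "code_at p (pc d') (compC (Loop b cm) (pc d'))" using LoopT.prems(3) d'(3) by simp
  from LoopT.IH(2)[OF d'(2) LoopT.prems(2) this]
  obtain k e where e: "reach p W k d' e" "simst S W s'' e" "pc e = pc d' + csize (Loop b cm)" "k + clk s' \<le> clk s''" by blast
  show ?case using reach_trans[OF d'(1) e(1)] c3(2) d(4) d'(3) e
    by (intro exI[of _ "Suc (n + m) + k"] exI[of _ e]) auto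
next
  case (LoopF b s cm)
  let ?l = "pc c + ccost b + csize cm + 1"
  have cd: "code_at p (pc c) (compB b (pc c) ?l)" using LoopF.prems by auto
  obtain c3 n where c3: "reach p W n c c3" "n \<le> ccost b" "simst S W s c3" "pc c3 = ?l"
    using compB_sim[OF LoopF.prems(1,2) LoopF.hyps(1) cd(1)] LoopF.hyps(2) by simp blast
  then show ?case by (intro exI[of _ n] exI[of _ c3]) auto
qed

section \<open>Weakest preconditions\<close>

text \<open>Existence of one derivation is enough: \<open>compC_sim\<close> turns it into a run of
  the deterministic machine.\<close>

definition wp :: "nat \<Rightarrow> nat \<Rightarrow> cmd \<Rightarrow> (st \<Rightarrow> bool) \<Rightarrow> st \<Rightarrow> bool" where
  "wp S B c Q s \<longleftrightarrow> (\<exists>s'. exec S B c s s' \<and> Q s')"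

lemma wp_mono: "wp S B c Q s \<Longrightarrow> (\<And>s'. Q s' \<Longrightarrow> Q' s') \<Longrightarrow> wp S B c Q' s"
  by (auto simp: wp_def)

lemma wp_Skip [intro]: "Q s \<Longrightarrow> wp S B Skip Q s"
  unfolding wp_def using exec.Skip by blast

lemma wp_Set: "okE S B e s \<Longrightarrow> v < TB \<Longrightarrow> v \<noteq> SR \<Longrightarrow> Q (tick (ecost e + 1) (setv v (val e s) s)) \<Longrightarrow>
    wp S B (Set v e) Q s"
  unfolding wp_def using exec.Set by blast

lemma wp_Put: "okE S B i s \<Longrightarrow> okE S B j s \<Longrightarrow> okE S B e s \<Longrightarrow> a < 8 \<Longrightarrow> val i s \<le> B \<Longrightarrow> val j s < width S a \<Longrightarrow>
    Q (tick (ecost i + ecost j + ecost e + 10) (put a (val i s) (val j s) (val e s) s)) \<Longrightarrow> wp S B (Put a i j e) Q s"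
  unfolding wp_def using exec.Put by blast

lemma wp_Seq: "wp S B c1 (wp S B c2 Q) s \<Longrightarrow> wp S B (c1 ;; c2) Q s"
  unfolding wp_def using exec.Seq by blast

lemma wp_Ifte: "okC S B b s \<Longrightarrow> (holds b s \<Longrightarrow> wp S B c1 Q (tick (ccost b + 1) s)) \<Longrightarrow>
    (\<not> holds b s \<Longrightarrow> wp S B c2 Q (tick (ccost b + 1) s)) \<Longrightarrow> wp S B (Ifte b c1 c2) Q s"
  unfolding wp_def using exec.IfT exec.IfF by metis

lemma wp_Loop:
  fixes \<mu> :: "st \<Rightarrow> nat"
  assumes I: "I s"
    and ok: "\<And>s. I s \<Longrightarrow> okC S B b s"
    and body: "\<And>s. I s \<Longrightarrow> holds b s \<Longrightarrow> wp S B c (\<lambda>s'. I s' \<and> \<mu> s' < \<mu> s) (tick (ccost b + 1) s)"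
    and exit: "\<And>s. I s \<Longrightarrow> \<not> holds b s \<Longrightarrow> Q (tick (ccost b + 1) s)"
  shows "wp S B (Loop b c) Q s"
  using I
proof (induction "\<mu> s" arbitrary: s rule: less_induct)
  case less
  show ?case
  proof (cases "holds b s")
    case True
    obtain s' where s': "exec S B c (tick (ccost b + 1) s) s'" "I s'" "\<mu> s' < \<mu> s"
      using body[OF less.prems True] unfolding wp_def by blast
    from less.hyps[OF s'(3,2)] obtain s'' where "exec S B (Loop b c) s' s''" "Q s''" unfolding wp_def by blast
    then show ?thesis unfolding wp_def using exec.LoopT[OF ok[OF less.prems] True s'(1)] by blast
  next
    case False
    then show ?thesis unfolding wp_def using exec.LoopF[OF ok[OF less.prems] False] exit[OF less.prems] by blast
  qed
qed

section \<open>Interval divisions of a symmetric matrix\<close>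

locale symmetric_array =
  fixes n k d :: nat and m :: "nat \<Rightarrow> nat \<Rightarrow> nat"
  assumes n_pos: "0 < n" and entry_less: "x < n \<Longrightarrow> y < n \<Longrightarrow> m x y < k"
    and sym: "x < n \<Longrightarrow> y < n \<Longrightarrow> m x y = m y x"
begin

lemma k_pos: "0 < k"
  using entry_less[of 0 0] n_pos by auto

definition row :: "nat set \<Rightarrow> nat \<Rightarrow> nat \<Rightarrow> nat" where
  "row C x = restrict (m x) C"

definition rows :: "nat set \<Rightarrow> nat set \<Rightarrow> nat" where
  "rows C W = card (row C ` W)"

text \<open>By \<open>rows_dual\<close>, d + 1 distinct lines in one direction permit at most k^(d +
  1) in the other; \<open>thr\<close> is the first value beyond.\<close>

definition thr :: nat where "thr = k ^ (d + 1) + 1"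
text \<open>Fewer than \<open>thr\<close> lines in one direction force fewer than \<open>big\<close>
  in the other. The summand \<open>thr\<close> keeps \<open>big\<close> at least \<open>thr\<close>,
  so that one count below \<open>thr\<close> makes both directions smaller than
  \<open>big\<close>.\<close>

definition big :: nat where "big = k ^ thr + thr"
text \<open>In \<open>stuck_no_D_sequence\<close> up to 2d(d + 1) blocks of at most three parts each
  are discarded, and the hits left over must outnumber the gaps between the discarded blocks; this
  takes more than 8d(d + 1) + 1 hits. The summand 5 also guarantees more than d + 2 blocks when d =
  0.\<close>

definition maxhit :: nat where "maxhit = 8 * d * (d + 1) + 5"

lemma row_eq_iff: "row C x = row C x' \<longleftrightarrow> (\<forall>y\<in>C. m x y = m x' y)"
  unfolding row_def by (auto simp: restrict_def fun_eq_iff)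

text \<open>Restriction sends the rows on the larger column set onto those on the smaller
  one.\<close>

lemma rows_mono:
  assumes "C \<subseteq> C'" "W \<subseteq> W'" "finite W'"
  shows "rows C W \<le> rows C' W'"
proof -
  have "row C ` W \<subseteq> (\<lambda>f. restrict f C) ` (row C' ` W')"
  proof
    fix f assume "f \<in> row C ` W"
    then obtain x where x: "x \<in> W" "f = row C x" by auto
    have "f = restrict (row C' x) C" using assms(1) by (auto simp: x row_def restrict_def fun_eq_iff)
    then show "f \<in> (\<lambda>f. restrict f C) ` (row C' ` W')" using x assms(2) by auto
  qed
  then have "card (row C ` W) \<le> card ((\<lambda>f. restrict f C) ` (row C' ` W'))"
    using assms(3) by (intro card_mono) auto
  also have "\<dots> \<le> card (row C' ` W')" using assms(3) by (intro card_image_le) auto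
  finally show ?thesis by (simp add: rows_def)
qed

text \<open>By symmetry the row of x on C lists the values at x of the functions
  \<open>row W y\<close>, for y in C. There are only \<open>rows W C\<close> different functions of
  this kind, and each of them takes one of k values at x.\<close>

lemma rows_dual:
  assumes "W \<subseteq> {..<n}" "C \<subseteq> {..<n}"
  shows "rows C W \<le> k ^ rows W C"
proof -
  define K where "K = row W ` C"
  have fin: "finite W" "finite C" "finite K" using assms by (auto simp: K_def intro: finite_subset)
  define g where "g x = restrict (\<lambda>f. f x) K" for x :: nat
  have "rows C W \<le> card (g ` W)"
    unfolding rows_def
  proof (rule card_le_if_inj_on_rel[where r = "\<lambda>f h. \<exists>x\<in>W. f = row C x \<and> h = g x"])
    show "finite (g ` W)" using fin by simp
    show "\<exists>b. b \<in> g ` W \<and> (\<exists>x\<in>W. a = row C x \<and> b = g x)" if "a \<in> row C ` W" for a using that by blast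
    fix a1 a2 b
    assume "\<exists>x\<in>W. a1 = row C x \<and> b = g x" "\<exists>x\<in>W. a2 = row C x \<and> b = g x"
    then obtain x x' where x: "x \<in> W" "a1 = row C x" "x' \<in> W" "a2 = row C x'" "g x = g x'" by auto
    have "m x y = m x' y" if "y \<in> C" for y
    proof -
      have "row W y \<in> K" using that by (simp add: K_def)
      then have "row W y x = row W y x'" using x(5) unfolding g_def by (metis restrict_apply')
      then have "m y x = m y x'" using x by (simp add: row_def)
      then show ?thesis using sym x(1,3) that assms by (metis lessThan_iff subsetD)
    qed
    then show "a1 = a2" using x row_eq_iff by simp
  qed
  also have "\<dots> \<le> card (K \<rightarrow>\<^sub>E {..<k})"
  proof (intro card_mono)
    show "finite (K \<rightarrow>\<^sub>E {..<k})" using fin by (intro finite_PiE) auto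
    show "g ` W \<subseteq> K \<rightarrow>\<^sub>E {..<k}"
    proof
      fix h assume "h \<in> g ` W"
      then obtain x where x: "x \<in> W" "h = g x" by auto
      have "f x < k" if "f \<in> K" for f
        using that x(1) assms by (auto simp: K_def row_def intro!: entry_less)
      then show "h \<in> K \<rightarrow>\<^sub>E {..<k}" by (auto simp: x g_def)
    qed
  qed
  also have "\<dots> = k ^ card K" using fin by (simp add: card_PiE)
  finally show ?thesis by (simp add: K_def rows_def)
qed

text \<open>A row on the union is determined by the tuple of its rows on the members.\<close>

lemma rows_Union:
  assumes "finite I" "finite W" "\<And>a. a \<in> I \<Longrightarrow> rows (F a) W \<le> b"
  shows "rows (\<Union>a\<in>I. F a) W \<le> b ^ card I"
proof -
  define g where "g x = restrict (\<lambda>a. row (F a) x) I" for x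
  have "rows (\<Union>a\<in>I. F a) W \<le> card (g ` W)"
    unfolding rows_def
  proof (rule card_le_if_inj_on_rel[where r = "\<lambda>f h. \<exists>x\<in>W. f = row (\<Union>a\<in>I. F a) x \<and> h = g x"])
    show "finite (g ` W)" using assms by simp
    fix a1 a2 h
    assume "\<exists>x\<in>W. a1 = row (\<Union>a\<in>I. F a) x \<and> h = g x" "\<exists>x\<in>W. a2 = row (\<Union>a\<in>I. F a) x \<and> h = g x"
    then obtain x x' where x: "a1 = row (\<Union>a\<in>I. F a) x" "a2 = row (\<Union>a\<in>I. F a) x'" "g x = g x'" by auto
    have "row (F a) x = row (F a) x'" if "a \<in> I" for a
      using x(3) that unfolding g_def by (metis restrict_apply')
    then show "a1 = a2" unfolding x(1,2) row_eq_iff by blast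
  qed blast
  also have "\<dots> \<le> card (PiE I (\<lambda>a. row (F a) ` W))"
    using assms by (intro card_mono finite_PiE) (auto simp: g_def)
  also have "\<dots> = (\<Prod>a\<in>I. rows (F a) W)" using assms by (simp add: card_PiE rows_def)
  also have "\<dots> \<le> (\<Prod>a\<in>I. b)" using assms(3) by (intro prod_mono) auto
  finally show ?thesis by simp
qed

lemma thr_ge2: "2 \<le> thr" using k_pos by (simp add: thr_def Suc_le_eq)

lemma k_less_thr: "k < thr"
proof -
  have "k \<le> k ^ (d + 1)" using k_pos by (intro self_le_power) auto
  then show ?thesis unfolding thr_def by linarith
qed

lemma big_bounds: "thr \<le> big" "a < thr \<Longrightarrow> k ^ a < big"
proof -
  assume "a < thr"
  then have "k ^ a \<le> k ^ thr" using k_pos by (intro power_increasing) auto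
  then show "k ^ a < big" using thr_ge2 by (simp add: big_def)
qed (simp add: big_def)

text \<open>A division into intervals is represented by the left ends of its parts. Merging two
  neighbours then just deletes an element, and a coarser division is a subset. In \<open>nxt\<close>
  the value n stands for the end behind the last part.\<close>

definition starts :: "nat set \<Rightarrow> bool" where
  "starts St \<longleftrightarrow> St \<subseteq> {..<n} \<and> 0 \<in> St"

definition pt :: "nat set \<Rightarrow> nat \<Rightarrow> nat" where
  "pt St x = Max {p\<in>St. p \<le> x}"

definition nxt :: "nat set \<Rightarrow> nat \<Rightarrow> nat" where
  "nxt St p = Min (insert n {q\<in>St. p < q})"

definition part :: "nat set \<Rightarrow> nat \<Rightarrow> nat set" where
  "part St p = {p..<nxt St p}"

lemma starts_finite: "starts St \<Longrightarrow> finite St"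
  unfolding starts_def using finite_subset by blast

lemma pt_props:
  assumes "starts St"
  shows "pt St x \<in> St" "pt St x \<le> x" "\<And>p. p \<in> St \<Longrightarrow> p \<le> x \<Longrightarrow> p \<le> pt St x"
proof -
  let ?A = "{p\<in>St. p \<le> x}"
  have f: "finite ?A" "?A \<noteq> {}" using starts_finite[OF assms] assms by (auto simp: starts_def)
  then have "Max ?A \<in> ?A" by (rule Max_in)
  then show "pt St x \<in> St" "pt St x \<le> x" by (auto simp: pt_def)
  show "\<And>p. p \<in> St \<Longrightarrow> p \<le> x \<Longrightarrow> p \<le> pt St x" using f by (auto simp: pt_def)
qed

lemma nxt_props:
  assumes "starts St" "p \<in> St"
  shows "nxt St p \<le> n" "p < nxt St p" "nxt St p = n \<or> nxt St p \<in> St" "\<And>q. q \<in> St \<Longrightarrow> p < q \<Longrightarrow> nxt St p \<le> q"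
proof -
  let ?A = "insert n {q\<in>St. p < q}"
  have f: "finite ?A" "?A \<noteq> {}" using starts_finite[OF assms(1)] by auto
  then have "Min ?A \<in> ?A" by (rule Min_in)
  then show "p < nxt St p" "nxt St p = n \<or> nxt St p \<in> St" using assms by (auto simp: nxt_def starts_def)
  show "nxt St p \<le> n" "\<And>q. q \<in> St \<Longrightarrow> p < q \<Longrightarrow> nxt St p \<le> q" using f by (auto simp: nxt_def)
qed

lemma pt_eqI:
  assumes "starts St" "p \<in> St" "p \<le> x" "x < nxt St p"
  shows "pt St x = p"
proof -
  have "p \<le> pt St x" using pt_props(3) assms by blast
  moreover have "\<not> p < pt St x" using nxt_props(4)[OF assms(1,2) pt_props(1)[OF assms(1)]] pt_props(2)[OF assms(1), of x] assms(4)
    by (meson leD order.strict_trans2 order.strict_trans1)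
  ultimately show ?thesis by simp
qed

lemma in_part_iff:
  assumes "starts St" "p \<in> St" "x < n"
  shows "x \<in> part St p \<longleftrightarrow> pt St x = p"
proof
  assume "pt St x = p"
  then have "p \<le> x" using pt_props(2) assms by blast
  moreover have "x < nxt St p"
  proof (rule ccontr)
    assume "\<not> x < nxt St p"
    then have "nxt St p \<in> St" "nxt St p \<le> x" using nxt_props(3)[OF assms(1,2)] assms(3) by auto
    then have "nxt St p \<le> p" using pt_props(3)[OF assms(1)] \<open>pt St x = p\<close> by metis
    then show False using nxt_props(2)[OF assms(1,2)] by simp
  qed
  ultimately show "x \<in> part St p" by (simp add: part_def)
qed (use pt_eqI[OF assms(1,2)] in \<open>auto simp: part_def\<close>)

lemma part_less: "starts St \<Longrightarrow> p \<in> St \<Longrightarrow> x \<in> part St p \<Longrightarrow> x < n"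
  using nxt_props(1) by (fastforce simp: part_def)

lemma part_eq: "starts St \<Longrightarrow> p \<in> St \<Longrightarrow> part St p = {x. x < n \<and> pt St x = p}"
  using in_part_iff[of St p] part_less[of St p] by auto

lemma self_in_part: "starts St \<Longrightarrow> p \<in> St \<Longrightarrow> p \<in> part St p"
  using nxt_props(2) by (simp add: part_def)

lemma finite_part [simp]: "finite (part St p)" by (simp add: part_def)

lemma pt_start: "starts St \<Longrightarrow> p \<in> St \<Longrightarrow> pt St p = p"
  using pt_eqI[of St p p] nxt_props(2) by simp

lemma pt_mono: "starts St \<Longrightarrow> x \<le> y \<Longrightarrow> pt St x \<le> pt St y"
  using pt_props by (meson le_trans)

section \<open>Greedy segmentation\<close>

text \<open>\<open>gs C x\<close> is the first row of the segment that contains \<open>x\<close> when the rows are cut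
  greedily into segments with fewer than \<open>thr\<close> distinct rows on \<open>C\<close>.  It does not depend on the
  division, which makes the number of parts hit by a cut monotone under merging.\<close>

primrec gs :: "nat set \<Rightarrow> nat \<Rightarrow> nat" where
  "gs C 0 = 0"
| "gs C (Suc x) = (if thr \<le> rows C {gs C x..Suc x} then Suc x else gs C x)"

text \<open>Row 0 opens a segment without a cut, so it is excluded; every other segment start is a
  mark.\<close>

definition mark :: "nat set \<Rightarrow> nat \<Rightarrow> bool" where
  "mark C x \<longleftrightarrow> 0 < x \<and> gs C x = x"

definition hits :: "nat set \<Rightarrow> nat set \<Rightarrow> nat set" where
  "hits St C = pt St ` {x. x < n \<and> mark C x}"

lemma gs_le: "gs C x \<le> x"
  by (induction x) (auto simp: le_SucI)

lemma gs_rows: "rows C {gs C x..x} < thr"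
proof (induction x)
  case 0
  have "rows C {0..0} = 1" by (simp add: rows_def)
  then show ?case using thr_ge2 by simp
next
  case (Suc x)
  have "rows C {Suc x..Suc x} = 1" by (simp add: rows_def)
  then show ?case using thr_ge2 by simp
qed

lemma gs_mono: "x \<le> y \<Longrightarrow> gs C x \<le> gs C y"
proof (rule lift_Suc_mono_le[of "gs C"])
  show "gs C y \<le> gs C (Suc y)" for y using gs_le[of C y] by simp
qed

lemma gs_idem: "gs C (gs C x) = gs C x"
  by (induction x) auto

lemma gs_eq_if_unmarked: "a \<le> b \<Longrightarrow> (\<And>x. a < x \<Longrightarrow> x \<le> b \<Longrightarrow> \<not> mark C x) \<Longrightarrow> gs C b = gs C a"
proof (induction rule: dec_induct)
  case (step x)
  have "\<not> mark C (Suc x)" using step by simp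
  then have "\<not> thr \<le> rows C {gs C x..Suc x}" by (auto simp: mark_def)
  then show ?case using step by simp
qed simp

text \<open>The segment that was open just before b overflowed when b was added, and it cannot begin
  before a, because a is itself a segment start.\<close>

lemma marks_rows:
  assumes "mark C a" "mark C b" "a < b"
  shows "thr \<le> rows C {a..b}"
proof -
  obtain b' where b': "b = Suc b'" using assms(3) by (cases b) auto
  have "gs C b' \<le> b'" by (rule gs_le)
  then have "thr \<le> rows C {gs C b'..b}" using assms(2) b' by (auto simp: mark_def split: if_splits)
  moreover have "a \<le> gs C b'" using gs_mono[of a b' C] assms b' by (simp add: mark_def)
  ultimately show ?thesis using rows_mono[of C C "{gs C b'..b}" "{a..b}"] by fastforce
qed

lemma hits_subset: "starts St \<Longrightarrow> hits St C \<subseteq> St"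
  using pt_props(1) by (auto simp: hits_def)

text \<open>Without a mark the whole part lies in one segment.\<close>

lemma unhit_rows:
  assumes "starts St" "i \<in> St" "i \<notin> hits St C"
  shows "rows C (part St i) < thr"
proof -
  let ?e = "nxt St i - 1"
  have e: "i \<le> ?e" "?e < nxt St i" using nxt_props(2)[OF assms(1,2)] by auto
  have "\<not> mark C x" if "i \<le> x" "x \<le> ?e" for x
  proof
    assume "mark C x"
    moreover have "pt St x = i" "x < n"
      using pt_eqI[OF assms(1,2), of x] that e nxt_props(1)[OF assms(1,2)] by auto
    ultimately show False using assms(3) by (auto simp: hits_def)
  qed
  then have "gs C ?e = gs C i" by (intro gs_eq_if_unmarked e) auto
  then have "part St i \<subseteq> {gs C ?e..?e}" using gs_le[of C i] by (auto simp: part_def)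
  then show ?thesis using rows_mono[of C C "part St i" "{gs C ?e..?e}"] gs_rows[of C ?e] by simp
qed

text \<open>Serves for the initial singleton parts, on which no segment ever overflows.\<close>

lemma rows_small_hits:
  assumes "C \<subseteq> {..<n}" "\<And>W. W \<subseteq> {..<n} \<Longrightarrow> rows C W < thr"
  shows "hits St C = {}"
proof -
  have "\<not> mark C x" if "x < n" for x
  proof
    assume "mark C x"
    then obtain x' where x': "x = Suc x'" "gs C (Suc x') = Suc x'" by (cases x) (auto simp: mark_def)
    have "gs C x' \<le> x'" by (rule gs_le)
    then have "thr \<le> rows C {gs C x'..Suc x'}" using x' by (auto split: if_splits)
    moreover have "rows C {gs C x'..Suc x'} < thr" using that x' by (intro assms(2)) auto
    ultimately show False by simp
  qed
  then show ?thesis by (auto simp: hits_def)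
qed

text \<open>The columns of the parts that are not bad for \<open>p\<close> are covered by at most \<open>maxhit + 1\<close>
  segments and at most \<open>maxhit\<close> hit parts, on each of which \<open>p\<close> has few distinct rows.\<close>

definition good_cols :: "nat set \<Rightarrow> nat \<Rightarrow> nat set" where
  "good_cols St p = {y. y < n \<and> rows (part St (pt St y)) (part St p) < big}"

lemma rows_good_cols:
  assumes St: "starts St" "p \<in> St" and h: "card (hits St (part St p)) \<le> h"
  shows "rows (good_cols St p) (part St p) \<le> big ^ (2 * h + 1)"
proof -
  let ?C = "part St p" and ?H = "hits St (part St p)"
  have fH: "finite ?H" by (simp add: hits_def)
  have Cn: "?C \<subseteq> {..<n}" using part_less[OF St] by auto
  \<comment> \<open>Only segments with a row outside the hit parts have to be counted; all other
    rows lie in hit parts and are covered by those.\<close>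
  define G where "G = gs ?C ` {y. y < n \<and> pt St y \<notin> ?H}"
  define I where "I = Inl ` G \<union> Inr ` (?H \<inter> {i. rows (part St i) ?C < big})"
  define F where "F a = (case a of Inl g \<Rightarrow> {y. y < n \<and> gs ?C y = g} | Inr i \<Rightarrow> part St i)" for a :: "nat + nat"
  have fG: "finite G" by (simp add: G_def)
  have G: "card G \<le> h + 1"
  proof -
    have "card (G - {0}) \<le> card ?H"
    proof (rule card_inj_on_le[where f = "pt St", OF _ _ fH])
      show "pt St ` (G - {0}) \<subseteq> ?H"
      proof
        fix i assume "i \<in> pt St ` (G - {0})"
        then obtain y where y: "i = pt St (gs ?C y)" "y < n" "gs ?C y \<noteq> 0" by (auto simp: G_def)
        then show "i \<in> ?H" using gs_le[of ?C y] gs_idem by (auto simp: hits_def mark_def)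
      qed
      \<comment> \<open>If two nonzero segment starts lay in the same part, every row of the earlier
        segment would lie between them and hence in that part, which is hit; but y was chosen
        outside the hit parts.\<close>
      have key: False if a: "y < n" "pt St y \<notin> ?H" "gs ?C y < gs ?C y'" "y' < n"
        "pt St (gs ?C y) = pt St (gs ?C y')" "gs ?C y \<noteq> 0" for y y'
      proof -
        have "gs ?C y' \<noteq> 0" using a by simp
        then have hit: "pt St (gs ?C y') \<in> ?H" using a gs_le[of ?C y'] gs_idem[of ?C y'] by (auto simp: hits_def mark_def)
        have "\<not> y \<le> gs ?C y'"
        proof
          assume "y \<le> gs ?C y'"
          then have "pt St y \<le> pt St (gs ?C y')" using pt_mono[OF St(1)] by blast
          moreover have "pt St (gs ?C y) \<le> pt St y" using pt_mono[OF St(1) gs_le] .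
          ultimately show False using a(2,5) hit by simp
        qed
        then have "gs ?C (gs ?C y') \<le> gs ?C y" by (intro gs_mono) simp
        then show False using gs_idem[of ?C y'] a(3) by simp
      qed
      show "inj_on (pt St) (G - {0})"
      proof (rule inj_onI)
        fix g g' assume "g \<in> G - {0}" "g' \<in> G - {0}" and e: "pt St g = pt St g'"
        then obtain y y' where y: "g = gs ?C y" "y < n" "pt St y \<notin> ?H" "g \<noteq> 0"
          "g' = gs ?C y'" "y' < n" "pt St y' \<notin> ?H" "g' \<noteq> 0" by (auto simp: G_def)
        then show "g = g'" using key[of y y'] key[of y' y] e by (metis linorder_neqE_nat)
      qed
    qed
    \<comment> \<open>Start 0 is not a mark and accounts for the additional 1.\<close>
    then have "card (G - {0}) \<le> h" using h by simp
    moreover have "card G \<le> card (G - {0}) + 1" using fG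
      by (metis Suc_eq_plus1 card.insert_remove card_insert_le finite.insertI insert_Diff_single)
    ultimately show ?thesis by simp
  qed
  have "card I \<le> card G + card (?H \<inter> {i. rows (part St i) ?C < big})"
    unfolding I_def by (metis card_Un_le card_image inj_Inl inj_Inr inj_on_subset subset_UNIV)
  also have "\<dots> \<le> (h + 1) + h" using G h card_mono[OF fH, of "?H \<inter> {i. rows (part St i) ?C < big}"] by simp
  finally have cI: "card I \<le> 2 * h + 1" by simp
  have fI: "finite I" using fG fH by (simp add: I_def)
  have "rows (F a) ?C \<le> big" if "a \<in> I" for a
  proof (cases a)
    case (Inr i)
    then show ?thesis using that by (auto simp: I_def F_def)
  next
    case (Inl g)
    let ?F = "{y. y < n \<and> gs ?C y = g}"
    \<comment> \<open>A segment has fewer than \<open>thr\<close> distinct rows on the columns of p.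
      Dualising, p has fewer than \<open>big\<close> distinct rows on the columns of the
      segment.\<close>
    have "rows ?C ?F < thr"
    proof (cases "?F = {}")
      case True
      have "rows ?C ?F = 0" unfolding rows_def True by simp
      then show ?thesis using thr_ge2 by simp
    next
      case False
      have fF: "finite ?F" by simp
      define z where "z = Max ?F"
      have "z \<in> ?F" unfolding z_def using fF False by (rule Max_in)
      have "?F \<subseteq> {gs ?C z..z}"
      proof
        fix y assume y: "y \<in> ?F"
        then have "y \<le> z" using fF by (simp add: z_def)
        moreover have "gs ?C z = gs ?C y" using y \<open>z \<in> ?F\<close> by simp
        ultimately show "y \<in> {gs ?C z..z}" using gs_le[of ?C y] by simp
      qed
      then show ?thesis using rows_mono[of ?C ?C ?F "{gs ?C z..z}"] gs_rows[of ?C z] by simp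
    qed
    then have "k ^ rows ?C ?F < big" by (rule big_bounds)
    moreover have "rows ?F ?C \<le> k ^ rows ?C ?F" using Cn by (intro rows_dual) auto
    ultimately show ?thesis using Inl by (simp add: F_def)
  qed
  then have b: "rows (\<Union>a\<in>I. F a) ?C \<le> big ^ card I" by (intro rows_Union fI) auto
  have "good_cols St p \<subseteq> (\<Union>a\<in>I. F a)"
  proof
    fix y assume y: "y \<in> good_cols St p"
    show "y \<in> (\<Union>a\<in>I. F a)"
    proof (cases "pt St y \<in> ?H")
      case True
      then have "Inr (pt St y) \<in> I" using y by (auto simp: I_def good_cols_def)
      moreover have "y \<in> F (Inr (pt St y))" using y part_eq[OF St(1) pt_props(1)[OF St(1)]] by (simp add: F_def good_cols_def)
      ultimately show ?thesis by blast
    next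
      case False
      then have "Inl (gs ?C y) \<in> I" "y \<in> F (Inl (gs ?C y))" using y by (auto simp: I_def G_def F_def good_cols_def)
      then show ?thesis by blast
    qed
  qed
  then have "rows (good_cols St p) ?C \<le> rows (\<Union>a\<in>I. F a) ?C" by (intro rows_mono) auto
  also have "\<dots> \<le> big ^ card I" by (rule b)
  also have "\<dots> \<le> big ^ (2 * h + 1)" using cI big_bounds(1) thr_ge2 by (intro power_increasing) auto
  finally show ?thesis .
qed

end

section \<open>Coarser divisions and the effect of one merge\<close>

context symmetric_array begin

lemma coarse_pt:
  assumes "starts St" "starts St'" "St' \<subseteq> St"
  shows "pt St' x = pt St' (pt St x)"
proof (rule antisym)
  show "pt St' (pt St x) \<le> pt St' x" using pt_mono[OF assms(2)] pt_props(2)[OF assms(1)] .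
  have "pt St' x \<le> pt St x" using pt_props[OF assms(2)] pt_props(3)[OF assms(1)] assms(3) by blast
  then show "pt St' x \<le> pt St' (pt St x)" using pt_props[OF assms(2)] by blast
qed

lemma coarse_hits:
  assumes "starts St" "starts St'" "St' \<subseteq> St"
  shows "hits St' C = pt St' ` hits St C"
  unfolding hits_def image_image coarse_pt[OF assms, symmetric] ..

lemma coarse_card_hits:
  assumes "starts St" "starts St'" "St' \<subseteq> St"
  shows "card (hits St' C) \<le> card (hits St C)"
  unfolding coarse_hits[OF assms] by (intro card_image_le) (simp add: hits_def)

lemma coarse_part:
  assumes "starts St" "starts St'" "St' \<subseteq> St" "x < n"
  shows "part St (pt St x) \<subseteq> part St' (pt St' x)"
  using part_eq[OF assms(1) pt_props(1)[OF assms(1)]] part_eq[OF assms(2) pt_props(1)[OF assms(2)]] coarse_pt[OF assms(1-3)]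
  by (metis (mono_tags, lifting) mem_Collect_eq subsetI)

text \<open>Merging can only increase the number of distinct rows, so a column may turn bad but
  never good again. Identifications made earlier therefore stay legitimate, as
  \<open>valid_coarse\<close> records.\<close>

lemma coarse_good_cols:
  assumes "starts St" "starts St'" "St' \<subseteq> St" "x < n"
  shows "good_cols St' (pt St' x) \<subseteq> good_cols St (pt St x)"
proof
  fix y assume "y \<in> good_cols St' (pt St' x)"
  then have y: "y < n" "rows (part St' (pt St' y)) (part St' (pt St' x)) < big" by (auto simp: good_cols_def)
  have "rows (part St (pt St y)) (part St (pt St x)) \<le> rows (part St' (pt St' y)) (part St' (pt St' x))"
    by (intro rows_mono coarse_part assms y finite_part)
  then show "y \<in> good_cols St (pt St x)" using y by (simp add: good_cols_def)
qed

lemma nxt_eqI: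
  assumes "p < e" "e = n \<or> e \<in> St" "starts St" "\<And>q. q \<in> St \<Longrightarrow> p < q \<Longrightarrow> e \<le> q"
  shows "nxt St p = e"
  unfolding nxt_def using assms starts_finite[OF assms(3)]
  by (intro Min_eqI) (auto simp: starts_def less_imp_le)

lemma merge_facts:
  assumes St: "starts St" "p \<in> St" and q: "q = nxt St p" "q < n"
  shows "starts (St - {q})" "nxt (St - {q}) p = nxt St q"
    "j \<in> St - {q} \<Longrightarrow> j \<noteq> p \<Longrightarrow> nxt (St - {q}) j = nxt St j"
    "part (St - {q}) p = part St p \<union> part St q"
    "pt (St - {q}) x = (if pt St x = q then p else pt St x)"
    "q \<in> St" "p < q"
proof -
  show qS: "q \<in> St" "p < q" using nxt_props[OF St] q by auto
  show St': "starts (St - {q})" using St qS by (auto simp: starts_def)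
  have qn: "q < nxt St q" using nxt_props(2)[OF St(1) qS(1)] .
  show 1: "nxt (St - {q}) p = nxt St q"
  proof (rule nxt_eqI[OF _ _ St'])
    show "p < nxt St q" using qS qn by simp
    show "nxt St q = n \<or> nxt St q \<in> St - {q}" using nxt_props(3)[OF St(1) qS(1)] qn by auto
    fix s assume s: "s \<in> St - {q}" "p < s"
    then have "q \<le> s" using nxt_props(4)[OF St] q by auto
    then show "nxt St q \<le> s" using s nxt_props(4)[OF St(1) qS(1)] by auto
  qed
  show "nxt (St - {q}) j = nxt St j" if j: "j \<in> St - {q}" "j \<noteq> p"
  proof (rule nxt_eqI[OF _ _ St'])
    have jS: "j \<in> St" using j by simp
    show "j < nxt St j" by (rule nxt_props(2)[OF St(1) jS])
    show "nxt St j = n \<or> nxt St j \<in> St - {q}"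
    proof (cases "nxt St j = q")
      case True
      have "j < p \<or> p < j" using j by auto
      then show ?thesis
      proof
        assume "j < p"
        then have "nxt St j \<le> p" by (rule nxt_props(4)[OF St(1) jS St(2)])
        then show ?thesis using True qS by simp
      next
        assume "p < j"
        then have "q \<le> j" using nxt_props(4)[OF St jS] q by simp
        then show ?thesis using True nxt_props(2)[OF St(1) jS] by simp
      qed
    qed (use nxt_props(3)[OF St(1) jS] in auto)
    show "\<And>s. s \<in> St - {q} \<Longrightarrow> j < s \<Longrightarrow> nxt St j \<le> s" using nxt_props(4)[OF St(1) jS] by auto
  qed
  show "part (St - {q}) p = part St p \<union> part St q"
    unfolding part_def 1 using q(1) qS qn by auto
  have sub: "St - {q} \<subseteq> St" by auto
  have p': "p \<in> St - {q}" using St qS by auto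
  show "pt (St - {q}) x = (if pt St x = q then p else pt St x)"
  proof (cases "pt St x = q")
    case True
    have "pt (St - {q}) q = p" by (rule pt_eqI[OF St' p']) (use qS qn 1 in auto)
    then show ?thesis using coarse_pt[OF St(1) St' sub, of x] True by simp
  next
    case False
    then have "pt St x \<in> St - {q}" using pt_props(1)[OF St(1)] by auto
    then show ?thesis using coarse_pt[OF St(1) St' sub, of x] pt_start[OF St'] False by simp
  qed
qed

section \<open>Row classes\<close>

text \<open>A class map sends every row to the representative of its class; the same map is used for
  the columns, up to a single merge.\<close>

definition valid :: "nat set \<Rightarrow> (nat \<Rightarrow> nat) \<Rightarrow> bool" where
  "valid St f \<longleftrightarrow> (\<forall>x<n. f x < n \<and> f (f x) = f x \<and> pt St (f x) = pt St x \<and>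
     (\<forall>y\<in>good_cols St (pt St x). m x y = m (f x) y))"

definition reps :: "nat set \<Rightarrow> (nat \<Rightarrow> nat) \<Rightarrow> nat \<Rightarrow> nat set" where
  "reps St f p = {x \<in> part St p. f x = x}"

definition join :: "(nat \<Rightarrow> nat) \<Rightarrow> nat \<Rightarrow> nat \<Rightarrow> nat \<Rightarrow> nat" where
  "join f z y = (\<lambda>x. if f x = y then z else f x)"

lemma validD:
  assumes "valid St f" "x < n"
  shows "f x < n" "f (f x) = f x" "pt St (f x) = pt St x" "\<And>y. y \<in> good_cols St (pt St x) \<Longrightarrow> m x y = m (f x) y"
  using assms unfolding valid_def by blast+

lemma valid_id: "valid St (\<lambda>x. x)" by (simp add: valid_def)

lemma valid_coarse:
  assumes "starts St" "starts St'" "St' \<subseteq> St" "valid St f"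
  shows "valid St' f"
  unfolding valid_def
proof (intro allI impI conjI ballI)
  fix x assume x: "x < n"
  note v = validD[OF assms(4) x]
  show "f x < n" "f (f x) = f x" by (fact v)+
  show "pt St' (f x) = pt St' x" using v(3) coarse_pt[OF assms(1-3)] by metis
  fix y assume "y \<in> good_cols St' (pt St' x)"
  then show "m x y = m (f x) y" using v(4) coarse_good_cols[OF assms(1-3) x] by blast
qed

text \<open>Agreement of the two representatives is enough, because every member of a class agrees
  with its representative on the same good columns.\<close>

lemma valid_join:
  assumes "starts St" "valid St f" "z \<in> reps St f p" "y \<in> reps St f p" "p \<in> St"
    "\<And>w. w \<in> good_cols St p \<Longrightarrow> m z w = m y w"
  shows "valid St (join f z y)"
  unfolding valid_def
proof (intro allI impI conjI ballI)
  fix x assume x: "x < n"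
  have zy: "z \<in> part St p" "f z = z" "y \<in> part St p" "f y = y" using assms(3,4) by (auto simp: reps_def)
  have zn: "z < n" "y < n" using part_less[OF assms(1,5)] zy(1,3) by blast+
  have z: "z < n" "f z = z" "pt St z = p" "y < n" "f y = y" "pt St y = p"
    using in_part_iff[OF assms(1,5) zn(1)] in_part_iff[OF assms(1,5) zn(2)] zn zy by blast+
  note f = validD[OF assms(2) x]
  show "join f z y x < n" "join f z y (join f z y x) = join f z y x" "pt St (join f z y x) = pt St x"
    using z f by (auto simp: join_def)
  fix w assume w: "w \<in> good_cols St (pt St x)"
  show "m x w = m (join f z y x) w" using f(3) f(4)[OF w] w z assms(6) by (auto simp: join_def)
qed

lemma reps_join: "z \<noteq> y \<Longrightarrow> f z = z \<Longrightarrow> f y = y \<Longrightarrow> reps St (join f z y) p = reps St f p - {y}"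
  by (auto simp: reps_def join_def)

text \<open>Rows told apart by good columns are different rows there, so
  \<open>rows_good_cols\<close> counts them. This bounds the classes of a part once no further
  identification is possible.\<close>

lemma card_distinguished_reps:
  assumes St: "starts St" "p \<in> St" and h: "card (hits St (part St p)) \<le> h"
    and X: "X \<subseteq> part St p" "\<And>x x'. x \<in> X \<Longrightarrow> x' \<in> X \<Longrightarrow> x \<noteq> x' \<Longrightarrow> \<exists>w\<in>good_cols St p. m x w \<noteq> m x' w"
  shows "card X \<le> big ^ (2 * h + 1)"
proof -
  have "inj_on (row (good_cols St p)) X"
    using X(2) by (intro inj_onI) (metis row_eq_iff)
  then have "card X = rows (good_cols St p) X" by (simp add: rows_def card_image)
  also have "\<dots> \<le> rows (good_cols St p) (part St p)" by (intro rows_mono X) auto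
  finally show ?thesis using rows_good_cols[OF St h] by simp
qed

end

text \<open>\<open>m\<close> is any injective recoding of the entries of M: atomic types across the
  two sides depend only on which entries coincide.\<close>

locale twin_width_input = symmetric_array n k d m for n k d m +
  fixes M :: "nat mat"
  assumes carrier: "M \<in> carrier_mat n n"
    and entries: "\<And>x y x' y'. x < n \<Longrightarrow> y < n \<Longrightarrow> x' < n \<Longrightarrow> y' < n \<Longrightarrow>
      m x y = m x' y' \<longleftrightarrow> M $$ (x, y) = M $$ (x', y')"
begin

abbreviation "S \<equiv> matrix_structure M"
abbreviation "U \<equiv> matrix_universe M"

lemma universe: "U = {..<n} <+> {..<n}" "universe S = U"
  using carrier by (auto simp: matrix_universe_def matrix_structure_def)

lemma in_U [simp]: "Inl x \<in> U \<longleftrightarrow> x < n" "Inr x \<in> U \<longleftrightarrow> x < n"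
  by (auto simp: universe)

lemma dims [simp]: "dim_row M = n" "dim_col M = n" using carrier by auto

lemmas S_simps = matrix_structure_def same_atomic_type_def split_option_all

lemma same_rows: "x < n \<Longrightarrow> w < n \<Longrightarrow> x' < n \<Longrightarrow> w' < n \<Longrightarrow>
  same_atomic_type S (Inl x, Inl w) (Inl x', Inl w') \<longleftrightarrow> (x \<le> w \<longleftrightarrow> x' \<le> w') \<and> (w \<le> x \<longleftrightarrow> w' \<le> x')"
  by (auto simp: S_simps)

lemma same_cols: "x < n \<Longrightarrow> w < n \<Longrightarrow> x' < n \<Longrightarrow> w' < n \<Longrightarrow>
  same_atomic_type S (Inr x, Inr w) (Inr x', Inr w') \<longleftrightarrow> (x \<le> w \<longleftrightarrow> x' \<le> w') \<and> (w \<le> x \<longleftrightarrow> w' \<le> x')"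
  by (auto simp: S_simps)

lemma same_row_col: "x < n \<Longrightarrow> y < n \<Longrightarrow> x' < n \<Longrightarrow> y' < n \<Longrightarrow>
  same_atomic_type S (Inl x, Inr y) (Inl x', Inr y') \<longleftrightarrow> m x y = m x' y'"
  using entries[of x y x' y'] by (auto simp: S_simps)

lemma same_col_row: "x < n \<Longrightarrow> y < n \<Longrightarrow> x' < n \<Longrightarrow> y' < n \<Longrightarrow>
  same_atomic_type S (Inr y, Inl x) (Inr y', Inl x') \<longleftrightarrow> m x y = m x' y'"
  using entries[of x y x' y'] by (auto simp: S_simps)

lemma not_same_unary: "x < n \<Longrightarrow> \<not> same_atomic_type S (Inl x, v) (Inr y, v')"
  "x < n \<Longrightarrow> \<not> same_atomic_type S (Inr y, v) (Inl x, v')"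
  by (auto simp: S_simps)

text \<open>J is the embedding of rows or of columns and J' the opposite one, so that an argument is
  carried out once for both sides.\<close>

definition sides :: "(nat \<Rightarrow> nat + nat) \<Rightarrow> (nat \<Rightarrow> nat + nat) \<Rightarrow> bool" where
  "sides J J' \<longleftrightarrow> J = Inl \<and> J' = Inr \<or> J = Inr \<and> J' = Inl"

lemma same_side: "sides J J' \<Longrightarrow> x < n \<Longrightarrow> w < n \<Longrightarrow> x' < n \<Longrightarrow> w' < n \<Longrightarrow>
  same_atomic_type S (J x, J w) (J x', J w') \<longleftrightarrow> (x \<le> w \<longleftrightarrow> x' \<le> w') \<and> (w \<le> x \<longleftrightarrow> w' \<le> x')"
  using same_rows same_cols by (auto simp: sides_def)

lemma same_cross: "sides J J' \<Longrightarrow> x < n \<Longrightarrow> y < n \<Longrightarrow> x' < n \<Longrightarrow> y' < n \<Longrightarrow>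
  same_atomic_type S (J x, J' y) (J x', J' y') \<longleftrightarrow> m x y = m x' y'"
  using same_row_col same_col_row sym by (auto simp: sides_def)

definition cls :: "(nat \<Rightarrow> nat + nat) \<Rightarrow> (nat \<Rightarrow> nat) \<Rightarrow> nat \<Rightarrow> (nat + nat) set" where
  "cls J f z = J ` {x. x < n \<and> f x = z}"

definition csets :: "(nat \<Rightarrow> nat + nat) \<Rightarrow> (nat \<Rightarrow> nat) \<Rightarrow> (nat + nat) set set" where
  "csets J f = cls J f ` {z. z < n \<and> f z = z}"

text \<open>Two class maps occur because a merge of rows precedes the same merge of columns. On one
  side only the order matters, and parts are intervals, so a class is homogeneous to the classes of
  all other parts. Across the sides red edges lead only to parts with at least \<open>thr\<close>
  distinct rows. This leaves c classes in the own part and c in each of at most b bad parts.\<close>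

lemma red_class_bound:
  assumes J: "sides J J'" and St: "starts St" and f: "valid St f" and g: "valid St g"
    and cf: "\<And>p. p \<in> St \<Longrightarrow> card (reps St f p) \<le> c" and cg: "\<And>p. p \<in> St \<Longrightarrow> card (reps St g p) \<le> c"
    and b: "\<And>i. i \<in> St \<Longrightarrow> card {j\<in>St. thr \<le> rows (part St i) (part St j)} \<le> b"
    and z: "z < n" "f z = z"
  shows "card {Y \<in> csets J f \<union> csets J' g. red_adjacent S (cls J f z) Y} \<le> c * (b + 1)"
proof -
  define i where "i = pt St z"
  define Bi where "Bi = {j\<in>St. thr \<le> rows (part St i) (part St j)}"
  have iS: "i \<in> St" using pt_props(1)[OF St] by (simp add: i_def)
  have fin: "finite Bi" using starts_finite[OF St] by (simp add: Bi_def)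
  have fpt: "pt St (f x) = pt St x" if "x < n" for x using validD(3)[OF f that] .
  have gpt: "pt St (g x) = pt St x" if "x < n" for x using validD(3)[OF g that] .
  have repI: "x \<in> reps St h p" if "x < n" "h x = x" "pt St x = p" "p \<in> St" for x h p
    using that in_part_iff[OF St that(4,1)] by (simp add: reps_def)
  have "{Y \<in> csets J f \<union> csets J' g. red_adjacent S (cls J f z) Y} \<subseteq>
      cls J f ` reps St f i \<union> cls J' g ` (\<Union>j\<in>Bi. reps St g j)"
  proof
    fix Y assume Y: "Y \<in> {Y \<in> csets J f \<union> csets J' g. red_adjacent S (cls J f z) Y}"
    then consider z' where "z' < n" "f z' = z'" "Y = cls J f z'" | z' where "z' < n" "g z' = z'" "Y = cls J' g z'"
      by (auto simp: csets_def)
    then show "Y \<in> cls J f ` reps St f i \<union> cls J' g ` (\<Union>j\<in>Bi. reps St g j)"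
    proof cases
      case 1
      have "pt St z' = i"
      proof (rule ccontr)
        assume ne: "pt St z' \<noteq> i"
        have ord: "x < w \<longleftrightarrow> i < pt St z'" "x \<noteq> w" if "x < n" "w < n" "f x = z" "f w = z'" for x w
        proof -
          have "pt St x = i" "pt St w = pt St z'" using fpt that by (auto simp: i_def)
          then show "x < w \<longleftrightarrow> i < pt St z'" "x \<noteq> w"
            using ne pt_mono[OF St, of x w] pt_mono[OF St, of w x] by (cases "x < w"; auto simp: not_less)+
        qed
        have s: "same_atomic_type S (J x, J w) (J x', J w')"
          if "x < n" "f x = z" "w < n" "f w = z'" "x' < n" "f x' = z" "w' < n" "f w' = z'" for x w x' w'
        proof -
          have "x < w \<longleftrightarrow> x' < w'" "x \<noteq> w" "x' \<noteq> w'" using ord[of x w] ord[of x' w'] that by blast+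
          then have "(x \<le> w \<longleftrightarrow> x' \<le> w') \<and> (w \<le> x \<longleftrightarrow> w' \<le> x')" by linarith
          then show ?thesis using same_side[OF J that(1,3,5,7)] by blast
        qed
        have "\<not> red_adjacent S (cls J f z) Y"
          unfolding red_adjacent_def 1(3) cls_def using s by blast
        then show False using Y by simp
      qed
      then show ?thesis using 1 repI iS by blast
    next
      case 2
      let ?j = "pt St z'"
      have jS: "?j \<in> St" using pt_props(1)[OF St] .
      have "thr \<le> rows (part St i) (part St ?j)"
      proof (rule ccontr)
        assume "\<not> thr \<le> rows (part St i) (part St ?j)"
        then have s: "rows (part St i) (part St ?j) < thr" by simp
        have "rows (part St ?j) (part St i) \<le> k ^ rows (part St i) (part St ?j)"
          using part_less[OF St iS] part_less[OF St jS] by (intro rows_dual) auto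
        then have ji: "rows (part St ?j) (part St i) < big" using big_bounds(2)[OF s] by simp
        have ij: "rows (part St i) (part St ?j) < big" using s big_bounds(1) by simp
        \<comment> \<open>The entry is moved from (x, y) to (z, y) inside the class of z and then to
          (z, z') inside the class of z'. The first move needs part j to be good for i, the second
          needs i to be good for j; both come from the one count below \<open>thr\<close>.\<close>
        have const: "m x y = m z z'" if "x < n" "f x = z" "y < n" "g y = z'" for x y
        proof -
          have px: "pt St x = i" "pt St y = ?j" using fpt gpt that by (auto simp: i_def)
          have "y \<in> good_cols St (pt St x)" using px ji that by (simp add: good_cols_def)
          then have "m x y = m z y" using validD(4)[OF f that(1)] that(2) by metis
          also have "\<dots> = m y z" using sym that z by simp
          also have "z \<in> good_cols St (pt St y)" using px ij z by (simp add: good_cols_def i_def)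
          then have "m y z = m z' z" using validD(4)[OF g that(3)] that(4) by metis
          also have "\<dots> = m z z'" using sym 2 z by simp
          finally show ?thesis .
        qed
        have "\<not> red_adjacent S (cls J f z) Y"
          unfolding red_adjacent_def 2(3) cls_def using same_cross[OF J] const by clarsimp
        then show False using Y by simp
      qed
      then have "?j \<in> Bi" using jS by (simp add: Bi_def)
      then show ?thesis using 2 repI jS by blast
    qed
  qed
  then have "card {Y \<in> csets J f \<union> csets J' g. red_adjacent S (cls J f z) Y} \<le>
      card (cls J f ` reps St f i \<union> cls J' g ` (\<Union>j\<in>Bi. reps St g j))"
    using fin by (intro card_mono) (auto simp: reps_def)
  also have "\<dots> \<le> card (reps St f i) + card (\<Union>j\<in>Bi. reps St g j)"
    using fin by (intro order.trans[OF card_Un_le] add_mono card_image_le) (auto simp: reps_def)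
  also have "\<dots> \<le> c + card Bi * c"
  proof (intro add_mono cf iS)
    have "card (\<Union>j\<in>Bi. reps St g j) \<le> (\<Sum>j\<in>Bi. card (reps St g j))" by (rule card_UN_le[OF fin])
    also have "\<dots> \<le> (\<Sum>j\<in>Bi. c)" using cg by (intro sum_mono) (auto simp: Bi_def)
    finally show "card (\<Union>j\<in>Bi. reps St g j) \<le> card Bi * c" by simp
  qed
  also have "\<dots> \<le> c + b * c" using b[OF iS] by (intro add_mono mult_le_mono) (auto simp: Bi_def)
  finally show ?thesis by (simp add: algebra_simps)
qed

definition division :: "(nat \<Rightarrow> nat) \<Rightarrow> (nat \<Rightarrow> nat) \<Rightarrow> (nat + nat) set set" where
  "division f g = csets Inl f \<union> csets Inr g"

definition narrow :: "nat \<Rightarrow> (nat + nat) set set \<Rightarrow> bool" where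
  "narrow D P \<longleftrightarrow> (\<forall>X\<in>P. card {Y\<in>P. red_adjacent S X Y} \<le> D)"

lemma narrow_division:
  assumes "starts St" "valid St f" "valid St g" "\<And>p. p \<in> St \<Longrightarrow> card (reps St f p) \<le> c"
    "\<And>p. p \<in> St \<Longrightarrow> card (reps St g p) \<le> c"
    "\<And>i. i \<in> St \<Longrightarrow> card {j\<in>St. thr \<le> rows (part St i) (part St j)} \<le> b"
  shows "narrow (c * (b + 1)) (division f g)"
  unfolding narrow_def
proof
  fix X assume "X \<in> division f g"
  then consider z where "z < n" "f z = z" "X = cls Inl f z" | z where "z < n" "g z = z" "X = cls Inr g z"
    by (auto simp: division_def csets_def)
  then show "card {Y \<in> division f g. red_adjacent S X Y} \<le> c * (b + 1)"
  proof cases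
    case 1
    then show ?thesis unfolding 1(3) division_def
      by (intro red_class_bound[OF _ assms]) (auto simp: sides_def)
  next
    case 2
    have "card {Y \<in> csets Inr g \<union> csets Inl f. red_adjacent S (cls Inr g z) Y} \<le> c * (b + 1)"
      using 2 by (intro red_class_bound[OF _ assms(1,3,2,5,4,6)]) (auto simp: sides_def)
    then show ?thesis unfolding 2(3) division_def by (simp add: Un_commute)
  qed
qed

section \<open>Output sequences\<close>

text \<open>Carries all conditions of a D-sequence except that the last partition is trivial, so
  that the output can be extended by one merge at a time.\<close>

definition fits_seq :: "nat \<Rightarrow> ((nat + nat) \<times> (nat + nat)) list \<Rightarrow> (nat + nat) set set \<Rightarrow> bool" where
  "fits_seq D es P \<longleftrightarrow> set es \<subseteq> U \<times> U \<and>
     (let Ps = merge_sequence ((\<lambda>v. {v}) ` U) es in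
      last Ps = P \<and> (\<forall>P\<in>set Ps. partition_on U P \<and> narrow D P) \<and>
      (\<forall>t. Suc t < length Ps \<longrightarrow> contraction_step (Ps ! t) (Ps ! Suc t)))"

lemma merge_sequence_ne [simp]: "merge_sequence P es \<noteq> []"
  by (cases es) auto

lemma merge_sequence_snoc:
  "merge_sequence P (es @ [(u, v)]) = merge_sequence P es @ [merge_parts u v (last (merge_sequence P es))]"
  by (induction P es rule: merge_sequence.induct) auto

lemma length_merge_sequence [simp]: "length (merge_sequence P es) = length es + 1"
  by (induction P es rule: merge_sequence.induct) auto

lemma hd_merge_sequence [simp]: "hd (merge_sequence P es) = P"
  by (cases es) auto

lemma merge_parts_eq:
  assumes "partition_on T P" "X \<in> P" "Y \<in> P" "u \<in> X" "v \<in> Y"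
  shows "merge_parts u v P = insert (X \<union> Y) (P - {X, Y})"
proof -
  have "Z = X" if "Z \<in> P" "u \<in> Z" for Z using that assms partition_onD2[OF assms(1)] unfolding disjoint_def by blast
  moreover have "Z = Y" if "Z \<in> P" "v \<in> Z" for Z using that assms partition_onD2[OF assms(1)] unfolding disjoint_def by blast
  ultimately have "{Z\<in>P. u \<in> Z \<or> v \<in> Z} = {X, Y}" using assms by blast
  then show ?thesis by (simp add: merge_parts_def)
qed

lemma partition_merge:
  assumes "partition_on T P" "X \<in> P" "Y \<in> P"
  shows "partition_on T (insert (X \<union> Y) (P - {X, Y}))"
proof (rule partition_onI)
  show "\<Union> (insert (X \<union> Y) (P - {X, Y})) = T" using partition_onD1[OF assms(1)] assms by blast
  show "{} \<notin> insert (X \<union> Y) (P - {X, Y})"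
    using partition_onD3[OF assms(1)] assms by auto
  have d: "A \<inter> B = {}" if "A \<in> P" "B \<in> P" "A \<noteq> B" for A B
    using that partition_onD2[OF assms(1)] unfolding disjoint_def by blast
  have o: "(X \<union> Y) \<inter> Z = {}" if "Z \<in> P - {X, Y}" for Z
  proof -
    have "X \<inter> Z = {}" by (rule d) (use that assms in auto)
    moreover have "Y \<inter> Z = {}" by (rule d) (use that assms in auto)
    ultimately show ?thesis by blast
  qed
  fix p p' assume p: "p \<in> insert (X \<union> Y) (P - {X, Y})" "p' \<in> insert (X \<union> Y) (P - {X, Y})" "p \<noteq> p'"
  consider "p = X \<union> Y" "p' \<in> P - {X, Y}" | "p' = X \<union> Y" "p \<in> P - {X, Y}" | "p \<in> P" "p' \<in> P"
    using p by blast
  then show "disjnt p p'"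
  proof cases
    case 1 then show ?thesis using o[of p'] by (simp add: disjnt_def)
  next
    case 2 then show ?thesis using o[of p] by (simp add: disjnt_def Int_commute)
  next
    case 3 then show ?thesis using d p(3) by (simp add: disjnt_def)
  qed
qed

lemma fits_seq_snoc:
  assumes "fits_seq D es P" "X \<in> P" "Y \<in> P" "u \<in> X" "v \<in> Y" "X \<noteq> Y"
    and Q: "Q = insert (X \<union> Y) (P - {X, Y})" "narrow D Q"
  shows "fits_seq D (es @ [(u, v)]) Q"
proof -
  let ?Ps = "merge_sequence ((\<lambda>v. {v}) ` U) es"
  have P: "last ?Ps = P" "partition_on U P" using assms(1) by (auto simp: fits_seq_def Let_def)
  have uv: "u \<in> U" "v \<in> U" using partition_onD1[OF P(2)] assms by auto
  have eq: "merge_sequence ((\<lambda>v. {v}) ` U) (es @ [(u, v)]) = ?Ps @ [Q]"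
    unfolding merge_sequence_snoc P(1) Q merge_parts_eq[OF P(2) assms(2-5)] ..
  have pQ: "partition_on U Q" unfolding Q by (rule partition_merge[OF P(2) assms(2,3)])
  have cs: "contraction_step P Q" unfolding contraction_step_def Q(1) using assms by blast
  have "contraction_step ((?Ps @ [Q]) ! t) ((?Ps @ [Q]) ! Suc t)" if "Suc t < length (?Ps @ [Q])" for t
  proof (cases "Suc t < length ?Ps")
    case True
    then show ?thesis using assms(1) by (simp add: fits_seq_def Let_def nth_append)
  next
    case False
    then have t: "t = length es" using that by simp
    have "?Ps ! length es = P" using P(1) by (simp add: last_conv_nth)
    then show ?thesis using cs t by (simp add: nth_append)
  qed
  then show ?thesis
    using assms(1) uv pQ Q(2) unfolding fits_seq_def Let_def eq by auto
qed

lemma fits_seq_D_sequence: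
  assumes "fits_seq D es {U}"
  shows "D_sequence S D (merge_sequence ((\<lambda>v. {v}) ` U) es)"
  using assms by (auto simp: fits_seq_def Let_def D_sequence_def contraction_sequence_def universe narrow_def)

lemma fits_seq_Nil:
  assumes "narrow D (division (\<lambda>x. x) (\<lambda>x. x))"
  shows "fits_seq D [] (division (\<lambda>x. x) (\<lambda>x. x))"
proof -
  have eq: "(\<lambda>v. {v}) ` U = division (\<lambda>x. x) (\<lambda>x. x)"
  proof -
    have c: "cls J (\<lambda>x. x) z = {J z}" if "z < n" for J z using that by (auto simp: cls_def)
    have "csets J (\<lambda>x. x) = (\<lambda>z. {J z}) ` {..<n}" for J
      unfolding csets_def using c by (auto simp: image_iff)
    then show ?thesis unfolding division_def universe(1) Plus_def image_Un image_image by simp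
  qed
  have "partition_on U ((\<lambda>v. {v}) ` U)" by (rule partition_onI) (auto simp: disjnt_def)
  then show ?thesis using assms unfolding fits_seq_def Let_def by (simp add: eq)
qed

lemma csets_join:
  assumes J: "sides J J'" and f: "\<And>x. x < n \<Longrightarrow> f x < n \<and> f (f x) = f x"
    and zy: "z < n" "f z = z" "y < n" "f y = y" "z \<noteq> y"
  shows "csets J (join f z y) = insert (cls J f z \<union> cls J f y) (csets J f - {cls J f z, cls J f y})"
    "cls J f z \<in> csets J f" "cls J f y \<in> csets J f" "cls J f z \<noteq> cls J f y" "J z \<in> cls J f z" "J y \<in> cls J f y"
proof -
  have injJ: "inj J" using J by (auto simp: sides_def)
  show m: "J z \<in> cls J f z" "J y \<in> cls J f y" using zy by (auto simp: cls_def)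
  show "cls J f z \<in> csets J f" "cls J f y \<in> csets J f" using zy by (auto simp: csets_def)
  have ne: "cls J f a \<noteq> cls J f b" if "a < n" "f a = a" "b < n" "f b = b" "a \<noteq> b" for a b
  proof -
    have "J a \<in> cls J f a" "J a \<notin> cls J f b" using that by (auto simp: cls_def dest: injD[OF injJ])
    then show ?thesis by blast
  qed
  show "cls J f z \<noteq> cls J f y" using ne zy by blast
  have jz: "cls J (join f z y) z = cls J f z \<union> cls J f y" using zy by (auto simp: cls_def join_def)
  have jw: "cls J (join f z y) w = cls J f w" if "w \<noteq> z" "w \<noteq> y" for w
    using that by (auto simp: cls_def join_def)
  have fx: "{w. w < n \<and> join f z y w = w} = {w. w < n \<and> f w = w} - {y}"
    using zy by (auto simp: join_def)
  show "csets J (join f z y) = insert (cls J f z \<union> cls J f y) (csets J f - {cls J f z, cls J f y})"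
  proof -
    have 1: "{w. w < n \<and> f w = w} - {y} = insert z ({w. w < n \<and> f w = w} - {z, y})" using zy by auto
    have 2: "cls J (join f z y) ` ({w. w < n \<and> f w = w} - {z, y}) = cls J f ` ({w. w < n \<and> f w = w} - {z, y})"
      using jw by (intro image_cong) auto
    have 3: "cls J f ` ({w. w < n \<and> f w = w} - {z, y}) = csets J f - {cls J f z, cls J f y}"
      unfolding csets_def using ne zy by blast
    show ?thesis unfolding csets_def[of J "join f z y"] fx 1 image_insert jz 2 3 ..
  qed
qed

lemma csets_disjoint: "sides J J' \<Longrightarrow> X \<in> csets J f \<Longrightarrow> X \<notin> csets J' g"
  unfolding csets_def cls_def sides_def by fastforce

lemma fits_seq_join_rows:
  assumes s: "fits_seq D es (division f g)" and f: "\<And>x. x < n \<Longrightarrow> f x < n \<and> f (f x) = f x"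
    and zy: "z < n" "f z = z" "y < n" "f y = y" "z \<noteq> y" and nr: "narrow D (division (join f z y) g)"
  shows "fits_seq D (es @ [(Inl z, Inl y)]) (division (join f z y) g)"
proof -
  have J: "sides Inl Inr" by (simp add: sides_def)
  note c = csets_join[OF J f zy]
  have e: "csets Inl (join f z y) = insert (cls Inl f z \<union> cls Inl f y) (csets Inl f - {cls Inl f z, cls Inl f y})"
    by (rule c(1))
  show ?thesis
  proof (rule fits_seq_snoc[OF s _ _ c(5,6,4) _ nr])
    show "cls Inl f z \<in> division f g" "cls Inl f y \<in> division f g" using c by (auto simp: division_def)
    show "division (join f z y) g = insert (cls Inl f z \<union> cls Inl f y) (division f g - {cls Inl f z, cls Inl f y})"
      unfolding division_def e using csets_disjoint[OF J c(2), of g] csets_disjoint[OF J c(3), of g] by auto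
  qed
qed

lemma fits_seq_join_cols:
  assumes s: "fits_seq D es (division f g)" and g: "\<And>x. x < n \<Longrightarrow> g x < n \<and> g (g x) = g x"
    and zy: "z < n" "g z = z" "y < n" "g y = y" "z \<noteq> y" and nr: "narrow D (division f (join g z y))"
  shows "fits_seq D (es @ [(Inr z, Inr y)]) (division f (join g z y))"
proof -
  have J: "sides Inr Inl" by (simp add: sides_def)
  note c = csets_join[OF J g zy]
  have e: "csets Inr (join g z y) = insert (cls Inr g z \<union> cls Inr g y) (csets Inr g - {cls Inr g z, cls Inr g y})"
    by (rule c(1))
  show ?thesis
  proof (rule fits_seq_snoc[OF s _ _ c(5,6,4) _ nr])
    show "cls Inr g z \<in> division f g" "cls Inr g y \<in> division f g" using c by (auto simp: division_def)
    show "division f (join g z y) = insert (cls Inr g z \<union> cls Inr g y) (division f g - {cls Inr g z, cls Inr g y})"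
      unfolding division_def e using csets_disjoint[OF J c(2), of f] csets_disjoint[OF J c(3), of f] by auto
  qed
qed

text \<open>With one class of rows and one of columns left, the last merge produces a single part,
  which has no red neighbour at all.\<close>

lemma fits_seq_final:
  assumes s: "fits_seq D es (division f f)" and f: "\<And>x. x < n \<Longrightarrow> f x = 0"
  shows "fits_seq D (es @ [(Inl 0, Inr 0)]) {U}"
proof -
  have c: "csets J f = {J ` {..<n}}" for J :: "nat \<Rightarrow> nat + nat"
  proof -
    have "{z. z < n \<and> f z = z} = {0}" using f n_pos by (auto; metis)
    moreover have "cls J f 0 = J ` {..<n}" using f by (auto simp: cls_def)
    ultimately show ?thesis by (simp add: csets_def)
  qed
  show ?thesis
  proof (rule fits_seq_snoc[OF s, of "Inl ` {..<n}" "Inr ` {..<n}"])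
    have "{Y \<in> {U}. red_adjacent S U Y} = {}" by (auto simp: red_adjacent_def)
    then show "narrow D {U}" unfolding narrow_def by (metis card.empty singletonD zero_le)
    show "{U} = insert (Inl ` {..<n} \<union> Inr ` {..<n}) (division f f - {Inl ` {..<n}, Inr ` {..<n}})"
      by (auto simp: division_def c universe)
    show "Inl ` {..<n} \<noteq> Inr ` {..<n}" using n_pos by blast
  qed (use n_pos in \<open>auto simp: division_def c\<close>)
qed

end

context twin_width_input begin

section \<open>Rich divisions\<close>

text \<open>Rows and columns with the same block number count as different blocks, so q block
  numbers give 2q blocks in all.\<close>

fun blk :: "(nat \<Rightarrow> nat) \<Rightarrow> nat + nat \<Rightarrow> nat + nat" where
  "blk bl (Inl x) = Inl (bl x)"
| "blk bl (Inr x) = Inr (bl x)"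

lemma finite_U: "finite U" by (simp add: universe)

text \<open>A pair beginning with a row and a pair beginning with a column differ in the unary
  relation. A mixed part is thus red-adjacent to every other part, which the bound d forbids while
  more than d + 1 parts are left.\<close>

lemma pure_part:
  assumes P: "partition_on U P" and nr: "narrow d P" and big_P: "d + 1 < card P" and W: "W \<in> P"
  shows "\<not> (Inl x \<in> W \<and> Inr y \<in> W)"
proof
  assume xy: "Inl x \<in> W \<and> Inr y \<in> W"
  have x: "x < n" using xy W partition_onD1[OF P] in_U by blast
  have "red_adjacent S W Y" if Y: "Y \<in> P" "Y \<noteq> W" for Y
  proof -
    obtain v where "v \<in> Y" using Y partition_onD3[OF P] by (metis ex_in_conv)
    then show ?thesis unfolding red_adjacent_def using xy Y not_same_unary(1)[OF x] by blast
  qed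
  then have "P - {W} \<subseteq> {Y\<in>P. red_adjacent S W Y}" by blast
  moreover have fP: "finite P" using finite_elements[OF finite_U P] .
  ultimately have "card (P - {W}) \<le> card {Y\<in>P. red_adjacent S W Y}" by (intro card_mono) auto
  also have "\<dots> \<le> d" using nr W by (simp add: narrow_def)
  finally show False using big_P fP W by (simp add: card_Diff_singleton)
qed

text \<open>The part \<open>Z\<close> of a narrow partition spans a whole block \<open>b\<close> of the division, so few parts
  meet \<open>b\<close>; away from the few blocks that their red neighbours meet, \<open>b\<close> has few distinct rows.\<close>

lemma few_rows_in_spanned_block:
  assumes J: "sides J J'" and P: "partition_on U P" and nr: "narrow d P" and big_P: "d + 1 < card P"
    and mono: "\<And>x y. x \<le> y \<Longrightarrow> y < n \<Longrightarrow> bl x \<le> bl y"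
    and two: "\<And>W. W \<in> P \<Longrightarrow> W \<noteq> Z \<Longrightarrow> card (blk bl ` W) \<le> 2"
    and Z: "Z \<in> P" "J x1 \<in> Z" "J x2 \<in> Z" "J x3 \<in> Z" "bl x1 < bl x2" "bl x2 < bl x3"
  shows "\<exists>D. D \<subseteq> bl ` {..<n} \<and> card D \<le> 2 * d * (d + 1) \<and>
    rows {y. y < n \<and> bl y \<notin> D} {x. x < n \<and> bl x = bl x2} \<le> d + 1"
proof -
  have fP: "finite P" using finite_elements[OF finite_U P] .
  have UP: "\<Union>P = U" using partition_onD1[OF P] by simp
  have less: "x < n" if "J x \<in> W" "W \<in> P" for x W using that UP in_U J unfolding sides_def by blast
  have less': "x < n" if "J' x \<in> W" "W \<in> P" for x W using that UP in_U J unfolding sides_def by blast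
  have pure: "\<not> (J x \<in> W \<and> J' y \<in> W)" if "W \<in> P" for W x y
    using pure_part[OF P nr big_P that] J unfolding sides_def by blast
  have deg: "card {Y\<in>P. red_adjacent S W Y} \<le> d" if "W \<in> P" for W using nr that by (simp add: narrow_def)
  \<comment> \<open>These are the parts meeting the block of x2 on the side of Z. An element of that
    block lies strictly between x1 and x3, so its order relation to Z is not uniform, and its part
    is Z or a red neighbour of Z.\<close>
  define W0 where "W0 = {W\<in>P. \<exists>x. x < n \<and> bl x = bl x2 \<and> J x \<in> W}"
  define R where "R W = {Y\<in>P. red_adjacent S W Y}" for W
  have x: "x1 < n" "x2 < n" "x3 < n" using less Z by blast+
  have "W0 \<subseteq> insert Z (R Z)"
  proof
    fix W assume W: "W \<in> W0"
    then obtain x where x': "x < n" "bl x = bl x2" "J x \<in> W" "W \<in> P" by (auto simp: W0_def)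
    have lt: "x1 < x" "x < x3" using mono[of x x1] mono[of x3 x] x x' Z(5,6) by (metis leD leI)+
    have "\<not> same_atomic_type S (J x1, J x) (J x3, J x)"
      using same_side[OF J x(1) x'(1) x(3) x'(1)] lt by auto
    then have "red_adjacent S Z W" if "W \<noteq> Z" unfolding red_adjacent_def using Z x' that by blast
    then show "W \<in> insert Z (R Z)" using x' by (auto simp: R_def)
  qed
  then have cW: "card W0 \<le> d + 1"
    using card_mono[of "insert Z (R Z)" W0] fP deg[OF Z(1)] card_insert_le_m1[of "Suc d" "R Z" Z]
    by (auto simp: R_def)
  have fW: "finite W0" using fP by (simp add: W0_def)
  \<comment> \<open>Elements of the other side whose part is outside E are homogeneous to every part
    in \<open>W0\<close>; D below collects the blocks that E meets on the other side.\<close>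
  define E where "E = (\<Union>W\<in>W0. R W)"
  have cE: "card E \<le> d * (d + 1)"
  proof -
    have "card E \<le> (\<Sum>W\<in>W0. card (R W))" unfolding E_def by (rule card_UN_le[OF fW])
    also have "\<dots> \<le> (\<Sum>W\<in>W0. d)" using deg by (intro sum_mono) (auto simp: R_def W0_def)
    also have "\<dots> = card W0 * d" by simp
    also have "\<dots> \<le> (d + 1) * d" by (rule mult_le_mono1[OF cW])
    also have "\<dots> = d * (d + 1)" by (rule mult.commute)
    finally show ?thesis .
  qed
  have fE: "finite E" using fW fP by (auto simp: E_def R_def)
  define D where "D = (\<Union>Y\<in>E. bl ` {y. J' y \<in> Y})"
  have EP: "E \<subseteq> P" by (auto simp: E_def R_def)
  have fJ: "finite {y. J' y \<in> Y}" if "Y \<in> E" for Y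
    using that EP less' by (intro finite_subset[of "{y. J' y \<in> Y}" "{..<n}"]) auto
  \<comment> \<open>Since Z is pure, a part with an element on the other side is not Z, so the bound
    of two blocks applies to it.\<close>
  have cY: "card (bl ` {y. J' y \<in> Y}) \<le> 2" if Y: "Y \<in> E" for Y
  proof (cases "{y. J' y \<in> Y} = {}")
    case False
    then obtain y where "J' y \<in> Y" by blast
    then have ne: "Y \<noteq> Z" using pure[OF Z(1)] Z(2) by blast
    have injJ: "inj J'" using J by (auto simp: sides_def)
    have "Y \<subseteq> U" using Y EP UP by blast
    then have fY: "finite Y" using finite_U by (rule finite_subset)
    have "card (bl ` {y. J' y \<in> Y}) = card (J' ` bl ` {y. J' y \<in> Y})"
      using injJ by (intro card_image[symmetric]) (auto intro: inj_on_subset)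
    also have "\<dots> \<le> card (blk bl ` Y)"
    proof (rule card_mono)
      show "finite (blk bl ` Y)" using fY by simp
      show "J' ` bl ` {y. J' y \<in> Y} \<subseteq> blk bl ` Y" using J by (force simp: sides_def)
    qed
    also have "\<dots> \<le> 2" using two ne Y EP by blast
    finally show ?thesis .
  qed simp
  have cD: "card D \<le> 2 * d * (d + 1)"
  proof -
    have "card D \<le> (\<Sum>Y\<in>E. card (bl ` {y. J' y \<in> Y}))" unfolding D_def by (rule card_UN_le[OF fE])
    also have "\<dots> \<le> (\<Sum>Y\<in>E. 2)" using cY by (intro sum_mono)
    also have "\<dots> \<le> 2 * d * (d + 1)" using cE by simp
    finally show ?thesis .
  qed
  have Dn: "D \<subseteq> bl ` {..<n}" unfolding D_def using less' EP by blast
  let ?C = "{y. y < n \<and> bl y \<notin> D}" and ?W = "{x. x < n \<and> bl x = bl x2}"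
  define h where "h x = (THE W. W \<in> P \<and> J x \<in> W)" for x
  have h: "h x \<in> P" "J x \<in> h x" if "x < n" for x
  proof -
    have "J x \<in> U" using that J by (auto simp: sides_def)
    then obtain W where W: "W \<in> P" "J x \<in> W" using UP by blast
    moreover have "W' = W" if "W' \<in> P \<and> J x \<in> W'" for W'
      using that W partition_onD2[OF P] unfolding disjoint_def by blast
    ultimately have "\<exists>!W. W \<in> P \<and> J x \<in> W" by blast
    then have "h x \<in> P \<and> J x \<in> h x" unfolding h_def by (rule theI')
    then show "h x \<in> P" "J x \<in> h x" by blast+
  qed
  have hW: "h ` ?W \<subseteq> W0" using h by (auto simp: W0_def)
  have eq: "row ?C x = row ?C x'" if xx: "x \<in> ?W" "x' \<in> ?W" "h x = h x'" for x x'
    unfolding row_eq_iff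
  proof
    fix y assume y: "y \<in> ?C"
    have "J' y \<in> U" using y J by (auto simp: sides_def)
    then obtain Y where Y: "Y \<in> P" "J' y \<in> Y" using UP by blast
    have hx: "h x \<in> W0" using hW xx by blast
    have "Y \<notin> E"
    proof
      assume "Y \<in> E"
      then have "bl y \<in> D" using Y unfolding D_def by blast
      then show False using y by simp
    qed
    then have "\<not> red_adjacent S (h x) Y" using Y hx unfolding E_def R_def by blast
    moreover have "h x \<noteq> Y" using pure[OF Y(1)] h(2)[of x] xx Y by auto
    moreover have "J x \<in> h x" "J x' \<in> h x" using h(2)[of x] h(2)[of x'] xx by auto
    ultimately have "same_atomic_type S (J x, J' y) (J x', J' y)" unfolding red_adjacent_def using Y by blast
    then show "m x y = m x' y" using same_cross[OF J] xx y by auto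
  qed
  have "rows ?C ?W \<le> card (h ` ?W)"
    unfolding rows_def
  proof (rule card_le_if_inj_on_rel[where r = "\<lambda>a b. \<exists>x\<in>?W. a = row ?C x \<and> b = h x"])
    fix a1 a2 b assume "\<exists>x\<in>?W. a1 = row ?C x \<and> b = h x" "\<exists>x\<in>?W. a2 = row ?C x \<and> b = h x"
    then obtain x x' where "x \<in> ?W" "x' \<in> ?W" "h x = h x'" "a1 = row ?C x" "a2 = row ?C x'" by (elim bexE) auto
    then show "a1 = a2" using eq by blast
  qed (simp, blast)
  also have "\<dots> \<le> card W0" by (rule card_mono[OF fW hW])
  also have "\<dots> \<le> d + 1" by (rule cW)
  finally show ?thesis using cD Dn by blast
qed

text \<open>The first part to meet three blocks is a union of two parts that meet at most two each,
  so it meets at most four. Such a moment exists: singletons meet one block, the whole universe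
  meets all of them.\<close>

lemma rich_no_D_sequence:
  assumes mono: "\<And>x y. x \<le> y \<Longrightarrow> y < n \<Longrightarrow> bl x \<le> bl y"
    and im: "bl ` {..<n} = {..<q}" and q: "d + 2 < q"
    and rich: "\<And>b D. b < q \<Longrightarrow> D \<subseteq> {..<q} \<Longrightarrow> card D \<le> 2 * d * (d + 1) \<Longrightarrow>
      d + 2 \<le> rows {y. y < n \<and> bl y \<notin> D} {x. x < n \<and> bl x = b}"
  shows "\<not> D_sequence S d Ps"
proof
  assume ds: "D_sequence S d Ps"
  then have Ps: "Ps \<noteq> []" "\<And>P. P \<in> set Ps \<Longrightarrow> partition_on U P \<and> narrow d P" "hd Ps = (\<lambda>v. {v}) ` U"
    "last Ps = {U}" "\<And>t. Suc t < length Ps \<Longrightarrow> contraction_step (Ps ! t) (Ps ! Suc t)"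
    by (auto simp: D_sequence_def contraction_sequence_def universe narrow_def)
  have blkU: "blk bl ` U = {..<q} <+> {..<q}"
  proof -
    have "blk bl ` U = Inl ` bl ` {..<n} \<union> Inr ` bl ` {..<n}"
      unfolding universe(1) Plus_def image_Un image_image by simp
    then show ?thesis unfolding im Plus_def .
  qed
  have cU: "card (blk bl ` U) = 2 * q" unfolding blkU by (simp add: card_Plus)
  define wide where "wide t \<longleftrightarrow> t < length Ps \<and> (\<exists>X\<in>Ps ! t. 3 \<le> card (blk bl ` X))" for t
  have "wide (length Ps - 1)"
    unfolding wide_def using Ps(1,4) cU q by (auto simp: last_conv_nth)
  then obtain t where t: "wide t" "\<And>s. s < t \<Longrightarrow> \<not> wide s" by (metis ex_least_nat_le not_less0 nat_less_le le_less_trans LeastI Least_le not_le)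
  have t0: "t \<noteq> 0"
  proof
    assume "t = 0"
    then have "\<exists>X\<in>(\<lambda>v. {v}) ` U. 3 \<le> card (blk bl ` X)" using t(1) Ps(1,3) by (auto simp: wide_def hd_conv_nth)
    then show False by auto
  qed
  then obtain s where s: "t = Suc s" by (cases t) auto
  define P where "P = Ps ! t"
  define P' where "P' = Ps ! s"
  have tl: "t < length Ps" using t by (simp add: wide_def)
  have P: "partition_on U P" "narrow d P" using Ps(2) tl by (auto simp: P_def)
  have P': "partition_on U P'" using Ps(2) tl s by (auto simp: P'_def)
  have two': "card (blk bl ` X) \<le> 2" if "X \<in> P'" for X
    using t(2)[of s] s tl that by (fastforce simp: wide_def P'_def)
  obtain X1 X2 where X: "X1 \<in> P'" "X2 \<in> P'" "P = insert (X1 \<union> X2) (P' - {X1, X2})"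
    using Ps(5)[of s] tl s unfolding contraction_step_def P_def P'_def by auto
  define Z where "Z = X1 \<union> X2"
  have Z: "Z \<in> P" using X by (simp add: Z_def)
  have two: "card (blk bl ` W) \<le> 2" if "W \<in> P" "W \<noteq> Z" for W using that X two' by (auto simp: Z_def)
  have Z3: "3 \<le> card (blk bl ` Z)"
  proof -
    obtain X where "X \<in> P" "3 \<le> card (blk bl ` X)" using t(1) by (auto simp: wide_def P_def)
    then show ?thesis using two[of X] by (cases "X = Z") auto
  qed
  have Z4: "card (blk bl ` Z) \<le> 4"
  proof -
    have "card (blk bl ` Z) \<le> card (blk bl ` X1) + card (blk bl ` X2)"
      unfolding Z_def image_Un by (rule card_Un_le)
    then show ?thesis using two'[OF X(1)] two'[OF X(2)] by linarith
  qed
  have fP: "finite P" using finite_elements[OF finite_U P(1)] .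
  have UP: "\<Union>P = U" using partition_onD1[OF P(1)] by simp
  \<comment> \<open>The new part covers at most 4 of the 2q blocks and every other part at most 2,
    so at least q - 1 parts remain. By \<open>pure_part\<close> each of them then lies on one
    side.\<close>
  have big_P: "d + 1 < card P"
  proof -
    have "2 * q = card (\<Union>W\<in>P. blk bl ` W)" unfolding cU[symmetric] UP[symmetric] by (simp add: image_Union)
    also have "\<dots> \<le> (\<Sum>W\<in>P. card (blk bl ` W))" by (rule card_UN_le[OF fP])
    also have "\<dots> = card (blk bl ` Z) + (\<Sum>W\<in>P - {Z}. card (blk bl ` W))" by (rule sum.remove[OF fP Z])
    also have "\<dots> \<le> 4 + (\<Sum>W\<in>P - {Z}. 2)" using Z4 two by (intro add_mono sum_mono) auto
    also have "\<dots> = 4 + 2 * (card P - 1)" using Z fP by (simp add: card_Diff_singleton)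
    finally show ?thesis using q Z fP by (cases "card P") auto
  qed
  obtain J J' where J: "sides J J'" and ZJ: "Z \<subseteq> range J"
  proof (cases "\<exists>x. Inl x \<in> Z")
    case True
    then have "Z \<subseteq> range Inl" using pure_part[OF P big_P Z] by (metis UNIV_I image_eqI subsetI sumE)
    then show thesis using that by (auto simp: sides_def)
  next
    case False
    then have "Z \<subseteq> range Inr" by (metis UNIV_I image_eqI subsetI sumE)
    then show thesis using that by (auto simp: sides_def)
  qed
  \<comment> \<open>Z lies on one side, so three blocks mean three different block numbers, and one
    of these lies strictly between the extremes: a spanned block.\<close>
  define B where "B = bl ` {x. J x \<in> Z}"
  have fZ: "finite Z" using Z UP finite_U by (metis Sup_upper finite_subset)
  have injJ: "inj J" using J by (auto simp: sides_def)
  have fB: "finite B" unfolding B_def using finite_vimageI[OF fZ injJ] by (simp add: vimage_def)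
  have "blk bl ` Z = J ` B"
  proof -
    have c: "blk bl (J x) = J (bl x)" for x using J by (auto simp: sides_def)
    have "blk bl ` J ` {x. J x \<in> Z} = J ` B" unfolding B_def image_image c ..
    moreover have "J ` {x. J x \<in> Z} = Z" using ZJ by auto
    ultimately show ?thesis by (simp only:)
  qed
  then have cB: "3 \<le> card B" using Z3 card_image[of J B] injJ by (metis inj_on_subset subset_UNIV)
  define b1 where "b1 = Min B"
  define b3 where "b3 = Max B"
  have "B \<noteq> {}" using cB by auto
  then have b13: "b1 \<in> B" "b3 \<in> B" using fB by (auto simp: b1_def b3_def)
  have "\<exists>b2. b2 \<in> B - {b1, b3}"
  proof (rule ccontr)
    assume "\<nexists>b2. b2 \<in> B - {b1, b3}"
    then have "B \<subseteq> {b1, b3}" by blast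
    then have "card B \<le> card {b1, b3}" by (intro card_mono) auto
    also have "\<dots> \<le> 2" by (simp add: card_insert_if)
    finally show False using cB by simp
  qed
  then obtain b2 where b2: "b2 \<in> B" "b2 \<noteq> b1" "b2 \<noteq> b3" by blast
  then have lt: "b1 < b2" "b2 < b3" using fB by (auto simp: b1_def b3_def le_neq_implies_less)
  obtain x1 x2 x3 where x: "J x1 \<in> Z" "J x2 \<in> Z" "J x3 \<in> Z" "bl x1 = b1" "bl x2 = b2" "bl x3 = b3"
    using b13 b2(1) unfolding B_def by auto
  obtain D where D: "D \<subseteq> bl ` {..<n}" "card D \<le> 2 * d * (d + 1)"
    "rows {y. y < n \<and> bl y \<notin> D} {x. x < n \<and> bl x = bl x2} \<le> d + 1"
    using few_rows_in_spanned_block[OF J P big_P mono two Z x(1-3)] lt x by auto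
  have "x2 < n" using x(2) Z UP in_U J unfolding sides_def by blast
  then have "bl x2 < q" using im by blast
  from rich[OF this _ D(2)] D im show False by auto
qed

section \<open>Stuck divisions\<close>

text \<open>The parts of the stuck division are paired up into blocks, so every block contains a
  rejected union, with more than \<open>maxhit\<close> hits. After few blocks have been deleted, two
  of these hits still have no deleted block between them, and the two cuts there certify many
  distinct rows.\<close>

lemma stuck_no_D_sequence:
  assumes St: "starts St" and two: "nxt St 0 < n"
    and stuck: "\<And>p. p \<in> St \<Longrightarrow> nxt St p < n \<Longrightarrow> maxhit < card (hits St (part St p \<union> part St (nxt St p)))"
  shows "\<not> D_sequence S d Ps"
proof -
  have fin: "finite St" using starts_finite[OF St] .
  define ix where "ix p = card {r\<in>St. r < p}" for p
  have ix_less: "ix p < ix p'" if "p \<in> St" "p < p'" for p p'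
    unfolding ix_def using fin that by (intro psubset_card_mono) auto
  have ix_inj: "inj_on ix St" using ix_less by (intro inj_onI) (metis linorder_neqE_nat nat_neq_iff)
  have ix_mono: "p \<le> p' \<Longrightarrow> ix p \<le> ix p'" for p p' unfolding ix_def using fin by (intro card_mono) auto
  define NP where "NP = card St"
  have ix_N: "ix p < NP" if "p \<in> St" for p
    unfolding ix_def NP_def using fin that by (intro psubset_card_mono) auto
  have ix_im: "ix ` St = {..<NP}"
  proof (rule card_subset_eq)
    show "ix ` St \<subseteq> {..<NP}" using ix_N by auto
    show "card (ix ` St) = card {..<NP}" using card_image[OF ix_inj] by (simp add: NP_def)
  qed simp
  have zS: "0 \<in> St" using St by (simp add: starts_def)
  have N_big: "maxhit < NP"
  proof -
    have "maxhit < card (hits St (part St 0 \<union> part St (nxt St 0)))" using stuck[OF zS two] .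
    also have "\<dots> \<le> NP" unfolding NP_def using hits_subset[OF St] fin by (intro card_mono)
    finally show ?thesis .
  qed
  define q where "q = NP div 2"
  have q: "d + 2 < q" using N_big by (auto simp: q_def maxhit_def)
  \<comment> \<open>Parts are paired by rank. The minimum sends a last unpaired part to the block
    before it, so a block has two or three parts.\<close>
  define bl where "bl x = min (ix (pt St x) div 2) (q - 1)" for x
  have mono: "bl x \<le> bl y" if "x \<le> y" for x y
    unfolding bl_def using ix_mono[OF pt_mono[OF St that]] by (intro min.mono div_le_mono) auto
  have bl_q: "bl x < q" for x using q by (simp add: bl_def)
  have pair: "\<exists>p\<in>St. nxt St p < n \<and> ix p = 2 * b \<and> part St p \<union> part St (nxt St p) \<subseteq> {x. x < n \<and> bl x = b}" if b: "b < q" for b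
  proof -
    have "2 * b \<in> {..<NP}" "2 * b + 1 \<in> {..<NP}" using b by (auto simp: q_def)
    then have im2: "2 * b \<in> ix ` St" "2 * b + 1 \<in> ix ` St" unfolding ix_im .
    from im2(1) obtain p where p1: "p \<in> St" "ix p = 2 * b" by (rule imageE) simp
    from im2(2) obtain p' where p2: "p' \<in> St" "ix p' = 2 * b + 1" by (rule imageE) simp
    note p = p1 p2
    have "p < p'"
    proof (rule ccontr)
      assume "\<not> p < p'"
      then have "ix p' \<le> ix p" by (intro ix_mono) simp
      then show False using p by simp
    qed
    have nx: "nxt St p = p'"
    proof (rule nxt_eqI[OF \<open>p < p'\<close> _ St])
      show "p' = n \<or> p' \<in> St" using p by simp
      fix r assume r: "r \<in> St" "p < r"
      show "p' \<le> r"
      proof (rule ccontr)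
        assume nl: "\<not> p' \<le> r"
        have "ix p < ix r" by (rule ix_less) (use p r in auto)
        moreover have "ix r < ix p'" by (rule ix_less) (use r nl in auto)
        ultimately have "2 * b < ix r" "ix r < 2 * b + 1" unfolding p by auto
        then show False by linarith
      qed
    qed
    have "part St p \<union> part St p' \<subseteq> {x. x < n \<and> bl x = b}"
    proof
      fix x assume x: "x \<in> part St p \<union> part St p'"
      then have xn: "x < n" using part_less[OF St] p by blast
      then have "pt St x = p \<or> pt St x = p'" using x in_part_iff[OF St] p by blast
      then show "x \<in> {x. x < n \<and> bl x = b}" using xn p b by (auto simp: bl_def)
    qed
    moreover have "p' < n" using p(3) St by (auto simp: starts_def)
    ultimately show ?thesis using p nx by blast
  qed
  have im: "bl ` {..<n} = {..<q}"
  proof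
    show "bl ` {..<n} \<subseteq> {..<q}" using bl_q by auto
    show "{..<q} \<subseteq> bl ` {..<n}"
    proof
      fix b assume "b \<in> {..<q}"
      then obtain p where p: "p \<in> St" "part St p \<subseteq> {x. x < n \<and> bl x = b}" using pair[of b] by auto
      then have "p < n" "bl p = b" using self_in_part[OF St p(1)] by auto
      then show "b \<in> bl ` {..<n}" by auto
    qed
  qed
  have three: "card {p\<in>St. bl p \<in> D} \<le> 3 * card D" if D: "D \<subseteq> {..<q}" for D
  proof -
    have fD: "finite D" using D finite_subset by blast
    have "ix ` {p\<in>St. bl p \<in> D} \<subseteq> (\<Union>b\<in>D. {2 * b, 2 * b + 1, 2 * b + 2})"
    proof
      fix i assume "i \<in> ix ` {p\<in>St. bl p \<in> D}"
      then obtain p where p: "p \<in> St" "bl p \<in> D" "i = ix p" by auto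
      have "pt St p = p" using pt_start[OF St p(1)] .
      then have "bl p = min (i div 2) (q - 1)" by (simp add: bl_def p)
      moreover have "i < NP" using ix_N p by simp
      ultimately have "i = 2 * bl p \<or> i = 2 * bl p + 1 \<or> i = 2 * bl p + 2"
        using q unfolding q_def by linarith
      then show "i \<in> (\<Union>b\<in>D. {2 * b, 2 * b + 1, 2 * b + 2})" using p(2) by blast
    qed
    then have "card (ix ` {p\<in>St. bl p \<in> D}) \<le> card (\<Union>b\<in>D. {2 * b, 2 * b + 1, 2 * b + 2})"
      using fD by (intro card_mono) auto
    also have "\<dots> \<le> (\<Sum>b\<in>D. card {2 * b, 2 * b + 1, 2 * b + 2})" by (rule card_UN_le[OF fD])
    also have "\<dots> \<le> (\<Sum>b\<in>D. 3)" by (intro sum_mono) (simp add: card_insert_if)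
    also have "card (ix ` {p\<in>St. bl p \<in> D}) = card {p\<in>St. bl p \<in> D}"
      using ix_inj by (intro card_image) (auto intro: inj_on_subset)
    finally show ?thesis by simp
  qed
  have rich: "d + 2 \<le> rows {y. y < n \<and> bl y \<notin> D} {x. x < n \<and> bl x = b}"
    if b: "b < q" and D: "D \<subseteq> {..<q}" "card D \<le> 2 * d * (d + 1)" for b D
  proof -
    obtain p where p: "p \<in> St" "nxt St p < n" "part St p \<union> part St (nxt St p) \<subseteq> {x. x < n \<and> bl x = b}"
      using pair[OF b] by blast
    let ?C = "part St p \<union> part St (nxt St p)"
    let ?G = "hits St ?C - {r\<in>St. bl r \<in> D}"
    have fD: "finite D" using D finite_subset by blast
    have fh: "finite (hits St ?C)" by (simp add: hits_def)
    \<comment> \<open>The number of deleted blocks to its left tells in which gap a hit lies; two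
      hits with the same number have no deleted block between them.\<close>
    define gp where "gp r = card {b'\<in>D. b' < bl r}" for r
    have "\<not> inj_on gp ?G"
    proof
      assume inj: "inj_on gp ?G"
      have "gp ` ?G \<subseteq> {..card D}" unfolding gp_def using fD by (auto intro!: card_mono)
      then have "card ?G \<le> card {..card D}" using inj by (intro card_inj_on_le[of gp]) auto
      moreover have "card (hits St ?C) - card {r\<in>St. bl r \<in> D} \<le> card ?G" by (rule diff_card_le_card_Diff) (use fin in simp)
      moreover have "maxhit < card (hits St ?C)" using stuck p by blast
      ultimately show False using three[OF D(1)] D(2) by (simp add: maxhit_def)
    qed
    then obtain s s' where s: "s \<in> ?G" "s' \<in> ?G" "s \<noteq> s'" "gp s = gp s'"
      unfolding inj_on_def by blast
    obtain r r' where r: "r \<in> ?G" "r' \<in> ?G" "r < r'" "gp r = gp r'"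
      by (cases "s < s'") (use s that[of s s'] that[of s' s] in auto)
    obtain a a' where a: "a < n" "mark ?C a" "r = pt St a" "a' < n" "mark ?C a'" "r' = pt St a'"
      using r(1,2) by (auto simp: hits_def)
    have "a < a'" using pt_mono[OF St, of a' a] a r(3) by (metis leD leI)
    have rS: "r \<in> St" "r' \<in> St" using a pt_props(1)[OF St] by auto
    have blr: "bl r = bl a" "bl r' = bl a'" unfolding bl_def using pt_start[OF St rS(1)] pt_start[OF St rS(2)] a by auto
    have "{a..a'} \<subseteq> {y. y < n \<and> bl y \<notin> D}"
    proof
      fix y assume y: "y \<in> {a..a'}"
      have "bl y \<notin> D"
      proof
        assume yD: "bl y \<in> D"
        have m1: "bl r \<le> bl y" "bl y \<le> bl r'" using y mono blr by auto
        moreover have "bl y \<noteq> bl r" "bl y \<noteq> bl r'" using r yD rS by auto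
        ultimately have lt: "bl r < bl y" "bl y < bl r'" by linarith+
        have "{b'\<in>D. b' < bl r} \<subseteq> {b'\<in>D. b' < bl r'}" using lt by (intro Collect_mono) linarith
        moreover have "bl y \<in> {b'\<in>D. b' < bl r'}" using lt yD by (intro CollectI conjI)
        moreover have "bl y \<notin> {b'\<in>D. b' < bl r}" using lt by simp
        ultimately have "{b'\<in>D. b' < bl r} \<subset> {b'\<in>D. b' < bl r'}" by blast
        then have "gp r < gp r'" unfolding gp_def using fD by (intro psubset_card_mono) auto
        then show False using r by simp
      qed
      then show "y \<in> {y. y < n \<and> bl y \<notin> D}" using y a by auto
    qed
    then have "rows {a..a'} ?C \<le> rows {y. y < n \<and> bl y \<notin> D} {x. x < n \<and> bl x = b}"
      using p(3) by (intro rows_mono) auto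
    \<comment> \<open>The two marks give \<open>thr\<close> distinct rows on the columns of the
      pair. By the choice of \<open>thr\<close>, at most d + 1 distinct rows of the pair on the
      interval between the marks could not produce that many.\<close>
    moreover have "d + 2 \<le> rows {a..a'} ?C"
    proof (rule ccontr)
      assume "\<not> d + 2 \<le> rows {a..a'} ?C"
      then have "k ^ rows {a..a'} ?C \<le> k ^ (d + 1)" using k_pos by (intro power_increasing) auto
      moreover have "rows ?C {a..a'} \<le> k ^ rows {a..a'} ?C" using p(3) a by (intro rows_dual) auto
      moreover have "thr \<le> rows ?C {a..a'}" using marks_rows[OF a(2,5) \<open>a < a'\<close>] .
      ultimately show False unfolding thr_def by linarith
    qed
    ultimately show ?thesis by linarith
  qed
  show ?thesis using rich_no_D_sequence[OF mono im q rich] by blast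
qed

section \<open>Twin-width zero, and existence of contraction sequences\<close>

text \<open>A part mixing rows and columns is red-adjacent to all others, so without red edges the
  first mixed part is the whole universe. Just before it there is one part with all rows and one
  with all columns, and these two are not red-adjacent, which makes all entries equal.\<close>

lemma zero_sequence_constant:
  assumes "D_sequence S 0 Ps" "x < n" "y < n"
  shows "m x y = m 0 0"
proof -
  have Ps: "Ps \<noteq> []" "\<And>P. P \<in> set Ps \<Longrightarrow> partition_on U P \<and> narrow 0 P" "hd Ps = (\<lambda>v. {v}) ` U"
    "last Ps = {U}" "\<And>t. Suc t < length Ps \<Longrightarrow> contraction_step (Ps ! t) (Ps ! Suc t)"
    using assms(1) by (auto simp: D_sequence_def contraction_sequence_def universe narrow_def)
  have nored: "\<not> red_adjacent S X Y" if "P \<in> set Ps" "X \<in> P" "Y \<in> P" for P X Y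
  proof
    assume r: "red_adjacent S X Y"
    have "finite P" using finite_elements[OF finite_U] Ps(2) that by blast
    moreover have "card {Y\<in>P. red_adjacent S X Y} = 0" using Ps(2) that by (auto simp: narrow_def)
    ultimately show False using r that by auto
  qed
  define mixed where "mixed t \<longleftrightarrow> t < length Ps \<and> (\<exists>X\<in>Ps ! t. \<exists>x y. Inl x \<in> X \<and> Inr y \<in> X)" for t
  have "U \<in> Ps ! (length Ps - 1)" using Ps(1,4) by (simp add: last_conv_nth)
  moreover have "Inl 0 \<in> U" "Inr 0 \<in> U" using n_pos by simp_all
  moreover have "length Ps - 1 < length Ps" using Ps(1) by simp
  ultimately have "mixed (length Ps - 1)" unfolding mixed_def by blast
  then obtain t where t: "mixed t" "\<And>s. s < t \<Longrightarrow> \<not> mixed s" using exists_least_iff[of mixed] by auto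
  have "t \<noteq> 0"
  proof
    assume "t = 0"
    then have "\<exists>X\<in>(\<lambda>v. {v}) ` U. \<exists>x y. Inl x \<in> X \<and> Inr y \<in> X" using t(1) Ps(1,3) by (auto simp: mixed_def hd_conv_nth)
    then show False by auto
  qed
  then obtain s where s: "t = Suc s" by (cases t) auto
  have tl: "t < length Ps" using t by (simp add: mixed_def)
  have P: "partition_on U (Ps ! t)" "partition_on U (Ps ! s)" using Ps(2) tl s by auto
  obtain Z x0 y0 where Z: "Z \<in> Ps ! t" "Inl x0 \<in> Z" "Inr y0 \<in> Z" using t(1) by (auto simp: mixed_def)
  have "Z = U"
  proof (rule ccontr)
    assume "Z \<noteq> U"
    moreover have "Z \<subseteq> U" using Z partition_onD1[OF P(1)] by auto
    ultimately obtain v where "v \<in> U" "v \<notin> Z" by auto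
    then obtain Y where Y: "Y \<in> Ps ! t" "v \<in> Y" "Y \<noteq> Z" using partition_onD1[OF P(1)] by auto
    have "x0 < n" using Z \<open>Z \<subseteq> U\<close> in_U by blast
    then have "red_adjacent S Z Y" unfolding red_adjacent_def using Z Y not_same_unary(1) by blast
    then show False using nored[OF _ Z(1) Y(1)] tl by simp
  qed
  obtain X1 X2 where X: "X1 \<in> Ps ! s" "X2 \<in> Ps ! s" "X1 \<noteq> X2" "Ps ! t = insert (X1 \<union> X2) (Ps ! s - {X1, X2})"
    using Ps(5)[of s] tl s unfolding contraction_step_def by auto
  have "X1 \<union> X2 = U"
  proof (rule ccontr)
    assume ne: "X1 \<union> X2 \<noteq> U"
    have "X1 \<noteq> {}" using X partition_onD3[OF P(2)] by metis
    moreover have "X1 \<subseteq> U" using X partition_onD1[OF P(2)] by auto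
    moreover have "(X1 \<union> X2) \<inter> U = {}"
    proof (rule disjointD[OF partition_onD2[OF P(1)] _ _ ne])
      show "X1 \<union> X2 \<in> Ps ! t" by (simp add: X(4))
      show "U \<in> Ps ! t" using Z(1) \<open>Z = U\<close> by simp
    qed
    ultimately show False by blast
  qed
  have pure: "\<not> (Inl x \<in> X \<and> Inr y \<in> X)" if "X \<in> Ps ! s" for X x y
    using t(2)[of s] s tl that by (auto simp: mixed_def)
  have "\<exists>R C. R \<in> Ps ! s \<and> C \<in> Ps ! s \<and> Inl ` {..<n} \<subseteq> R \<and> Inr ` {..<n} \<subseteq> C"
  proof -
    have 0: "Inl 0 \<in> X1 \<union> X2" "Inr 0 \<in> X1 \<union> X2" unfolding \<open>X1 \<union> X2 = U\<close> using n_pos by auto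
    have all: "Inl x \<in> X1 \<union> X2" "Inr x \<in> X1 \<union> X2" if "x < n" for x unfolding \<open>X1 \<union> X2 = U\<close> using that by auto
    show ?thesis
    proof (cases "Inl 0 \<in> X1")
      case True
      then have "Inr x \<in> X2" if "x < n" for x using pure[OF X(1)] all(2)[OF that] by blast
      moreover from this have "Inl x \<in> X1" if "x < n" for x using pure[OF X(2)] all(1)[OF that] n_pos by blast
      ultimately show ?thesis using X by blast
    next
      case False
      then have "Inl 0 \<in> X2" using 0 by blast
      then have "Inr x \<in> X1" if "x < n" for x using pure[OF X(2)] all(2)[OF that] by blast
      moreover from this have "Inl x \<in> X2" if "x < n" for x using pure[OF X(1)] all(1)[OF that] n_pos by blast
      ultimately show ?thesis using X by blast
    qed
  qed
  then obtain R C where RC: "R \<in> Ps ! s" "C \<in> Ps ! s" "Inl ` {..<n} \<subseteq> R" "Inr ` {..<n} \<subseteq> C" by blast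
  have "R \<noteq> C" using pure[OF RC(1)] RC n_pos by blast
  moreover have "\<not> red_adjacent S R C" using nored[OF _ RC(1,2)] tl s by simp
  ultimately have "same_atomic_type S (Inl x, Inr y) (Inl 0, Inr 0)"
    unfolding red_adjacent_def using RC assms n_pos by blast
  then show ?thesis using same_row_col assms n_pos by auto
qed

lemma narrow_trivial: "narrow (2 * n) (division f g)"
  unfolding narrow_def
proof
  fix X
  have c: "card (csets J h) \<le> n" "finite (csets J h)" for J h
  proof -
    have "card (csets J h) \<le> card {z. z < n \<and> h z = z}" unfolding csets_def by (intro card_image_le) simp
    also have "\<dots> \<le> card {..<n}" by (intro card_mono) auto
    finally show "card (csets J h) \<le> n" by simp
  qed (simp add: csets_def)
  have "card {Y \<in> division f g. red_adjacent S X Y} \<le> card (division f g)"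
    unfolding division_def using c by (intro card_mono) auto
  also have "\<dots> \<le> card (csets Inl f) + card (csets Inr g)" unfolding division_def by (rule card_Un_le)
  also have "\<dots> \<le> 2 * n" using c(1)[of Inl f] c(1)[of Inr g] by simp
  finally show "card {Y \<in> division f g. red_adjacent S X Y} \<le> 2 * n" .
qed

text \<open>\<open>twin_width\<close> is a least element, and it carries information only if some
  sequence exists. Merging the rows and the columns one after another into 0 gives one, with the
  trivial degree 2n.\<close>

lemma D_sequence_exists: "\<exists>Ps. D_sequence S (2 * n) Ps"
proof -
  define f where "f j = (\<lambda>x. if x \<le> j then 0 else x)" for j :: nat
  have idem: "f j x < n \<and> f j (f j x) = f j x" if "x < n" for j x using that by (auto simp: f_def)
  have jn: "join (f j) 0 (Suc j) = f (Suc j)" for j by (auto simp: join_def f_def fun_eq_iff)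
  have "\<exists>es. fits_seq (2 * n) es (division (f j) (f j))" if "j < n" for j
    using that
  proof (induction j)
    case 0
    have "f 0 = (\<lambda>x. x)" by (auto simp: f_def)
    then show ?case using fits_seq_Nil[OF narrow_trivial] by auto
  next
    case (Suc j)
    then obtain es where es: "fits_seq (2 * n) es (division (f j) (f j))" by auto
    have z: "0 < n" "f j 0 = 0" "Suc j < n" "f j (Suc j) = Suc j" "0 \<noteq> Suc j" using Suc n_pos by (auto simp: f_def)
    have "fits_seq (2 * n) (es @ [(Inl 0, Inl (Suc j))]) (division (f (Suc j)) (f j))"
      using fits_seq_join_rows[OF es idem z narrow_trivial] unfolding jn .
    then have "fits_seq (2 * n) ((es @ [(Inl 0, Inl (Suc j))]) @ [(Inr 0, Inr (Suc j))]) (division (f (Suc j)) (f (Suc j)))"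
      using fits_seq_join_cols[OF _ idem z narrow_trivial] unfolding jn by blast
    then show ?case by blast
  qed
  then obtain es where "fits_seq (2 * n) es (division (f (n - 1)) (f (n - 1)))" using n_pos by fastforce
  then have "fits_seq (2 * n) (es @ [(Inl 0, Inr 0)]) {U}" by (rule fits_seq_final) (auto simp: f_def)
  then show ?thesis using fits_seq_D_sequence by blast
qed

lemma twin_width_greater:
  assumes "\<And>Ps. \<not> D_sequence S e Ps"
  shows "e < twin_width S"
proof (rule ccontr)
  assume "\<not> e < twin_width S"
  then have le: "twin_width S \<le> e" by simp
  have "\<exists>Ps. D_sequence S (twin_width S) Ps"
    unfolding twin_width_def by (rule LeastI_ex) (use D_sequence_exists in blast)
  then obtain Ps where "D_sequence S (twin_width S) Ps" by blast
  then have "D_sequence S e Ps" unfolding D_sequence_def using le by (meson order_trans)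
  then show False using assms by blast
qed

end

section \<open>The program\<close>

text \<open>Registers 0 to 3 hold the side length, the size of the alphabet, the parameter and the row
  length of the two-dimensional arrays.\<close>

abbreviation (input) "vmax \<equiv> 5 :: nat"
abbreviation (input) "vthr \<equiv> 6 :: nat"
abbreviation (input) "vbig \<equiv> 7 :: nat"
abbreviation (input) "vo \<equiv> 8 :: nat"
abbreviation (input) "vp \<equiv> 9 :: nat"
abbreviation (input) "vq \<equiv> 10 :: nat"
abbreviation (input) "ve \<equiv> 11 :: nat"
abbreviation (input) "vprev \<equiv> 12 :: nat"
abbreviation (input) "vx \<equiv> 13 :: nat"
abbreviation (input) "vi \<equiv> 14 :: nat"
abbreviation (input) "vc \<equiv> 15 :: nat"
abbreviation (input) "vg \<equiv> 16 :: nat"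
abbreviation (input) "vss \<equiv> 17 :: nat"
abbreviation (input) "vcnt \<equiv> 18 :: nat"
abbreviation (input) "vy \<equiv> 19 :: nat"
abbreviation (input) "vz \<equiv> 20 :: nat"
abbreviation (input) "veq \<equiv> 21 :: nat"
abbreviation (input) "vf \<equiv> 22 :: nat"
abbreviation (input) "vgo \<equiv> 23 :: nat"
abbreviation (input) "vres \<equiv> 24 :: nat"

text \<open>Arrays: 0 input and output, 1 row labels per part, 2 hit flags per candidate pair, 3 a
  dictionary indexed by pairs of labels, 4 links to the next part, 5 flags of the class
  representatives, 6 number of hits per candidate pair, 7 flags of the bad parts.\<close>

definition inc :: "nat \<Rightarrow> cmd" where "inc v = Set v (Plus (V v) (N 1))"

definition upto :: "nat \<Rightarrow> cmd \<Rightarrow> cmd" where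
  "upto v c = Set v (N 0) ;; Loop (Lt (V v) (V 0)) (c ;; inc v)"

text \<open>Only the cells addressed by keys that occur are cleared; clearing the whole table would
  make every scan quadratic.\<close>

definition cand_reset :: cmd where
  "cand_reset = upto vx (Put 3 (Rd 1 (V vx) (V vc)) (Rd 1 (V vx) (V vg)) (N 0))"

text \<open>Following the links keeps \<open>vi\<close> at the part of the current row, and the hit
  flag of a part is cleared when the part is entered.\<close>

definition cand_part :: cmd where
  "cand_part = Ifte (Eq (V vx) (Rd 4 (V vi) (N 0))) (Set vi (V vx) ;; Put 2 (V vc) (V vx) (N 0)) Skip"

text \<open>A dictionary cell holds one plus the last row with this key, and 0 if there is none. A
  value of at most \<open>vss\<close> thus means that the row is new in the current segment, and
  moving \<open>vss\<close> forward forgets all older rows at no cost.\<close>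

definition cand_count :: cmd where
  "cand_count =
     Ifte (Lt (Rd 3 (Rd 1 (V vx) (V vc)) (Rd 1 (V vx) (V vg))) (Plus (V vss) (N 1)))
       (inc vcnt ;;
        Ifte (Eq (V vcnt) (V vthr))
          (Set vss (V vx) ;; Set vcnt (N 1) ;;
           Ifte (Eq (Rd 2 (V vc) (V vi)) (N 0))
             (Put 2 (V vc) (V vi) (N 1) ;; Put 6 (V vc) (N 0) (Plus (Rd 6 (V vc) (N 0)) (N 1))) Skip) Skip) Skip"

definition cand_row :: cmd where
  "cand_row = cand_part ;; cand_count ;; Put 3 (Rd 1 (V vx) (V vc)) (Rd 1 (V vx) (V vg)) (Plus (V vx) (N 1))"

definition cand :: cmd where
  "cand = Set vg (Rd 4 (V vc) (N 0)) ;; cand_reset ;;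
     Set vi (N 0) ;; Put 2 (V vc) (N 0) (N 0) ;; Put 6 (V vc) (N 0) (N 0) ;;
     Set vss (N 0) ;; Set vcnt (N 0) ;; upto vx cand_row"

text \<open>A frame condition; the clock is left open.\<close>

definition unch :: "nat set \<Rightarrow> nat set \<Rightarrow> st \<Rightarrow> st \<Rightarrow> bool" where
  "unch Vs As s s' \<longleftrightarrow> (\<forall>v. v \<notin> Vs \<longrightarrow> var s' v = var s v) \<and> (\<forall>a. a \<notin> As \<longrightarrow> arr s' a = arr s a)"

lemma unch_refl [simp]: "unch Vs As s s" by (simp add: unch_def)

lemma unch_trans: "unch Vs As s s' \<Longrightarrow> unch Vs' As' s' s'' \<Longrightarrow> unch (Vs \<union> Vs') (As \<union> As') s s''"
  by (auto simp: unch_def)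

lemma unch_upd [simp]:
  "unch Vs As s (tick c s') = unch Vs As s s'"
  "v \<in> Vs \<Longrightarrow> unch Vs As s s' \<Longrightarrow> unch Vs As s (setv v x s')"
  "a \<in> As \<Longrightarrow> unch Vs As s s' \<Longrightarrow> unch Vs As s (put a i j x s')"
  by (auto simp: unch_def)

section \<open>Greedy cuts computed by a single scan of the rows\<close>

context twin_width_input begin

text \<open>Labels are at first the entries themselves, below k, and after a merge numbers of rows,
  below n. Both kinds index the dictionary, and row length n + k accommodates them.\<close>

definition SS :: nat where "SS = n + k"
text \<open>The square covers input addresses, 10n the output addresses and counters, the rest
  labels and thresholds.\<close>

definition Bd :: nat where "Bd = n * n + 10 * n + k + big + maxhit + 50"

lemma SS_less: "x < n \<Longrightarrow> x < SS" by (simp add: SS_def)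

lemma thr_le_Bd: "thr + 40 \<le> Bd" using big_bounds(1) by (simp add: Bd_def)
lemma n_le_Bd: "10 * n + 50 \<le> Bd" by (simp add: Bd_def)
lemma SS_le_Bd: "SS + 50 \<le> Bd" by (simp add: Bd_def SS_def)

abbreviation "WP \<equiv> wp SS Bd"

text \<open>\<open>I x\<close> is the invariant before iteration \<open>x\<close>; the ticks 2, 4 and 5 pay for initialising,
  incrementing and testing the loop counter.\<close>

lemma wp_upto:
  assumes start: "v < TB" "v \<noteq> SR" "v \<noteq> 0" "var s0 0 = n"
    and I0: "\<And>s. s = tick 2 (setv v 0 s0) \<Longrightarrow> I 0 s"
    and fr: "\<And>x s. I x s \<Longrightarrow> x \<le> n \<Longrightarrow> var s 0 = n \<and> var s v = x"
    and body: "\<And>x s. I x s \<Longrightarrow> x < n \<Longrightarrow> WP c (\<lambda>s'. var s' v = x \<and> I (Suc x) (tick 4 (setv v (Suc x) s'))) (tick 5 s)"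
    and Q: "\<And>s. I n s \<Longrightarrow> Q (tick 5 s)"
  shows "WP (upto v c) Q s0"
proof -
  have e: "ecost (N 0) + 1 = 2" "ccost (Lt (V v) (V 0)) + 1 = 5" "ecost (Plus (V v) (N 1)) + 1 = 4" by auto
  show ?thesis unfolding upto_def inc_def
  proof (rule wp_Seq, rule wp_Set)
    show "WP (Loop (Lt (V v) (V 0)) (c ;; Set v (Plus (V v) (N 1)))) Q (tick (ecost (N 0) + 1) (setv v (val (N 0) s0) s0))"
    proof (rule wp_Loop[where I = "\<lambda>s. \<exists>x\<le>n. I x s" and \<mu> = "\<lambda>s. n - var s v"])
      show "\<exists>x\<le>n. I x (tick (ecost (N 0) + 1) (setv v (val (N 0) s0) s0))"
        using I0 unfolding e by auto
      show "okC SS Bd (Lt (V v) (V 0)) s" if "\<exists>x\<le>n. I x s" for s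
        using start by (simp add: TB_def)
      fix s assume "\<exists>x\<le>n. I x s"
      then obtain x where x: "x \<le> n" "I x s" by blast
      note v = fr[OF x(2,1)]
      show "Q (tick (ccost (Lt (V v) (V 0)) + 1) s)" if "\<not> holds (Lt (V v) (V 0)) s"
      proof -
        have "x = n" using that v x by simp
        then show ?thesis unfolding e using Q x(2) by blast
      qed
      show "WP (c ;; Set v (Plus (V v) (N 1))) (\<lambda>s'. (\<exists>x\<le>n. I x s') \<and> n - var s' v < n - var s v)
          (tick (ccost (Lt (V v) (V 0)) + 1) s)" if "holds (Lt (V v) (V 0)) s"
      proof -
        have xn: "x < n" using that v by simp
        show ?thesis unfolding e
        proof (rule wp_Seq, rule wp_mono[OF body[OF x(2) xn]])
          fix s' assume s': "var s' v = x \<and> I (Suc x) (tick 4 (setv v (Suc x) s'))"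
          show "WP (Set v (Plus (V v) (N 1))) (\<lambda>s'. (\<exists>x\<le>n. I x s') \<and> n - var s' v < n - var s v) s'"
          proof (rule wp_Set)
            show "okE SS Bd (Plus (V v) (N 1)) s'" using s' xn start n_le_Bd by simp
            have st: "tick (ecost (Plus (V v) (N 1)) + 1) (setv v (val (Plus (V v) (N 1)) s') s') = tick 4 (setv v (Suc x) s')"
              using s' unfolding e by simp
            show "(\<exists>xa\<le>n. I xa (tick (ecost (Plus (V v) (N 1)) + 1) (setv v (val (Plus (V v) (N 1)) s') s'))) \<and>
               n - var (tick (ecost (Plus (V v) (N 1)) + 1) (setv v (val (Plus (V v) (N 1)) s') s')) v < n - var s v"
              unfolding st using s' xn v by (auto intro!: exI[of _ "Suc x"])
          qed (use start in auto)
        qed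
      qed
    qed
  qed (use start in auto)
qed

definition labels :: "nat set \<Rightarrow> st \<Rightarrow> bool" where
  "labels St s \<longleftrightarrow> (\<forall>p\<in>St. \<forall>x<n. arr s 1 x p < SS \<and>
     (\<forall>y<n. arr s 1 x p = arr s 1 y p \<longleftrightarrow> row (part St p) x = row (part St p) y))"

definition links :: "nat set \<Rightarrow> st \<Rightarrow> bool" where
  "links St s \<longleftrightarrow> (\<forall>p\<in>St. arr s 4 p 0 = nxt St p)"

definition env :: "st \<Rightarrow> bool" where
  "env s \<longleftrightarrow> var s 0 = n \<and> var s vmax = maxhit \<and> var s vthr = thr \<and> var s vbig = big"

lemma row_Un: "row (C \<union> C') x = row (C \<union> C') y \<longleftrightarrow> row C x = row C y \<and> row C' x = row C' y"
  unfolding row_eq_iff by blast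

definition pair :: "nat set \<Rightarrow> nat \<Rightarrow> nat set" where
  "pair St c = part St c \<union> part St (nxt St c)"

text \<open>\<open>seg\<close> and \<open>seg_rows\<close> are the state of the scan before row x is
  read: the start of the open segment and the number of distinct rows in it. This state lags one row
  behind \<open>gs\<close>, and at x = 0 the open segment is still empty.\<close>

definition seg :: "nat set \<Rightarrow> nat \<Rightarrow> nat" where
  "seg C x = (if x = 0 then 0 else gs C (x - 1))"

definition seg_rows :: "nat set \<Rightarrow> nat \<Rightarrow> nat" where
  "seg_rows C x = (if x = 0 then 0 else rows C {gs C (x - 1)..x - 1})"

lemma seg_le: "seg C x \<le> x" using gs_le[of C "x - 1"] by (auto simp: seg_def)

lemma seg_step_old:
  assumes "\<exists>y<x. seg C x \<le> y \<and> row C y = row C x"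
  shows "\<not> mark C x" "seg C (Suc x) = seg C x" "seg_rows C (Suc x) = seg_rows C x"
proof -
  obtain y x' where y: "y < x" "seg C x \<le> y" "row C y = row C x" and x': "x = Suc x'" using assms by (cases x) auto
  have sx: "seg C x = gs C x'" by (simp add: seg_def x')
  have "row C ` {gs C x'..x} = row C ` {gs C x'..x'}"
  proof -
    have "{gs C x'..x} = insert x {gs C x'..x'}" using gs_le[of C x'] x' by auto
    moreover have "y \<in> {gs C x'..x'}" using y x' sx by auto
    then have "row C x \<in> row C ` {gs C x'..x'}" using y(3) by (metis imageI)
    ultimately show ?thesis by (simp add: insert_absorb)
  qed
  then have r: "rows C {gs C x'..x} = rows C {gs C x'..x'}" by (simp add: rows_def)
  then have g: "gs C x = gs C x'" using gs_rows[of C x'] by (simp add: x')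
  show "\<not> mark C x" using g gs_le[of C x'] x' by (simp add: mark_def)
  show "seg C (Suc x) = seg C x" using g sx by (simp add: seg_def)
  show "seg_rows C (Suc x) = seg_rows C x" using g r x' by (simp add: seg_rows_def)
qed

text \<open>The count grows by one at a time and stays below \<open>thr\<close>, so the overflow
  test may be an equality, as it is in \<open>cand_count\<close>.\<close>

lemma seg_step_new:
  assumes "\<not> (\<exists>y<x. seg C x \<le> y \<and> row C y = row C x)"
  shows "mark C x \<longleftrightarrow> Suc (seg_rows C x) = thr"
    "mark C x \<Longrightarrow> seg C (Suc x) = x \<and> seg_rows C (Suc x) = 1"
    "\<not> mark C x \<Longrightarrow> seg C (Suc x) = seg C x \<and> seg_rows C (Suc x) = Suc (seg_rows C x)"
proof -
  have single: "rows C {y..y} = 1" for y by (simp add: rows_def)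
  have *: "(mark C x \<longleftrightarrow> Suc (seg_rows C x) = thr) \<and> (mark C x \<longrightarrow> seg C (Suc x) = x \<and> seg_rows C (Suc x) = 1) \<and>
    (\<not> mark C x \<longrightarrow> seg C (Suc x) = seg C x \<and> seg_rows C (Suc x) = Suc (seg_rows C x))"
  proof (cases x)
    case 0
    then show ?thesis using thr_ge2 single[of 0] by (auto simp: mark_def seg_def seg_rows_def)
  next
    case (Suc x')
    have sx: "seg C x = gs C x'" by (simp add: seg_def Suc)
    have ins: "{gs C x'..x} = insert x {gs C x'..x'}" using gs_le[of C x'] Suc by auto
    have "row C x \<notin> row C ` {gs C x'..x'}"
    proof
      assume "row C x \<in> row C ` {gs C x'..x'}"
      then obtain y where "y \<in> {gs C x'..x'}" "row C x = row C y" by blast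
      then have "y < x \<and> seg C x \<le> y \<and> row C y = row C x" using Suc sx by auto
      then show False using assms by blast
    qed
    then have r: "rows C {gs C x'..x} = Suc (rows C {gs C x'..x'})"
      unfolding rows_def ins by simp
    have lt: "rows C {gs C x'..x'} < thr" by (rule gs_rows)
    have g: "gs C x = (if thr \<le> rows C {gs C x'..x} then x else gs C x')" by (simp add: Suc)
    have le: "gs C x' < x" using gs_le[of C x'] Suc by simp
    have mk: "mark C x \<longleftrightarrow> thr \<le> rows C {gs C x'..x}" using g le by (auto simp: mark_def)
    show ?thesis
    proof (intro conjI impI)
      show "mark C x \<longleftrightarrow> Suc (seg_rows C x) = thr" using mk r lt Suc by (auto simp: seg_rows_def)
      show "seg C (Suc x) = x" if "mark C x" using that by (simp add: seg_def mark_def)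
      show "seg_rows C (Suc x) = 1" if "mark C x" using that single[of x] by (simp add: seg_rows_def mark_def)
      show "seg C (Suc x) = seg C x" if "\<not> mark C x" using that g mk sx by (simp add: seg_def)
      show "seg_rows C (Suc x) = Suc (seg_rows C x)" if "\<not> mark C x" using that g mk r Suc by (simp add: seg_rows_def)
    qed
  qed
  show "mark C x \<longleftrightarrow> Suc (seg_rows C x) = thr" using * by blast
  show "mark C x \<Longrightarrow> seg C (Suc x) = x \<and> seg_rows C (Suc x) = 1" using * by blast
  show "\<not> mark C x \<Longrightarrow> seg C (Suc x) = seg C x \<and> seg_rows C (Suc x) = Suc (seg_rows C x)" using * by blast
qed

lemma seg_rows_less: "seg_rows C x < thr"
  using gs_rows[of C "x - 1"] thr_ge2 by (auto simp: seg_rows_def)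

definition hits_upto :: "nat set \<Rightarrow> nat set \<Rightarrow> nat \<Rightarrow> nat set" where
  "hits_upto St C x = pt St ` {y. y < x \<and> mark C y}"

lemma hits_upto_Suc: "hits_upto St C (Suc x) = (if mark C x then insert (pt St x) (hits_upto St C x) else hits_upto St C x)"
proof -
  have "{y. y < Suc x \<and> mark C y} = (if mark C x then insert x {y. y < x \<and> mark C y} else {y. y < x \<and> mark C y})"
    by (auto simp: less_Suc_eq)
  then show ?thesis by (simp add: hits_upto_def)
qed

lemma hits_upto_n: "hits_upto St C n = hits St C" by (simp add: hits_upto_def hits_def)

lemma finite_hits_upto [simp]: "finite (hits_upto St C x)" by (simp add: hits_upto_def)

definition same_key :: "nat set \<Rightarrow> nat \<Rightarrow> nat \<Rightarrow> st \<Rightarrow> bool" where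
  "same_key C p q s \<longleftrightarrow> (\<forall>x<n. arr s 1 x p < SS \<and> arr s 1 x q < SS) \<and>
     (\<forall>x<n. \<forall>y<n. arr s 1 x p = arr s 1 y p \<and> arr s 1 x q = arr s 1 y q \<longleftrightarrow> row C x = row C y)"

lemma labels_same_key:
  assumes "labels St s" "p \<in> St" "q \<in> St"
  shows "same_key (part St p \<union> part St q) p q s"
  using assms unfolding labels_def same_key_def row_Un by blast

lemma same_keyD:
  assumes "same_key C p q s" "x < n"
  shows "arr s 1 x p < SS" "arr s 1 x q < SS"
    "y < n \<Longrightarrow> arr s 1 x p = arr s 1 y p \<and> arr s 1 x q = arr s 1 y q \<longleftrightarrow> row C x = row C y"
  using assms unfolding same_key_def by blast+

lemma cand_reset_wp:
  assumes "env s0" "var s0 vc < n" "var s0 vg < n" "same_key C (var s0 vc) (var s0 vg) s0"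
    and Q: "\<And>s. unch {vx} {3} s0 s \<Longrightarrow> clk s \<le> clk s0 + 60 * n + 10 \<Longrightarrow>
      (\<And>x. x < n \<Longrightarrow> arr s 3 (arr s0 1 x (var s0 vc)) (arr s0 1 x (var s0 vg)) = 0) \<Longrightarrow> Q s"
  shows "WP cand_reset Q s0"
  unfolding cand_reset_def
proof (rule wp_upto[where I = "\<lambda>x s. unch {vx} {3} s0 s \<and> var s vx = x \<and> clk s \<le> clk s0 + 60 * x + 5 \<and>
     (\<forall>y<x. arr s 3 (arr s0 1 y (var s0 vc)) (arr s0 1 y (var s0 vg)) = 0)"])
  show "var s0 0 = n" using assms(1) by (simp add: env_def)
  fix x s assume I: "unch {vx} {3} s0 s \<and> var s vx = x \<and> clk s \<le> clk s0 + 60 * x + 5 \<and>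
     (\<forall>y<x. arr s 3 (arr s0 1 y (var s0 vc)) (arr s0 1 y (var s0 vg)) = 0)"
  then have v: "var s 0 = n" "var s vc = var s0 vc" "var s vg = var s0 vg" "arr s 1 = arr s0 1" "var s vx = x"
    using assms(1) by (auto simp: unch_def env_def)
  show "var s 0 = n \<and> var s vx = x" using v by simp
  assume x: "x < n"
  note k = same_keyD[OF assms(4) x]
  show "WP (Put 3 (Rd 1 (V vx) (V vc)) (Rd 1 (V vx) (V vg)) (N 0))
     (\<lambda>s'. var s' vx = x \<and> unch {vx} {3} s0 (tick 4 (setv vx (Suc x) s')) \<and>
       var (tick 4 (setv vx (Suc x) s')) vx = Suc x \<and> clk (tick 4 (setv vx (Suc x) s')) \<le> clk s0 + 60 * Suc x + 5 \<and>
       (\<forall>y<Suc x. arr (tick 4 (setv vx (Suc x) s')) 3 (arr s0 1 y (var s0 vc)) (arr s0 1 y (var s0 vg)) = 0)) (tick 5 s)"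
    by (rule wp_Put)
      (use I v x k assms(2,3) SS_less SS_le_Bd n_le_Bd in \<open>auto simp: TB_def width_def less_Suc_eq\<close>)
next
  fix s assume "unch {vx} {3} s0 s \<and> var s vx = n \<and> clk s \<le> clk s0 + 60 * n + 5 \<and>
     (\<forall>y<n. arr s 3 (arr s0 1 y (var s0 vc)) (arr s0 1 y (var s0 vg)) = 0)"
  then show "Q (tick 5 s)" by (intro Q) auto
qed (use assms in \<open>auto simp: TB_def SR_def\<close>)

text \<open>The scan of one row consists of three commands, so the current part i, the number x of
  rows in the dictionary and the number y of rows counted advance separately. The equivalence for
  all e says that a cell is one plus the last recorded row with the same key, or 0, without
  mentioning a maximum.\<close>

definition cand_inv :: "st \<Rightarrow> nat set \<Rightarrow> nat \<Rightarrow> nat \<Rightarrow> nat \<Rightarrow> nat \<Rightarrow> nat \<Rightarrow> st \<Rightarrow> bool" where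
  "cand_inv s0 St i x y tm vxx s \<longleftrightarrow> (let c = var s0 vc; C = pair St c in
     unch {vx, vi, vss, vcnt} {2, 3, 6} s0 s \<and> clk s \<le> tm \<and> var s vx = vxx \<and>
     (\<forall>c'. c' \<noteq> c \<longrightarrow> arr s 2 c' = arr s0 2 c' \<and> arr s 6 c' = arr s0 6 c') \<and>
     var s vi = i \<and> var s vss = seg C y \<and> var s vcnt = seg_rows C y \<and>
     (\<forall>w<n. \<forall>e. e < arr s 3 (arr s0 1 w c) (arr s0 1 w (nxt St c)) \<longleftrightarrow> (\<exists>y<x. e \<le> y \<and> row C y = row C w)) \<and>
     arr s 6 c 0 = card (hits_upto St C y) \<and>
     (\<forall>j\<in>St. j \<le> i \<longrightarrow> arr s 2 c j = (if j \<in> hits_upto St C y then 1 else 0)))"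

definition cand_pre :: "nat set \<Rightarrow> st \<Rightarrow> bool" where
  "cand_pre St s \<longleftrightarrow> starts St \<and> env s \<and> links St s \<and> labels St s \<and> var s vc \<in> St \<and> nxt St (var s vc) < n \<and>
     var s vg = nxt St (var s vc)"

lemma cand_preD:
  assumes "cand_pre St s"
  shows "starts St" "env s" "links St s" "var s vc \<in> St" "var s vc < n" "nxt St (var s vc) < n" "var s vg = nxt St (var s vc)"
    "same_key (pair St (var s vc)) (var s vc) (nxt St (var s vc)) s" "0 < SS"
proof -
  show a: "starts St" "env s" "links St s" "var s vc \<in> St" "nxt St (var s vc) < n" "var s vg = nxt St (var s vc)"
    using assms by (auto simp: cand_pre_def)
  show "var s vc < n" using a(1,4) by (auto simp: starts_def)
  have "nxt St (var s vc) \<in> St" using nxt_props(3)[OF a(1,4)] a(5) by auto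
  then show "same_key (pair St (var s vc)) (var s vc) (nxt St (var s vc)) s"
    unfolding pair_def using assms a by (intro labels_same_key) (auto simp: cand_pre_def)
  show "0 < SS" using n_pos by (simp add: SS_def)
qed

lemma cand_part_wp:
  assumes pre: "cand_pre St s0" and x: "x < n" and I: "cand_inv s0 St (pt St (x - 1)) x x tm x s"
    and Q: "\<And>s. cand_inv s0 St (pt St x) x x (tm + 50) x s \<Longrightarrow> Q s"
  shows "WP cand_part Q s"
proof -
  note p = cand_preD[OF pre]
  define c where "c = var s0 vc"
  define C where "C = pair St c"
  define i where "i = pt St (x - 1)"
  have un: "unch {vx, vi, vss, vcnt} {2, 3, 6} s0 s" using I by (simp add: cand_inv_def Let_def)
  have v: "var s vi = i" "var s vx = x" "var s vc = c" "arr s 4 = arr s0 4"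
    using I un by (auto simp: cand_inv_def Let_def unch_def c_def i_def)
  have iS: "i \<in> St" "i < n" using pt_props(1)[OF p(1)] p(1) unfolding i_def starts_def by blast+
  have link: "arr s0 4 i 0 = nxt St i" using p(3) iS by (simp add: links_def)
  have ilt: "i < x \<or> x = 0" using pt_props(2)[OF p(1), of "x - 1"] by (auto simp: i_def)
  have part: "pt St x = (if x = nxt St i then x else i)"
  proof (cases "x = nxt St i")
    case True
    then have "x \<in> St" using nxt_props(3)[OF p(1) iS(1)] x by auto
    then show ?thesis using True pt_start[OF p(1)] by simp
  next
    case False
    have "x < nxt St i"
    proof (cases x)
      case 0 then show ?thesis using nxt_props(2)[OF p(1) iS(1)] by simp
    next
      case (Suc x')
      have "x' \<in> part St i" using in_part_iff[OF p(1) iS(1), of x'] x Suc by (simp add: i_def)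
      then show ?thesis using Suc False by (simp add: part_def)
    qed
    then show ?thesis using False pt_eqI[OF p(1) iS(1), of x] ilt pt_props(2)[OF p(1), of "x - 1"] by (simp add: i_def)
  qed
  \<comment> \<open>The rows read so far belong to earlier parts, so a part that is just entered has
    no hit and its flag rightly starts at 0.\<close>
  have unhit: "x \<notin> hits_upto St C x" if "0 < x"
  proof
    assume "x \<in> hits_upto St C x"
    then obtain y where "y < x" "x = pt St y" by (auto simp: hits_upto_def)
    then show False using pt_props(2)[OF p(1), of y] by simp
  qed
  have between: "j \<le> i" if "j \<in> St" "j \<le> x" "j \<noteq> x" for j
    using pt_props(3)[OF p(1) that(1), of "x - 1"] that by (simp add: i_def)
  show ?thesis unfolding cand_part_def
  proof (rule wp_Ifte)
    show "okC SS Bd (Eq (V vx) (Rd 4 (V vi) (N 0))) s" using v iS n_le_Bd p(9) by (simp add: TB_def width_def)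
    assume "holds (Eq (V vx) (Rd 4 (V vi) (N 0))) s"
    then have xi: "x = nxt St i" using v link by simp
    then have px: "pt St x = x" using part by simp
    have x0: "0 < x" using xi nxt_props(2)[OF p(1) iS(1)] by simp
    show "WP (Set vi (V vx) ;; Put 2 (V vc) (V vx) (N 0)) Q (tick (ccost (Eq (V vx) (Rd 4 (V vi) (N 0))) + 1) s)"
      by (intro wp_Seq wp_Set wp_Put Q)
        (use I v p(5) x n_le_Bd SS_less unhit x0 px between in
          \<open>auto simp: TB_def SR_def width_def cand_inv_def Let_def c_def C_def i_def\<close>)
  next
    assume "\<not> holds (Eq (V vx) (Rd 4 (V vi) (N 0))) s"
    then have "x \<noteq> nxt St i" using v link by simp
    then have "pt St x = i" using part by simp
    then show "WP Skip Q (tick (ccost (Eq (V vx) (Rd 4 (V vi) (N 0))) + 1) s)"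
      using I by (intro wp_Skip Q) (auto simp: cand_inv_def Let_def i_def)
  qed
qed

lemma cand_count_wp:
  assumes pre: "cand_pre St s0" and x: "x < n" and I: "cand_inv s0 St (pt St x) x x tm x s"
    and Q: "\<And>s. cand_inv s0 St (pt St x) x (Suc x) (tm + 120) x s \<Longrightarrow> Q s"
  shows "WP cand_count Q s"
proof -
  note p = cand_preD[OF pre]
  define c where "c = var s0 vc"
  define C where "C = pair St c"
  define i where "i = pt St x"
  have un: "unch {vx, vi, vss, vcnt} {2, 3, 6} s0 s" using I by (simp add: cand_inv_def Let_def)
  have v: "var s vi = i" "var s vx = x" "var s vc = c" "var s vg = nxt St c" "arr s 1 = arr s0 1"
    "var s vss = seg C x" "var s vcnt = seg_rows C x" "var s vthr = thr"
    using I un p by (auto simp: cand_inv_def Let_def unch_def c_def i_def C_def env_def)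
  have iS: "i \<in> St" "i < n" using pt_props(1)[OF p(1)] p(1) unfolding i_def starts_def by blast+
  have cn: "c < n" "nxt St c < n" using p by (auto simp: c_def)
  have l: "arr s0 1 x c < SS" "arr s0 1 x (nxt St c) < SS" using same_keyD(1,2)[OF p(8) x] by (auto simp: c_def)
  have T: "e < arr s 3 (arr s0 1 x c) (arr s0 1 x (nxt St c)) \<longleftrightarrow> (\<exists>y<x. e \<le> y \<and> row C y = row C x)" for e
    using I x by (simp add: cand_inv_def Let_def c_def C_def)
  have H: "arr s 2 c i = (if i \<in> hits_upto St C x then 1 else 0)" "arr s 6 c 0 = card (hits_upto St C x)"
    using I iS by (auto simp: cand_inv_def Let_def c_def C_def i_def)
  have hx: "card (hits_upto St C x) \<le> n"
  proof -
    have "hits_upto St C x \<subseteq> {..<n}" using pt_props(1)[OF p(1)] p(1) by (auto simp: hits_upto_def starts_def)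
    then show ?thesis using card_mono[of "{..<n}" "hits_upto St C x"] by simp
  qed
  have bnds: "seg C x \<le> n" "seg_rows C x < thr" "SS \<le> Bd" "thr + 40 \<le> Bd" "10 * n + 50 \<le> Bd" "0 < SS" "c < SS" "i < SS"
    using seg_le[of C x] x seg_rows_less[of C x] SS_le_Bd thr_le_Bd n_le_Bd p(9) cn iS SS_less by auto
  let ?b = "Lt (Rd 3 (Rd 1 (V vx) (V vc)) (Rd 1 (V vx) (V vg))) (Plus (V vss) (N 1))"
  show ?thesis unfolding cand_count_def
  proof (rule wp_Ifte)
    show "okC SS Bd ?b s" using v l x cn bnds SS_less by (simp add: TB_def width_def)
  next
    assume "\<not> holds ?b s"
    then have "\<exists>y<x. seg C x \<le> y \<and> row C y = row C x"
      using T[of "seg C x"] v by (simp add: not_less Suc_le_eq)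
    note o = seg_step_old[OF this]
    show "WP Skip Q (tick (ccost ?b + 1) s)"
      using I o by (intro wp_Skip Q) (auto simp: cand_inv_def Let_def c_def C_def hits_upto_Suc)
  next
    assume "holds ?b s"
    \<comment> \<open>A cell of at most \<open>vss\<close> means that the last equal row lies before
      the start of the open segment.\<close>
    then have "\<not> (\<exists>y<x. seg C x \<le> y \<and> row C y = row C x)" using T[of "seg C x"] v by (simp add: not_less less_Suc_eq_le)
    note nw = seg_step_new[OF this]
    show "WP (inc vcnt ;; Ifte (Eq (V vcnt) (V vthr))
          (Set vss (V vx) ;; Set vcnt (N 1) ;;
           Ifte (Eq (Rd 2 (V vc) (V vi)) (N 0))
             (Put 2 (V vc) (V vi) (N 1) ;; Put 6 (V vc) (N 0) (Plus (Rd 6 (V vc) (N 0)) (N 1))) Skip) Skip) Q (tick (ccost ?b + 1) s)"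
    proof (cases "mark C x")
      case False
      then have nt: "Suc (seg_rows C x) \<noteq> thr" using nw(1) by simp
      show ?thesis unfolding inc_def
        by (intro wp_Seq wp_Set wp_Ifte wp_Skip Q)
          (use I nw(3)[OF False] nt False v bnds in
            \<open>auto simp: TB_def SR_def cand_inv_def Let_def c_def[symmetric] C_def[symmetric] hits_upto_Suc\<close>)
    next
      case True
      then have nt: "Suc (seg_rows C x) = thr" using nw(1) by simp
      have hS: "hits_upto St C (Suc x) = insert i (hits_upto St C x)" using True by (simp add: hits_upto_Suc i_def)
      show ?thesis
      proof (cases "i \<in> hits_upto St C x")
        case hit: True
        then have "hits_upto St C (Suc x) = hits_upto St C x" using hS by auto
        then show ?thesis unfolding inc_def
          by (intro wp_Seq wp_Set wp_Ifte wp_Skip wp_Put Q)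
            (use I nw(2)[OF True] nt v bnds H hit i_def x in
              \<open>auto simp: TB_def SR_def width_def cand_inv_def Let_def c_def[symmetric] C_def[symmetric]\<close>)
      next
        case nohit: False
        have cS: "card (hits_upto St C (Suc x)) = Suc (card (hits_upto St C x))" using nohit hS by simp
        have mS: "j \<in> hits_upto St C (Suc x) \<longleftrightarrow> j = i \<or> j \<in> hits_upto St C x" for j unfolding hS by simp
        have I': "cand_inv s0 St i x x tm x s" using I by (simp add: i_def)
        note I'' = I'[unfolded cand_inv_def Let_def, folded c_def, folded C_def]
        have fin: "cand_inv s0 St i x (Suc x) (tm + 120) x s'"
          if "unch {vx, vi, vss, vcnt} {2, 3, 6} s s'" "clk s' \<le> clk s + 120" "var s' vx = x" "var s' vi = i"
            "var s' vss = x" "var s' vcnt = 1" "arr s' 3 = arr s 3"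
            "arr s' 2 = (arr s 2)(c := (arr s 2 c)(i := 1))"
            "arr s' 6 = (arr s 6)(c := (arr s 6 c)(0 := Suc (card (hits_upto St C x))))" for s'
        proof -
          have "unch {vx, vi, vss, vcnt} {2, 3, 6} s0 s'" using that(1) un by (auto simp: unch_def)
          then show ?thesis unfolding cand_inv_def Let_def c_def[symmetric] C_def[symmetric] cS
            using I'' that(2-) nw(2)[OF True] mS by simp
        qed
        show ?thesis unfolding inc_def
          by (intro wp_Seq wp_Set wp_Ifte wp_Skip wp_Put Q[folded i_def] fin)
            (use nt v bnds H nohit hx x in \<open>simp_all add: TB_def SR_def width_def unch_def\<close>)
      qed
    qed
  qed
qed

end

text \<open>The first pass leaves in every cell the last row with that key, and this row number
  becomes the common label. Each cell that the second pass reads has been written by the first, so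
  the dictionary needs no clearing.\<close>

definition relabel :: cmd where
  "relabel = upto vx (Put 3 (Rd 1 (V vx) (V vp)) (Rd 1 (V vx) (V vq)) (V vx)) ;;
     upto vx (Put 1 (V vx) (V vp) (Rd 3 (Rd 1 (V vx) (V vp)) (Rd 1 (V vx) (V vq))))"

text \<open>The cuts of the other candidates do not depend on the division. A merge only turns hits
  of q into hits of p, and a candidate that hit both loses one.\<close>

definition merge_hits :: cmd where
  "merge_hits = upto vx
     (Ifte (Eq (Rd 2 (V vx) (V vq)) (N 1))
       (Ifte (Eq (Rd 2 (V vx) (V vp)) (N 1)) (Put 6 (V vx) (N 0) (Minus (Rd 6 (V vx) (N 0)) (N 1)))
         (Put 2 (V vx) (V vp) (N 1))) Skip)"

section \<open>Correctness of scanning, relabelling and moving hits\<close>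

context twin_width_input begin

lemma cand_row_wp:
  assumes pre: "cand_pre St s0" and x: "x < n" and I: "cand_inv s0 St (pt St (x - 1)) x x tm x s"
    and Q: "\<And>s. cand_inv s0 St (pt St x) (Suc x) (Suc x) (tm + 210) x s \<Longrightarrow> Q s"
  shows "WP cand_row Q s"
  unfolding cand_row_def
proof (rule wp_Seq, rule cand_part_wp[OF pre x I], rule wp_Seq, rule cand_count_wp[OF pre x], assumption)
  note p = cand_preD[OF pre]
  fix s assume J: "cand_inv s0 St (pt St x) x (Suc x) (tm + 50 + 120) x s"
  define c where "c = var s0 vc"
  define C where "C = pair St c"
  note J' = J[unfolded cand_inv_def Let_def, folded c_def, folded C_def]
  have un: "unch {vx, vi, vss, vcnt} {2, 3, 6} s0 s" using J' by blast
  have v: "var s vx = x" "var s vc = c" "var s vg = nxt St c" "arr s 1 = arr s0 1"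
    using J' un p by (auto simp: unch_def c_def)
  note k = same_keyD[OF p(8) x, folded c_def, folded C_def]
  have cn: "c < n" "nxt St c < n" using p by (auto simp: c_def)
  show "WP (Put 3 (Rd 1 (V vx) (V vc)) (Rd 1 (V vx) (V vg)) (Plus (V vx) (N 1))) Q s"
  proof (rule wp_Put)
    show "okE SS Bd (Rd 1 (V vx) (V vc)) s" "okE SS Bd (Rd 1 (V vx) (V vg)) s" "okE SS Bd (Plus (V vx) (N 1)) s"
      using v x cn SS_less n_le_Bd by (auto simp: TB_def width_def)
    show "val (Rd 1 (V vx) (V vc)) s \<le> Bd" "val (Rd 1 (V vx) (V vg)) s < width SS 3"
      using v k(1,2) SS_le_Bd by (auto simp: width_def)
    let ?s = "tick (ecost (Rd 1 (V vx) (V vc)) + ecost (Rd 1 (V vx) (V vg)) + ecost (Plus (V vx) (N 1)) + 10)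
            (put 3 (val (Rd 1 (V vx) (V vc)) s) (val (Rd 1 (V vx) (V vg)) s) (val (Plus (V vx) (N 1)) s) s)"
    have T: "(e < arr ?s 3 (arr s0 1 w c) (arr s0 1 w (nxt St c))) \<longleftrightarrow> (\<exists>y<Suc x. e \<le> y \<and> row C y = row C w)"
      if w: "w < n" for w e
    proof -
      have key: "(arr s0 1 w c = arr s0 1 x c \<and> arr s0 1 w (nxt St c) = arr s0 1 x (nxt St c)) \<longleftrightarrow> row C x = row C w"
        using k(3)[OF w] by metis
      show ?thesis
      proof (cases "row C x = row C w")
        case True
        then have "arr ?s 3 (arr s0 1 w c) (arr s0 1 w (nxt St c)) = Suc x" using key v by simp
        then show ?thesis using True by (auto simp: less_Suc_eq_le)
      next
        case False
        then have "arr ?s 3 (arr s0 1 w c) (arr s0 1 w (nxt St c)) = arr s 3 (arr s0 1 w c) (arr s0 1 w (nxt St c))"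
          using key v by auto
        also have "e < \<dots> \<longleftrightarrow> (\<exists>y<x. e \<le> y \<and> row C y = row C w)" using J' w by blast
        finally show ?thesis using False by (metis less_Suc_eq)
      qed
    qed
    have j: "clk s \<le> tm + 50 + 120" "\<forall>c'. c' \<noteq> c \<longrightarrow> arr s 2 c' = arr s0 2 c' \<and> arr s 6 c' = arr s0 6 c'"
      "var s vi = pt St x" "var s vss = seg C (Suc x)" "var s vcnt = seg_rows C (Suc x)"
      "arr s 6 c 0 = card (hits_upto St C (Suc x))"
      "\<forall>j\<in>St. j \<le> pt St x \<longrightarrow> arr s 2 c j = (if j \<in> hits_upto St C (Suc x) then 1 else 0)"
      using J' by blast+
    have oth: "unch {vx, vi, vss, vcnt} {2, 3, 6} s0 ?s" "clk ?s \<le> tm + 210" "arr ?s 2 = arr s 2" "arr ?s 6 = arr s 6"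
      "var ?s = var s" using un j(1) by simp_all
    have "cand_inv s0 St (pt St x) (Suc x) (Suc x) (tm + 210) x s'"
      if "unch {vx, vi, vss, vcnt} {2, 3, 6} s0 s'" "clk s' \<le> tm + 210" "arr s' 2 = arr s 2" "arr s' 6 = arr s 6"
        "var s' = var s"
        "\<And>w e. w < n \<Longrightarrow> (e < arr s' 3 (arr s0 1 w c) (arr s0 1 w (nxt St c))) \<longleftrightarrow> (\<exists>y<Suc x. e \<le> y \<and> row C y = row C w)" for s'
      unfolding cand_inv_def Let_def c_def[symmetric] C_def[symmetric] that(3-5)
      by (intro conjI that(1,2) j(2-) v(1) allI impI that(6))
    then show "Q ?s" by (rule Q[OF _]) (fact oth T)+
  qed simp
qed

lemma cand_wp:
  assumes St: "starts St" and e: "env s0" and ln: "links St s0" and lb: "labels St s0"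
    and c: "var s0 vc \<in> St" "nxt St (var s0 vc) < n"
    and Q: "\<And>s. unch {vg, vx, vi, vss, vcnt} {2, 3, 6} s0 s \<Longrightarrow> clk s \<le> clk s0 + 300 * n + 150 \<Longrightarrow>
      (\<And>c'. c' \<noteq> var s0 vc \<Longrightarrow> arr s 2 c' = arr s0 2 c' \<and> arr s 6 c' = arr s0 6 c') \<Longrightarrow>
      arr s 6 (var s0 vc) 0 = card (hits St (pair St (var s0 vc))) \<Longrightarrow>
      (\<And>j. j \<in> St \<Longrightarrow> arr s 2 (var s0 vc) j = (if j \<in> hits St (pair St (var s0 vc)) then 1 else 0)) \<Longrightarrow> Q s"
  shows "WP cand Q s0"
  unfolding cand_def
proof (rule wp_Seq, rule wp_Set)
  define c where "c = var s0 vc"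
  have cS: "c \<in> St" "nxt St c < n" "c < n" using c St by (auto simp: c_def starts_def)
  show "okE SS Bd (Rd 4 (V vc) (N 0)) s0" using cS n_le_Bd SS_less n_pos by (auto simp: TB_def width_def c_def)
  let ?s1 = "tick (ecost (Rd 4 (V vc) (N 0)) + 1) (setv vg (val (Rd 4 (V vc) (N 0)) s0) s0)"
  define s1 where "s1 = ?s1"
  have nx: "arr s0 4 c 0 = nxt St c" using ln cS by (simp add: links_def)
  have s1: "var s1 = (var s0)(vg := nxt St c)" "arr s1 = arr s0" "clk s1 = clk s0 + 10"
    using nx by (auto simp: s1_def c_def)
  have pre: "cand_pre St s1" unfolding cand_pre_def using St e ln lb cS s1
    by (auto simp: env_def links_def labels_def c_def[symmetric])
  note p = cand_preD[OF pre]
  have c1: "var s1 vc = c" by (simp add: s1 c_def)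
  define C where "C = pair St c"
  show "WP (cand_reset ;; Set vi (N 0) ;; Put 2 (V vc) (N 0) (N 0) ;; Put 6 (V vc) (N 0) (N 0) ;;
     Set vss (N 0) ;; Set vcnt (N 0) ;; upto vx cand_row) Q ?s1"
    unfolding s1_def[symmetric]
  proof (rule wp_Seq, rule cand_reset_wp[OF p(2) _ _ _])
    show "var s1 vc < n" "var s1 vg < n" using p by auto
    show "same_key C (var s1 vc) (var s1 vg) s1" using p(7,8) unfolding C_def c1 by simp
    fix s2 assume u: "unch {vx} {3} s1 s2" and t: "clk s2 \<le> clk s1 + 60 * n + 10"
      and z: "\<And>x. x < n \<Longrightarrow> arr s2 3 (arr s1 1 x (var s1 vc)) (arr s1 1 x (var s1 vg)) = 0"
    define s3 where "s3 = tick 2 (setv vcnt 0 (tick 2 (setv vss 0 (tick 13 (put 6 c 0 0 (tick 13 (put 2 c 0 0 (tick 2 (setv vi 0 s2)))))))))"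
    have c2: "var s2 vc = c" using u c1 by (simp add: unch_def)
    have fin: "WP (upto vx cand_row) Q s3"
    proof (rule wp_upto[where I = "\<lambda>x. cand_inv s1 St (pt St (x - 1)) x x (clk s1 + 60 * n + 60 + 220 * x) x"])
      show "var s3 0 = n" using u p(2) by (simp add: s3_def unch_def env_def)
      have "unch {vx, vi, vss, vcnt} {2, 3, 6} s1 s3" using u by (auto simp: unch_def s3_def)
      \<comment> \<open>At x = 0 the difference x - 1 is truncated, so the scan formally starts in
        the part of row 0, whose flag has been cleared beforehand.\<close>
      moreover have "pt St 0 = 0" using pt_props(2)[OF St, of 0] by simp
      moreover have "\<forall>c'. c' \<noteq> c \<longrightarrow> arr s3 2 c' = arr s1 2 c' \<and> arr s3 6 c' = arr s1 6 c'"
        using u by (auto simp: unch_def s3_def)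
      moreover have "arr s3 3 = arr s2 3" by (simp add: s3_def)
      moreover have "arr s2 3 (arr s1 1 w c) (arr s1 1 w (nxt St c)) = 0" if "w < n" for w
        using z[OF that] p(7) unfolding c1 by simp
      ultimately show "cand_inv s1 St (pt St (0 - 1)) 0 0 (clk s1 + 60 * n + 60 + 220 * 0) 0 s" if "s = tick 2 (setv vx 0 s3)" for s
        using t unfolding that cand_inv_def Let_def c1
        by (simp add: unch_def seg_def seg_rows_def hits_upto_def s3_def)
      fix x s assume I: "cand_inv s1 St (pt St (x - 1)) x x (clk s1 + 60 * n + 60 + 220 * x) x s"
      show "var s 0 = n \<and> var s vx = x" using I p(2) by (auto simp: cand_inv_def Let_def unch_def env_def)
      assume x: "x < n"
      have I': "cand_inv s1 St (pt St (x - 1)) x x (clk s1 + 60 * n + 65 + 220 * x) x (tick 5 s)"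
        using I by (simp add: cand_inv_def Let_def)
      show "WP cand_row (\<lambda>s'. var s' vx = x \<and> cand_inv s1 St (pt St (Suc x - 1)) (Suc x) (Suc x)
          (clk s1 + 60 * n + 60 + 220 * Suc x) (Suc x) (tick 4 (setv vx (Suc x) s'))) (tick 5 s)"
        by (rule cand_row_wp[OF pre x I']) (simp add: cand_inv_def Let_def)
    next
      fix s assume I: "cand_inv s1 St (pt St (n - 1)) n n (clk s1 + 60 * n + 60 + 220 * n) n s"
      note I' = I[unfolded cand_inv_def Let_def c1 hits_upto_n, folded C_def]
      have un: "unch {vx, vi, vss, vcnt} {2, 3, 6} s1 s" using I' by blast
      show "Q (tick 5 s)"
      proof (rule Q)
        show "unch {vg, vx, vi, vss, vcnt} {2, 3, 6} s0 (tick 5 s)" using un s1 by (auto simp: unch_def)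
        show "clk (tick 5 s) \<le> clk s0 + 300 * n + 150" using I' s1(3) n_pos by simp
        show "arr (tick 5 s) 2 c' = arr s0 2 c' \<and> arr (tick 5 s) 6 c' = arr s0 6 c'" if "c' \<noteq> var s0 vc" for c'
          using I' s1(2) that by (simp add: c_def)
        show "arr (tick 5 s) 6 (var s0 vc) 0 = card (hits St (pair St (var s0 vc)))"
          using I' by (simp add: c_def C_def)
        fix j assume j: "j \<in> St"
        \<comment> \<open>At the end the scan is in the last part, so the flags of all parts are
          settled.\<close>
        then have "j \<le> pt St (n - 1)" using pt_props(3)[OF St j, of "n - 1"] St by (auto simp: starts_def)
        then show "arr (tick 5 s) 2 (var s0 vc) j = (if j \<in> hits St (pair St (var s0 vc)) then 1 else 0)"
          using I' j unfolding c_def[symmetric] C_def[symmetric] by simp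
      qed
    qed (auto simp: TB_def SR_def)
    show "WP (Set vi (N 0) ;; Put 2 (V vc) (N 0) (N 0) ;; Put 6 (V vc) (N 0) (N 0) ;;
     Set vss (N 0) ;; Set vcnt (N 0) ;; upto vx cand_row) Q s2"
      by (intro wp_Seq wp_Set wp_Put)
        (use fin c2 cS(3) n_le_Bd p(9) in \<open>simp_all add: TB_def SR_def width_def s3_def numeral_2_eq_2\<close>)
  qed
qed (auto simp: TB_def SR_def)

lemma relabel_wp:
  assumes e: "env s0" and key: "same_key C (var s0 vp) (var s0 vq) s0"
    and pq: "var s0 vp < n" "var s0 vq < n" "var s0 vp \<noteq> var s0 vq"
    and Q: "\<And>s. unch {vx} {1, 3} s0 s \<Longrightarrow> clk s \<le> clk s0 + 150 * n + 20 \<Longrightarrow>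
      (\<And>x j. x < n \<Longrightarrow> j \<noteq> var s0 vp \<Longrightarrow> arr s 1 x j = arr s0 1 x j) \<Longrightarrow>
      (\<And>x. x < n \<Longrightarrow> arr s 1 x (var s0 vp) < SS) \<Longrightarrow>
      (\<And>x y. x < n \<Longrightarrow> y < n \<Longrightarrow> arr s 1 x (var s0 vp) = arr s 1 y (var s0 vp) \<longleftrightarrow> row C x = row C y) \<Longrightarrow> Q s"
  shows "WP relabel Q s0"
  unfolding relabel_def
proof (rule wp_Seq)
  define p where "p = var s0 vp"
  define q where "q = var s0 vq"
  have pqn: "p < n" "q < n" "p \<noteq> q" using pq by (auto simp: p_def q_def)
  note k = same_keyD[OF key, folded p_def q_def]
  define ky where "ky s x = arr s 3 (arr s0 1 x p) (arr s0 1 x q)" for s :: st and x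
  show "WP (upto vx (Put 3 (Rd 1 (V vx) (V vp)) (Rd 1 (V vx) (V vq)) (V vx)))
     (WP (upto vx (Put 1 (V vx) (V vp) (Rd 3 (Rd 1 (V vx) (V vp)) (Rd 1 (V vx) (V vq)))) ) Q) s0"
  proof (rule wp_upto[where I = "\<lambda>x s. unch {vx} {3} s0 s \<and> var s vx = x \<and> clk s \<le> clk s0 + 2 + 50 * x \<and>
      (\<forall>w<n. (\<exists>y<x. row C y = row C w) \<longrightarrow> ky s w < n \<and> row C (ky s w) = row C w)"])
    show "var s0 0 = n" using e by (simp add: env_def)
    fix x s assume I: "unch {vx} {3} s0 s \<and> var s vx = x \<and> clk s \<le> clk s0 + 2 + 50 * x \<and>
      (\<forall>w<n. (\<exists>y<x. row C y = row C w) \<longrightarrow> ky s w < n \<and> row C (ky s w) = row C w)"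
    then have v: "var s 0 = n" "var s vp = p" "var s vq = q" "arr s 1 = arr s0 1" "var s vx = x"
      using e by (auto simp: unch_def env_def p_def q_def)
    show "var s 0 = n \<and> var s vx = x" using v by simp
    assume x: "x < n"
    have fin: "var s' vx = x \<and> unch {vx} {3} s0 (tick 4 (setv vx (Suc x) s')) \<and> var (tick 4 (setv vx (Suc x) s')) vx = Suc x \<and>
        clk (tick 4 (setv vx (Suc x) s')) \<le> clk s0 + 2 + 50 * Suc x \<and>
        (\<forall>w<n. (\<exists>y<Suc x. row C y = row C w) \<longrightarrow> ky (tick 4 (setv vx (Suc x) s')) w < n \<and>
          row C (ky (tick 4 (setv vx (Suc x) s')) w) = row C w)"
      if s': "var s' = var s" "clk s' \<le> clk s + 40" "arr s' = (arr s)(3 := (arr s 3)(arr s0 1 x p := (arr s 3 (arr s0 1 x p))(arr s0 1 x q := x)))" for s'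
    proof (intro conjI allI impI)
      show "unch {vx} {3} s0 (tick 4 (setv vx (Suc x) s'))" using I s' by (auto simp: unch_def)
      fix w assume w: "w < n" "\<exists>y<Suc x. row C y = row C w"
      have kk: "(arr s0 1 w p = arr s0 1 x p \<and> arr s0 1 w q = arr s0 1 x q) \<longleftrightarrow> row C x = row C w"
        using k(3)[OF x w(1)] by metis
      have "ky s' w < n \<and> row C (ky s' w) = row C w"
      proof (cases "row C x = row C w")
        case True
        then have "ky s' w = x" unfolding ky_def s'(3) using kk by simp
        then show ?thesis using True x by simp
      next
        case False
        then have "ky s' w = ky s w" unfolding ky_def s'(3) using kk by auto
        moreover have "\<exists>y<x. row C y = row C w" using w(2) False by (metis less_Suc_eq)
        ultimately show ?thesis using I w(1) by simp
      qed
      moreover have "ky (tick 4 (setv vx (Suc x) s')) w = ky s' w" by (simp add: ky_def)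
      ultimately show "ky (tick 4 (setv vx (Suc x) s')) w < n" "row C (ky (tick 4 (setv vx (Suc x) s')) w) = row C w" by simp_all
    qed (use I s' in auto)
    show "WP (Put 3 (Rd 1 (V vx) (V vp)) (Rd 1 (V vx) (V vq)) (V vx))
     (\<lambda>s'. var s' vx = x \<and> unch {vx} {3} s0 (tick 4 (setv vx (Suc x) s')) \<and> var (tick 4 (setv vx (Suc x) s')) vx = Suc x \<and>
        clk (tick 4 (setv vx (Suc x) s')) \<le> clk s0 + 2 + 50 * Suc x \<and>
        (\<forall>w<n. (\<exists>y<Suc x. row C y = row C w) \<longrightarrow> ky (tick 4 (setv vx (Suc x) s')) w < n \<and>
          row C (ky (tick 4 (setv vx (Suc x) s')) w) = row C w)) (tick 5 s)"
      apply (rule wp_Put)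
        prefer 7
        subgoal by (rule fin) (use v x in simp_all)
        by (use v x k(1,2)[OF x] pqn SS_less SS_le_Bd n_le_Bd in \<open>simp_all add: TB_def width_def\<close>)
  next
    fix s assume I: "unch {vx} {3} s0 s \<and> var s vx = n \<and> clk s \<le> clk s0 + 2 + 50 * n \<and>
      (\<forall>w<n. (\<exists>y<n. row C y = row C w) \<longrightarrow> ky s w < n \<and> row C (ky s w) = row C w)"
    define t where "t w = ky s w" for w
    have t: "t w < n" "row C (t w) = row C w" if "w < n" for w using I that by (auto simp: t_def)
    have teq: "t w = t w' \<longleftrightarrow> row C w = row C w'" if "w < n" "w' < n" for w w'
    proof
      assume "row C w = row C w'"
      then show "t w = t w'" unfolding t_def ky_def using k(3)[OF that] by metis
    qed (use t that in metis)
    have v0: "var s 0 = n" "arr s 1 = arr s0 1" using I e by (auto simp: unch_def env_def)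
    show "WP (upto vx (Put 1 (V vx) (V vp) (Rd 3 (Rd 1 (V vx) (V vp)) (Rd 1 (V vx) (V vq))))) Q (tick 5 s)"
    proof (rule wp_upto[where I = "\<lambda>x s'. unch {vx} {1} s s' \<and> var s' vx = x \<and> clk s' \<le> clk s + 10 + 60 * x \<and>
       arr s' 1 = (\<lambda>w. if w < x then (arr s0 1 w)(p := t w) else arr s0 1 w)"])
      show "var (tick 5 s) 0 = n" using v0 by simp
      show "unch {vx} {1} s s' \<and> var s' vx = 0 \<and> clk s' \<le> clk s + 10 + 60 * 0 \<and>
         arr s' 1 = (\<lambda>w. if w < 0 then (arr s0 1 w)(p := t w) else arr s0 1 w)" if "s' = tick 2 (setv vx 0 (tick 5 s))" for s'
        unfolding that using v0 by simp
      fix x s' assume I2: "unch {vx} {1} s s' \<and> var s' vx = x \<and> clk s' \<le> clk s + 10 + 60 * x \<and>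
       arr s' 1 = (\<lambda>w. if w < x then (arr s0 1 w)(p := t w) else arr s0 1 w)"
      have v: "var s' 0 = n" "var s' vp = p" "var s' vq = q" "var s' vx = x" "arr s' 3 = arr s 3"
        using I I2 e by (auto simp: unch_def env_def p_def q_def)
      show "var s' 0 = n \<and> var s' vx = x" using v by simp
      assume x: "x < n"
      \<comment> \<open>Only rows below x have been relabelled, so the old key of x is still there
        and the labels can be overwritten in place.\<close>
      have l: "arr s' 1 x = arr s0 1 x" using I2 by simp
      have l3: "arr s 3 (arr s0 1 x p) (arr s0 1 x q) = t x" by (simp add: t_def ky_def)
      have fin: "var s2 vx = x \<and> unch {vx} {1} s (tick 4 (setv vx (Suc x) s2)) \<and> var (tick 4 (setv vx (Suc x) s2)) vx = Suc x \<and>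
         clk (tick 4 (setv vx (Suc x) s2)) \<le> clk s + 10 + 60 * Suc x \<and>
         arr (tick 4 (setv vx (Suc x) s2)) 1 = (\<lambda>w. if w < Suc x then (arr s0 1 w)(p := t w) else arr s0 1 w)"
        if s2: "var s2 = var s'" "clk s2 \<le> clk s' + 50" "arr s2 = (arr s')(1 := (arr s' 1)(x := (arr s0 1 x)(p := t x)))" for s2
        using I2 s2 by (auto simp: unch_def fun_eq_iff less_Suc_eq)
      show "WP (Put 1 (V vx) (V vp) (Rd 3 (Rd 1 (V vx) (V vp)) (Rd 1 (V vx) (V vq))))
         (\<lambda>s2. var s2 vx = x \<and> unch {vx} {1} s (tick 4 (setv vx (Suc x) s2)) \<and> var (tick 4 (setv vx (Suc x) s2)) vx = Suc x \<and>
         clk (tick 4 (setv vx (Suc x) s2)) \<le> clk s + 10 + 60 * Suc x \<and>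
         arr (tick 4 (setv vx (Suc x) s2)) 1 = (\<lambda>w. if w < Suc x then (arr s0 1 w)(p := t w) else arr s0 1 w)) (tick 5 s')"
        apply (rule wp_Put)
        prefer 7
        subgoal by (rule fin) (use v x l l3 I2 in simp_all)
        by (use v x k(1,2)[OF x] pqn l l3 SS_less SS_le_Bd n_le_Bd in \<open>simp_all add: TB_def width_def\<close>)
    next
      fix s' assume I2: "unch {vx} {1} s s' \<and> var s' vx = n \<and> clk s' \<le> clk s + 10 + 60 * n \<and>
       arr s' 1 = (\<lambda>w. if w < n then (arr s0 1 w)(p := t w) else arr s0 1 w)"
      show "Q (tick 5 s')"
      proof (rule Q, unfold p_def[symmetric])
        show "unch {vx} {1, 3} s0 (tick 5 s')" using I I2 by (auto simp: unch_def)
        show "clk (tick 5 s') \<le> clk s0 + 150 * n + 20" using I I2 by simp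
        show "arr (tick 5 s') 1 x p < SS" if "x < n" for x using I2 t(1)[OF that] SS_less that by simp
        show "arr (tick 5 s') 1 x p = arr (tick 5 s') 1 y p \<longleftrightarrow> row C x = row C y" if "x < n" "y < n" for x y
          using I2 teq that by simp
        show "arr (tick 5 s') 1 x j = arr s0 1 x j" if "x < n" "j \<noteq> p" for x j using I2 that by simp
      qed
    qed (auto simp: TB_def SR_def)
  qed (auto simp: TB_def SR_def)
qed

text \<open>Demanded for every c, also where no part starts any more: \<open>merge_hits\<close> runs
  over all rows, and its subtraction of 1 is exact only if the counter agrees with the
  flags.\<close>

definition counted :: "nat set \<Rightarrow> st \<Rightarrow> bool" where
  "counted St s \<longleftrightarrow> (\<forall>c<n. arr s 6 c 0 = card {i\<in>St. arr s 2 c i = 1})"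

lemma merge_hits_wp:
  assumes e: "env s0" and St: "starts St" and pq: "var s0 vp \<in> St" "var s0 vq \<in> St" "var s0 vp \<noteq> var s0 vq"
    and ct: "counted St s0"
    and Q: "\<And>s. unch {vx} {2, 6} s0 s \<Longrightarrow> clk s \<le> clk s0 + 100 * n + 10 \<Longrightarrow> counted (St - {var s0 vq}) s \<Longrightarrow>
      (\<And>c. c < n \<Longrightarrow> arr s 2 c = (if arr s0 2 c (var s0 vq) = 1 then (arr s0 2 c)(var s0 vp := 1) else arr s0 2 c)) \<Longrightarrow> Q s"
  shows "WP merge_hits Q s0"
  unfolding merge_hits_def
proof -
  define p where "p = var s0 vp"
  define q where "q = var s0 vq"
  have pS: "p \<in> St" "q \<in> St" "p \<noteq> q" "p < n" "q < n" using pq St by (auto simp: p_def q_def starts_def)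
  have fin: "finite St" by (rule starts_finite[OF St])
  define H where "H c = (if arr s0 2 c q = 1 then (arr s0 2 c)(p := 1) else arr s0 2 c)" for c
  define cn where "cn c = card {i\<in>St - {q}. H c i = 1}" for c
  define A where "A c = {i\<in>St. arr s0 2 c i = 1}" for c
  have fA: "finite (A c)" for c using fin by (simp add: A_def)
  have a6: "arr s0 6 c 0 = card (A c)" if "c < n" for c using ct that by (simp add: counted_def A_def)
  have cA: "card (A c) \<le> n" for c
  proof -
    have "A c \<subseteq> {..<n}" using St by (auto simp: A_def starts_def)
    then show ?thesis using card_mono[of "{..<n}" "A c"] by simp
  qed
  have cn1: "cn c = card (A c)" if "arr s0 2 c q \<noteq> 1" for c
    unfolding cn_def A_def H_def using that by (intro arg_cong[of _ _ card]) auto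
  have cn2: "cn c = card (A c) - 1" "1 \<le> card (A c)" if "arr s0 2 c q = 1" "arr s0 2 c p = 1" for c
  proof -
    have "{i\<in>St - {q}. H c i = 1} = A c - {q}" using that pS by (auto simp: A_def H_def)
    moreover have "q \<in> A c" using that pS by (simp add: A_def)
    ultimately show "cn c = card (A c) - 1" "1 \<le> card (A c)"
      using fA[of c] by (auto simp: cn_def card_Diff_singleton Suc_le_eq card_gt_0_iff)
  qed
  have cn3: "cn c = card (A c)" if "arr s0 2 c q = 1" "arr s0 2 c p \<noteq> 1" for c
  proof -
    have s: "{i\<in>St - {q}. H c i = 1} = insert p (A c - {q})" using that pS by (auto simp: A_def H_def)
    have m: "q \<in> A c" "p \<notin> A c" using that pS by (auto simp: A_def)
    have "card (insert p (A c - {q})) = Suc (card (A c - {q}))" using m fA[of c] by (intro card_insert_disjoint) auto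
    also have "\<dots> = card (A c)" by (rule card_Suc_Diff1[OF fA m(1)])
    finally show ?thesis unfolding cn_def s .
  qed
  let ?I = "\<lambda>x s. unch {vx} {2, 6} s0 s \<and> var s vx = x \<and> clk s \<le> clk s0 + 2 + 90 * x \<and>
     (\<forall>c<x. arr s 2 c = H c \<and> arr s 6 c 0 = cn c) \<and> (\<forall>c\<ge>x. arr s 2 c = arr s0 2 c \<and> arr s 6 c = arr s0 6 c)"
  let ?c = "Ifte (Eq (Rd 2 (V vx) (V vq)) (N 1))
       (Ifte (Eq (Rd 2 (V vx) (V vp)) (N 1)) (Put 6 (V vx) (N 0) (Minus (Rd 6 (V vx) (N 0)) (N 1)))
         (Put 2 (V vx) (V vp) (N 1))) Skip"
  show "WP (upto vx ?c) Q s0"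
  proof (rule wp_upto[where I = ?I])
    show "var s0 0 = n" using e by (simp add: env_def)
    fix x s assume I: "?I x s"
    then have v: "var s 0 = n" "var s vp = p" "var s vq = q" "var s vx = x"
      using e by (auto simp: unch_def env_def p_def q_def)
    show "var s 0 = n \<and> var s vx = x" using v by simp
    assume x: "x < n"
    have h: "arr s 2 x = arr s0 2 x" "arr s 6 x 0 = card (A x)" using I a6[OF x] by auto
    have fin: "var s' vx = x \<and> ?I (Suc x) (tick 4 (setv vx (Suc x) s'))"
      if s': "var s' = var s" "clk s' \<le> clk s + 80" "unch {vx} {2, 6} s s'" "arr s' 2 x = H x" "arr s' 6 x 0 = cn x"
        "\<forall>c. c \<noteq> x \<longrightarrow> arr s' 2 c = arr s 2 c \<and> arr s' 6 c = arr s 6 c" for s'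
      using I s' by (auto simp: unch_def less_Suc_eq)
    show "WP ?c (\<lambda>s'. var s' vx = x \<and> ?I (Suc x) (tick 4 (setv vx (Suc x) s'))) (tick 5 s)"
    proof (rule wp_Ifte)
      show "okC SS Bd (Eq (Rd 2 (V vx) (V vq)) (N 1)) (tick 5 s)"
        using v x pS SS_less n_le_Bd by (simp add: TB_def width_def)
      assume "\<not> holds (Eq (Rd 2 (V vx) (V vq)) (N 1)) (tick 5 s)"
      then have "arr s0 2 x q \<noteq> 1" using v h by simp
      then show "WP Skip (\<lambda>s'. var s' vx = x \<and> ?I (Suc x) (tick 4 (setv vx (Suc x) s'))) (tick (ccost (Eq (Rd 2 (V vx) (V vq)) (N 1)) + 1) (tick 5 s))"
        by (intro wp_Skip fin) (use h cn1 in \<open>simp_all add: H_def unch_def\<close>)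
    next
      assume "holds (Eq (Rd 2 (V vx) (V vq)) (N 1)) (tick 5 s)"
      then have q1: "arr s0 2 x q = 1" using v h by simp
      show "WP (Ifte (Eq (Rd 2 (V vx) (V vp)) (N 1)) (Put 6 (V vx) (N 0) (Minus (Rd 6 (V vx) (N 0)) (N 1)))
         (Put 2 (V vx) (V vp) (N 1))) (\<lambda>s'. var s' vx = x \<and> ?I (Suc x) (tick 4 (setv vx (Suc x) s'))) (tick (ccost (Eq (Rd 2 (V vx) (V vq)) (N 1)) + 1) (tick 5 s))"
        by (intro wp_Ifte wp_Put fin)
          (use v x pS SS_less n_le_Bd h cn2[OF q1] cn3[OF q1] q1 n_pos in
            \<open>auto simp: TB_def width_def unch_def H_def SS_def fun_eq_iff\<close>)
    qed
  next
    fix s assume I: "?I n s"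
    show "Q (tick 5 s)"
    proof (rule Q)
      show "counted (St - {var s0 vq}) (tick 5 s)" using I by (auto simp: counted_def cn_def q_def[symmetric])
      show "arr (tick 5 s) 2 c = (if arr s0 2 c (var s0 vq) = 1 then (arr s0 2 c)(var s0 vp := 1) else arr s0 2 c)"
        if "c < n" for c using I that by (simp add: H_def p_def q_def)
    qed (use I in auto)
  qed (auto simp: TB_def SR_def)
qed

end

definition range_loop :: "nat \<Rightarrow> nat \<Rightarrow> nat \<Rightarrow> cmd \<Rightarrow> cmd" where
  "range_loop v a b c = Set v (V a) ;; Loop (Lt (V v) (V b)) (c ;; inc v)"

definition parts_loop :: "nat \<Rightarrow> cmd \<Rightarrow> cmd" where
  "parts_loop v c = Set v (N 0) ;; Loop (Lt (V v) (V 0)) (c ;; Set v (Rd 4 (V v) (N 0)))"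

text \<open>Column 0 of the dictionary array serves as a set of labels. Clearing just the labels
  that occur keeps the cost linear in the part.\<close>

definition count_labels :: cmd where
  "count_labels =
     range_loop vy vp ve (Put 3 (Rd 1 (V vy) (V vi)) (N 0) (N 0)) ;; Set vcnt (N 0) ;;
     range_loop vy vp ve
       (Ifte (Eq (Rd 3 (Rd 1 (V vy) (V vi)) (N 0)) (N 0)) (inc vcnt ;; Put 3 (Rd 1 (V vy) (V vi)) (N 0) (N 1)) Skip)"

text \<open>A part that is not hit has fewer than \<open>thr\<close> distinct rows on the columns of
  p, so by duality p has fewer than \<open>big\<close> on it and it cannot be bad. The count is thus
  made for at most \<open>maxhit\<close> parts. The flags stored for candidate p before the merge
  now describe the merged part itself.\<close>

definition flag_bad :: cmd where
  "flag_bad = parts_loop vi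
     (Put 7 (V vi) (N 0) (N 0) ;;
      Ifte (Eq (Rd 2 (V vp) (V vi)) (N 1))
        (count_labels ;; Ifte (Lt (V vcnt) (V vbig)) Skip (Put 7 (V vi) (N 0) (N 1))) Skip)"

definition compare :: cmd where
  "compare = Set veq (N 1) ;; parts_loop vi
     (Ifte (Eq (Rd 7 (V vi) (N 0)) (N 0))
       (Ifte (Eq (Rd 1 (V vy) (V vi)) (Rd 1 (V vz) (V vi))) Skip (Set veq (N 0))) Skip)"

definition emit :: cmd where
  "emit = Put 0 (V vo) (N 0) (V vz) ;; Put 0 (Plus (V vo) (N 1)) (N 0) (V vy) ;;
     Put 0 (Plus (V vo) (N 2)) (N 0) (Plus (V 0) (V vz)) ;; Put 0 (Plus (V vo) (N 3)) (N 0) (Plus (V 0) (V vy)) ;;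
     Set vo (Plus (V vo) (N 4))"

definition try_merge :: cmd where
  "try_merge = Ifte (Eq (Rd 5 (V vz) (N 0)) (N 1))
     (Ifte (Eq (Rd 5 (V vy) (N 0)) (N 1))
       (compare ;; Ifte (Eq (V veq) (N 1)) (emit ;; Put 5 (V vy) (N 0) (N 0)) Skip) Skip) Skip"

text \<open>Both loops run over the whole part, but the inner one starts only for a representative
  and a comparison happens only between two representatives. Just after a merge there are boundedly
  many of these.\<close>

definition merge_classes :: cmd where
  "merge_classes = range_loop vy vp ve
     (Ifte (Eq (Rd 5 (V vy) (N 0)) (N 1)) (range_loop vz vp vy try_merge) Skip)"

section \<open>Loops over ranges and over parts, and counting distinct labels\<close>

context twin_width_input begin

lemma wp_range:
  assumes start: "v < TB" "v \<noteq> SR" "a < TB" "b < TB" "var s0 a = lo" "b \<noteq> v" "var s0 b = hi" "lo \<le> hi" "hi \<le> n"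
    and I0: "\<And>s. s = tick 2 (setv v lo s0) \<Longrightarrow> I lo s"
    and fr: "\<And>x s. I x s \<Longrightarrow> lo \<le> x \<Longrightarrow> x \<le> hi \<Longrightarrow> var s b = hi \<and> var s v = x"
    and body: "\<And>x s. I x s \<Longrightarrow> lo \<le> x \<Longrightarrow> x < hi \<Longrightarrow>
      WP c (\<lambda>s'. var s' v = x \<and> I (Suc x) (tick 4 (setv v (Suc x) s'))) (tick 5 s)"
    and Q: "\<And>s. I hi s \<Longrightarrow> Q (tick 5 s)"
  shows "WP (range_loop v a b c) Q s0"
proof -
  have e: "ecost (V a) + 1 = 2" "ccost (Lt (V v) (V b)) + 1 = 5" "ecost (Plus (V v) (N 1)) + 1 = 4" by auto
  show ?thesis unfolding range_loop_def inc_def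
  proof (rule wp_Seq, rule wp_Set)
    show "WP (Loop (Lt (V v) (V b)) (c ;; Set v (Plus (V v) (N 1)))) Q (tick (ecost (V a) + 1) (setv v (val (V a) s0) s0))"
    proof (rule wp_Loop[where I = "\<lambda>s. \<exists>x. lo \<le> x \<and> x \<le> hi \<and> I x s" and \<mu> = "\<lambda>s. hi - var s v"])
      show "\<exists>x. lo \<le> x \<and> x \<le> hi \<and> I x (tick (ecost (V a) + 1) (setv v (val (V a) s0) s0))"
        using I0 start unfolding e by auto
      show "okC SS Bd (Lt (V v) (V b)) s" if "\<exists>x. lo \<le> x \<and> x \<le> hi \<and> I x s" for s
        using start by simp
      fix s assume "\<exists>x. lo \<le> x \<and> x \<le> hi \<and> I x s"
      then obtain x where x: "lo \<le> x" "x \<le> hi" "I x s" by blast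
      note v = fr[OF x(3,1,2)]
      show "Q (tick (ccost (Lt (V v) (V b)) + 1) s)" if "\<not> holds (Lt (V v) (V b)) s"
      proof -
        have "x = hi" using that v x by simp
        then show ?thesis unfolding e using Q x(3) by blast
      qed
      show "WP (c ;; Set v (Plus (V v) (N 1))) (\<lambda>s'. (\<exists>x. lo \<le> x \<and> x \<le> hi \<and> I x s') \<and> hi - var s' v < hi - var s v)
          (tick (ccost (Lt (V v) (V b)) + 1) s)" if "holds (Lt (V v) (V b)) s"
      proof -
        have xn: "x < hi" using that v by simp
        show ?thesis unfolding e
        proof (rule wp_Seq, rule wp_mono[OF body[OF x(3,1) xn]])
          fix s' assume s': "var s' v = x \<and> I (Suc x) (tick 4 (setv v (Suc x) s'))"
          show "WP (Set v (Plus (V v) (N 1))) (\<lambda>s'. (\<exists>x. lo \<le> x \<and> x \<le> hi \<and> I x s') \<and> hi - var s' v < hi - var s v) s'"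
          proof (rule wp_Set)
            show "okE SS Bd (Plus (V v) (N 1)) s'" using s' xn start n_le_Bd by simp
            have st: "tick (ecost (Plus (V v) (N 1)) + 1) (setv v (val (Plus (V v) (N 1)) s') s') = tick 4 (setv v (Suc x) s')"
              using s' unfolding e by simp
            show "(\<exists>xa. lo \<le> xa \<and> xa \<le> hi \<and> I xa (tick (ecost (Plus (V v) (N 1)) + 1) (setv v (val (Plus (V v) (N 1)) s') s'))) \<and>
               hi - var (tick (ecost (Plus (V v) (N 1)) + 1) (setv v (val (Plus (V v) (N 1)) s') s')) v < hi - var s v"
              unfolding st using s' xn x(1) v by (auto intro!: exI[of _ "Suc x"])
          qed (use start in auto)
        qed
      qed
    qed
  qed (use start in auto)
qed

text \<open>\<open>I i\<close> is the invariant when all parts before \<open>i\<close> have been visited.\<close>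

lemma wp_parts:
  assumes start: "v < TB" "v \<noteq> SR" "v \<noteq> 0" "var s0 0 = n" and St: "starts St"
    and I0: "\<And>s. s = tick 2 (setv v 0 s0) \<Longrightarrow> I 0 s"
    and fr: "\<And>x s. I x s \<Longrightarrow> x \<in> St \<or> x = n \<Longrightarrow> var s 0 = n \<and> var s v = x"
    and body: "\<And>x s. I x s \<Longrightarrow> x \<in> St \<Longrightarrow>
      WP c (\<lambda>s'. var s' v = x \<and> arr s' 4 x 0 = nxt St x \<and> I (nxt St x) (tick 10 (setv v (nxt St x) s'))) (tick 5 s)"
    and Q: "\<And>s. I n s \<Longrightarrow> Q (tick 5 s)"
  shows "WP (parts_loop v c) Q s0"
proof -
  have e: "ecost (N 0) + 1 = 2" "ccost (Lt (V v) (V 0)) + 1 = 5" "ecost (Rd 4 (V v) (N 0)) + 1 = 10" by auto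
  have Sn: "x < n" if "x \<in> St" for x using that St by (auto simp: starts_def)
  have z: "0 \<in> St" using St by (simp add: starts_def)
  show ?thesis unfolding parts_loop_def
  proof (rule wp_Seq, rule wp_Set)
    show "WP (Loop (Lt (V v) (V 0)) (c ;; Set v (Rd 4 (V v) (N 0)))) Q (tick (ecost (N 0) + 1) (setv v (val (N 0) s0) s0))"
    proof (rule wp_Loop[where I = "\<lambda>s. \<exists>x. (x \<in> St \<or> x = n) \<and> I x s" and \<mu> = "\<lambda>s. n - var s v"])
      show "\<exists>x. (x \<in> St \<or> x = n) \<and> I x (tick (ecost (N 0) + 1) (setv v (val (N 0) s0) s0))"
        using I0 z unfolding e by auto
      show "okC SS Bd (Lt (V v) (V 0)) s" if "\<exists>x. (x \<in> St \<or> x = n) \<and> I x s" for s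
        using start by (simp add: TB_def)
      fix s assume "\<exists>x. (x \<in> St \<or> x = n) \<and> I x s"
      then obtain x where x: "x \<in> St \<or> x = n" "I x s" by blast
      note v = fr[OF x(2,1)]
      show "Q (tick (ccost (Lt (V v) (V 0)) + 1) s)" if "\<not> holds (Lt (V v) (V 0)) s"
      proof -
        have "x = n" using that v x Sn[of x] by auto
        then show ?thesis unfolding e using Q x(2) by blast
      qed
      show "WP (c ;; Set v (Rd 4 (V v) (N 0))) (\<lambda>s'. (\<exists>x. (x \<in> St \<or> x = n) \<and> I x s') \<and> n - var s' v < n - var s v)
          (tick (ccost (Lt (V v) (V 0)) + 1) s)" if "holds (Lt (V v) (V 0)) s"
      proof -
        have xS: "x \<in> St" "x < n" using that v x by auto
        note nx = nxt_props[OF St xS(1)]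
        show ?thesis unfolding e
        proof (rule wp_Seq, rule wp_mono[OF body[OF x(2) xS(1)]])
          fix s' assume s': "var s' v = x \<and> arr s' 4 x 0 = nxt St x \<and> I (nxt St x) (tick 10 (setv v (nxt St x) s'))"
          show "WP (Set v (Rd 4 (V v) (N 0))) (\<lambda>s'. (\<exists>x. (x \<in> St \<or> x = n) \<and> I x s') \<and> n - var s' v < n - var s v) s'"
          proof (rule wp_Set)
            show "okE SS Bd (Rd 4 (V v) (N 0)) s'" using s' xS start n_le_Bd SS_less[OF xS(2)] by (simp add: width_def)
            have st: "tick (ecost (Rd 4 (V v) (N 0)) + 1) (setv v (val (Rd 4 (V v) (N 0)) s') s') = tick 10 (setv v (nxt St x) s')"
              using s' unfolding e by simp
            show "(\<exists>xa. (xa \<in> St \<or> xa = n) \<and> I xa (tick (ecost (Rd 4 (V v) (N 0)) + 1) (setv v (val (Rd 4 (V v) (N 0)) s') s'))) \<and>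
               n - var (tick (ecost (Rd 4 (V v) (N 0)) + 1) (setv v (val (Rd 4 (V v) (N 0)) s') s')) v < n - var s v"
              unfolding st using s' xS nx v by (auto intro!: exI[of _ "nxt St x"])
          qed (use start in auto)
        qed
      qed
    qed
  qed (use start in auto)
qed

lemma before_nxt: "starts St \<Longrightarrow> i \<in> St \<Longrightarrow> {j \<in> St. j < nxt St i} = insert i {j \<in> St. j < i}"
  using nxt_props[of St i] by (auto simp: not_less) (meson leD leI le_neq_implies_less order.strict_trans)+

definition part_env :: "nat set \<Rightarrow> nat \<Rightarrow> st \<Rightarrow> bool" where
  "part_env St p s \<longleftrightarrow> starts St \<and> p \<in> St \<and> env s \<and> links St s \<and> labels St s \<and> var s vp = p \<and> var s ve = nxt St p"

lemma part_env_unch: "part_env St p s \<Longrightarrow> unch Vs As s s' \<Longrightarrow> {0, vmax, vthr, vbig, vp, ve} \<inter> Vs = {} \<Longrightarrow> {1, 4} \<inter> As = {} \<Longrightarrow> part_env St p s'"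
  unfolding part_env_def env_def links_def labels_def unch_def by auto

lemma part_envD:
  assumes "part_env St p s"
  shows "starts St" "p \<in> St" "p < n" "var s vp = p" "var s ve = nxt St p" "p \<le> nxt St p" "nxt St p \<le> n" "var s 0 = n"
    "var s vbig = big" "\<And>i. i \<in> St \<Longrightarrow> i < n" "\<And>i. i \<in> St \<Longrightarrow> arr s 4 i 0 = nxt St i"
    "\<And>i x. i \<in> St \<Longrightarrow> x < n \<Longrightarrow> arr s 1 x i < SS"
    "\<And>i x y. i \<in> St \<Longrightarrow> x < n \<Longrightarrow> y < n \<Longrightarrow> arr s 1 x i = arr s 1 y i \<longleftrightarrow> row (part St i) x = row (part St i) y"
proof -
  show a: "starts St" "p \<in> St" "var s vp = p" "var s ve = nxt St p" using assms by (auto simp: part_env_def)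
  then show "p < n" by (auto simp: starts_def)
  show "p \<le> nxt St p" "nxt St p \<le> n" using nxt_props[OF a(1,2)] by auto
  show "var s 0 = n" "var s vbig = big" using assms by (auto simp: part_env_def env_def)
  show "\<And>i. i \<in> St \<Longrightarrow> i < n" using a(1) by (auto simp: starts_def)
  show "\<And>i. i \<in> St \<Longrightarrow> arr s 4 i 0 = nxt St i" using assms by (auto simp: part_env_def links_def)
  have lb: "labels St s" using assms by (auto simp: part_env_def)
  show "\<And>i x. i \<in> St \<Longrightarrow> x < n \<Longrightarrow> arr s 1 x i < SS" using lb unfolding labels_def by blast
  show "\<And>i x y. i \<in> St \<Longrightarrow> x < n \<Longrightarrow> y < n \<Longrightarrow> arr s 1 x i = arr s 1 y i \<longleftrightarrow> row (part St i) x = row (part St i) y"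
    using lb unfolding labels_def by blast
qed

lemma count_labels_wp:
  assumes P: "part_env St p s0" and i: "var s0 vi = i" "i \<in> St"
    and Q: "\<And>s. unch {vy, vcnt} {3} s0 s \<Longrightarrow> clk s \<le> clk s0 + 200 * n + 30 \<Longrightarrow>
      var s vcnt = rows (part St i) (part St p) \<Longrightarrow> Q s"
  shows "WP count_labels Q s0"
proof -
  note p = part_envD[OF P]
  define e where "e = nxt St p"
  define l where "l x = arr s0 1 x i" for x
  have iS: "i < n" "i < SS" using p(10)[OF i(2)] SS_less by auto
  have e: "p \<le> e" "e \<le> n" using p by (auto simp: e_def)
  have lS: "l x < SS" if "x < e" for x using p(12)[OF i(2), of x] that e by (simp add: l_def)
  have pos: "0 < SS" using n_pos by (simp add: SS_def)
  have fin2: "WP (range_loop vy vp ve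
       (Ifte (Eq (Rd 3 (Rd 1 (V vy) (V vi)) (N 0)) (N 0)) (inc vcnt ;; Put 3 (Rd 1 (V vy) (V vi)) (N 0) (N 1)) Skip)) Q s1"
    if u1: "unch {vy, vcnt} {3} s0 s1" and c1: "clk s1 \<le> clk s0 + 50 * n + 15" "var s1 vcnt = 0"
      and z: "\<And>x. p \<le> x \<Longrightarrow> x < e \<Longrightarrow> arr s1 3 (l x) 0 = 0" for s1
  proof (rule wp_range[where lo = p and hi = e and I = "\<lambda>y s. unch {vy, vcnt} {3} s0 s \<and> var s vy = y \<and>
       clk s \<le> clk s0 + 50 * n + 17 + 80 * (y - p) \<and> var s vcnt = card (l ` {p..<y}) \<and>
       (\<forall>x. p \<le> x \<longrightarrow> x < e \<longrightarrow> arr s 3 (l x) 0 = (if l x \<in> l ` {p..<y} then 1 else 0))"])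
    show "var s1 vp = p" "var s1 ve = e" using u1 p by (auto simp: unch_def e_def)
    show "unch {vy, vcnt} {3} s0 s \<and> var s vy = p \<and>
       clk s \<le> clk s0 + 50 * n + 17 + 80 * (p - p) \<and> var s vcnt = card (l ` {p..<p}) \<and>
       (\<forall>x. p \<le> x \<longrightarrow> x < e \<longrightarrow> arr s 3 (l x) 0 = (if l x \<in> l ` {p..<p} then 1 else 0))" if "s = tick 2 (setv vy p s1)" for s
      using u1 c1 z that by (auto simp: unch_def)
    fix y s assume I: "unch {vy, vcnt} {3} s0 s \<and> var s vy = y \<and>
       clk s \<le> clk s0 + 50 * n + 17 + 80 * (y - p) \<and> var s vcnt = card (l ` {p..<y}) \<and>
       (\<forall>x. p \<le> x \<longrightarrow> x < e \<longrightarrow> arr s 3 (l x) 0 = (if l x \<in> l ` {p..<y} then 1 else 0))" and py: "p \<le> y"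
    have v: "var s ve = e" "var s vy = y" "var s vi = i" "arr s 1 = arr s0 1" "var s vcnt = card (l ` {p..<y})"
      using I p i by (auto simp: unch_def e_def)
    show "var s ve = e \<and> var s vy = y" using v by simp
    assume y: "y < e"
    have set: "l ` {p..<Suc y} = insert (l y) (l ` {p..<y})" using py by (simp add: atLeastLessThanSuc)
    have t: "arr s 3 (l y) 0 = (if l y \<in> l ` {p..<y} then 1 else 0)" using I y py by blast
    have ly: "arr s 1 y i = l y" using v by (simp add: l_def)
    have cb: "card (l ` {p..<y}) \<le> n" using card_image_le[of "{p..<y}" l] y e by simp
    have bn: "y < n" "y < SS" "l y < SS" using y e lS SS_less by auto
    let ?I = "\<lambda>y s. unch {vy, vcnt} {3} s0 s \<and> var s vy = y \<and>
       clk s \<le> clk s0 + 50 * n + 17 + 80 * (y - p) \<and> var s vcnt = card (l ` {p..<y}) \<and>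
       (\<forall>x. p \<le> x \<longrightarrow> x < e \<longrightarrow> arr s 3 (l x) 0 = (if l x \<in> l ` {p..<y} then 1 else 0))"
    have fin: "var s' vy = y \<and> ?I (Suc y) (tick 4 (setv vy (Suc y) s'))"
      if s': "unch {vy, vcnt} {3} s s'" "var s' vy = y" "clk s' \<le> clk s + 70" "var s' vcnt = card (l ` {p..<Suc y})"
        "\<And>x. arr s' 3 (l x) 0 = (if l x = l y then 1 else arr s 3 (l x) 0)" for s'
    proof (intro conjI allI impI)
      show "unch {vy, vcnt} {3} s0 (tick 4 (setv vy (Suc y) s'))" using I s'(1) by (auto simp: unch_def)
      show "clk (tick 4 (setv vy (Suc y) s')) \<le> clk s0 + 50 * n + 17 + 80 * (Suc y - p)" using I s'(3) py by (auto simp: Suc_diff_le)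
      fix x assume x: "p \<le> x" "x < e"
      then have "arr s 3 (l x) 0 = (if l x \<in> l ` {p..<y} then 1 else 0)" using I by blast
      then show "arr (tick 4 (setv vy (Suc y) s')) 3 (l x) 0 = (if l x \<in> l ` {p..<Suc y} then 1 else 0)"
        unfolding set using s'(5)[of x] by simp
    qed (use s' in auto)
    show "WP (Ifte (Eq (Rd 3 (Rd 1 (V vy) (V vi)) (N 0)) (N 0)) (inc vcnt ;; Put 3 (Rd 1 (V vy) (V vi)) (N 0) (N 1)) Skip)
      (\<lambda>s'. var s' vy = y \<and> ?I (Suc y) (tick 4 (setv vy (Suc y) s'))) (tick 5 s)"
    proof (rule wp_Ifte)
      show "okC SS Bd (Eq (Rd 3 (Rd 1 (V vy) (V vi)) (N 0)) (N 0)) (tick 5 s)"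
        using v ly bn iS n_le_Bd SS_le_Bd pos by (simp add: TB_def width_def)
      assume "\<not> holds (Eq (Rd 3 (Rd 1 (V vy) (V vi)) (N 0)) (N 0)) (tick 5 s)"
      then have m: "l y \<in> l ` {p..<y}" using v ly t by (auto split: if_splits)
      show "WP Skip (\<lambda>s'. var s' vy = y \<and> ?I (Suc y) (tick 4 (setv vy (Suc y) s'))) (tick (ccost (Eq (Rd 3 (Rd 1 (V vy) (V vi)) (N 0)) (N 0)) + 1) (tick 5 s))"
        by (rule wp_Skip, rule fin) (use v set m t in \<open>auto simp: unch_def insert_absorb\<close>)
    next
      assume "holds (Eq (Rd 3 (Rd 1 (V vy) (V vi)) (N 0)) (N 0)) (tick 5 s)"
      then have m: "l y \<notin> l ` {p..<y}" using v ly t by (auto split: if_splits)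
      have "card (l ` {p..<Suc y}) = Suc (card (l ` {p..<y}))" unfolding set using m by simp
      then show "WP (inc vcnt ;; Put 3 (Rd 1 (V vy) (V vi)) (N 0) (N 1)) (\<lambda>s'. var s' vy = y \<and> ?I (Suc y) (tick 4 (setv vy (Suc y) s'))) (tick (ccost (Eq (Rd 3 (Rd 1 (V vy) (V vi)) (N 0)) (N 0)) + 1) (tick 5 s))"
        unfolding inc_def
        by (intro wp_Seq wp_Set wp_Put fin)
          (use v ly bn iS n_le_Bd SS_le_Bd pos cb in \<open>auto simp: TB_def SR_def width_def unch_def\<close>)
    qed
  next
    fix s assume I: "unch {vy, vcnt} {3} s0 s \<and> var s vy = e \<and>
       clk s \<le> clk s0 + 50 * n + 17 + 80 * (e - p) \<and> var s vcnt = card (l ` {p..<e}) \<and>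
       (\<forall>x. p \<le> x \<longrightarrow> x < e \<longrightarrow> arr s 3 (l x) 0 = (if l x \<in> l ` {p..<e} then 1 else 0))"
    have "card (l ` {p..<e}) = rows (part St i) (part St p)"
    proof -
      have eq: "l x = l y \<longleftrightarrow> row (part St i) x = row (part St i) y" if "x \<in> {p..<e}" "y \<in> {p..<e}" for x y
        using p(13)[OF i(2), of x y] that e by (simp add: l_def)
      \<comment> \<open>Equal labels mean equal rows, so passing from a label to the row of any
        element that carries it is a bijection.\<close>
      have "bij_betw (\<lambda>a. row (part St i) (SOME x. x \<in> {p..<e} \<and> l x = a)) (l ` {p..<e}) (row (part St i) ` {p..<e})"
      proof (rule bij_betw_imageI)
        have some: "(SOME z. z \<in> {p..<e} \<and> l z = l x) \<in> {p..<e} \<and> l (SOME z. z \<in> {p..<e} \<and> l z = l x) = l x" if "x \<in> {p..<e}" for x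
          using that by (intro someI[of "\<lambda>z. z \<in> {p..<e} \<and> l z = l x" x]) auto
        then have r: "row (part St i) (SOME z. z \<in> {p..<e} \<and> l z = l x) = row (part St i) x" if "x \<in> {p..<e}" for x
          using eq that by blast
        show "inj_on (\<lambda>a. row (part St i) (SOME x. x \<in> {p..<e} \<and> l x = a)) (l ` {p..<e})"
          using r eq by (auto intro!: inj_onI)
        show "(\<lambda>a. row (part St i) (SOME x. x \<in> {p..<e} \<and> l x = a)) ` l ` {p..<e} = row (part St i) ` {p..<e}"
          unfolding image_image using r by (intro image_cong) auto
      qed
      then show ?thesis unfolding rows_def part_def e_def by (rule bij_betw_same_card)
    qed
    moreover have "clk s + 5 \<le> clk s0 + 200 * n + 30" using I e by linarith
    ultimately show "Q (tick 5 s)" using I by (intro Q) (auto simp: part_def e_def)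
  qed (use e in \<open>auto simp: TB_def SR_def\<close>)
  show ?thesis unfolding count_labels_def
  proof (rule wp_Seq, rule wp_range[where lo = p and hi = e and I = "\<lambda>y s. unch {vy} {3} s0 s \<and> var s vy = y \<and>
       clk s \<le> clk s0 + 2 + 40 * (y - p) \<and> (\<forall>x. p \<le> x \<longrightarrow> x < y \<longrightarrow> arr s 3 (l x) 0 = 0)"])
    show "var s0 vp = p" "var s0 ve = e" using p by (auto simp: e_def)
    fix y s assume I: "unch {vy} {3} s0 s \<and> var s vy = y \<and>
       clk s \<le> clk s0 + 2 + 40 * (y - p) \<and> (\<forall>x. p \<le> x \<longrightarrow> x < y \<longrightarrow> arr s 3 (l x) 0 = 0)" and py: "p \<le> y"
    have v: "var s ve = e" "var s vy = y" "var s vi = i" "arr s 1 = arr s0 1"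
      using I p i by (auto simp: unch_def e_def)
    show "var s ve = e \<and> var s vy = y" using v by simp
    assume y: "y < e"
    have ly: "arr s 1 y i = l y" using v by (simp add: l_def)
    have bn: "y < n" "y < SS" "l y < SS" using y e lS SS_less by auto
    show "WP (Put 3 (Rd 1 (V vy) (V vi)) (N 0) (N 0)) (\<lambda>s'. var s' vy = y \<and> unch {vy} {3} s0 (tick 4 (setv vy (Suc y) s')) \<and>
       var (tick 4 (setv vy (Suc y) s')) vy = Suc y \<and> clk (tick 4 (setv vy (Suc y) s')) \<le> clk s0 + 2 + 40 * (Suc y - p) \<and>
       (\<forall>x. p \<le> x \<longrightarrow> x < Suc y \<longrightarrow> arr (tick 4 (setv vy (Suc y) s')) 3 (l x) 0 = 0)) (tick 5 s)"
      by (rule wp_Put) (use I v ly bn iS n_le_Bd SS_le_Bd pos py in \<open>auto simp: TB_def width_def less_Suc_eq Suc_diff_le\<close>)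
  next
    fix s assume I: "unch {vy} {3} s0 s \<and> var s vy = e \<and>
       clk s \<le> clk s0 + 2 + 40 * (e - p) \<and> (\<forall>x. p \<le> x \<longrightarrow> x < e \<longrightarrow> arr s 3 (l x) 0 = 0)"
    have ck: "clk s + 7 \<le> clk s0 + 50 * n + 15" using I e by linarith
    show "WP (Set vcnt (N 0) ;; range_loop vy vp ve
       (Ifte (Eq (Rd 3 (Rd 1 (V vy) (V vi)) (N 0)) (N 0)) (inc vcnt ;; Put 3 (Rd 1 (V vy) (V vi)) (N 0) (N 1)) Skip)) Q (tick 5 s)"
      by (intro wp_Seq wp_Set fin2) (use I ck in \<open>auto simp: TB_def SR_def unch_def\<close>)
  qed (use e in \<open>auto simp: TB_def SR_def\<close>)
qed

end

section \<open>Bad parts, comparison of rows and identification of classes\<close>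

context twin_width_input begin

lemma flag_bad_wp:
  assumes P: "part_env St p s0"
    and H: "\<And>i. i \<in> St \<Longrightarrow> arr s0 2 p i = (if i \<in> hits St (part St p) then 1 else 0)"
    and h: "card (hits St (part St p)) \<le> h"
    and Q: "\<And>s. unch {vi, vy, vcnt} {3, 7} s0 s \<Longrightarrow> clk s \<le> clk s0 + 100 * n + h * (300 * n + 100) + 10 \<Longrightarrow>
      (\<And>i. i \<in> St \<Longrightarrow> arr s 7 i 0 = (if rows (part St i) (part St p) < big then 0 else 1)) \<Longrightarrow> Q s"
  shows "WP flag_bad Q s0"
proof -
  note p = part_envD[OF P]
  define Hs where "Hs = hits St (part St p)"
  define fl where "fl i = (if rows (part St i) (part St p) < big then 0 else 1 :: nat)" for i
  have fH: "finite Hs" by (simp add: Hs_def hits_def)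
  have HS: "Hs \<subseteq> St" using hits_subset[OF p(1)] by (simp add: Hs_def)
  have pos: "0 < SS" using n_pos by (simp add: SS_def)
  have good: "fl i = 0" if "i \<in> St" "i \<notin> Hs" for i
  proof -
    have r: "rows (part St p) (part St i) < thr" using unhit_rows[OF p(1) that(1)] that(2) by (simp add: Hs_def)
    have "rows (part St i) (part St p) \<le> k ^ rows (part St p) (part St i)"
      using part_less[OF p(1,2)] part_less[OF p(1) that(1)] by (intro rows_dual) auto
    then show ?thesis using big_bounds(2)[OF r] by (simp add: fl_def)
  qed
  \<comment> \<open>The number of hit parts already visited: each of them pays for one linear count
    of labels.\<close>
  define cst where "cst i = card {j\<in>Hs. j < i}" for i
  have cst: "cst (nxt St i) = (if i \<in> Hs then Suc (cst i) else cst i)" if i: "i \<in> St" for i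
  proof -
    have "{j\<in>Hs. j < nxt St i} = (if i \<in> Hs then insert i {j\<in>Hs. j < i} else {j\<in>Hs. j < i})"
      using before_nxt[OF p(1) i] HS by (auto simp: set_eq_iff)
    then show ?thesis using fH by (simp add: cst_def)
  qed
  let ?I = "\<lambda>i s. unch {vi, vy, vcnt} {3, 7} s0 s \<and> var s vi = i \<and>
     clk s \<le> clk s0 + 2 + 80 * i + cst i * (300 * n + 100) \<and> (\<forall>j\<in>St. j < i \<longrightarrow> arr s 7 j 0 = fl j)"
  let ?c = "Put 7 (V vi) (N 0) (N 0) ;;
      Ifte (Eq (Rd 2 (V vp) (V vi)) (N 1))
        (count_labels ;; Ifte (Lt (V vcnt) (V vbig)) Skip (Put 7 (V vi) (N 0) (N 1))) Skip"
  show ?thesis unfolding flag_bad_def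
  proof (rule wp_parts[OF _ _ _ p(8,1), where I = ?I])
    show "?I 0 s" if "s = tick 2 (setv vi 0 s0)" for s using that by (simp add: cst_def)
    show "var s 0 = n \<and> var s vi = i" if "?I i s" for i s using that p(8) by (auto simp: unch_def)
    fix i s assume I: "?I i s" and i: "i \<in> St"
    have iS: "i < n" "i < SS" "p < SS" using p(3,10) i SS_less by auto
    have un: "unch {vi, vy, vcnt} {3, 7} s0 s" using I by blast
    have v: "var s vp = p" "var s vi = i" "arr s 2 p i = (if i \<in> Hs then 1 else 0)" "arr s 4 i 0 = nxt St i" "var s vbig = big"
      using I p H[OF i] p(11)[OF i] by (auto simp: unch_def Hs_def)
    have nx: "i < nxt St i" using nxt_props(2)[OF p(1) i] .
    have nx80: "80 * i + 80 \<le> 80 * nxt St i" using nx by simp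
    have lt: "j < nxt St i \<longleftrightarrow> j = i \<or> j < i" if "j \<in> St" for j using before_nxt[OF p(1) i] that by blast
    have fin: "var s' vi = i \<and> arr s' 4 i 0 = nxt St i \<and> ?I (nxt St i) (tick 10 (setv vi (nxt St i) s'))"
      if s': "unch {vi, vy, vcnt} {3, 7} s s'" "var s' vi = i" "clk s' \<le> clk s + 60 + (if i \<in> Hs then 300 * n + 100 else 0)"
        "arr s' 7 i 0 = fl i" "\<And>j. j \<noteq> i \<Longrightarrow> arr s' 7 j 0 = arr s 7 j 0" for s'
    proof (intro conjI ballI impI)
      show "arr s' 4 i 0 = nxt St i" using s'(1) v by (simp add: unch_def)
      show "unch {vi, vy, vcnt} {3, 7} s0 (tick 10 (setv vi (nxt St i) s'))" using un s'(1) by (auto simp: unch_def)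
      have "clk s \<le> clk s0 + 2 + 80 * i + cst i * (300 * n + 100)" using I by blast
      then show "clk (tick 10 (setv vi (nxt St i) s')) \<le> clk s0 + 2 + 80 * nxt St i + cst (nxt St i) * (300 * n + 100)"
        using s'(3) cst[OF i] nx80 by (auto split: if_splits)
      show "arr (tick 10 (setv vi (nxt St i) s')) 7 j 0 = fl j" if "j \<in> St" "j < nxt St i" for j
        using I s'(4,5) lt[OF that(1)] that by (cases "j = i") auto
    qed (use s' in auto)
    show "WP ?c (\<lambda>s'. var s' vi = i \<and> arr s' 4 i 0 = nxt St i \<and> ?I (nxt St i) (tick 10 (setv vi (nxt St i) s'))) (tick 5 s)"
    proof (rule wp_Seq, rule wp_Put)
      let ?s1 = "tick (ecost (V vi) + ecost (N 0) + ecost (N 0) + 10) (put 7 (val (V vi) (tick 5 s)) (val (N 0) (tick 5 s)) (val (N 0) (tick 5 s)) (tick 5 s))"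
      define s1 where "s1 = ?s1"
      have s1: "var s1 = var s" "clk s1 = clk s + 18" "arr s1 = (arr s)(7 := (arr s 7)(i := (arr s 7 i)(0 := 0)))"
        using v by (auto simp: s1_def)
      have u1: "unch {vi, vy, vcnt} {3, 7} s s1" using s1 by (auto simp: unch_def)
      show "WP (Ifte (Eq (Rd 2 (V vp) (V vi)) (N 1))
        (count_labels ;; Ifte (Lt (V vcnt) (V vbig)) Skip (Put 7 (V vi) (N 0) (N 1))) Skip)
         (\<lambda>s'. var s' vi = i \<and> arr s' 4 i 0 = nxt St i \<and> ?I (nxt St i) (tick 10 (setv vi (nxt St i) s'))) ?s1"
        unfolding s1_def[symmetric]
      proof (rule wp_Ifte)
        show "okC SS Bd (Eq (Rd 2 (V vp) (V vi)) (N 1)) s1" using s1 v iS p(3) n_le_Bd by (simp add: TB_def width_def)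
        assume "\<not> holds (Eq (Rd 2 (V vp) (V vi)) (N 1)) s1"
        then have nH: "i \<notin> Hs" using s1(1,3) v(1-3) by (simp split: if_splits)
        show "WP Skip (\<lambda>s'. var s' vi = i \<and> arr s' 4 i 0 = nxt St i \<and> ?I (nxt St i) (tick 10 (setv vi (nxt St i) s')))
           (tick (ccost (Eq (Rd 2 (V vp) (V vi)) (N 1)) + 1) s1)"
          apply (rule wp_Skip)
          apply (rule fin)
          subgoal using u1 by simp
          subgoal using s1(1) v(2) by simp
          subgoal using s1(2) nH by simp
          subgoal using s1(3) good[OF i nH] by simp
          subgoal using s1(3) by simp
          done
      next
        assume "holds (Eq (Rd 2 (V vp) (V vi)) (N 1)) s1"
        then have "arr s1 2 p i = 1" using s1(1) v(1,2) by simp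
        moreover have "arr s1 2 p i = (if i \<in> Hs then 1 else 0)" using s1(3) v(3) by simp
        ultimately have iH: "i \<in> Hs" by (cases "i \<in> Hs") simp_all
        let ?s2 = "tick (ccost (Eq (Rd 2 (V vp) (V vi)) (N 1)) + 1) s1"
        have u2: "unch {vi, vy, vcnt} {3, 7} s0 ?s2" using unch_trans[OF un u1] by simp
        show "WP (count_labels ;; Ifte (Lt (V vcnt) (V vbig)) Skip (Put 7 (V vi) (N 0) (N 1)))
           (\<lambda>s'. var s' vi = i \<and> arr s' 4 i 0 = nxt St i \<and> ?I (nxt St i) (tick 10 (setv vi (nxt St i) s'))) ?s2"
        proof (rule wp_Seq, rule count_labels_wp[OF part_env_unch[OF P u2] _ i])
          show "var ?s2 vi = i" using s1 v by simp
          fix s3 assume u3: "unch {vy, vcnt} {3} ?s2 s3" and c3: "clk s3 \<le> clk ?s2 + 200 * n + 30"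
            and r3: "var s3 vcnt = rows (part St i) (part St p)"
          have v3: "var s3 vi = i" "var s3 vbig = big" "arr s3 7 = arr s1 7"
            using u3 s1(1) v(2,5) by (simp_all add: unch_def)
          have u: "unch {vi, vy, vcnt} {3, 7} s s3" using u1 u3 unfolding unch_def by simp
          have c: "clk s3 \<le> clk s + 200 * n + 70" using c3 s1(2) by simp
          have a7: "arr s3 7 i 0 = 0" "\<And>j. j \<noteq> i \<Longrightarrow> arr s3 7 j 0 = arr s 7 j 0" using v3(3) s1(3) by simp_all
          show "WP (Ifte (Lt (V vcnt) (V vbig)) Skip (Put 7 (V vi) (N 0) (N 1)))
             (\<lambda>s'. var s' vi = i \<and> arr s' 4 i 0 = nxt St i \<and> ?I (nxt St i) (tick 10 (setv vi (nxt St i) s'))) s3"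
            by (intro wp_Ifte wp_Skip wp_Put fin)
              (use v3(1,2) u r3 c a7 iS iH pos n_le_Bd in \<open>simp_all add: TB_def width_def fl_def\<close>)
        qed (auto)
      qed
    qed (use v iS pos n_le_Bd in \<open>auto simp: TB_def width_def\<close>)
  next
    fix s assume I: "?I n s"
    have "cst n \<le> h"
    proof -
      have "cst n \<le> card Hs" unfolding cst_def using fH by (intro card_mono) auto
      then show ?thesis using h by (simp add: Hs_def)
    qed
    then have "cst n * (300 * n + 100) \<le> h * (300 * n + 100)" by (rule mult_le_mono1)
    moreover have "clk s \<le> clk s0 + 2 + 80 * n + cst n * (300 * n + 100)" using I by blast
    ultimately have "clk (tick 5 s) \<le> clk s0 + 100 * n + h * (300 * n + 100) + 10" unfolding st_simps by linarith
    then show "Q (tick 5 s)" using I p(10) by (intro Q) (auto simp: fl_def)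
  qed (auto simp: TB_def SR_def)
qed

definition apart :: "nat set \<Rightarrow> nat \<Rightarrow> nat \<Rightarrow> nat \<Rightarrow> bool" where
  "apart St p x y \<longleftrightarrow> (\<exists>w\<in>good_cols St p. m x w \<noteq> m y w)"

lemma apart_sym: "apart St p x y \<longleftrightarrow> apart St p y x"
  unfolding apart_def by metis

lemma compare_wp:
  assumes P: "part_env St p s0" and yz: "var s0 vy = y" "var s0 vz = z" "y < n" "z < n"
    and fl: "\<And>i. i \<in> St \<Longrightarrow> arr s0 7 i 0 = (if rows (part St i) (part St p) < big then 0 else 1)"
    and Q: "\<And>s. unch {veq, vi} {} s0 s \<Longrightarrow> clk s \<le> clk s0 + 100 * n + 20 \<Longrightarrow>
      var s veq = (if apart St p y z then 0 else 1) \<Longrightarrow> Q s"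
  shows "WP compare Q s0"
proof -
  note p = part_envD[OF P]
  have pos: "0 < SS" using n_pos by (simp add: SS_def)
  define ok where "ok j \<longleftrightarrow> rows (part St j) (part St p) < big \<longrightarrow> row (part St j) y = row (part St j) z" for j
  let ?I = "\<lambda>i s. unch {veq, vi} {} s0 s \<and> var s vi = i \<and> clk s \<le> clk s0 + 4 + 80 * i \<and>
     var s veq = (if \<forall>j\<in>St. j < i \<longrightarrow> ok j then 1 else 0)"
  show ?thesis unfolding compare_def
  proof (rule wp_Seq, rule wp_Set)
    define s1 where "s1 = tick (ecost (N 1) + 1) (setv veq (val (N 1) s0) s0)"
    have s1: "var s1 = (var s0)(veq := 1)" "arr s1 = arr s0" "clk s1 = clk s0 + 2" by (auto simp: s1_def)
    let ?c = "Ifte (Eq (Rd 7 (V vi) (N 0)) (N 0))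
       (Ifte (Eq (Rd 1 (V vy) (V vi)) (Rd 1 (V vz) (V vi))) Skip (Set veq (N 0))) Skip"
    show "WP (parts_loop vi ?c) Q (tick (ecost (N 1) + 1) (setv veq (val (N 1) s0) s0))"
      unfolding s1_def[symmetric]
    proof (rule wp_parts[OF _ _ _ _ p(1), where I = ?I])
      show "var s1 0 = n" using s1 p(8) by simp
      show "?I 0 s" if "s = tick 2 (setv vi 0 s1)" for s using that s1 by (auto simp: unch_def)
      show "var s 0 = n \<and> var s vi = i" if "?I i s" for i s using that p(8) by (auto simp: unch_def)
      fix i s assume I: "?I i s" and i: "i \<in> St"
      have iS: "i < n" "i < SS" using p(10) i SS_less by auto
      have v: "var s vy = y" "var s vz = z" "var s vi = i" "arr s = arr s0" using I yz by (auto simp: unch_def fun_eq_iff)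
      have nx80: "80 * i + 80 \<le> 80 * nxt St i" using nxt_props(2)[OF p(1) i] by simp
      have lt': "j < nxt St i \<longleftrightarrow> j = i \<or> j < i" if "j \<in> St" for j using before_nxt[OF p(1) i] that by blast
      have lt: "(\<forall>j\<in>St. j < nxt St i \<longrightarrow> ok j) \<longleftrightarrow> ok i \<and> (\<forall>j\<in>St. j < i \<longrightarrow> ok j)"
      proof
        assume a: "\<forall>j\<in>St. j < nxt St i \<longrightarrow> ok j"
        then show "ok i \<and> (\<forall>j\<in>St. j < i \<longrightarrow> ok j)" using lt' i by simp
      next
        assume "ok i \<and> (\<forall>j\<in>St. j < i \<longrightarrow> ok j)"
        then show "\<forall>j\<in>St. j < nxt St i \<longrightarrow> ok j" using lt' by auto
      qed
      have fin: "var s' vi = i \<and> arr s' 4 i 0 = nxt St i \<and> ?I (nxt St i) (tick 10 (setv vi (nxt St i) s'))"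
        if s': "unch {veq, vi} {} s s'" "var s' vi = i" "clk s' \<le> clk s + 60" "var s' veq = (if ok i then var s veq else 0)" for s'
        using I s' p(11)[OF i] nx80 v lt by (auto simp: unch_def)
      show "WP ?c (\<lambda>s'. var s' vi = i \<and> arr s' 4 i 0 = nxt St i \<and> ?I (nxt St i) (tick 10 (setv vi (nxt St i) s'))) (tick 5 s)"
        by (intro wp_Ifte wp_Skip wp_Set fin)
          (use v yz iS pos n_le_Bd fl[OF i] p(13)[OF i yz(3,4)] in \<open>auto simp: TB_def SR_def width_def unch_def ok_def split: if_splits\<close>)
    next
      fix s assume I: "?I n s"
      have "(\<forall>j\<in>St. j < n \<longrightarrow> ok j) \<longleftrightarrow> \<not> apart St p y z"
      proof
        assume a: "\<forall>j\<in>St. j < n \<longrightarrow> ok j"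
        have "m y w = m z w" if w: "w \<in> good_cols St p" for w
        proof -
          have wn: "w < n" "rows (part St (pt St w)) (part St p) < big" using w by (auto simp: good_cols_def)
          have "pt St w \<in> St" using pt_props(1)[OF p(1)] .
          then have "row (part St (pt St w)) y = row (part St (pt St w)) z" using a wn p(10) by (auto simp: ok_def)
          moreover have "w \<in> part St (pt St w)" using in_part_iff[OF p(1) \<open>pt St w \<in> St\<close> wn(1)] by simp
          ultimately show ?thesis unfolding row_eq_iff by blast
        qed
        then show "\<not> apart St p y z" by (auto simp: apart_def)
      next
        assume a: "\<not> apart St p y z"
        show "\<forall>j\<in>St. j < n \<longrightarrow> ok j"
        proof (intro ballI impI)
          fix j assume j: "j \<in> St"
          show "ok j" unfolding ok_def row_eq_iff
          proof (intro impI ballI)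
            fix w assume b: "rows (part St j) (part St p) < big" and w: "w \<in> part St j"
            have "w < n" using part_less[OF p(1) j w] .
            moreover have "pt St w = j" using in_part_iff[OF p(1) j \<open>w < n\<close>] w by simp
            ultimately have "w \<in> good_cols St p" using b by (simp add: good_cols_def)
            then show "m y w = m z w" using a by (auto simp: apart_def)
          qed
        qed
      qed
      then show "Q (tick 5 s)" using I by (intro Q) auto
    qed (auto simp: TB_def SR_def)
  qed (use n_le_Bd in \<open>auto simp: TB_def SR_def\<close>)
qed

definition out :: "((nat + nat) \<times> (nat + nat)) list \<Rightarrow> st \<Rightarrow> bool" where
  "out es s \<longleftrightarrow> var s vo = 2 * length es \<and> (\<forall>t<length es.
     arr s 0 (2 * t) 0 = vertex_index n (fst (es ! t)) \<and> arr s 0 (2 * t + 1) 0 = vertex_index n (snd (es ! t)))"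

definition nreps :: "(nat \<Rightarrow> nat) \<Rightarrow> nat" where "nreps f = card {x. x < n \<and> f x = x}"

text \<open>An identification writes two pairs and removes one representative. The resulting
  equation for the length of the output keeps output addresses linear in n. Row 0 stays a
  representative so that everything can finally be merged into it.\<close>

definition state :: "nat set \<Rightarrow> nat \<Rightarrow> (nat \<Rightarrow> nat) \<Rightarrow> ((nat + nat) \<times> (nat + nat)) list \<Rightarrow> st \<Rightarrow> bool" where
  "state St D f es s \<longleftrightarrow> valid St f \<and> f 0 = 0 \<and> (\<forall>x<n. arr s 5 x 0 = (if f x = x then 1 else 0)) \<and> out es s \<and>
     fits_seq D es (division f f) \<and> length es + 2 * nreps f = 2 * n"

lemma out_snoc2:
  assumes "out es s" "arr s' 0 = (\<lambda>a b. if b = 0 \<and> a = 2 * length es then vertex_index n u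
      else if b = 0 \<and> a = 2 * length es + 1 then vertex_index n v
      else if b = 0 \<and> a = 2 * length es + 2 then vertex_index n u'
      else if b = 0 \<and> a = 2 * length es + 3 then vertex_index n v' else arr s 0 a b)" "var s' vo = var s vo + 4"
  shows "out (es @ [(u, v), (u', v')]) s'"
  unfolding out_def
proof (intro conjI allI impI)
  show "var s' vo = 2 * length (es @ [(u, v), (u', v')])" using assms by (simp add: out_def)
  fix t assume t: "t < length (es @ [(u, v), (u', v')])"
  consider "t < length es" | "t = length es" | "t = Suc (length es)" using t by fastforce
  then show "arr s' 0 (2 * t) 0 = vertex_index n (fst ((es @ [(u, v), (u', v')]) ! t))"
    "arr s' 0 (2 * t + 1) 0 = vertex_index n (snd ((es @ [(u, v), (u', v')]) ! t))"
    using assms(1) unfolding assms(2) by (cases; simp add: out_def nth_append)+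
qed

lemma state_unch: "state St D f es s \<Longrightarrow> unch Vs As s s' \<Longrightarrow> vo \<notin> Vs \<Longrightarrow> {0, 5} \<inter> As = {} \<Longrightarrow> state St D f es s'"
  unfolding state_def out_def unch_def by auto

text \<open>The rows are merged before the columns. In between the two sides have different class
  maps, both of them valid, and \<open>narrow_division\<close> covers this intermediate partition as
  well.\<close>

lemma join_sequence:
  assumes St: "starts St" "p \<in> St" and f: "valid St f" and zy: "z \<in> reps St f p" "y \<in> reps St f p" "z \<noteq> y"
    and ag: "\<not> apart St p y z" and c: "\<And>i. i \<in> St \<Longrightarrow> card (reps St f i) \<le> c"
    and b: "\<And>i. i \<in> St \<Longrightarrow> card {j\<in>St. thr \<le> rows (part St i) (part St j)} \<le> b" and s: "fits_seq (c * (b + 1)) es (division f f)"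
  shows "valid St (join f z y)" "fits_seq (c * (b + 1)) (es @ [(Inl z, Inl y), (Inr z, Inr y)]) (division (join f z y) (join f z y))"
    "nreps f = Suc (nreps (join f z y))"
proof -
  have zr: "z < n" "f z = z" "y < n" "f y = y" using zy part_less[OF St] by (auto simp: reps_def)
  show v: "valid St (join f z y)"
    by (rule valid_join[OF St(1) f zy(1,2) St(2)]) (use ag in \<open>auto simp: apart_def\<close>)
  have c': "card (reps St (join f z y) i) \<le> c" if "i \<in> St" for i
  proof -
    have "card (reps St (join f z y) i) \<le> card (reps St f i)"
      unfolding reps_join[of z y f, OF zy(3) zr(2,4)] by (intro card_mono) (auto simp: reps_def)
    then show ?thesis using c[OF that] by simp
  qed
  have idem: "f x < n \<and> f (f x) = f x" if "x < n" for x using validD[OF f that] by blast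
  have 1: "fits_seq (c * (b + 1)) (es @ [(Inl z, Inl y)]) (division (join f z y) f)"
    by (rule fits_seq_join_rows[OF s idem zr zy(3) narrow_division[OF St(1) v f c' c b]])
  have "fits_seq (c * (b + 1)) ((es @ [(Inl z, Inl y)]) @ [(Inr z, Inr y)]) (division (join f z y) (join f z y))"
    by (rule fits_seq_join_cols[OF 1 idem zr zy(3) narrow_division[OF St(1) v v c' c' b]])
  then show "fits_seq (c * (b + 1)) (es @ [(Inl z, Inl y), (Inr z, Inr y)]) (division (join f z y) (join f z y))" by simp
  have "{x. x < n \<and> join f z y x = x} = {x. x < n \<and> f x = x} - {y}" using zr zy(3) by (auto simp: join_def)
  then have "nreps (join f z y) = nreps f - 1" unfolding nreps_def using zr by (simp add: card_Diff_singleton)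
  moreover have "0 < nreps f" unfolding nreps_def using zr by (auto simp: card_gt_0_iff)
  ultimately show "nreps f = Suc (nreps (join f z y))" by simp
qed

lemma try_merge_wp:
  assumes P: "part_env St p s0" and yz: "var s0 vy = y" "var s0 vz = z" "y \<in> part St p" "z \<in> part St p" "z < y"
    and fl: "\<And>i. i \<in> St \<Longrightarrow> arr s0 7 i 0 = (if rows (part St i) (part St p) < big then 0 else 1)"
    and c: "\<And>i. i \<in> St \<Longrightarrow> card (reps St f i) \<le> c"
    and b: "\<And>i. i \<in> St \<Longrightarrow> card {j\<in>St. thr \<le> rows (part St i) (part St j)} \<le> b"
    and s: "state St (c * (b + 1)) f es s0"
    and Q: "\<And>s f' es'. unch {veq, vi, vo} {0, 5} s0 s \<Longrightarrow> clk s \<le> clk s0 + 30 + (if f z = z then 100 * n + 150 else 0) \<Longrightarrow>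
      state St (c * (b + 1)) f' es' s \<Longrightarrow> f' = f \<or> f z = z \<and> f y = y \<and> f' = join f z y \<Longrightarrow>
      (f' y = y \<Longrightarrow> f z = z \<Longrightarrow> apart St p y z) \<Longrightarrow> Q s"
  shows "WP try_merge Q s0"
proof -
  note p = part_envD[OF P]
  have pos: "0 < SS" using n_pos by (simp add: SS_def)
  have yn: "y < n" "z < n" using part_less[OF p(1,2)] yz by auto
  note st = s[unfolded state_def]
  have r: "arr s0 5 y 0 = (if f y = y then 1 else 0)" "arr s0 5 z 0 = (if f z = z then 1 else 0)" using st yn by auto
  have o: "out es s0" "length es + 2 * nreps f = 2 * n" using st by auto
  let ?cm = "Ifte (Eq (V veq) (N 1)) (emit ;; Put 5 (V vy) (N 0) (N 0)) Skip"
  have main: "WP (compare ;; ?cm) Q s1"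
    if s1: "unch {} {} s0 s1" "clk s1 \<le> clk s0 + 30" and fx: "f z = z" "f y = y" for s1
  proof (rule wp_Seq, rule compare_wp[OF part_env_unch[OF P s1(1)] _ _ yn])
    show "var s1 vy = y" "var s1 vz = z" using s1 yz by (auto simp: unch_def)
    show "arr s1 7 i 0 = (if rows (part St i) (part St p) < big then 0 else 1)" if "i \<in> St" for i
      using fl[OF that] s1 by (simp add: unch_def)
    fix s2 assume u2: "unch {veq, vi} {} s1 s2" and c2: "clk s2 \<le> clk s1 + 100 * n + 20"
      and q2: "var s2 veq = (if apart St p y z then 0 else 1)"
    have u: "unch {veq, vi} {} s0 s2" using s1 u2 by (auto simp: unch_def)
    have s2: "state St (c * (b + 1)) f es s2" by (rule state_unch[OF s u]) auto
    show "WP ?cm Q s2"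
    proof (rule wp_Ifte)
      show "okC SS Bd (Eq (V veq) (N 1)) s2" using n_le_Bd by (simp add: TB_def)
      assume "\<not> holds (Eq (V veq) (N 1)) s2"
      then have a: "apart St p y z" using q2 by (auto split: if_splits)
      show "WP Skip Q (tick (ccost (Eq (V veq) (N 1)) + 1) s2)"
      proof (rule wp_Skip, rule Q)
        show "unch {veq, vi, vo} {0, 5} s0 (tick (ccost (Eq (V veq) (N 1)) + 1) s2)" using u by (auto simp: unch_def)
        show "state St (c * (b + 1)) f es (tick (ccost (Eq (V veq) (N 1)) + 1) s2)"
          by (rule state_unch[OF s2, of "{}" "{}"]) auto
      qed (use a c2 s1 fx in auto)
    next
      assume "holds (Eq (V veq) (N 1)) s2"
      then have "var s2 veq = 1" by simp
      then have a: "\<not> apart St p y z" using q2 by (cases "apart St p y z") simp_all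
      have zr: "z \<in> reps St f p" "y \<in> reps St f p" "z \<noteq> y" using fx yz by (auto simp: reps_def)
      have fv: "valid St f" "fits_seq (c * (b + 1)) es (division f f)" using st by auto
      have j: "valid St (join f z y)"
        "fits_seq (c * (b + 1)) (es @ [(Inl z, Inl y), (Inr z, Inr y)]) (division (join f z y) (join f z y))"
        "nreps f = Suc (nreps (join f z y))"
        using join_sequence[OF p(1,2) fv(1) zr a _ _ fv(2)] c b by blast+
      have v: "var s2 0 = n" "var s2 vy = y" "var s2 vz = z" "var s2 vo = 2 * length es"
        using u p yz o by (auto simp: unch_def out_def)
      have len: "length es \<le> 2 * n" using o by simp
      let ?es = "es @ [(Inl z, Inl y), (Inr z, Inr y)]"
      have fin: "Q s'"
        if s': "unch {vo} {0, 5} s2 s'" "clk s' \<le> clk s2 + 100" "var s' vo = var s2 vo + 4"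
          "arr s' 0 = (\<lambda>a b. if b = 0 \<and> a = 2 * length es then vertex_index n (Inl z)
            else if b = 0 \<and> a = 2 * length es + 1 then vertex_index n (Inl y)
            else if b = 0 \<and> a = 2 * length es + 2 then vertex_index n (Inr z)
            else if b = 0 \<and> a = 2 * length es + 3 then vertex_index n (Inr y) else arr s2 0 a b)"
          "\<And>x. arr s' 5 x 0 = (if x = y then 0 else arr s2 5 x 0)" for s'
      proof (rule Q)
        show "unch {veq, vi, vo} {0, 5} s0 s'" using u s'(1) by (auto simp: unch_def)
        show "clk s' \<le> clk s0 + 30 + (if f z = z then 100 * n + 150 else 0)" using s'(2) c2 s1 fx by simp
        show "state St (c * (b + 1)) (join f z y) ?es s'"
          unfolding state_def
        proof (intro conjI allI impI j(1,2))
          show "join f z y 0 = 0" using st yz(5) by (auto simp: join_def)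
          show "arr s' 5 x 0 = (if join f z y x = x then 1 else 0)" if "x < n" for x
            using s'(5)[of x] st that fx yz(5) u by (auto simp: join_def unch_def)
          show "out ?es s'" using out_snoc2[OF _ s'(4,3)] s2 by (simp add: state_def)
          show "length ?es + 2 * nreps (join f z y) = 2 * n" using o j(3) by simp
        qed
        show "join f z y = f \<or> f z = z \<and> f y = y \<and> join f z y = join f z y" using fx by blast
        show "apart St p y z" if "join f z y y = y" using that fx yz(5) by (simp add: join_def)
      qed
      show "WP (emit ;; Put 5 (V vy) (N 0) (N 0)) Q (tick (ccost (Eq (V veq) (N 1)) + 1) s2)"
        unfolding emit_def
        by (intro wp_Seq wp_Set wp_Put fin)
          (use v yn len n_le_Bd pos in \<open>auto simp: TB_def SR_def width_def unch_def fun_eq_iff\<close>)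
    qed
  qed simp_all
  show ?thesis unfolding try_merge_def
  proof (rule wp_Ifte)
    show "okC SS Bd (Eq (Rd 5 (V vz) (N 0)) (N 1)) s0" using yz yn pos n_le_Bd by (simp add: TB_def width_def)
    assume h: "\<not> holds (Eq (Rd 5 (V vz) (N 0)) (N 1)) s0"
    then have "f z \<noteq> z" using yz r by (auto split: if_splits)
    then show "WP Skip Q (tick (ccost (Eq (Rd 5 (V vz) (N 0)) (N 1)) + 1) s0)"
      by (intro wp_Skip Q[of _ f es] state_unch[OF s, of "{}" "{}"]) auto
  next
    assume h: "holds (Eq (Rd 5 (V vz) (N 0)) (N 1)) s0"
    then have "arr s0 5 z 0 = 1" using yz by simp
    then have fz: "f z = z" using r(2) by (cases "f z = z") simp_all
    let ?s1 = "tick (ccost (Eq (Rd 5 (V vz) (N 0)) (N 1)) + 1) s0"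
    show "WP (Ifte (Eq (Rd 5 (V vy) (N 0)) (N 1)) (compare ;; ?cm) Skip) Q ?s1"
    proof (rule wp_Ifte)
      show "okC SS Bd (Eq (Rd 5 (V vy) (N 0)) (N 1)) ?s1" using yz yn pos n_le_Bd by (simp add: TB_def width_def)
      assume "\<not> holds (Eq (Rd 5 (V vy) (N 0)) (N 1)) ?s1"
      then have "f y \<noteq> y" using yz r by (auto split: if_splits)
      then show "WP Skip Q (tick (ccost (Eq (Rd 5 (V vy) (N 0)) (N 1)) + 1) ?s1)"
        by (intro wp_Skip Q[of _ f es] state_unch[OF s, of "{}" "{}"]) auto
    next
      assume "holds (Eq (Rd 5 (V vy) (N 0)) (N 1)) ?s1"
      then have "arr s0 5 y 0 = 1" using yz by simp
      then have fy: "f y = y" using r(1) by (cases "f y = y") simp_all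
      show "WP (compare ;; ?cm) Q (tick (ccost (Eq (Rd 5 (V vy) (N 0)) (N 1)) + 1) ?s1)"
        by (rule main) (use fz fy in auto)
    qed
  qed
qed

end

text \<open>\<open>vf\<close> is 0 while searching, 1 when a merge has been found and 2 when the end
  is reached; in the last case \<open>vp\<close> is the last part. \<open>vprev\<close> is
  remembered because links lead only forward and \<open>refresh\<close> has to reach the
  predecessor.\<close>

definition search :: cmd where
  "search = Set vp (N 0) ;; Set vprev (N 0) ;; Set vf (N 0) ;;
     Loop (Eq (V vf) (N 0))
       (Set vq (Rd 4 (V vp) (N 0)) ;;
        Ifte (Lt (V vq) (V 0))
          (Ifte (Lt (V vmax) (Rd 6 (V vp) (N 0))) (Set vprev (V vp) ;; Set vp (V vq)) (Set vf (N 1)))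
          (Set vf (N 2)))"

text \<open>After a merge only two candidates have different columns: the merged part with its
  successor, and its predecessor with it. Two linear scans restore them.\<close>

definition refresh :: cmd where
  "refresh = Ifte (Lt (V ve) (V 0)) (Set vc (V vp) ;; cand) Skip ;;
     Ifte (Lt (N 0) (V vp)) (Set vc (V vprev) ;; cand) Skip"

text \<open>The order matters: \<open>flag_bad\<close> reads the flags of candidate
  \<open>vp\<close> while they still describe the merged part, and \<open>refresh\<close> then
  overwrites them with those of the next candidate.\<close>

definition merge_step :: cmd where
  "merge_step = Set ve (Rd 4 (V vq) (N 0)) ;; relabel ;; Put 4 (V vp) (N 0) (V ve) ;; merge_hits ;; flag_bad ;;
     merge_classes ;; refresh"

definition main_loop :: cmd where
  "main_loop = Set vgo (N 1) ;;
     Loop (Eq (V vgo) (N 1)) (search ;; Ifte (Eq (V vf) (N 1)) merge_step (Set vgo (N 0)))"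

section \<open>Identifying rows inside the merged part, and the search for a merge\<close>

context twin_width_input begin

definition apart_below :: "nat set \<Rightarrow> nat \<Rightarrow> (nat \<Rightarrow> nat) \<Rightarrow> nat \<Rightarrow> bool" where
  "apart_below St p f y \<longleftrightarrow> (\<forall>x\<in>reps St f p. \<forall>x'\<in>reps St f p. x < y \<longrightarrow> x' < y \<longrightarrow> x \<noteq> x' \<longrightarrow> apart St p x x')"

definition shrinks :: "nat set \<Rightarrow> (nat \<Rightarrow> nat) \<Rightarrow> (nat \<Rightarrow> nat) \<Rightarrow> bool" where
  "shrinks St f f' \<longleftrightarrow> (\<forall>i\<in>St. reps St f' i \<subseteq> reps St f i)"

lemma finite_reps [simp]: "finite (reps St f p)" by (simp add: reps_def)

lemma card_shrinks: "shrinks St f f' \<Longrightarrow> i \<in> St \<Longrightarrow> card (reps St f i) \<le> c \<Longrightarrow> card (reps St f' i) \<le> c"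
  unfolding shrinks_def by (meson card_mono finite_reps le_trans)

lemma merge_classes_wp:
  assumes P: "part_env St p s0"
    and fl: "\<And>i. i \<in> St \<Longrightarrow> arr s0 7 i 0 = (if rows (part St i) (part St p) < big then 0 else 1)"
    and c: "\<And>i. i \<in> St \<Longrightarrow> card (reps St f0 i) \<le> c"
    and b: "\<And>i. i \<in> St \<Longrightarrow> card {j\<in>St. thr \<le> rows (part St i) (part St j)} \<le> b"
    and s: "state St (c * (b + 1)) f0 es0 s0"
    and Q: "\<And>s f es. unch {vy, vz, veq, vi, vo} {0, 5} s0 s \<Longrightarrow>
      clk s \<le> clk s0 + 50 * n + c * (60 * n + c * (100 * n + 200) + 50) + 20 \<Longrightarrow>
      state St (c * (b + 1)) f es s \<Longrightarrow> shrinks St f0 f \<Longrightarrow>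
      (\<And>x x'. x \<in> reps St f p \<Longrightarrow> x' \<in> reps St f p \<Longrightarrow> x \<noteq> x' \<Longrightarrow> apart St p x x') \<Longrightarrow> Q s"
  shows "WP merge_classes Q s0"
proof -
  note p = part_envD[OF P]
  define e where "e = nxt St p"
  define D where "D = c * (b + 1)"
  define R0 where "R0 = reps St f0 p"
  \<comment> \<open>Representatives only disappear, so every expensive round belongs to one of the
    initial representatives below the current position, and this number is at most c.\<close>
  define cst where "cst y = card {w\<in>R0. w < y}" for y
  define IN where "IN = 60 * n + c * (100 * n + 200) + 50"
  have pos: "0 < SS" using n_pos by (simp add: SS_def)
  have fR: "finite R0" by (simp add: R0_def)
  have cst_le: "cst y \<le> c" for y
  proof -
    have "cst y \<le> card R0" unfolding cst_def using fR by (intro card_mono) auto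
    then show ?thesis using c[OF p(2)] by (simp add: R0_def)
  qed
  have cst_Suc: "cst (Suc y) = (if y \<in> R0 then Suc (cst y) else cst y)" for y
  proof -
    have "{w\<in>R0. w < Suc y} = (if y \<in> R0 then insert y {w\<in>R0. w < y} else {w\<in>R0. w < y})" by (auto simp: less_Suc_eq)
    then show ?thesis using fR by (simp add: cst_def)
  qed
  have ele: "p \<le> e" "e \<le> n" using p by (auto simp: e_def)
  have inp: "y \<in> part St p" if "p \<le> y" "y < e" for y using that by (simp add: part_def e_def)
  define OI where "OI y s \<longleftrightarrow> unch {vy, vz, veq, vi, vo} {0, 5} s0 s \<and> var s vy = y \<and>
     clk s \<le> clk s0 + 2 + 50 * (y - p) + cst y * IN \<and>
     (\<exists>f es. state St D f es s \<and> shrinks St f0 f \<and> apart_below St p f y)" for y s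
  have inner: "WP (range_loop vz vp vy try_merge) Q' s1"
    if y: "p \<le> y" "y < e" and u1: "unch {vy, vz, veq, vi, vo} {0, 5} s0 s1" "var s1 vy = y"
      and st: "state St D f1 es1 s1" "shrinks St f0 f1" "apart_below St p f1 y"
      and Q': "\<And>s f es. unch {vz, veq, vi, vo} {0, 5} s1 s \<Longrightarrow> clk s \<le> clk s1 + IN - 20 \<Longrightarrow> state St D f es s \<Longrightarrow>
         shrinks St f0 f \<Longrightarrow> apart_below St p f (Suc y) \<Longrightarrow> Q' s"
    for y s1 f1 es1 Q'
  proof -
    \<comment> \<open>The row y is told apart from all representatives below z. When y itself is
      merged away, this last condition becomes void.\<close>
    define J where "J z s \<longleftrightarrow> unch {vz, veq, vi, vo} {0, 5} s1 s \<and> var s vz = z \<and>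
       clk s \<le> clk s1 + 2 + 50 * (z - p) + cst z * (100 * n + 200) \<and>
       (\<exists>f es. state St D f es s \<and> shrinks St f0 f \<and> apart_below St p f y \<and>
         (f y = y \<longrightarrow> (\<forall>w\<in>reps St f p. w < z \<longrightarrow> apart St p y w)))" for z s
    have v1: "var s1 vp = p" "var s1 0 = n" using u1 p by (auto simp: unch_def)
    show ?thesis
    proof (rule wp_range[where lo = p and hi = y and I = J])
      show "var s1 vp = p" "var s1 vy = y" "p \<le> y" "y \<le> n" using v1 u1 y ele by auto
      show "J p s" if "s = tick 2 (setv vz p s1)" for s
      proof -
        have "state St D f1 es1 s" by (rule state_unch[OF st(1), of "{vz}" "{}"]) (auto simp: that)
        moreover have "\<forall>w\<in>reps St f1 p. w < p \<longrightarrow> apart St p y w" by (auto simp: reps_def part_def)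
        ultimately show ?thesis unfolding J_def using st(2,3) that by auto
      qed
      show "var s vy = y \<and> var s vz = z" if "J z s" for z s using that u1 by (auto simp: J_def unch_def)
      fix z s assume Jz: "J z s" and z: "p \<le> z" "z < y"
      then obtain f es where f: "state St D f es s" "shrinks St f0 f" "apart_below St p f y"
        "f y = y \<longrightarrow> (\<forall>w\<in>reps St f p. w < z \<longrightarrow> apart St p y w)" unfolding J_def by blast
      have us: "unch {vz, veq, vi, vo} {0, 5} s1 s" and vz: "var s vz = z"
        and ck: "clk s \<le> clk s1 + 2 + 50 * (z - p) + cst z * (100 * n + 200)" using Jz by (auto simp: J_def)
      have u0: "unch {vy, vz, veq, vi, vo} {0, 5} s0 (tick 5 s)" using u1(1) us by (auto simp: unch_def)
      have zp: "z \<in> part St p" "y \<in> part St p" using inp z y by auto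
      have zn: "z < n" using part_less[OF p(1,2) zp(1)] .
      show "WP try_merge (\<lambda>s'. var s' vz = z \<and> J (Suc z) (tick 4 (setv vz (Suc z) s'))) (tick 5 s)"
      proof (rule try_merge_wp[where f = f and es = es and y = y and z = z and c = c and b = b and St = St and p = p])
        show "part_env St p (tick 5 s)" by (rule part_env_unch[OF P u0]) auto
        show "var (tick 5 s) vy = y" using us u1 by (simp add: unch_def)
        show "var (tick 5 s) vz = z" using vz by simp
        show "y \<in> part St p" "z \<in> part St p" "z < y" using zp z by auto
        show "arr (tick 5 s) 7 i 0 = (if rows (part St i) (part St p) < big then 0 else 1)" if "i \<in> St" for i
          using fl[OF that] u0 by (simp add: unch_def)
        show "card (reps St f i) \<le> c" if "i \<in> St" for i by (rule card_shrinks[OF f(2) that c[OF that]])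
        show "\<And>i. i \<in> St \<Longrightarrow> card {j\<in>St. thr \<le> rows (part St i) (part St j)} \<le> b" by (rule b)
        show "state St (c * (b + 1)) f es (tick 5 s)" unfolding D_def[symmetric]
          by (rule state_unch[OF f(1), of "{}" "{}"]) auto
        fix s' f' es' assume s': "unch {veq, vi, vo} {0, 5} (tick 5 s) s'"
          "clk s' \<le> clk (tick 5 s) + 30 + (if f z = z then 100 * n + 150 else 0)" "state St (c * (b + 1)) f' es' s'"
          "f' = f \<or> f z = z \<and> f y = y \<and> f' = join f z y" "f' y = y \<Longrightarrow> f z = z \<Longrightarrow> apart St p y z"
        \<comment> \<open>An identification only removes a representative, so distinctions
          established earlier persist.\<close>
        have sub: "reps St f' i \<subseteq> reps St f i" for i
          using s'(4) reps_join[of z y f St i] z by auto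
        let ?s = "tick 4 (setv vz (Suc z) s')"
        have vs: "var s' vz = z" using s'(1) vz by (simp add: unch_def)
        have 1: "unch {vz, veq, vi, vo} {0, 5} s1 ?s" using us s'(1) by (auto simp: unch_def)
        have zR: "z \<in> R0" if "f z = z"
          using that f(2) zp(1) p(2) by (auto simp: shrinks_def R0_def reps_def)
        have 2: "clk ?s \<le> clk s1 + 2 + 50 * (Suc z - p) + cst (Suc z) * (100 * n + 200)"
          using s'(2) ck z zR cst_Suc[of z] by (cases "f z = z") (auto simp: Suc_diff_le)
        have 3: "state St D f' es' ?s" unfolding D_def by (rule state_unch[OF s'(3), of "{vz}" "{}"]) auto
        have 4: "shrinks St f0 f'" using f(2) sub unfolding shrinks_def by blast
        have 5: "apart_below St p f' y" using f(3) sub unfolding apart_below_def by blast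
        have 6: "f' y = y \<longrightarrow> (\<forall>w\<in>reps St f' p. w < Suc z \<longrightarrow> apart St p y w)"
        proof (intro impI ballI)
          fix w assume a: "f' y = y" "w \<in> reps St f' p" "w < Suc z"
          have wf: "w \<in> reps St f p" using a sub by blast
          have fy: "f y = y" using a(1) s'(4) by auto
          show "apart St p y w"
          proof (cases "w = z")
            case True
            then show ?thesis using s'(5)[OF a(1)] wf by (simp add: reps_def)
          qed (use f(4) fy wf a(3) in auto)
        qed
        show "var s' vz = z \<and> J (Suc z) ?s" unfolding J_def using vs 1 2 3 4 5 6 by auto
      qed
    next
      fix s assume Jy: "J y s"
      then obtain f es where f: "state St D f es s" "shrinks St f0 f" "apart_below St p f y"
        "f y = y \<longrightarrow> (\<forall>w\<in>reps St f p. w < y \<longrightarrow> apart St p y w)" unfolding J_def by blast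
      have ab: "apart_below St p f (Suc y)"
        unfolding apart_below_def
      proof (intro ballI impI)
        fix x x' assume x: "x \<in> reps St f p" "x' \<in> reps St f p" "x < Suc y" "x' < Suc y" "x \<noteq> x'"
        show "apart St p x x'"
        proof (cases "x = y \<or> x' = y")
          case True
          then have "f y = y" using x by (auto simp: reps_def)
          then show ?thesis using True f(4) x apart_sym by (metis less_SucE)
        next
          case False
          then show ?thesis using f(3) x unfolding apart_below_def by (metis less_SucE)
        qed
      qed
      have "clk s \<le> clk s1 + 2 + 50 * (y - p) + cst y * (100 * n + 200)" using Jy by (simp add: J_def)
      moreover have "cst y * (100 * n + 200) \<le> c * (100 * n + 200)" using cst_le by (rule mult_le_mono1)
      moreover have "50 * (y - p) + 50 \<le> 60 * n + 40" using y ele by linarith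
      ultimately have ck: "clk (tick 5 s) \<le> clk s1 + IN - 20" unfolding IN_def st_simps using n_pos y ele by linarith
      have st5: "state St D f es (tick 5 s)" by (rule state_unch[OF f(1), of "{}" "{}"]) auto
      show "Q' (tick 5 s)"
        by (rule Q'[OF _ ck st5 f(2) ab]) (use Jy in \<open>simp add: J_def\<close>)
    qed (auto simp: TB_def SR_def)
  qed
  show ?thesis unfolding merge_classes_def
  proof (rule wp_range[where lo = p and hi = e and I = OI])
    show "var s0 vp = p" "var s0 ve = e" "p \<le> e" "e \<le> n" using p ele by (auto simp: e_def)
    show "OI p s" if "s = tick 2 (setv vy p s0)" for s
    proof -
      have "state St D f0 es0 s" unfolding D_def by (rule state_unch[OF s, of "{vy}" "{}"]) (auto simp: that)
      moreover have "apart_below St p f0 p" by (auto simp: apart_below_def reps_def part_def)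
      moreover have "shrinks St f0 f0" by (simp add: shrinks_def)
      ultimately show ?thesis unfolding OI_def using that by auto
    qed
    show "var s ve = e \<and> var s vy = y" if "OI y s" for y s using that p by (auto simp: OI_def unch_def e_def)
    fix y s assume Oy: "OI y s" and y: "p \<le> y" "y < e"
    then obtain f es where f: "state St D f es s" "shrinks St f0 f" "apart_below St p f y" unfolding OI_def by blast
    have us: "unch {vy, vz, veq, vi, vo} {0, 5} s0 s" and vy: "var s vy = y"
      and ck: "clk s \<le> clk s0 + 2 + 50 * (y - p) + cst y * IN" using Oy by (auto simp: OI_def)
    have yp: "y \<in> part St p" "y < n" using inp y ele by auto
    have rep: "arr s 5 y 0 = (if f y = y then 1 else 0)" using f(1) yp by (simp add: state_def)
    let ?b = "Eq (Rd 5 (V vy) (N 0)) (N 1)"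
    have fin: "var s' vy = y \<and> OI (Suc y) (tick 4 (setv vy (Suc y) s'))"
      if s': "unch {vy, vz, veq, vi, vo} {0, 5} s s'" "var s' vy = y" "clk s' \<le> clk s + 30 + (if f y = y then IN else 0)"
        "state St D f' es' s'" "shrinks St f0 f'" "apart_below St p f' (Suc y)" for s' f' es'
    proof -
      let ?s = "tick 4 (setv vy (Suc y) s')"
      have 1: "unch {vy, vz, veq, vi, vo} {0, 5} s0 ?s" using us s'(1) by (auto simp: unch_def)
      have yR: "y \<in> R0" if "f y = y" using that f(2) yp p(2) by (auto simp: shrinks_def R0_def reps_def)
      have 2: "clk ?s \<le> clk s0 + 2 + 50 * (Suc y - p) + cst (Suc y) * IN"
        using s'(3) ck y yR cst_Suc[of y] by (cases "f y = y") (auto simp: Suc_diff_le)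
      have 3: "state St D f' es' ?s" by (rule state_unch[OF s'(4), of "{vy}" "{}"]) auto
      show ?thesis unfolding OI_def using s'(2,5,6) 1 2 3 by auto
    qed
    show "WP (Ifte ?b (range_loop vz vp vy try_merge) Skip) (\<lambda>s'. var s' vy = y \<and> OI (Suc y) (tick 4 (setv vy (Suc y) s'))) (tick 5 s)"
    proof (rule wp_Ifte)
      show "okC SS Bd ?b (tick 5 s)" using vy yp pos n_le_Bd by (simp add: TB_def width_def)
      assume "\<not> holds ?b (tick 5 s)"
      then have ny: "f y \<noteq> y" using vy rep by (cases "f y = y") simp_all
      have ab: "apart_below St p f (Suc y)"
        unfolding apart_below_def
      proof (intro ballI impI)
        fix x x' assume x: "x \<in> reps St f p" "x' \<in> reps St f p" "x < Suc y" "x' < Suc y" "x \<noteq> x'"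
        have "x \<noteq> y" "x' \<noteq> y" using x ny by (auto simp: reps_def)
        then show "apart St p x x'" using x f(3) unfolding apart_below_def by (metis less_SucE)
      qed
      show "WP Skip (\<lambda>s'. var s' vy = y \<and> OI (Suc y) (tick 4 (setv vy (Suc y) s'))) (tick (ccost ?b + 1) (tick 5 s))"
      proof (rule wp_Skip, rule fin[OF _ _ _ _ f(2) ab])
        show "state St D f es (tick (ccost ?b + 1) (tick 5 s))" by (rule state_unch[OF f(1), of "{}" "{}"]) auto
      qed (use vy in auto)
    next
      assume "holds ?b (tick 5 s)"
      then have fy: "f y = y" using vy rep by (cases "f y = y") simp_all
      let ?s1 = "tick (ccost ?b + 1) (tick 5 s)"
      show "WP (range_loop vz vp vy try_merge) (\<lambda>s'. var s' vy = y \<and> OI (Suc y) (tick 4 (setv vy (Suc y) s'))) ?s1"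
      proof (rule inner[OF y _ _ _ f(2,3)])
        show "unch {vy, vz, veq, vi, vo} {0, 5} s0 ?s1" using us by simp
        show "var ?s1 vy = y" using vy by simp
        show "state St D f es ?s1" by (rule state_unch[OF f(1), of "{}" "{}"]) auto
        fix s' f' es' assume s': "unch {vz, veq, vi, vo} {0, 5} ?s1 s'" "clk s' \<le> clk ?s1 + IN - 20" "state St D f' es' s'"
          "shrinks St f0 f'" "apart_below St p f' (Suc y)"
        show "var s' vy = y \<and> OI (Suc y) (tick 4 (setv vy (Suc y) s'))"
          by (rule fin[OF _ _ _ s'(3-5)]) (use s'(1,2) vy fy in \<open>auto simp: unch_def IN_def\<close>)
      qed
    qed
  next
    fix s assume Oe: "OI e s"
    then obtain f es where f: "state St D f es s" "shrinks St f0 f" "apart_below St p f e" unfolding OI_def by blast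
    show "Q (tick 5 s)"
    proof (rule Q)
      show "unch {vy, vz, veq, vi, vo} {0, 5} s0 (tick 5 s)" using Oe by (simp add: OI_def)
      have "clk s \<le> clk s0 + 2 + 50 * (e - p) + cst e * IN" using Oe by (simp add: OI_def)
      moreover have "cst e * IN \<le> c * IN" using cst_le by (rule mult_le_mono1)
      ultimately show "clk (tick 5 s) \<le> clk s0 + 50 * n + c * (60 * n + c * (100 * n + 200) + 50) + 20"
        unfolding IN_def[symmetric] st_simps using ele by linarith
      show "state St (c * (b + 1)) f es (tick 5 s)" unfolding D_def[symmetric] by (rule state_unch[OF f(1), of "{}" "{}"]) auto
      show "shrinks St f0 f" by (rule f(2))
      show "apart St p x x'" if "x \<in> reps St f p" "x' \<in> reps St f p" "x \<noteq> x'" for x x'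
        using f(3) that unfolding apart_below_def by (auto simp: reps_def part_def e_def)
    qed
  qed (auto simp: TB_def SR_def)
qed

text \<open>Nothing is claimed about flags at positions where no part starts; a merge leaves stale
  values there.\<close>

definition hits_ok :: "nat set \<Rightarrow> st \<Rightarrow> nat \<Rightarrow> bool" where
  "hits_ok St s j \<longleftrightarrow> (\<forall>i\<in>St. arr s 2 j i = (if i \<in> hits St (pair St j) then 1 else 0)) \<and> arr s 6 j 0 = card (hits St (pair St j))"

lemma search_wp:
  assumes St: "starts St" and e: "env s0" and ln: "links St s0"
    and hk: "\<And>j. j \<in> St \<Longrightarrow> nxt St j < n \<Longrightarrow> hits_ok St s0 j"
    and Q1: "\<And>s. unch {vp, vprev, vf, vq} {} s0 s \<Longrightarrow> clk s \<le> clk s0 + 70 * n + 100 \<Longrightarrow> var s vf = 1 \<Longrightarrow>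
      var s vp \<in> St \<Longrightarrow> var s vq = nxt St (var s vp) \<Longrightarrow> nxt St (var s vp) < n \<Longrightarrow>
      card (hits St (pair St (var s vp))) \<le> maxhit \<Longrightarrow>
      (var s vp \<noteq> 0 \<Longrightarrow> var s vprev \<in> St \<and> nxt St (var s vprev) = var s vp) \<Longrightarrow> Q s"
    and Q2: "\<And>s. unch {vp, vprev, vf, vq} {} s0 s \<Longrightarrow> clk s \<le> clk s0 + 70 * n + 100 \<Longrightarrow> var s vf = 2 \<Longrightarrow>
      var s vp \<in> St \<Longrightarrow> nxt St (var s vp) = n \<Longrightarrow>
      (\<And>j. j \<in> St \<Longrightarrow> nxt St j < n \<Longrightarrow> maxhit < card (hits St (pair St j))) \<Longrightarrow> Q s"
  shows "WP search Q s0"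
proof -
  have zS: "0 \<in> St" using St by (simp add: starts_def)
  have pos: "0 < SS" using n_pos by (simp add: SS_def)
  have Sn: "j < n" if "j \<in> St" for j using that St by (auto simp: starts_def)
  let ?b = "Ifte (Lt (V vq) (V 0))
          (Ifte (Lt (V vmax) (Rd 6 (V vp) (N 0))) (Set vprev (V vp) ;; Set vp (V vq)) (Set vf (N 1)))
          (Set vf (N 2))"
  define I where "I s \<longleftrightarrow> unch {vp, vprev, vf, vq} {} s0 s \<and> var s vp \<in> St \<and>
     clk s \<le> clk s0 + 6 + 60 * var s vp + (if var s vf = 0 then 0 else 60) \<and>
     (\<forall>j\<in>St. j < var s vp \<longrightarrow> maxhit < card (hits St (pair St j))) \<and>
     (var s vp \<noteq> 0 \<longrightarrow> var s vprev \<in> St \<and> nxt St (var s vprev) = var s vp) \<and>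
     (var s vf = 0 \<or> var s vf = 1 \<and> var s vq = nxt St (var s vp) \<and> nxt St (var s vp) < n \<and> card (hits St (pair St (var s vp))) \<le> maxhit \<or>
      var s vf = 2 \<and> nxt St (var s vp) = n)" for s
  have loop: "WP (Loop (Eq (V vf) (N 0)) (Set vq (Rd 4 (V vp) (N 0)) ;; ?b)) Q s1" if "I s1" for s1
  proof (rule wp_Loop[where I = I and \<mu> = "\<lambda>s. if var s vf = 0 then Suc n - var s vp else 0"])
    show "I s1" by (rule that)
    show "okC SS Bd (Eq (V vf) (N 0)) s" for s by (simp add: TB_def)
    fix s assume I: "I s"
    define p where "p = var s vp"
    have pS: "p \<in> St" "p < n" using I Sn by (auto simp: I_def p_def)
    note nx = nxt_props[OF St pS(1)]
    have us: "unch {vp, vprev, vf, vq} {} s0 s" using I by (simp add: I_def)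
    have v: "var s 0 = n" "var s vmax = maxhit" "arr s = arr s0" "var s vp = p"
      using us e by (auto simp: unch_def env_def p_def fun_eq_iff)
    have l: "arr s0 4 p 0 = nxt St p" using ln pS by (simp add: links_def)
    show "Q (tick (ccost (Eq (V vf) (N 0)) + 1) s)" if "\<not> holds (Eq (V vf) (N 0)) s"
    proof -
      have f: "var s vf \<noteq> 0" using that by simp
      have ck: "clk s + 5 \<le> clk s0 + 70 * n + 100" using I f pS(2) by (auto simp: I_def p_def)
      consider "var s vf = 1" "var s vq = nxt St p" "nxt St p < n" "card (hits St (pair St p)) \<le> maxhit"
        | "var s vf = 2" "nxt St p = n" using I f by (auto simp: I_def p_def)
      then show ?thesis
      proof cases
        case 1
        then show ?thesis using I ck us v pS by (intro Q1) (auto simp: I_def)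
      next
        case 2
        have "maxhit < card (hits St (pair St j))" if j: "j \<in> St" "nxt St j < n" for j
        proof -
          have "j \<noteq> p" using 2 j by auto
          moreover have "\<not> p < j" using nx(4)[OF j(1)] 2 Sn[OF j(1)] by auto
          ultimately have "j < p" by simp
          then show ?thesis using I j by (auto simp: I_def p_def)
        qed
        then show ?thesis using ck us v pS 2 by (intro Q2) auto
      qed
    qed
    show "WP (Set vq (Rd 4 (V vp) (N 0)) ;; ?b) (\<lambda>s'. I s' \<and> (if var s' vf = 0 then Suc n - var s' vp else 0) <
        (if var s vf = 0 then Suc n - var s vp else 0)) (tick (ccost (Eq (V vf) (N 0)) + 1) s)" if "holds (Eq (V vf) (N 0)) s"
    proof -
      have f: "var s vf = 0" using that by simp
      have ck: "clk s \<le> clk s0 + 6 + 60 * p" using I f by (auto simp: I_def p_def)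
      have below: "\<forall>j\<in>St. j < p \<longrightarrow> maxhit < card (hits St (pair St j))" using I by (simp add: I_def p_def)
      have prev: "p \<noteq> 0 \<longrightarrow> var s vprev \<in> St \<and> nxt St (var s vprev) = p" using I by (simp add: I_def p_def)
      define s2 where "s2 = tick 10 (setv vq (nxt St p) (tick 5 s))"
      have s2: "var s2 = (var s)(vq := nxt St p)" "arr s2 = arr s0" "clk s2 = clk s + 15" using v by (auto simp: s2_def)
      have un2: "unch {vp, vprev, vf, vq} {} s0 s2" using us by (auto simp: unch_def s2_def)
      have main: "WP ?b (\<lambda>s'. I s' \<and> (if var s' vf = 0 then Suc n - var s' vp else 0) <
        (if var s vf = 0 then Suc n - var s vp else 0)) s2"
      proof (rule wp_Ifte)
        show "okC SS Bd (Lt (V vq) (V 0)) s2" by (simp add: TB_def)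
        assume "\<not> holds (Lt (V vq) (V 0)) s2"
        then have "nxt St p = n" using s2 v nx(1) by simp
        then show "WP (Set vf (N 2)) (\<lambda>s'. I s' \<and> (if var s' vf = 0 then Suc n - var s' vp else 0) <
          (if var s vf = 0 then Suc n - var s vp else 0)) (tick (ccost (Lt (V vq) (V 0)) + 1) s2)"
          by (intro wp_Set) (use f s2 un2 v pS ck below prev n_le_Bd in \<open>auto simp: TB_def SR_def I_def\<close>)
      next
        assume "holds (Lt (V vq) (V 0)) s2"
        then have lt: "nxt St p < n" using s2 v by simp
        then have nS: "nxt St p \<in> St" using nx(3) by auto
        have a6: "arr s0 6 p 0 = card (hits St (pair St p))" using hk[OF pS(1) lt] by (simp add: hits_ok_def)
        let ?s3 = "tick (ccost (Lt (V vq) (V 0)) + 1) s2"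
        show "WP (Ifte (Lt (V vmax) (Rd 6 (V vp) (N 0))) (Set vprev (V vp) ;; Set vp (V vq)) (Set vf (N 1)))
          (\<lambda>s'. I s' \<and> (if var s' vf = 0 then Suc n - var s' vp else 0) < (if var s vf = 0 then Suc n - var s vp else 0)) ?s3"
        proof (rule wp_Ifte)
          show "okC SS Bd (Lt (V vmax) (Rd 6 (V vp) (N 0))) ?s3" using s2 v pS pos n_le_Bd by (simp add: TB_def width_def)
          assume "\<not> holds (Lt (V vmax) (Rd 6 (V vp) (N 0))) ?s3"
          then have "card (hits St (pair St p)) \<le> maxhit" using s2 v a6 by simp
          then show "WP (Set vf (N 1)) (\<lambda>s'. I s' \<and> (if var s' vf = 0 then Suc n - var s' vp else 0) < (if var s vf = 0 then Suc n - var s vp else 0))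
            (tick (ccost (Lt (V vmax) (Rd 6 (V vp) (N 0))) + 1) ?s3)"
            by (intro wp_Set) (use f s2 un2 v pS ck below prev lt n_le_Bd in \<open>auto simp: TB_def SR_def I_def\<close>)
        next
          assume "holds (Lt (V vmax) (Rd 6 (V vp) (N 0))) ?s3"
          then have big_p: "maxhit < card (hits St (pair St p))" using s2 v a6 by simp
          have below': "\<forall>j\<in>St. j < nxt St p \<longrightarrow> maxhit < card (hits St (pair St j))"
          proof (intro ballI impI)
            fix j assume j: "j \<in> St" "j < nxt St p"
            have "j \<le> p" using nx(4)[OF j(1)] j(2) by (meson leD leI)
            then show "maxhit < card (hits St (pair St j))" using below big_p j(1) by (cases "j = p") auto
          qed
          have ck': "clk s + 60 \<le> clk s0 + 6 + 60 * nxt St p" using ck nx(2) by linarith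
          have m: "Suc n - nxt St p < Suc n - p" using nx(1,2) by linarith
          show "WP (Set vprev (V vp) ;; Set vp (V vq)) (\<lambda>s'. I s' \<and> (if var s' vf = 0 then Suc n - var s' vp else 0) < (if var s vf = 0 then Suc n - var s vp else 0))
            (tick (ccost (Lt (V vmax) (Rd 6 (V vp) (N 0))) + 1) ?s3)"
            by (intro wp_Seq wp_Set) (use f s2 un2 v pS nS ck' below' m in \<open>auto simp: TB_def SR_def I_def\<close>)
        qed
      qed
      have e10: "tick (ecost (Rd 4 (V vp) (N 0)) + 1) (setv vq (val (Rd 4 (V vp) (N 0)) (tick (ccost (Eq (V vf) (N 0)) + 1) s))
         (tick (ccost (Eq (V vf) (N 0)) + 1) s)) = s2"
        using v l by (simp add: s2_def)
      show ?thesis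
        by (rule wp_Seq, rule wp_Set, goal_cases)
          (use v pS pos n_le_Bd main in \<open>simp_all only: e10\<close>, auto simp: TB_def SR_def width_def)
    qed
  qed
  show ?thesis unfolding search_def
    by (intro wp_Seq wp_Set loop) (use zS in \<open>auto simp: TB_def SR_def I_def unch_def\<close>)
qed

end

lemma flag_eq: "((if P then 1 else 0) = Suc 0) = P" "((if P then 1 else 0) = (1::nat)) = P"
  by simp_all

text \<open>The main loop decreases the number of parts, which is not a variable of the program. The
  variant is therefore an index of the invariant rather than a function of the state.\<close>

lemma wp_Loop_indexed:
  fixes m :: nat
  assumes "I m s"
    and ok: "\<And>m s. I m s \<Longrightarrow> okC S B b s"
    and body: "\<And>m s. I m s \<Longrightarrow> holds b s \<Longrightarrow> wp S B c (\<lambda>s'. \<exists>m'<m. I m' s') (tick (ccost b + 1) s)"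
    and exit: "\<And>m s. I m s \<Longrightarrow> \<not> holds b s \<Longrightarrow> Q (tick (ccost b + 1) s)"
  shows "wp S B (Loop b c) Q s"
  using assms(1)
proof (induction m arbitrary: s rule: less_induct)
  case (less m)
  show ?case
  proof (cases "holds b s")
    case True
    obtain s' m' where s': "exec S B c (tick (ccost b + 1) s) s'" "m' < m" "I m' s'"
      using body[OF less.prems True] unfolding wp_def by blast
    from less.IH[OF s'(2,3)] obtain s'' where "exec S B (Loop b c) s' s''" "Q s''" unfolding wp_def by blast
    then show ?thesis unfolding wp_def using exec.LoopT[OF ok[OF less.prems] True s'(1)] by blast
  next
    case False
    then show ?thesis unfolding wp_def using exec.LoopF[OF ok[OF less.prems] False] exit[OF less.prems] by blast
  qed
qed

section \<open>Candidate merges before and after a merge\<close>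

context twin_width_input begin

lemma hits_merge:
  assumes St: "starts St" "p \<in> St" and q: "q = nxt St p" "q < n" and i: "i \<in> St - {q}"
  shows "i \<in> hits (St - {q}) C \<longleftrightarrow> i \<in> hits St C \<or> i = p \<and> q \<in> hits St C"
proof -
  note mf = merge_facts[OF St q]
  have sub: "St - {q} \<subseteq> St" by auto
  have pt: "pt (St - {q}) j = (if j = q then p else j)" if "j \<in> St" for j
    using mf(5)[of j] pt_start[OF St(1) that] by simp
  have H: "hits St C \<subseteq> St" using hits_subset[OF St(1)] .
  have "hits (St - {q}) C = pt (St - {q}) ` hits St C" by (rule coarse_hits[OF St(1) mf(1) sub])
  also have "\<dots> = (\<lambda>j. if j = q then p else j) ` hits St C"
  proof (rule image_cong[OF refl])
    show "pt (St - {q}) j = (if j = q then p else j)" if "j \<in> hits St C" for j using pt that H by blast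
  qed
  finally have eq: "hits (St - {q}) C = (\<lambda>j. if j = q then p else j) ` hits St C" .
  show ?thesis
  proof
    assume "i \<in> hits (St - {q}) C"
    then obtain j where "j \<in> hits St C" "i = (if j = q then p else j)" unfolding eq by blast
    then show "i \<in> hits St C \<or> i = p \<and> q \<in> hits St C" by (cases "j = q") simp_all
  next
    assume "i \<in> hits St C \<or> i = p \<and> q \<in> hits St C"
    then show "i \<in> hits (St - {q}) C"
    proof
      assume "i \<in> hits St C"
      then show ?thesis unfolding eq using i by (intro image_eqI[of _ _ i]) auto
    next
      assume "i = p \<and> q \<in> hits St C"
      then show ?thesis unfolding eq by (intro image_eqI[of _ _ q]) auto
    qed
  qed
qed

text \<open>Among the surviving candidates only p and its predecessor have a union that involves
  p.\<close>

lemma pair_merge: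
  assumes St: "starts St" "p \<in> St" and q: "q = nxt St p" "q < n" and j: "j \<in> St - {q}" "j \<noteq> p" "nxt St j \<noteq> p" "nxt St j < n"
  shows "pair (St - {q}) j = pair St j"
proof -
  note mf = merge_facts[OF St q]
  have n1: "nxt (St - {q}) j = nxt St j" using mf(3)[OF j(1,2)] .
  have n2: "nxt St j \<in> St - {q}" using nxt_props(3)[OF mf(1) j(1)] j(4) n1 by auto
  have n3: "nxt (St - {q}) (nxt St j) = nxt St (nxt St j)" using mf(3)[OF n2 j(3)] .
  show ?thesis unfolding pair_def part_def n1 n3 ..
qed

lemma emitted_unch: "state St D f es s \<Longrightarrow> valid St' f \<Longrightarrow> state St' D f es s"
  by (simp add: state_def)

lemma hits_ok_unch: "hits_ok St s j \<Longrightarrow> arr s' 2 j = arr s 2 j \<Longrightarrow> arr s' 6 j = arr s 6 j \<Longrightarrow> hits_ok St s' j"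
  by (simp add: hits_ok_def)

lemma env_unch: "env s \<Longrightarrow> unch Vs As s s' \<Longrightarrow> {0, vmax, vthr, vbig} \<inter> Vs = {} \<Longrightarrow> env s'"
  unfolding env_def unch_def by auto

lemma links_unch: "links St s \<Longrightarrow> unch Vs As s s' \<Longrightarrow> 4 \<notin> As \<Longrightarrow> links St s'"
  unfolding links_def unch_def by auto

lemma labels_unch: "labels St s \<Longrightarrow> unch Vs As s s' \<Longrightarrow> 1 \<notin> As \<Longrightarrow> labels St s'"
  unfolding labels_def unch_def by auto

lemma counted_cand:
  assumes "counted St s" "hits_ok St s' j" "\<And>c. c \<noteq> j \<Longrightarrow> arr s' 2 c = arr s 2 c \<and> arr s' 6 c = arr s 6 c" "starts St"
  shows "counted St s'"
  unfolding counted_def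
proof (intro allI impI)
  fix c assume c: "c < n"
  show "arr s' 6 c 0 = card {i \<in> St. arr s' 2 c i = 1}"
  proof (cases "c = j")
    case True
    have "{i \<in> St. arr s' 2 j i = 1} = hits St (pair St j)"
      using assms(2) hits_subset[OF assms(4), of "pair St j"] unfolding hits_ok_def by (auto simp: flag_eq)
    then show ?thesis using True assms(2) by (simp add: hits_ok_def)
  next
    case False
    then show ?thesis using assms(1,3) c by (simp add: counted_def)
  qed
qed

text \<open>X lists the candidates whose recorded hits may be out of date; only the consistency of
  flags and counters is still required of them.\<close>

definition cands :: "nat set \<Rightarrow> nat set \<Rightarrow> st \<Rightarrow> bool" where
  "cands St X s \<longleftrightarrow> (\<forall>j\<in>St. nxt St j < n \<longrightarrow> j \<notin> X \<longrightarrow> hits_ok St s j) \<and> counted St s"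

lemma cand_step_wp:
  assumes St: "starts St" and e: "env s0" and ln: "links St s0" and lb: "labels St s0" and cd: "cands St X s0"
    and j: "j \<in> St" "nxt St j < n" "var s0 v = j" "v < TB"
    and Q: "\<And>s. unch {vc, vg, vx, vi, vss, vcnt} {2, 3, 6} s0 s \<Longrightarrow> clk s \<le> clk s0 + 300 * n + 160 \<Longrightarrow>
      cands St (X - {j}) s \<Longrightarrow> Q s"
  shows "WP (Set vc (V v) ;; cand) Q s0"
proof (rule wp_Seq, rule wp_Set)
  let ?s = "tick (ecost (V v) + 1) (setv vc (val (V v) s0) s0)"
  have u: "unch {vc} {} s0 ?s" by simp
  have v: "var ?s vc = j" using j by simp
  show "WP cand Q ?s"
  proof (rule cand_wp[OF St])
    show "env ?s" by (rule env_unch[OF e u]) auto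
    show "links St ?s" by (rule links_unch[OF ln u]) auto
    show "labels St ?s" by (rule labels_unch[OF lb u]) auto
    show "var ?s vc \<in> St" "nxt St (var ?s vc) < n" using v j by auto
    fix s assume a: "unch {vg, vx, vi, vss, vcnt} {2, 3, 6} ?s s" "clk s \<le> clk ?s + 300 * n + 150"
      "\<And>c'. c' \<noteq> var ?s vc \<Longrightarrow> arr s 2 c' = arr ?s 2 c' \<and> arr s 6 c' = arr ?s 6 c'"
      "arr s 6 (var ?s vc) 0 = card (hits St (pair St (var ?s vc)))"
      "\<And>i. i \<in> St \<Longrightarrow> arr s 2 (var ?s vc) i = (if i \<in> hits St (pair St (var ?s vc)) then 1 else 0)"
    have hk: "hits_ok St s j" using a(4,5) unfolding hits_ok_def v by blast
    have oth: "arr s 2 c' = arr s0 2 c' \<and> arr s 6 c' = arr s0 6 c'" if "c' \<noteq> j" for c' using a(3)[of c'] that v by simp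
    have "cands St (X - {j}) s" unfolding cands_def
    proof (intro conjI ballI impI)
      show "counted St s" using counted_cand[OF _ hk oth St] cd by (simp add: cands_def)
      fix i assume i: "i \<in> St" "nxt St i < n" "i \<notin> X - {j}"
      show "hits_ok St s i"
      proof (cases "i = j")
        case False
        then have "hits_ok St s0 i" using cd i by (auto simp: cands_def)
        then show ?thesis using hits_ok_unch oth[OF False] by blast
      qed (use hk in simp)
    qed
    moreover have "unch {vc, vg, vx, vi, vss, vcnt} {2, 3, 6} s0 s" using a(1) by (auto simp: unch_def)
    ultimately show "Q s" using a(2) by (intro Q) auto
  qed
qed (use j in \<open>auto simp: TB_def SR_def\<close>)

lemma refresh_wp:
  assumes St: "starts St" and e: "env s0" and ln: "links St s0" and lb: "labels St s0"
    and p: "var s0 vp = p" "p \<in> St" "var s0 ve = nxt St p"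
    and pr: "p \<noteq> 0 \<Longrightarrow> var s0 vprev \<in> St \<and> nxt St (var s0 vprev) = p"
    and cd: "cands St {j\<in>St. j = p \<or> nxt St j = p} s0"
    and Q: "\<And>s. unch {vc, vg, vx, vi, vss, vcnt} {2, 3, 6} s0 s \<Longrightarrow> clk s \<le> clk s0 + 600 * n + 400 \<Longrightarrow>
      cands St {} s \<Longrightarrow> Q s"
  shows "WP refresh Q s0"
proof -
  let ?X = "{j\<in>St. j = p \<or> nxt St j = p}"
  let ?U = "{vc, vg, vx, vi, vss, vcnt}"
  have pn: "p < n" using St p by (auto simp: starts_def)
  \<comment> \<open>The links are injective, so p has at most one predecessor and two scans
    suffice.\<close>
  have uniq: "j = j'" if "j \<in> St" "j' \<in> St" "nxt St j = p" "nxt St j' = p" for j j'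
  proof (rule ccontr)
    assume "j \<noteq> j'"
    then consider "j < j'" | "j' < j" by linarith
    then show False
      using nxt_props(2,4)[OF St that(1)] nxt_props(2,4)[OF St that(2)] that by cases (metis leD)+
  qed
  have p0: "j \<in> St \<Longrightarrow> nxt St j \<noteq> 0" for j using nxt_props(2)[OF St, of j] by auto
  have second: "WP (Ifte (Lt (N 0) (V vp)) (Set vc (V vprev) ;; cand) Skip) Q s1"
    if s1: "unch ?U {2, 3, 6} s0 s1" "clk s1 \<le> clk s0 + 300 * n + 180" "cands St (?X - {p}) s1" for s1
  proof (rule wp_Ifte)
    have v1: "var s1 vp = p" "var s1 vprev = var s0 vprev" using s1 p by (auto simp: unch_def)
    show "okC SS Bd (Lt (N 0) (V vp)) s1" by (simp add: TB_def)
    show "WP Skip Q (tick (ccost (Lt (N 0) (V vp)) + 1) s1)" if "\<not> holds (Lt (N 0) (V vp)) s1"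
    proof -
      have "p = 0" using that v1 by simp
      then have Xe: "?X - {p} = {}" using p0 by fastforce
      have "cands St {} s1" using s1(3) unfolding Xe .
      then have "cands St {} (tick (ccost (Lt (N 0) (V vp)) + 1) s1)" by (simp add: cands_def counted_def hits_ok_def)
      then show ?thesis using s1 by (intro wp_Skip Q) auto
    qed
    show "WP (Set vc (V vprev) ;; cand) Q (tick (ccost (Lt (N 0) (V vp)) + 1) s1)" if "holds (Lt (N 0) (V vp)) s1"
    proof -
      let ?s = "tick (ccost (Lt (N 0) (V vp)) + 1) s1"
      have "p \<noteq> 0" using that v1 by simp
      note pr' = pr[OF this]
      have u: "unch ?U {2, 3, 6} s0 ?s" using s1(1) by simp
      have X: "?X - {p} - {var s0 vprev} = {}" using uniq pr' by auto
      have cd': "cands St (?X - {p}) ?s" using s1(3) by (simp add: cands_def counted_def hits_ok_def)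
      show ?thesis
      proof (rule cand_step_wp[OF St _ _ _ cd'])
        show "env ?s" by (rule env_unch[OF e u]) auto
        show "links St ?s" by (rule links_unch[OF ln u]) auto
        show "labels St ?s" by (rule labels_unch[OF lb u]) auto
        show "var s0 vprev \<in> St" "nxt St (var s0 vprev) < n" "var ?s vprev = var s0 vprev" "vprev < TB"
          using pr' pn v1 by (auto simp: TB_def)
        fix s assume a: "unch ?U {2, 3, 6} ?s s" "clk s \<le> clk ?s + 300 * n + 160" "cands St (?X - {p} - {var s0 vprev}) s"
        show "Q s"
        proof (rule Q)
          show "unch ?U {2, 3, 6} s0 s" using unch_trans[OF u a(1)] by simp
          show "clk s \<le> clk s0 + 600 * n + 400" using a(2) s1(2) by simp
          show "cands St {} s" using a(3) unfolding X .
        qed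
      qed
    qed
  qed
  show ?thesis unfolding refresh_def
  proof (rule wp_Seq, rule wp_Ifte)
    show "okC SS Bd (Lt (V ve) (V 0)) s0" by (simp add: TB_def)
    have v0: "var s0 0 = n" using e by (simp add: env_def)
    let ?s = "tick (ccost (Lt (V ve) (V 0)) + 1) s0"
    show "WP Skip (WP (Ifte (Lt (N 0) (V vp)) (Set vc (V vprev) ;; cand) Skip) Q) ?s" if "\<not> holds (Lt (V ve) (V 0)) s0"
    proof -
      have "\<not> nxt St p < n" using that p v0 by simp
      then have "cands St (?X - {p}) ?s" using cd by (auto simp: cands_def counted_def hits_ok_def)
      then show ?thesis by (intro wp_Skip second) auto
    qed
    show "WP (Set vc (V vp) ;; cand) (WP (Ifte (Lt (N 0) (V vp)) (Set vc (V vprev) ;; cand) Skip) Q) ?s" if "holds (Lt (V ve) (V 0)) s0"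
    proof -
      have lt: "nxt St p < n" using that p v0 by simp
      have u: "unch ?U {2, 3, 6} s0 ?s" by simp
      have cd': "cands St ?X ?s" using cd by (simp add: cands_def counted_def hits_ok_def)
      show ?thesis
      proof (rule cand_step_wp[OF St _ _ _ cd' p(2) lt])
        show "env ?s" by (rule env_unch[OF e u]) auto
        show "links St ?s" by (rule links_unch[OF ln u]) auto
        show "labels St ?s" by (rule labels_unch[OF lb u]) auto
        show "var ?s vp = p" "vp < TB" using p by (auto simp: TB_def)
        fix s assume a: "unch ?U {2, 3, 6} ?s s" "clk s \<le> clk ?s + 300 * n + 160" "cands St (?X - {p}) s"
        show "WP (Ifte (Lt (N 0) (V vp)) (Set vc (V vprev) ;; cand) Skip) Q s"
          by (rule second) (use a unch_trans[OF u a(1)] in auto)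
      qed
    qed
  qed
qed

end

text \<open>Both bounds are asked only for parts with few hits, the only ones the algorithm creates.
  The general case uses \<open>class_bound\<close> and \<open>maxhit\<close>, the constant matrix 1
  and 0; the latter keeps the degree at 2 when d = 0.\<close>

locale class_bounds = twin_width_input n k d m M for n k d m M +
  fixes c b :: nat
  assumes few_classes: "\<And>St p X. starts St \<Longrightarrow> p \<in> St \<Longrightarrow> card (hits St (part St p)) \<le> maxhit \<Longrightarrow> X \<subseteq> part St p \<Longrightarrow>
      (\<And>x x'. x \<in> X \<Longrightarrow> x' \<in> X \<Longrightarrow> x \<noteq> x' \<Longrightarrow> apart St p x x') \<Longrightarrow> card X \<le> c"
    and few_bad: "\<And>St i. starts St \<Longrightarrow> i \<in> St \<Longrightarrow> card (hits St (part St i)) \<le> maxhit \<Longrightarrow>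
      card {j\<in>St. thr \<le> rows (part St i) (part St j)} \<le> b"
begin

text \<open>The factor 2 accounts for the moment right after a merge, when the new part still
  carries the classes of both halves.\<close>

abbreviation "DD \<equiv> 2 * c * (b + 1)"

text \<open>At most \<open>maxhit\<close> hits per part survive every step: a merge is carried out
  only if the union satisfies this, and coarsening never adds hits.\<close>

definition main_inv :: "nat set \<Rightarrow> (nat \<Rightarrow> nat) \<Rightarrow> ((nat + nat) \<times> (nat + nat)) list \<Rightarrow> st \<Rightarrow> bool" where
  "main_inv St f es s \<longleftrightarrow> starts St \<and> env s \<and> links St s \<and> labels St s \<and> state St DD f es s \<and>
     (\<forall>i\<in>St. card (reps St f i) \<le> c) \<and> (\<forall>j\<in>St. card (hits St (part St j)) \<le> maxhit) \<and> cands St {} s"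

text \<open>The summand with \<open>maxhit\<close> pays for counting labels in hit parts, the nested
  one for comparisons among at most 2c representatives.\<close>

definition step_time :: nat where
  "step_time = 1000 * n + maxhit * (300 * n + 100) + 2 * c * (60 * n + 2 * c * (100 * n + 200) + 50) + 1000"

lemma merge_step_wp:
  assumes I: "main_inv St f es s0" and p: "var s0 vp = p" "p \<in> St" and q: "var s0 vq = nxt St p" "nxt St p < n"
    and h: "card (hits St (pair St p)) \<le> maxhit"
    and pr: "p \<noteq> 0 \<Longrightarrow> var s0 vprev \<in> St \<and> nxt St (var s0 vprev) = p"
    and Q: "\<And>s f' es'. main_inv (St - {nxt St p}) f' es' s \<Longrightarrow> clk s \<le> clk s0 + step_time \<Longrightarrow> var s vgo = var s0 vgo \<Longrightarrow> Q s"
  shows "WP merge_step Q s0"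
proof -
  define q where "q = nxt St p"
  define St' where "St' = St - {q}"
  define e where "e = nxt St q"
  have St: "starts St" and en: "env s0" and ln: "links St s0" and lb: "labels St s0" and st: "state St DD f es s0"
    and cr: "\<And>i. i \<in> St \<Longrightarrow> card (reps St f i) \<le> c" and hk: "\<And>j. j \<in> St \<Longrightarrow> card (hits St (part St j)) \<le> maxhit"
    and cd: "cands St {} s0" using I by (auto simp: main_inv_def)
  have qn: "q = nxt St p" "q < n" using q by (auto simp: q_def)
  note mf = merge_facts[OF St p(2) qn, folded St'_def]
  have St': "starts St'" and qS: "q \<in> St" "p < q" by (fact mf)+
  have sub: "St' \<subseteq> St" by (auto simp: St'_def)
  have pS': "p \<in> St'" using p(2) qS by (auto simp: St'_def)
  have pn: "p < n" "p < SS" "q < SS" using St p(2) qn SS_less by (auto simp: starts_def)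
  have pos: "0 < SS" using n_pos by (simp add: SS_def)
  have nx': "nxt St' p = e" using mf(2) by (simp add: e_def)
  have parts: "part St' j = part St j" if "j \<in> St'" "j \<noteq> p" for j
    unfolding part_def using mf(3)[OF that] by simp
  \<comment> \<open>The columns of the candidate have become the columns of a part, so flags and
    bounds recorded for the candidate serve the part.\<close>
  have pp: "part St' p = pair St p" unfolding pair_def using mf(4) qn by simp
  have hp: "card (hits St' (part St' p)) \<le> maxhit"
    using coarse_card_hits[OF St St' sub, of "part St' p"] h unfolding pp by simp
  have hk': "card (hits St' (part St' j)) \<le> maxhit" if "j \<in> St'" for j
  proof (cases "j = p")
    case False
    have "card (hits St' (part St j)) \<le> card (hits St (part St j))" by (rule coarse_card_hits[OF St St' sub])
    then show ?thesis using hk[of j] parts[OF that False] that sub by fastforce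
  qed (use hp in simp)
  have fv: "valid St f" using st by (simp add: state_def)
  have fv': "valid St' f" by (rule valid_coarse[OF St St' sub fv])
  have cr': "card (reps St' f j) \<le> 2 * c" "j \<noteq> p \<Longrightarrow> card (reps St' f j) \<le> c" if "j \<in> St'" for j
  proof -
    show 1: "card (reps St' f j) \<le> c" if "j \<noteq> p"
      using cr[of j] parts[OF \<open>j \<in> St'\<close> that] \<open>j \<in> St'\<close> sub by (auto simp: reps_def)
    have "reps St' f p = reps St f p \<union> reps St f q" unfolding reps_def pp pair_def qn(1)[symmetric] by auto
    then have "card (reps St' f p) \<le> c + c"
      using card_Un_le[of "reps St f p" "reps St f q"] cr[OF p(2)] cr[OF qS(1)] by simp
    then show "card (reps St' f j) \<le> 2 * c" using 1 by (cases "j = p") auto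
  qed
  define s1 where "s1 = tick 10 (setv ve e s0)"
  have a4: "arr s0 4 q 0 = e" using ln qS by (simp add: links_def e_def)
  have u1: "unch {ve} {} s0 s1" by (simp add: s1_def)
  have v1: "var s1 vp = p" "var s1 vq = q" "var s1 ve = e" using p q by (auto simp: s1_def q_def)
  show ?thesis unfolding merge_step_def
  proof (rule wp_Seq, rule wp_Set)
    show "okE SS Bd (Rd 4 (V vq) (N 0)) s0" using q qn pos n_le_Bd by (simp add: TB_def width_def q_def)
    have e1: "tick (ecost (Rd 4 (V vq) (N 0)) + 1) (setv ve (val (Rd 4 (V vq) (N 0)) s0) s0) = s1"
      using q a4 by (simp add: s1_def q_def)
    show "WP (relabel ;; Put 4 (V vp) (N 0) (V ve) ;; merge_hits ;; flag_bad ;; merge_classes ;; refresh) Q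
       (tick (ecost (Rd 4 (V vq) (N 0)) + 1) (setv ve (val (Rd 4 (V vq) (N 0)) s0) s0))"
      unfolding e1
    proof (rule wp_Seq, rule relabel_wp[where C = "pair St p"])
      show "env s1" by (rule env_unch[OF en u1]) auto
      have "labels St s1" by (rule labels_unch[OF lb u1]) auto
      then show "same_key (pair St p) (var s1 vp) (var s1 vq) s1"
        unfolding v1 pair_def qn(1)[symmetric] using p(2) qS(1) by (rule labels_same_key)
      show "var s1 vp < n" "var s1 vq < n" "var s1 vp \<noteq> var s1 vq" using v1 pn qn qS by auto
      fix s2 assume u2: "unch {vx} {1, 3} s1 s2" and c2: "clk s2 \<le> clk s1 + 150 * n + 20"
        and l2: "\<And>x j. x < n \<Longrightarrow> j \<noteq> var s1 vp \<Longrightarrow> arr s2 1 x j = arr s1 1 x j"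
          "\<And>x. x < n \<Longrightarrow> arr s2 1 x (var s1 vp) < SS"
          "\<And>x y. x < n \<Longrightarrow> y < n \<Longrightarrow> arr s2 1 x (var s1 vp) = arr s2 1 y (var s1 vp) \<longleftrightarrow> row (pair St p) x = row (pair St p) y"
      have lb2: "labels St' s2"
        unfolding labels_def
      proof (intro ballI allI impI)
        fix j x assume j: "j \<in> St'" and x: "x < n"
        show "arr s2 1 x j < SS \<and> (\<forall>y<n. (arr s2 1 x j = arr s2 1 y j) = (row (part St' j) x = row (part St' j) y))"
        proof (cases "j = p")
          case True
          then show ?thesis using l2(2,3) x v1 pp by simp
        next
          case False
          have "arr s1 1 = arr s0 1" by (simp add: s1_def)
          moreover have "j \<in> St" using j sub by blast
          ultimately show ?thesis using lb x False l2(1) v1 parts[OF j False] by (simp add: labels_def)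
        qed
      qed
      define s3 where "s3 = tick 13 (put 4 p 0 e s2)"
      have u3: "unch {vx, ve} {1, 3, 4} s0 s3" using u1 u2 by (auto simp: s3_def unch_def)
      have v2: "var s2 vp = p" "var s2 ve = e" using u2 v1 by (auto simp: unch_def)
      have v3: "var s3 vp = p" "var s3 vq = q" "var s3 ve = e" using u2 v1 by (auto simp: s3_def unch_def)
      have c3: "clk s3 \<le> clk s0 + 150 * n + 50" using c2 by (simp add: s3_def s1_def)
      have ln3: "links St' s3" unfolding links_def
      proof
        fix j assume j: "j \<in> St'"
        show "arr s3 4 j 0 = nxt St' j"
        proof (cases "j = p")
          case True then show ?thesis using nx' by (simp add: s3_def)
        next
          case False
          have "arr s3 4 j 0 = arr s0 4 j 0" using False u1 u2 by (simp add: s3_def unch_def)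
          also have "\<dots> = nxt St j" using ln j sub by (auto simp: links_def)
          also have "\<dots> = nxt St' j" using mf(3)[of j] j False by (simp add: St'_def)
          finally show ?thesis .
        qed
      qed
      have lb3: "labels St' s3" by (rule labels_unch[OF lb2, of "{}" "{4}"]) (auto simp: s3_def)
      have en3: "env s3" by (rule env_unch[OF en u3]) auto
      have cd3: "cands St {} s3"
        using cd u3 unfolding cands_def counted_def hits_ok_def unch_def by simp
      show "WP (Put 4 (V vp) (N 0) (V ve) ;; merge_hits ;; flag_bad ;; merge_classes ;; refresh) Q s2"
      proof (rule wp_Seq, rule wp_Put)
        have e3: "tick (ecost (V vp) + ecost (N 0) + ecost (V ve) + 10) (put 4 (val (V vp) s2) (val (N 0) s2) (val (V ve) s2) s2) = s3"
          using v2 by (simp add: s3_def)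
        show "WP (merge_hits ;; flag_bad ;; merge_classes ;; refresh) Q
          (tick (ecost (V vp) + ecost (N 0) + ecost (V ve) + 10) (put 4 (val (V vp) s2) (val (N 0) s2) (val (V ve) s2) s2))"
          unfolding e3
        proof (rule wp_Seq, rule merge_hits_wp[OF en3 St])
          show "var s3 vp \<in> St" "var s3 vq \<in> St" "var s3 vp \<noteq> var s3 vq" using v3 p(2) qS by auto
          show "counted St s3" using cd3 by (simp add: cands_def)
          fix s4 assume u4: "unch {vx} {2, 6} s3 s4" and c4: "clk s4 \<le> clk s3 + 100 * n + 10"
            and ct4: "counted (St - {var s3 vq}) s4"
            and h4: "\<And>c. c < n \<Longrightarrow> arr s4 2 c = (if arr s3 2 c (var s3 vq) = 1 then (arr s3 2 c)(var s3 vp := 1) else arr s3 2 c)"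
          have ct4': "counted St' s4" using ct4 v3 by (simp add: St'_def)
          \<comment> \<open>The cuts are those of the old division; only the names of the parts they
            hit have changed, which \<open>merge_hits\<close> has carried out.\<close>
          have moved: "arr s4 2 j i = (if i \<in> hits St' (pair St j) then 1 else 0)" if j: "j \<in> St" "nxt St j < n" and i: "i \<in> St'" for i j
          proof -
            have H: "\<And>i. i \<in> St \<Longrightarrow> arr s3 2 j i = (if i \<in> hits St (pair St j) then 1 else 0)"
              using cd3 j by (simp add: cands_def hits_ok_def)
            have jn: "j < n" using j(1) St by (auto simp: starts_def)
            have iS: "i \<in> St" using i sub by blast
            have hm: "i \<in> hits St' (pair St j) \<longleftrightarrow> i \<in> hits St (pair St j) \<or> i = p \<and> q \<in> hits St (pair St j)"
              unfolding St'_def using i by (intro hits_merge[OF St p(2) qn]) (simp add: St'_def)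
            show ?thesis unfolding h4[OF jn] v3 hm using H[OF qS(1)] H[OF iS]
              by (cases "q \<in> hits St (pair St j)"; cases "i = p") simp_all
          qed
          have cd4: "cands St' {j\<in>St'. j = p \<or> nxt St' j = p} s4"
            unfolding cands_def
          proof (intro conjI ballI impI ct4')
            fix j assume j: "j \<in> St'" "nxt St' j < n" "j \<notin> {j\<in>St'. j = p \<or> nxt St' j = p}"
            then have ne: "j \<noteq> p" "nxt St' j \<noteq> p" by auto
            have nj: "nxt St' j = nxt St j" using mf(3)[of j] j(1) ne by (simp add: St'_def)
            have pj: "pair St' j = pair St j" unfolding St'_def
              using j ne nj by (intro pair_merge[OF St p(2) qn]) (auto simp: St'_def)
            have jS: "j \<in> St" "j < n" using j(1) sub St by (auto simp: starts_def)
            have fl: "arr s4 2 j i = (if i \<in> hits St' (pair St' j) then 1 else 0)" if "i \<in> St'" for i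
              unfolding pj using moved[OF jS(1) _ that] j nj by simp
            have "{i\<in>St'. arr s4 2 j i = 1} = hits St' (pair St' j)"
              using fl hits_subset[OF St', of "pair St' j"] by (auto simp: flag_eq)
            then have "arr s4 6 j 0 = card (hits St' (pair St' j))" using ct4' jS by (simp add: counted_def)
            then show "hits_ok St' s4 j" using fl by (simp add: hits_ok_def)
          qed
          have en4: "env s4" by (rule env_unch[OF en3 u4]) auto
          have ln4: "links St' s4" by (rule links_unch[OF ln3 u4]) auto
          have lb4: "labels St' s4" by (rule labels_unch[OF lb3 u4]) auto
          have v4: "var s4 vp = p" "var s4 ve = e" using u4 v3 by (auto simp: unch_def)
          have pe4: "part_env St' p s4" using St' pS' en4 ln4 lb4 v4 nx' by (simp add: part_env_def)
          have st4: "state St' DD f es s4"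
          proof (rule emitted_unch[OF _ fv'])
            have u04: "unch {vx, ve} {1, 2, 3, 4, 6} s0 s4" using u3 u4 by (auto simp: unch_def)
            show "state St DD f es s4" by (rule state_unch[OF st u04]) auto
          qed
          show "WP (flag_bad ;; merge_classes ;; refresh) Q s4"
          proof (rule wp_Seq, rule flag_bad_wp[OF pe4 _ hp])
            show "arr s4 2 p i = (if i \<in> hits St' (part St' p) then 1 else 0)" if "i \<in> St'" for i
              unfolding pp using moved[OF p(2) _ that] qn by simp
            fix s5 assume u5: "unch {vi, vy, vcnt} {3, 7} s4 s5" and c5: "clk s5 \<le> clk s4 + 100 * n + maxhit * (300 * n + 100) + 10"
              and f5: "\<And>i. i \<in> St' \<Longrightarrow> arr s5 7 i 0 = (if rows (part St' i) (part St' p) < big then 0 else 1)"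
            have pe5: "part_env St' p s5" by (rule part_env_unch[OF pe4 u5]) auto
            have st5: "state St' DD f es s5" by (rule state_unch[OF st4 u5]) auto
            show "WP (merge_classes ;; refresh) Q s5"
            proof (rule wp_Seq, rule merge_classes_wp[OF pe5 f5 cr'(1) few_bad[OF St' _ hk'] st5])
              fix s6 f6 es6 assume u6: "unch {vy, vz, veq, vi, vo} {0, 5} s5 s6"
                and c6: "clk s6 \<le> clk s5 + 50 * n + 2 * c * (60 * n + 2 * c * (100 * n + 200) + 50) + 20"
                and st6: "state St' DD f6 es6 s6" and sh6: "shrinks St' f f6"
                and ap6: "\<And>x x'. x \<in> reps St' f6 p \<Longrightarrow> x' \<in> reps St' f6 p \<Longrightarrow> x \<noteq> x' \<Longrightarrow> apart St' p x x'"
              have u46: "unch {vi, vy, vcnt, vz, veq, vo} {0, 3, 5, 7} s4 s6" using u5 u6 by (auto simp: unch_def)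
              have en6: "env s6" by (rule env_unch[OF en4 u46]) auto
              have ln6: "links St' s6" by (rule links_unch[OF ln4 u46]) auto
              have lb6: "labels St' s6" by (rule labels_unch[OF lb4 u46]) auto
              have v6: "var s6 vp = p" "var s6 ve = nxt St' p" "var s6 vprev = var s0 vprev" "var s6 vgo = var s0 vgo"
                using u46 u4 u3 v4 nx' by (auto simp: unch_def)
              have cd6: "cands St' {j\<in>St'. j = p \<or> nxt St' j = p} s6"
                using cd4 u46 unfolding cands_def counted_def hits_ok_def unch_def by simp
              have cr6: "card (reps St' f6 j) \<le> c" if "j \<in> St'" for j
              proof (cases "j = p")
                case True
                have "card (reps St' f6 p) \<le> c"
                  by (rule few_classes[OF St' pS' hp _ ap6]) (auto simp: reps_def)
                then show ?thesis using True by simp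
              next
                case False
                show ?thesis by (rule card_shrinks[OF sh6 that cr'(2)[OF that False]])
              qed
              have pr': "var s0 vprev \<in> St' \<and> nxt St' (var s0 vprev) = p" if "p \<noteq> 0"
              proof -
                have a: "var s0 vprev \<in> St" "nxt St (var s0 vprev) = p" using pr[OF that] by auto
                have "var s0 vprev < p" using nxt_props(2)[OF St a(1)] a(2) by simp
                then have "var s0 vprev \<in> St'" "var s0 vprev \<noteq> p" using a qS by (auto simp: St'_def)
                then show ?thesis using mf(3)[of "var s0 vprev"] a by (simp add: St'_def)
              qed
              show "WP refresh Q s6"
              proof (rule refresh_wp[OF St' en6 ln6 lb6 v6(1) pS' v6(2) _ cd6])
                show "p \<noteq> 0 \<Longrightarrow> var s6 vprev \<in> St' \<and> nxt St' (var s6 vprev) = p" using pr' v6 by simp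
                fix s7 assume u7: "unch {vc, vg, vx, vi, vss, vcnt} {2, 3, 6} s6 s7" and c7: "clk s7 \<le> clk s6 + 600 * n + 400"
                  and cd7: "cands St' {} s7"
                show "Q s7"
                proof (rule Q)
                  have "env s7" by (rule env_unch[OF en6 u7]) auto
                  moreover have "links St' s7" by (rule links_unch[OF ln6 u7]) auto
                  moreover have "labels St' s7" by (rule labels_unch[OF lb6 u7]) auto
                  moreover have "state St' DD f6 es6 s7" by (rule state_unch[OF st6 u7]) auto
                  ultimately show "main_inv (St - {nxt St p}) f6 es6 s7"
                    unfolding main_inv_def q_def[symmetric] St'_def[symmetric] using St' cr6 hk' cd7 by blast
                  show "clk s7 \<le> clk s0 + step_time" using c7 c6 c5 c4 c3 unfolding step_time_def by linarith
                  show "var s7 vgo = var s0 vgo" using u7 v6 by (simp add: unch_def)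
                qed
              qed
            qed (assumption+)?
          qed
        qed
      qed (use v2 pn qn pos n_le_Bd nx' in \<open>auto simp: TB_def width_def\<close>)
    qed
  qed (auto simp: TB_def SR_def)
qed

lemma main_loop_wp:
  assumes I: "main_inv St f es s0"
    and Q: "\<And>s St f es. main_inv St f es s \<Longrightarrow> clk s \<le> clk s0 + n * (step_time + 70 * n + 120) + 70 * n + 150 \<Longrightarrow> var s vp \<in> St \<Longrightarrow>
      nxt St (var s vp) = n \<Longrightarrow> (\<And>j. j \<in> St \<Longrightarrow> nxt St j < n \<Longrightarrow> maxhit < card (hits St (pair St j))) \<Longrightarrow> Q s"
  shows "WP main_loop Q s0"
proof -
  define ST where "ST = step_time + 70 * n + 120"
  define fin where "fin St s \<longleftrightarrow> var s vp \<in> St \<and> nxt St (var s vp) = n \<and>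
    (\<forall>j\<in>St. nxt St j < n \<longrightarrow> maxhit < card (hits St (pair St j)))" for St and s :: st
  \<comment> \<open>A running state has an index one above the number of parts, so that the stopped
    state can take index 0 below all of them. The time bound is a potential: every remaining part
    has prepaid one round.\<close>
  define J where "J x s \<longleftrightarrow> (\<exists>St f es. main_inv St f es s \<and>
     (var s vgo = 1 \<and> x = Suc (card St) \<and> clk s + card St * ST \<le> clk s0 + 2 + n * ST \<or>
     var s vgo = 0 \<and> x = 0 \<and> fin St s \<and> clk s \<le> clk s0 + n * ST + 70 * n + 130))" for x :: nat and s
  have cardn: "card St \<le> n" if "starts St" for St
  proof -
    have "card St \<le> card {..<n}" using that by (intro card_mono) (auto simp: starts_def)
    then show ?thesis by simp
  qed
  let ?VS = "{vp, vprev, vf, vq, vgo}"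
  have inv_tick: "main_inv St f es s'" if a: "main_inv St f es s" and u: "unch ?VS {} s s'" for St f es s s'
  proof -
    have "env s'" by (rule env_unch[OF _ u]) (use a in \<open>auto simp: main_inv_def\<close>)
    moreover have "links St s'" by (rule links_unch[OF _ u]) (use a in \<open>auto simp: main_inv_def\<close>)
    moreover have "labels St s'" by (rule labels_unch[OF _ u]) (use a in \<open>auto simp: main_inv_def\<close>)
    moreover have "state St DD f es s'" by (rule state_unch[OF _ u]) (use a in \<open>auto simp: main_inv_def\<close>)
    moreover have "cands St {} s'" using a u unfolding main_inv_def cands_def counted_def hits_ok_def unch_def by simp
    ultimately show ?thesis using a unfolding main_inv_def by blast
  qed
  have loop: "WP (Loop (Eq (V vgo) (N 1)) (search ;; Ifte (Eq (V vf) (N 1)) merge_step (Set vgo (N 0)))) Q s1" if "J x1 s1" for x1 s1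
  proof (rule wp_Loop_indexed[where I = J])
    show "J x1 s1" by (rule that)
    show "okC SS Bd (Eq (V vgo) (N 1)) s" for s using n_le_Bd by (simp add: TB_def)
    fix x s assume J: "J x s"
    show "Q (tick (ccost (Eq (V vgo) (N 1)) + 1) s)" if "\<not> holds (Eq (V vgo) (N 1)) s"
    proof -
      have g0: "var s vgo \<noteq> 1" using that by simp
      obtain St f es where a: "main_inv St f es s" "fin St s" "clk s \<le> clk s0 + n * ST + 70 * n + 130"
        using J g0 unfolding J_def by blast
      let ?s = "tick (ccost (Eq (V vgo) (N 1)) + 1) s"
      have "main_inv St f es ?s" by (rule inv_tick[OF a(1)]) auto
      then show ?thesis
        by (rule Q) (use a(2,3) in \<open>auto simp: fin_def ST_def[symmetric]\<close>)
    qed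
    show "WP (search ;; Ifte (Eq (V vf) (N 1)) merge_step (Set vgo (N 0))) (\<lambda>s'. \<exists>y<x. J y s')
       (tick (ccost (Eq (V vgo) (N 1)) + 1) s)" if h: "holds (Eq (V vgo) (N 1)) s"
    proof -
      have go: "var s vgo = 1" using h by simp
      then obtain St f es where a: "main_inv St f es s" "clk s + card St * ST \<le> clk s0 + 2 + n * ST" and x: "x = Suc (card St)"
        using J unfolding J_def by (metis zero_neq_one)
      have St: "starts St" using a(1) by (simp add: main_inv_def)
      have fS: "finite St" by (rule starts_finite[OF St])
      let ?s = "tick (ccost (Eq (V vgo) (N 1)) + 1) s"
      have i: "main_inv St f es ?s" by (rule inv_tick[OF a(1)]) auto
      show ?thesis
      proof (rule wp_Seq, rule search_wp[OF St])
        show "env ?s" "links St ?s" using i by (auto simp: main_inv_def)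
        show "hits_ok St ?s j" if "j \<in> St" "nxt St j < n" for j using i that by (auto simp: main_inv_def cands_def)
        let ?c = "Ifte (Eq (V vf) (N 1)) merge_step (Set vgo (N 0))"
        show "WP ?c (\<lambda>s'. \<exists>y<x. J y s') s2"
          if u: "unch {vp, vprev, vf, vq} {} ?s s2" and ck: "clk s2 \<le> clk ?s + 70 * n + 100" and v: "var s2 vf = 2"
            "var s2 vp \<in> St" "nxt St (var s2 vp) = n" and stk: "\<And>j. j \<in> St \<Longrightarrow> nxt St j < n \<Longrightarrow> maxhit < card (hits St (pair St j))" for s2
        proof (rule wp_Ifte)
          show "okC SS Bd (Eq (V vf) (N 1)) s2" using n_le_Bd by (simp add: TB_def)
          show "WP merge_step (\<lambda>s'. \<exists>y<x. J y s') (tick (ccost (Eq (V vf) (N 1)) + 1) s2)" if "holds (Eq (V vf) (N 1)) s2"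
            using that v by simp
          show "WP (Set vgo (N 0)) (\<lambda>s'. \<exists>y<x. J y s') (tick (ccost (Eq (V vf) (N 1)) + 1) s2)"
          proof (rule wp_Set)
            let ?s3 = "tick (ecost (N 0) + 1) (setv vgo (val (N 0) (tick (ccost (Eq (V vf) (N 1)) + 1) s2)) (tick (ccost (Eq (V vf) (N 1)) + 1) s2))"
            have "main_inv St f es ?s3"
              by (rule inv_tick[OF i]) (use u in \<open>auto simp: unch_def\<close>)
            moreover have "fin St ?s3" using v stk by (simp add: fin_def)
            moreover have "clk ?s3 \<le> clk s0 + n * ST + 70 * n + 130" using ck a(2) by simp
            ultimately have "J 0 ?s3" unfolding J_def by auto
            then show "\<exists>y<x. J y ?s3" using x by blast
          qed (auto simp: TB_def SR_def)
        qed
        show "WP ?c (\<lambda>s'. \<exists>y<x. J y s') s2"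
          if u: "unch {vp, vprev, vf, vq} {} ?s s2" and ck: "clk s2 \<le> clk ?s + 70 * n + 100" and v: "var s2 vf = 1"
            "var s2 vp \<in> St" "var s2 vq = nxt St (var s2 vp)" "nxt St (var s2 vp) < n" "card (hits St (pair St (var s2 vp))) \<le> maxhit"
            and pr: "var s2 vp \<noteq> 0 \<Longrightarrow> var s2 vprev \<in> St \<and> nxt St (var s2 vprev) = var s2 vp" for s2
        proof (rule wp_Ifte)
          show "okC SS Bd (Eq (V vf) (N 1)) s2" using n_le_Bd by (simp add: TB_def)
          show "WP (Set vgo (N 0)) (\<lambda>s'. \<exists>y<x. J y s') (tick (ccost (Eq (V vf) (N 1)) + 1) s2)" if "\<not> holds (Eq (V vf) (N 1)) s2"
            using that v by simp
          let ?s3 = "tick (ccost (Eq (V vf) (N 1)) + 1) s2"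
          let ?p = "var s2 vp"
          have i3: "main_inv St f es ?s3"
            by (rule inv_tick[OF i]) (use u in \<open>auto simp: unch_def\<close>)
          show "WP merge_step (\<lambda>s'. \<exists>y<x. J y s') ?s3"
          proof (rule merge_step_wp[OF i3 _ v(2)])
            show "var ?s3 vp = ?p" by simp
            show "var ?s3 vq = nxt St ?p" "nxt St ?p < n" "card (hits St (pair St ?p)) \<le> maxhit" using v by auto
            show "?p \<noteq> 0 \<Longrightarrow> var ?s3 vprev \<in> St \<and> nxt St (var ?s3 vprev) = ?p" using pr by simp
            fix s4 f4 es4 assume i4: "main_inv (St - {nxt St ?p}) f4 es4 s4" and c4: "clk s4 \<le> clk ?s3 + step_time"
              and g4: "var s4 vgo = var ?s3 vgo"
            have nS: "nxt St ?p \<in> St" using nxt_props(3)[OF St v(2)] v(4) by auto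
            have cs: "card St = Suc (card (St - {nxt St ?p}))" by (rule card_Suc_Diff1[OF fS nS, symmetric])
            have c4': "clk s4 \<le> clk s + ST" using c4 ck by (simp add: ST_def)
            have g: "var s4 vgo = 1" using g4 u go by (simp add: unch_def)
            have key: "clk s4 + card (St - {nxt St ?p}) * ST \<le> clk s0 + 2 + n * ST" using a(2) c4' unfolding cs by simp
            have "J (Suc (card (St - {nxt St ?p}))) s4" unfolding J_def using i4 g key by blast
            then show "\<exists>y<x. J y s4" using x cs by auto
          qed
        qed
      qed
    qed
  qed
  have St0: "starts St" using I by (simp add: main_inv_def)
  have "main_inv St f es (tick 2 (setv vgo 1 s0))" by (rule inv_tick[OF I]) auto
  moreover have "card St * ST \<le> n * ST" using cardn[OF St0] by (rule mult_le_mono1)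
  ultimately have "J (Suc (card St)) (tick 2 (setv vgo 1 s0))" unfolding J_def by auto
  then show ?thesis unfolding main_loop_def
    by (intro wp_Seq wp_Set) (use loop n_le_Bd in \<open>auto simp: TB_def SR_def numeral_2_eq_2\<close>)
qed

end

text \<open>Runs only when a single part is left. The few remaining representatives are merged into
  0 on both sides without any comparison; then the rows, named by vertex 0, are merged with the
  columns, named by vertex n.\<close>

definition finish :: cmd where
  "finish = upto vx
     (Ifte (Lt (N 0) (V vx))
       (Ifte (Eq (Rd 5 (V vx) (N 0)) (N 1)) (Set vz (N 0) ;; Set vy (V vx) ;; emit) Skip) Skip) ;;
     Put 0 (V vo) (N 0) (N 0) ;; Put 0 (Plus (V vo) (N 1)) (N 0) (V 0)"

definition power_cmd :: "nat \<Rightarrow> nat \<Rightarrow> cmd" where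
  "power_cmd v b = Set v (N 1) ;; Set vx (N 0) ;;
     Loop (Lt (V vx) (V b)) (Set v (Times (V v) (V 1)) ;; inc vx)"

definition params :: cmd where
  "params = Set vy (Plus (V 2) (N 1)) ;; power_cmd vthr vy ;; inc vthr ;;
     power_cmd vbig vthr ;; Set vbig (Plus (V vbig) (V vthr)) ;;
     Set vmax (Plus (Times (Times (N 8) (V 2)) (Plus (V 2) (N 1))) (N 5))"

text \<open>Besides copying the input, this records in \<open>vres\<close> whether the matrix is constant.\<close>

definition copy_input :: cmd where
  "copy_input = Set vz (N 0) ;; Set vres (N 0) ;;
     upto vx (upto vy
       (Put 1 (V vx) (V vy) (Rd 0 (V vz) (N 0)) ;;
        Ifte (Eq (Rd 0 (V vz) (N 0)) (Rd 0 (N 0) (N 0))) Skip (Set vres (N 1)) ;; inc vz))"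

definition init_parts :: cmd where
  "init_parts = upto vx (Put 4 (V vx) (N 0) (Plus (V vx) (N 1)) ;; Put 5 (V vx) (N 0) (N 1)) ;; Set vo (N 0)"

definition init_cands :: cmd where
  "init_cands = upto vp (Ifte (Lt (Plus (V vp) (N 1)) (V 0)) (Set vc (V vp) ;; cand) Skip)"

definition solve :: cmd where
  "solve = init_parts ;; init_cands ;; main_loop ;;
     Ifte (Eq (V vp) (N 0)) (finish ;; Set 0 (N 1)) (Set 0 (N 0))"

text \<open>\<open>vres\<close> is 0 or 1, so d < \<open>vres\<close> holds exactly if d = 0 and the
  matrix is not constant, and then no 0-sequence exists.\<close>

definition whole :: cmd where
  "whole = params ;; copy_input ;; Ifte (Lt (V 2) (V vres)) (Set 0 (N 0)) solve"

context twin_width_input begin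

lemma emit_wp:
  assumes o: "out es s0" "length es \<le> 2 * n" and v: "var s0 vz = z" "var s0 vy = y" "var s0 0 = n" "z < n" "y < n"
    and Q: "\<And>s. unch {vo} {0} s0 s \<Longrightarrow> clk s \<le> clk s0 + 90 \<Longrightarrow> out (es @ [(Inl z, Inl y), (Inr z, Inr y)]) s \<Longrightarrow> Q s"
  shows "WP emit Q s0"
proof -
  have vo: "var s0 vo = 2 * length es" using o by (simp add: out_def)
  have fin: "Q s'"
    if s': "unch {vo} {0} s0 s'" "clk s' \<le> clk s0 + 90" "var s' vo = var s0 vo + 4"
      "arr s' 0 = (\<lambda>a b. if b = 0 \<and> a = 2 * length es then vertex_index n (Inl z)
            else if b = 0 \<and> a = 2 * length es + 1 then vertex_index n (Inl y)
            else if b = 0 \<and> a = 2 * length es + 2 then vertex_index n (Inr z)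
            else if b = 0 \<and> a = 2 * length es + 3 then vertex_index n (Inr y) else arr s0 0 a b)" for s'
    by (rule Q[OF s'(1,2) out_snoc2[OF o(1) s'(4,3)]])
  show ?thesis unfolding emit_def
    by (intro wp_Seq wp_Set wp_Put fin)
      (use v vo o(2) n_le_Bd in \<open>auto simp: TB_def SR_def width_def unch_def fun_eq_iff\<close>)
qed

lemma csets_cong: "(\<And>x. x < n \<Longrightarrow> f x = g x) \<Longrightarrow> csets J f = csets J g"
proof -
  assume a: "\<And>x. x < n \<Longrightarrow> f x = g x"
  then have "cls J f = cls J g" unfolding cls_def by (intro ext arg_cong[of _ _ "image J"]) auto
  moreover have "{z. z < n \<and> f z = z} = {z. z < n \<and> g z = z}" using a by auto
  ultimately show ?thesis by (simp add: csets_def)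
qed

text \<open>Used in the final sweep, when so few classes are left that all of them may be red
  neighbours.\<close>

lemma narrow_few:
  assumes "nreps f + nreps g \<le> D"
  shows "narrow D (division f g)"
  unfolding narrow_def
proof
  fix X
  have c: "card (csets J h) \<le> nreps h" "finite (csets J h)" for J h
    unfolding csets_def nreps_def by (auto intro: card_image_le)
  have "card {Y \<in> division f g. red_adjacent S X Y} \<le> card (division f g)"
    unfolding division_def using c by (intro card_mono) auto
  also have "\<dots> \<le> card (csets Inl f) + card (csets Inr g)" unfolding division_def by (rule card_Un_le)
  also have "\<dots> \<le> D" using c(1)[of Inl f] c(1)[of Inr g] assms by simp
  finally show "card {Y \<in> division f g. red_adjacent S X Y} \<le> D" .
qed

lemma finish_wp:
  assumes e: "var s0 0 = n" and st: "state St D f es s0" and D: "2 * nreps f \<le> D"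
    and Q: "\<And>s es. clk s \<le> clk s0 + 150 * n + 60 \<Longrightarrow> fits_seq D es {U} \<Longrightarrow>
      (\<And>t. t < length es \<Longrightarrow> arr s 0 (2 * t) 0 = vertex_index n (fst (es ! t)) \<and> arr s 0 (2 * t + 1) 0 = vertex_index n (snd (es ! t))) \<Longrightarrow> Q s"
  shows "WP finish Q s0"
proof -
  have pos: "0 < SS" using n_pos by (simp add: SS_def)
  have vf: "valid St f" and f0: "f 0 = 0" and rep: "\<And>x. x < n \<Longrightarrow> arr s0 5 x 0 = (if f x = x then 1 else 0)"
    using st by (auto simp: state_def)
  note fv = validD[OF vf]
  \<comment> \<open>The class map after x rounds of the sweep, expressed through the fixed f: the
    sweep leaves the flags of representatives in array 5 as they are.\<close>
  define g where "g x = (\<lambda>y. if f y < x then 0 else f y)" for x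
  have idem: "g x y < n \<and> g x (g x y) = g x y" if "y < n" for x y
    using fv(1,2)[OF that] f0 n_pos by (auto simp: g_def)
  have nr: "nreps (g x) \<le> nreps f" for x
    unfolding nreps_def using f0 by (intro card_mono) (auto simp: g_def split: if_splits)
  have step: "csets J (g (Suc x)) = csets J (if 0 < x \<and> f x = x then join (g x) 0 x else g x)" if "x < n" for x J
  proof (rule csets_cong)
    fix y assume y: "y < n"
    have "f y = x \<Longrightarrow> f x = x" using fv(2)[OF y] by simp
    then show "g (Suc x) y = (if 0 < x \<and> f x = x then join (g x) 0 x else g x) y"
      by (cases "f y = x") (auto simp: g_def join_def less_Suc_eq)
  qed
  let ?c = "Ifte (Lt (N 0) (V vx))
       (Ifte (Eq (Rd 5 (V vx) (N 0)) (N 1)) (Set vz (N 0) ;; Set vy (V vx) ;; emit) Skip) Skip"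
  define I where "I x s \<longleftrightarrow> unch {vx, vy, vz, vo} {0} s0 s \<and> var s vx = x \<and> clk s \<le> clk s0 + 2 + 140 * x \<and>
     (\<exists>es. out es s \<and> fits_seq D es (division (g x) (g x)) \<and> length es + 2 * nreps (g x) = 2 * n)" for x s
  show ?thesis unfolding finish_def
  proof (rule wp_Seq, rule wp_upto[where I = I])
    show "var s0 0 = n" by (rule e)
    have g0: "g 0 = f" by (simp add: g_def)
    show "I 0 s" if "s = tick 2 (setv vx 0 s0)" for s
      using st unfolding I_def that g0 state_def by (auto simp: out_def)
    show "var s 0 = n \<and> var s vx = x" if "I x s" for x s using that e by (auto simp: I_def unch_def)
    fix x s assume I: "I x s" and x: "x < n"
    obtain es where es: "out es s" "fits_seq D es (division (g x) (g x))" "length es + 2 * nreps (g x) = 2 * n"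
      using I by (auto simp: I_def)
    have us: "unch {vx, vy, vz, vo} {0} s0 s" and ck: "clk s \<le> clk s0 + 2 + 140 * x" and vx: "var s vx = x" using I by (auto simp: I_def)
    have r: "arr s 5 x 0 = (if f x = x then 1 else 0)" using rep[OF x] us by (simp add: unch_def)
    have v0: "var s 0 = n" using us e by (simp add: unch_def)
    have skip: "var s' vx = x \<and> I (Suc x) (tick 4 (setv vx (Suc x) s'))"
      if s': "unch {} {} s s'" "clk s' \<le> clk s + 100" and no: "\<not> (0 < x \<and> f x = x)" for s'
    proof -
      have "division (g (Suc x)) (g (Suc x)) = division (g x) (g x)" using step[OF x] no by (simp add: division_def)
      moreover have "nreps (g (Suc x)) = nreps (g x)"
      proof -
        have "{y. y < n \<and> g (Suc x) y = y} = {y. y < n \<and> g x y = y}"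
          using no f0 fv(2) by (auto simp: g_def less_Suc_eq split: if_splits)
        then show ?thesis by (simp add: nreps_def)
      qed
      moreover have "out es (tick 4 (setv vx (Suc x) s'))" using es(1) s'(1) by (auto simp: out_def unch_def)
      moreover have "unch {vx, vy, vz, vo} {0} s0 (tick 4 (setv vx (Suc x) s'))" using us s'(1) by (auto simp: unch_def)
      ultimately show ?thesis unfolding I_def using es(2,3) s' vx ck by (auto simp: unch_def)
    qed
    show "WP ?c (\<lambda>s'. var s' vx = x \<and> I (Suc x) (tick 4 (setv vx (Suc x) s'))) (tick 5 s)"
    proof (cases "0 < x \<and> f x = x")
      case False
      show ?thesis
      proof (rule wp_Ifte)
        show "okC SS Bd (Lt (N 0) (V vx)) (tick 5 s)" by (simp add: TB_def)
        show "WP Skip (\<lambda>s'. var s' vx = x \<and> I (Suc x) (tick 4 (setv vx (Suc x) s'))) (tick (ccost (Lt (N 0) (V vx)) + 1) (tick 5 s))"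
          by (rule wp_Skip, rule skip) (use False in auto)
        assume "holds (Lt (N 0) (V vx)) (tick 5 s)"
        then have "f x \<noteq> x" using False vx by simp
        then have "arr s 5 x 0 \<noteq> 1" using r by simp
        then show "WP (Ifte (Eq (Rd 5 (V vx) (N 0)) (N 1)) (Set vz (N 0) ;; Set vy (V vx) ;; emit) Skip)
          (\<lambda>s'. var s' vx = x \<and> I (Suc x) (tick 4 (setv vx (Suc x) s'))) (tick (ccost (Lt (N 0) (V vx)) + 1) (tick 5 s))"
          by (intro wp_Ifte wp_Skip skip) (use False vx x pos n_le_Bd in \<open>auto simp: TB_def width_def\<close>)
      qed
    next
      case True
      have gx: "g x 0 = 0" "g x x = x" using f0 True by (auto simp: g_def)
      have zr: "0 < n" "g x 0 = 0" "x < n" "g x x = x" "0 \<noteq> x" using n_pos x gx True by auto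
      have nj: "nreps (g x) = Suc (nreps (join (g x) 0 x))"
      proof -
        have "{y. y < n \<and> join (g x) 0 x y = y} = {y. y < n \<and> g x y = y} - {x}" using zr by (auto simp: join_def)
        then have "nreps (join (g x) 0 x) = nreps (g x) - 1" unfolding nreps_def using zr by (simp add: card_Diff_singleton)
        moreover have "0 < nreps (g x)" unfolding nreps_def using zr by (auto simp: card_gt_0_iff)
        ultimately show ?thesis by simp
      qed
      have dv: "division (join (g x) 0 x) (join (g x) 0 x) = division (g (Suc x)) (g (Suc x))"
        using step[OF x] True by (simp add: division_def)
      have nS: "nreps (g (Suc x)) = nreps (join (g x) 0 x)"
      proof -
        have "{y. y < n \<and> g (Suc x) y = y} = {y. y < n \<and> join (g x) 0 x y = y}"
          using True f0 by (auto simp: g_def join_def less_Suc_eq split: if_splits)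
        then show ?thesis by (simp add: nreps_def)
      qed
      have 1: "fits_seq D (es @ [(Inl 0, Inl x)]) (division (join (g x) 0 x) (g x))"
        by (rule fits_seq_join_rows[OF es(2) idem zr narrow_few]) (use nj nr[of x] D in auto)
      have "fits_seq D ((es @ [(Inl 0, Inl x)]) @ [(Inr 0, Inr x)]) (division (join (g x) 0 x) (join (g x) 0 x))"
        by (rule fits_seq_join_cols[OF 1 idem zr narrow_few]) (use nj nr[of x] D in auto)
      then have 2: "fits_seq D (es @ [(Inl 0, Inl x), (Inr 0, Inr x)]) (division (g (Suc x)) (g (Suc x)))" unfolding dv by simp
      have fin: "var s' vx = x \<and> I (Suc x) (tick 4 (setv vx (Suc x) s'))"
        if s': "unch {vz, vy, vo} {0} s s'" "clk s' \<le> clk s + 130" "out (es @ [(Inl 0, Inl x), (Inr 0, Inr x)]) s'" for s'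
      proof -
        have "out (es @ [(Inl 0, Inl x), (Inr 0, Inr x)]) (tick 4 (setv vx (Suc x) s'))" using s'(3) by (simp add: out_def)
        moreover have "unch {vx, vy, vz, vo} {0} s0 (tick 4 (setv vx (Suc x) s'))" using us s'(1) by (auto simp: unch_def)
        moreover have "length (es @ [(Inl 0, Inl x), (Inr 0, Inr x)]) + 2 * nreps (g (Suc x)) = 2 * n" using es(3) nj nS by simp
        ultimately show ?thesis unfolding I_def using 2 s' vx ck by (auto simp: unch_def)
      qed
      have em: "WP emit (\<lambda>s'. var s' vx = x \<and> I (Suc x) (tick 4 (setv vx (Suc x) s'))) s'"
        if s': "unch {vz, vy} {} s s'" "var s' vz = 0" "var s' vy = x" "clk s' \<le> clk s + 40" for s'
      proof (rule emit_wp[of es])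
        show "out es s'" using es(1) s'(1) by (simp add: out_def unch_def)
        show "length es \<le> 2 * n" using es(3) by simp
        show "var s' vz = 0" "var s' vy = x" "var s' 0 = n" "0 < n" "x < n" using s' v0 x n_pos by (auto simp: unch_def)
        fix s2 assume "unch {vo} {0} s' s2" "clk s2 \<le> clk s' + 90" "out (es @ [(Inl 0, Inl x), (Inr 0, Inr x)]) s2"
        then show "var s2 vx = x \<and> I (Suc x) (tick 4 (setv vx (Suc x) s2))"
          using s' by (intro fin) (auto simp: unch_def)
      qed
      have r1: "arr s 5 x 0 = 1" using r True by simp
      show ?thesis
        by (intro wp_Ifte wp_Skip wp_Seq wp_Set em) (use True vx x r1 pos n_le_Bd in \<open>auto simp: TB_def SR_def width_def unch_def\<close>)
    qed
  next
    fix s assume I: "I n s"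
    obtain es where es: "out es s" "fits_seq D es (division (g n) (g n))" "length es + 2 * nreps (g n) = 2 * n"
      using I by (auto simp: I_def)
    have us: "unch {vx, vy, vz, vo} {0} s0 s" and ck: "clk s \<le> clk s0 + 2 + 140 * n" using I by (auto simp: I_def)
    have v: "var s 0 = n" "var s vo = 2 * length es" using us e es(1) by (auto simp: unch_def out_def)
    have len: "length es \<le> 2 * n" using es(3) by simp
    have gn: "g n x = 0" if "x < n" for x using fv(1)[OF that] by (simp add: g_def)
    let ?es = "es @ [(Inl 0, Inr 0)]"
    have fs: "fits_seq D ?es {U}" by (rule fits_seq_final[OF es(2) gn])
    have fin: "Q s'" if s': "clk s' \<le> clk s + 40"
      "arr s' 0 = (\<lambda>a b. if b = 0 \<and> a = 2 * length es then 0 else if b = 0 \<and> a = 2 * length es + 1 then n else arr s 0 a b)" for s'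
    proof (rule Q[OF _ fs])
      show "clk s' \<le> clk s0 + 150 * n + 60" using s' ck by simp
      fix t assume t: "t < length ?es"
      then consider "t < length es" | "t = length es" by fastforce
      then show "arr s' 0 (2 * t) 0 = vertex_index n (fst (?es ! t)) \<and> arr s' 0 (2 * t + 1) 0 = vertex_index n (snd (?es ! t))"
        using es(1) unfolding s'(2) by cases (simp_all add: out_def nth_append)
    qed
    show "WP (Put 0 (V vo) (N 0) (N 0) ;; Put 0 (Plus (V vo) (N 1)) (N 0) (V 0)) Q (tick 5 s)"
      by (intro wp_Seq wp_Put fin) (use v len n_le_Bd in \<open>auto simp: TB_def width_def fun_eq_iff\<close>)
  qed (auto simp: TB_def SR_def)
qed

lemma power_cmd_wp:
  assumes v: "v < TB" "v \<noteq> SR" "v \<noteq> 1" "v \<noteq> vx" "b < TB" "b \<noteq> v" "b \<noteq> vx" and s: "var s0 b = ex" "var s0 1 = k"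
    and bd: "k ^ ex \<le> Bd" "ex + 1 \<le> Bd"
    and Q: "\<And>s. unch {v, vx} {} s0 s \<Longrightarrow> clk s \<le> clk s0 + 20 * ex + 20 \<Longrightarrow> var s v = k ^ ex \<Longrightarrow> Q s"
  shows "WP (power_cmd v b) Q s0"
proof -
  define I where "I s \<longleftrightarrow> unch {v, vx} {} s0 s \<and> var s vx \<le> ex \<and> var s v = k ^ var s vx \<and> clk s \<le> clk s0 + 4 + 20 * var s vx" for s
  have pw: "k ^ x \<le> Bd" if "x \<le> ex" for x
    using power_increasing[OF that, of k] k_pos bd(1) by simp
  have loop: "WP (Loop (Lt (V vx) (V b)) (Set v (Times (V v) (V 1)) ;; inc vx)) Q s1" if "I s1" for s1
  proof (rule wp_Loop[where I = I and \<mu> = "\<lambda>s. ex - var s vx"])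
    show "I s1" by (rule that)
    show "okC SS Bd (Lt (V vx) (V b)) s" for s using v by (simp add: TB_def)
    fix s assume I: "I s"
    have vb: "var s b = ex" "var s 1 = k" using I v s by (auto simp: I_def unch_def)
    show "Q (tick (ccost (Lt (V vx) (V b)) + 1) s)" if "\<not> holds (Lt (V vx) (V b)) s"
    proof -
      have "var s vx = ex" using that vb I by (simp add: I_def)
      then show ?thesis using I by (intro Q) (auto simp: I_def)
    qed
    show "WP (Set v (Times (V v) (V 1)) ;; inc vx) (\<lambda>s'. I s' \<and> ex - var s' vx < ex - var s vx) (tick (ccost (Lt (V vx) (V b)) + 1) s)"
      if "holds (Lt (V vx) (V b)) s"
    proof -
      have lt: "var s vx < ex" using that vb by simp
      have p: "k ^ var s vx * k \<le> Bd" using pw[of "Suc (var s vx)"] lt by (simp add: mult.commute)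
      show ?thesis unfolding inc_def
        by (intro wp_Seq wp_Set) (use I vb lt p v bd(2) in \<open>auto simp: TB_def SR_def I_def unch_def mult.commute\<close>)
    qed
  qed
  show ?thesis unfolding power_cmd_def
    by (intro wp_Seq wp_Set loop) (use v bd in \<open>auto simp: TB_def SR_def I_def unch_def\<close>)
qed

lemma params_wp:
  assumes s: "var s0 0 = n" "var s0 1 = k" "var s0 2 = d"
    and Q: "\<And>s. unch {vx, vy, vthr, vbig, vmax} {} s0 s \<Longrightarrow> clk s \<le> clk s0 + 20 * d + 20 * thr + 150 \<Longrightarrow> env s \<Longrightarrow> Q s"
  shows "WP params Q s0"
proof -
  have t: "k ^ (d + 1) + 1 = thr" "k ^ thr + thr = big" by (simp_all add: thr_def big_def)
  have mx: "d + 3 \<le> maxhit" "8 * d \<le> maxhit" "8 * d * (d + 1) + 5 = maxhit" by (simp_all add: maxhit_def)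
  have B: "big + maxhit + 50 \<le> Bd" "thr \<le> big" by (simp_all add: Bd_def big_bounds(1))
  define s1 where "s1 = tick 4 (setv vy (d + 1) s0)"
  show ?thesis unfolding params_def
  proof (rule wp_Seq, rule wp_Set)
    have e1: "tick (ecost (Plus (V 2) (N 1)) + 1) (setv vy (val (Plus (V 2) (N 1)) s0) s0) = s1" using s by (simp add: s1_def)
    show "WP (power_cmd vthr vy ;; inc vthr ;; power_cmd vbig vthr ;; Set vbig (Plus (V vbig) (V vthr)) ;;
     Set vmax (Plus (Times (Times (N 8) (V 2)) (Plus (V 2) (N 1))) (N 5))) Q
       (tick (ecost (Plus (V 2) (N 1)) + 1) (setv vy (val (Plus (V 2) (N 1)) s0) s0))"
      unfolding e1
    proof (rule wp_Seq, rule power_cmd_wp[where ex = "d + 1"])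
      show "var s1 vy = d + 1" "var s1 1 = k" using s by (auto simp: s1_def)
      show "k ^ (d + 1) \<le> Bd" "d + 1 + 1 \<le> Bd" using t B mx by linarith+
      fix s2 assume s2: "unch {vthr, vx} {} s1 s2" "clk s2 \<le> clk s1 + 20 * (d + 1) + 20" "var s2 vthr = k ^ (d + 1)"
      define s3 where "s3 = tick 4 (setv vthr thr s2)"
      show "WP (inc vthr ;; power_cmd vbig vthr ;; Set vbig (Plus (V vbig) (V vthr)) ;;
         Set vmax (Plus (Times (Times (N 8) (V 2)) (Plus (V 2) (N 1))) (N 5))) Q s2"
        unfolding inc_def
      proof (rule wp_Seq, rule wp_Set)
        have e3: "tick (ecost (Plus (V vthr) (N 1)) + 1) (setv vthr (val (Plus (V vthr) (N 1)) s2) s2) = s3"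
          using s2(3) t(1) by (simp add: s3_def)
        show "okE SS Bd (Plus (V vthr) (N 1)) s2" using s2(3) t(1) B by (simp add: TB_def)
        show "WP (power_cmd vbig vthr ;; Set vbig (Plus (V vbig) (V vthr)) ;;
         Set vmax (Plus (Times (Times (N 8) (V 2)) (Plus (V 2) (N 1))) (N 5))) Q
          (tick (ecost (Plus (V vthr) (N 1)) + 1) (setv vthr (val (Plus (V vthr) (N 1)) s2) s2))"
          unfolding e3
        proof (rule wp_Seq, rule power_cmd_wp[where ex = thr])
          show "var s3 vthr = thr" "var s3 1 = k" using s2(1) s by (auto simp: s3_def s1_def unch_def)
          show "k ^ thr \<le> Bd" "thr + 1 \<le> Bd" using t B by linarith+
          fix s4 assume s4: "unch {vbig, vx} {} s3 s4" "clk s4 \<le> clk s3 + 20 * thr + 20" "var s4 vbig = k ^ thr"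
          have v4: "var s4 vthr = thr" "var s4 2 = d" "var s4 0 = n" using s4(1) s2(1) s by (auto simp: s3_def s1_def unch_def)
          have u4: "unch {vx, vy, vthr, vbig, vmax} {} s0 s4" using s4(1) s2(1) by (auto simp: s3_def s1_def unch_def)
          have c4: "clk s4 \<le> clk s0 + 20 * d + 20 * thr + 80" using s4(2) s2(2) by (simp add: s3_def s1_def)
          have m8: "8 * d * (d + 1) \<le> Bd" "8 * d \<le> Bd" "d + 1 \<le> Bd" "8 * d * (d + 1) + 5 \<le> Bd" using mx B by linarith+
          show "WP (Set vbig (Plus (V vbig) (V vthr)) ;; Set vmax (Plus (Times (Times (N 8) (V 2)) (Plus (V 2) (N 1))) (N 5))) Q s4"
            by (intro wp_Seq wp_Set Q) (use v4 s4(3) t u4 c4 B m8 mx(3) in \<open>simp_all add: TB_def SR_def env_def\<close>)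
        qed (auto simp: TB_def SR_def)
      qed (auto simp: TB_def SR_def)
    qed (auto simp: TB_def SR_def)
  qed (use s mx B in \<open>auto simp: TB_def SR_def\<close>)
qed

lemma copy_input_wp:
  assumes e: "var s0 0 = n" and inp: "\<And>x y. x < n \<Longrightarrow> y < n \<Longrightarrow> arr s0 0 (x * n + y) 0 = m x y"
    and Q: "\<And>s. unch {vx, vy, vz, vres} {1} s0 s \<Longrightarrow> clk s \<le> clk s0 + n * (80 * n + 30) + 20 \<Longrightarrow>
      (\<And>x y. x < n \<Longrightarrow> y < n \<Longrightarrow> arr s 1 x y = m x y) \<Longrightarrow>
      (var s vres = 0 \<and> (\<forall>x<n. \<forall>y<n. m x y = m 0 0) \<or> var s vres = 1 \<and> \<not> (\<forall>x<n. \<forall>y<n. m x y = m 0 0)) \<Longrightarrow> Q s"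
  shows "WP copy_input Q s0"
proof -
  \<comment> \<open>The entries already copied, in the row-by-row order of the input.\<close>
  define seen where "seen x y a b \<longleftrightarrow> a < x \<or> a = x \<and> b < y" for x y a b :: nat
  define flag where "flag x y = (if \<forall>a<n. \<forall>b<n. seen x y a b \<longrightarrow> m a b = m 0 0 then 0 else 1 :: nat)" for x y
  have nn: "n * n + 10 * n + 50 \<le> Bd" by (simp add: Bd_def)
  have pos: "0 < SS" using n_pos by (simp add: SS_def)
  define I where "I x y tm s \<longleftrightarrow> unch {vx, vy, vz, vres} {1} s0 s \<and> var s vx = x \<and> clk s \<le> tm \<and> var s vz = x * n + y \<and>
     (\<forall>a<n. \<forall>b<n. seen x y a b \<longrightarrow> arr s 1 a b = m a b) \<and> var s vres = flag x y" for x y tm s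
  have seen_row: "seen (Suc x) 0 a b \<longleftrightarrow> seen x n a b" if "b < n" for x a b using that by (auto simp: seen_def)
  have flag_row: "flag (Suc x) 0 = flag x n" for x unfolding flag_def using seen_row by (intro if_cong) auto
  have flag_Suc: "flag x (Suc y) = (if m x y = m 0 0 then flag x y else 1)" if "x < n" "y < n" for x y
  proof -
    have d: "seen x (Suc y) a b \<longleftrightarrow> seen x y a b \<or> a = x \<and> b = y" for a b by (auto simp: seen_def)
    have "(\<forall>a<n. \<forall>b<n. seen x (Suc y) a b \<longrightarrow> m a b = m 0 0) \<longleftrightarrow>
        (\<forall>a<n. \<forall>b<n. seen x y a b \<longrightarrow> m a b = m 0 0) \<and> m x y = m 0 0"
      unfolding d using that by blast
    then show ?thesis unfolding flag_def by simp
  qed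
  have inner: "WP (upto vy (Put 1 (V vx) (V vy) (Rd 0 (V vz) (N 0)) ;;
        Ifte (Eq (Rd 0 (V vz) (N 0)) (Rd 0 (N 0) (N 0))) Skip (Set vres (N 1)) ;; inc vz)) Q' s1"
    if x: "x < n" and s1: "I x 0 tm s1" and Q': "\<And>s. I x n (tm + 80 * n + 10) s \<Longrightarrow> Q' s" for x tm s1 Q'
  proof (rule wp_upto[where I = "\<lambda>y s. I x y (tm + 2 + 80 * y) s \<and> var s vy = y"])
    show "var s1 0 = n" using s1 e by (simp add: I_def unch_def)
    show "I x 0 (tm + 2 + 80 * 0) s \<and> var s vy = 0" if "s = tick 2 (setv vy 0 s1)" for s
      using s1 unfolding that by (simp add: I_def)
    fix y s assume J: "I x y (tm + 2 + 80 * y) s \<and> var s vy = y"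
    show "var s 0 = n \<and> var s vy = y" using J e by (auto simp: I_def unch_def)
    assume y: "y < n"
    have us: "unch {vx, vy, vz, vres} {1} s0 s" using J by (simp add: I_def)
    have v: "var s vx = x" "var s vy = y" "var s vz = x * n + y" "arr s 0 = arr s0 0" "var s vres = flag x y" "var s 0 = n"
      using J us e by (auto simp: I_def unch_def)
    have z: "x * n + y < n * n"
    proof -
      have "x * n + n \<le> n * n" using x by (metis Suc_leI add.commute mult_Suc mult_le_mono1)
      then show ?thesis using y by simp
    qed
    have zB: "x * n + y + 1 \<le> Bd" "y < SS" "x \<le> Bd" using z nn y SS_less x by auto
    have a: "arr s0 0 (x * n + y) 0 = m x y" "arr s0 0 0 0 = m 0 0" using inp[OF x y] inp[of 0 0] n_pos by auto
    have fin: "var s' vy = y \<and> I x (Suc y) (tm + 2 + 80 * Suc y) (tick 4 (setv vy (Suc y) s')) \<and> var (tick 4 (setv vy (Suc y) s')) vy = Suc y"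
      if s': "unch {vz, vres} {1} s s'" "clk s' \<le> clk s + 70" "var s' vz = x * n + y + 1" "var s' vres = (if m x y = m 0 0 then flag x y else 1)"
        "arr s' 1 = (arr s 1)(x := (arr s 1 x)(y := m x y))" for s'
    proof -
      have d: "seen x (Suc y) a b \<longleftrightarrow> seen x y a b \<or> a = x \<and> b = y" for a b by (auto simp: seen_def)
      have "unch {vx, vy, vz, vres} {1} s0 (tick 4 (setv vy (Suc y) s'))" using us s'(1) by (auto simp: unch_def)
      moreover have "arr s' 1 a b = m a b" if "a < n" "b < n" "seen x (Suc y) a b" for a b
        using J that unfolding s'(5) d by (auto simp: I_def)
      ultimately show ?thesis using J s' flag_Suc[OF x y] v by (simp add: I_def unch_def)
    qed
    show "WP (Put 1 (V vx) (V vy) (Rd 0 (V vz) (N 0)) ;;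
        Ifte (Eq (Rd 0 (V vz) (N 0)) (Rd 0 (N 0) (N 0))) Skip (Set vres (N 1)) ;; inc vz)
      (\<lambda>s'. var s' vy = y \<and> I x (Suc y) (tm + 2 + 80 * Suc y) (tick 4 (setv vy (Suc y) s')) \<and> var (tick 4 (setv vy (Suc y) s')) vy = Suc y) (tick 5 s)"
      unfolding inc_def
      by (intro wp_Seq wp_Put wp_Ifte wp_Skip wp_Set fin)
        (use v a zB nn in \<open>simp_all add: TB_def SR_def width_def unch_def\<close>)
  next
    fix s assume "I x n (tm + 2 + 80 * n) s \<and> var s vy = n"
    then show "Q' (tick 5 s)" by (intro Q') (simp add: I_def)
  qed (auto simp: TB_def SR_def)
  have outer: "WP (upto vx (upto vy (Put 1 (V vx) (V vy) (Rd 0 (V vz) (N 0)) ;;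
        Ifte (Eq (Rd 0 (V vz) (N 0)) (Rd 0 (N 0) (N 0))) Skip (Set vres (N 1)) ;; inc vz))) Q s1"
    if s1: "unch {vz, vres} {} s0 s1" "var s1 vz = 0" "var s1 vres = 0" "clk s1 \<le> clk s0 + 4" for s1
  proof (rule wp_upto[where I = "\<lambda>x s. I x 0 (clk s0 + 8 + x * (80 * n + 30)) s"])
    show "var s1 0 = n" using s1 e by (simp add: unch_def)
    show "I 0 0 (clk s0 + 8 + 0 * (80 * n + 30)) s" if "s = tick 2 (setv vx 0 s1)" for s
      using s1 unfolding that by (auto simp: I_def unch_def seen_def flag_def)
    fix x s assume J: "I x 0 (clk s0 + 8 + x * (80 * n + 30)) s"
    show "var s 0 = n \<and> var s vx = x" using J e by (auto simp: I_def unch_def)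
    assume x: "x < n"
    have J': "I x 0 (clk s0 + 13 + x * (80 * n + 30)) (tick 5 s)" using J by (simp add: I_def)
    show "WP (upto vy (Put 1 (V vx) (V vy) (Rd 0 (V vz) (N 0)) ;;
        Ifte (Eq (Rd 0 (V vz) (N 0)) (Rd 0 (N 0) (N 0))) Skip (Set vres (N 1)) ;; inc vz))
      (\<lambda>s'. var s' vx = x \<and> I (Suc x) 0 (clk s0 + 8 + Suc x * (80 * n + 30)) (tick 4 (setv vx (Suc x) s'))) (tick 5 s)"
    proof (rule inner[OF x J'])
      fix s' assume "I x n (clk s0 + 13 + x * (80 * n + 30) + 80 * n + 10) s'"
      then show "var s' vx = x \<and> I (Suc x) 0 (clk s0 + 8 + Suc x * (80 * n + 30)) (tick 4 (setv vx (Suc x) s'))"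
        using seen_row by (simp add: I_def flag_row)
    qed
  next
    fix s assume J: "I n 0 (clk s0 + 8 + n * (80 * n + 30)) s"
    have vr: "var s vres = flag n 0" using J by (simp add: I_def)
    have fl: "flag n 0 = 0 \<and> (\<forall>x<n. \<forall>y<n. m x y = m 0 0) \<or> flag n 0 = 1 \<and> \<not> (\<forall>x<n. \<forall>y<n. m x y = m 0 0)"
    proof -
      have "(\<forall>a<n. \<forall>b<n. seen n 0 a b \<longrightarrow> m a b = m 0 0) = (\<forall>x<n. \<forall>y<n. m x y = m 0 0)" unfolding seen_def by blast
      then show ?thesis unfolding flag_def by metis
    qed
    show "Q (tick 5 s)"
    proof (rule Q)
      show "unch {vx, vy, vz, vres} {1} s0 (tick 5 s)" using J by (simp add: I_def)
      show "clk (tick 5 s) \<le> clk s0 + n * (80 * n + 30) + 20" using J by (simp add: I_def)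
      show "arr (tick 5 s) 1 x y = m x y" if "x < n" "y < n" for x y using J that by (simp add: I_def seen_def)
      show "var (tick 5 s) vres = 0 \<and> (\<forall>x<n. \<forall>y<n. m x y = m 0 0) \<or> var (tick 5 s) vres = 1 \<and> \<not> (\<forall>x<n. \<forall>y<n. m x y = m 0 0)"
        unfolding st_simps vr by (rule fl)
    qed
  qed (auto simp: TB_def SR_def)
  show ?thesis unfolding copy_input_def
    by (intro wp_Seq wp_Set outer) (use nn in \<open>auto simp: TB_def SR_def unch_def\<close>)
qed

end

section \<open>The initial division into singletons\<close>

context twin_width_input begin

lemma singletons:
  assumes "p < n"
  shows "starts {..<n}" "nxt {..<n} p = Suc p" "part {..<n} p = {p}"
proof -
  show st: "starts {..<n}" using n_pos by (simp add: starts_def)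
  show nx: "nxt {..<n} p = Suc p" by (rule nxt_eqI[OF _ _ st]) (use assms in auto)
  show "part {..<n} p = {p}" unfolding part_def nx by auto
qed

text \<open>On a single column there are at most k distinct rows, fewer than \<open>thr\<close>, so
  the first segment never ends.\<close>

lemma hits_singletons:
  assumes "p < n"
  shows "hits {..<n} (part {..<n} p) = {}"
proof (rule rows_small_hits)
  show "part {..<n} p \<subseteq> {..<n}" using assms singletons(3)[OF assms] by simp
  fix W assume W: "W \<subseteq> {..<n}"
  have "rows {p} W \<le> k ^ rows W {p}" by (rule rows_dual[OF W]) (use assms in simp)
  then show "rows (part {..<n} p) W < thr"
    using singletons(3)[OF assms] k_less_thr by (simp add: rows_def)
qed

lemma init_parts_wp:
  assumes e: "var s0 0 = n"
    and Q: "\<And>s. unch {vx, vo} {4, 5} s0 s \<Longrightarrow> clk s \<le> clk s0 + 70 * n + 20 \<Longrightarrow> var s vo = 0 \<Longrightarrow>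
      (\<And>x. x < n \<Longrightarrow> arr s 4 x 0 = Suc x \<and> arr s 5 x 0 = 1) \<Longrightarrow> Q s"
  shows "WP init_parts Q s0"
proof -
  have pos: "0 < SS" using n_pos by (simp add: SS_def)
  define I where "I x s \<longleftrightarrow> unch {vx, vo} {4, 5} s0 s \<and> clk s \<le> clk s0 + 2 + 70 * x \<and> var s vx = x \<and>
    (\<forall>y<x. arr s 4 y 0 = Suc y \<and> arr s 5 y 0 = 1)" for x and s :: st
  show ?thesis unfolding init_parts_def
  proof (rule wp_Seq, rule wp_upto[where I = I])
    show "var s0 0 = n" by (rule e)
    show "I 0 s" if "s = tick 2 (setv vx 0 s0)" for s unfolding that I_def by simp
    show "var s 0 = n \<and> var s vx = x" if "I x s" for x s using that e by (auto simp: I_def unch_def)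
    fix x s assume I: "I x s" and x: "x < n"
    have fin: "var s' vx = x \<and> I (Suc x) (tick 4 (setv vx (Suc x) s'))"
      if "unch {} {4, 5} s s'" "clk s' \<le> clk s + 50" "arr s' 4 = (arr s 4)(x := (arr s 4 x)(0 := Suc x))"
        "arr s' 5 = (arr s 5)(x := (arr s 5 x)(0 := 1))" for s'
      using I that by (auto simp: I_def unch_def less_Suc_eq)
    show "WP (Put 4 (V vx) (N 0) (Plus (V vx) (N 1)) ;; Put 5 (V vx) (N 0) (N 1))
      (\<lambda>s'. var s' vx = x \<and> I (Suc x) (tick 4 (setv vx (Suc x) s'))) (tick 5 s)"
      by (intro wp_Seq wp_Put fin) (use I x pos n_le_Bd in \<open>auto simp: TB_def width_def unch_def I_def\<close>)
  next
    fix s assume I: "I n s"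
    show "WP (Set vo (N 0)) Q (tick 5 s)"
      by (intro wp_Set Q) (use I in \<open>auto simp: TB_def SR_def I_def unch_def\<close>)
  qed (auto simp: TB_def SR_def)
qed

lemma init_cands_wp:
  assumes e: "env s0" and ln: "links {..<n} s0" and lb: "labels {..<n} s0" and ct: "counted {..<n} s0"
    and Q: "\<And>s. unch {vp, vc, vg, vx, vi, vss, vcnt} {2, 3, 6} s0 s \<Longrightarrow> clk s \<le> clk s0 + n * (300 * n + 200) + 20 \<Longrightarrow>
      cands {..<n} {} s \<Longrightarrow> Q s"
  shows "WP init_cands Q s0"
proof -
  let ?St = "{..<n}" let ?U = "{vp, vc, vg, vx, vi, vss, vcnt}"
  note St = singletons(1)[OF n_pos]
  define I where "I x s \<longleftrightarrow> unch ?U {2, 3, 6} s0 s \<and> clk s \<le> clk s0 + 2 + x * (300 * n + 190) \<and> var s vp = x \<and>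
    cands ?St {x..<n} s" for x and s :: st
  have up: "cands ?St X (tick a (setv vp y s)) = cands ?St X s" for X a y s
    by (simp add: cands_def hits_ok_def counted_def)
  show ?thesis unfolding init_cands_def
  proof (rule wp_upto[where I = I])
    show e0: "var s0 0 = n" using e by (simp add: env_def)
    show "I 0 s" if "s = tick 2 (setv vp 0 s0)" for s
    proof -
      have "cands ?St {0..<n} s0" using ct by (simp add: cands_def)
      then show ?thesis unfolding that I_def up by simp
    qed
    show "var s 0 = n \<and> var s vp = x" if "I x s" for x s using that e0 by (auto simp: I_def unch_def)
    fix x s assume I: "I x s" and x: "x < n"
    let ?R = "\<lambda>s'. var s' vp = x \<and> I (Suc x) (tick 4 (setv vp (Suc x) s'))"
    have us: "unch ?U {2, 3, 6} s0 s" using I by (simp add: I_def)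
    have v: "var s vp = x" "var s 0 = n" using I e0 by (auto simp: I_def unch_def)
    have cd: "cands ?St {x..<n} (tick a s)" for a using I by (simp add: I_def cands_def hits_ok_def counted_def)
    have "WP (Ifte (Lt (Plus (V vp) (N 1)) (V 0)) (Set vc (V vp) ;; cand) Skip) ?R (tick 5 s)"
    proof (rule wp_Ifte)
      show "okC SS Bd (Lt (Plus (V vp) (N 1)) (V 0)) (tick 5 s)" using v x n_le_Bd by (simp add: TB_def)
      have c: "ccost (Lt (Plus (V vp) (N 1)) (V 0)) + 1 = 7" by simp
      show "WP (Set vc (V vp) ;; cand) ?R (tick (ccost (Lt (Plus (V vp) (N 1)) (V 0)) + 1) (tick 5 s))"
        if "holds (Lt (Plus (V vp) (N 1)) (V 0)) (tick 5 s)"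
        unfolding c
      proof (rule cand_step_wp[OF St])
        have u: "unch ?U {2, 3, 6} s0 (tick 7 (tick 5 s))" using us by simp
        show "env (tick 7 (tick 5 s))" by (rule env_unch[OF e u]) auto
        show "links ?St (tick 7 (tick 5 s))" by (rule links_unch[OF ln u]) auto
        show "labels ?St (tick 7 (tick 5 s))" by (rule labels_unch[OF lb u]) auto
        show "cands ?St {x..<n} (tick 7 (tick 5 s))" using cd[of 12] by (simp add: cands_def hits_ok_def counted_def)
        show "x \<in> ?St" "var (tick 7 (tick 5 s)) vp = x" "vp < TB" using x v by (auto simp: TB_def)
        show "nxt ?St x < n" using that v singletons(2)[OF x] by simp
        fix s' assume s': "unch {vc, vg, vx, vi, vss, vcnt} {2, 3, 6} (tick 7 (tick 5 s)) s'"
          "clk s' \<le> clk (tick 7 (tick 5 s)) + 300 * n + 160" "cands ?St ({x..<n} - {x}) s'"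
        have "{x..<n} - {x} = {Suc x..<n}" by auto
        then have "cands ?St {Suc x..<n} s'" using s'(3) by simp
        moreover have "unch ?U {2, 3, 6} s0 s'" using us s'(1) by (auto simp: unch_def)
        moreover have "clk s' + 4 \<le> clk s0 + 2 + Suc x * (300 * n + 190)" using s'(2) I by (simp add: I_def)
        ultimately show "?R s'" using s'(1) v unfolding I_def up by (auto simp: unch_def)
      qed
      show "WP Skip ?R (tick (ccost (Lt (Plus (V vp) (N 1)) (V 0)) + 1) (tick 5 s))"
        if "\<not> holds (Lt (Plus (V vp) (N 1)) (V 0)) (tick 5 s)"
      proof (rule wp_Skip)
        have nx: "Suc x = n" using that v x by simp
        then have "nxt ?St x = n" using singletons(2)[OF x] by simp
        then have "cands ?St {Suc x..<n} s" using cd[of 0] nx unfolding cands_def hits_ok_def counted_def by (auto simp: less_Suc_eq)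
        moreover have "clk s + 16 \<le> clk s0 + 2 + Suc x * (300 * n + 190)" using I by (simp add: I_def)
        ultimately show "?R (tick (ccost (Lt (Plus (V vp) (N 1)) (V 0)) + 1) (tick 5 s))"
          using us v unfolding I_def c by (simp add: cands_def hits_ok_def counted_def)
      qed
    qed
    then show "WP (Ifte (Lt (Plus (V vp) (N 1)) (V 0)) (Set vc (V vp) ;; cand) Skip) ?R (tick 5 s)" .
  next
    fix s assume I: "I n s"
    show "Q (tick 5 s)"
    proof (rule Q)
      show "unch ?U {2, 3, 6} s0 (tick 5 s)" using I by (simp add: I_def)
      have "n * (300 * n + 190) \<le> n * (300 * n + 200)" by simp
      then show "clk (tick 5 s) \<le> clk s0 + n * (300 * n + 200) + 20" using I unfolding I_def st_simps by linarith
      show "cands ?St {} (tick 5 s)" using I by (simp add: I_def cands_def hits_ok_def counted_def)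
    qed
  qed (auto simp: TB_def SR_def)
qed

end

section \<open>The complete merging procedure\<close>

context class_bounds begin

text \<open>The bound c has to admit the singleton classes of the initial division.\<close>

lemma c_pos: "1 \<le> c"
proof -
  have "card {0::nat} \<le> c"
    by (rule few_classes[OF singletons(1)[OF n_pos], of 0])
      (use n_pos singletons(3)[OF n_pos] hits_singletons[OF n_pos] in auto)
  then show ?thesis by simp
qed

definition solve_time :: nat where
  "solve_time = n * (step_time + 370 * n + 320) + 300 * n + 400"

lemma solve_wp:
  assumes e: "env s0" and m: "\<And>x y. x < n \<Longrightarrow> y < n \<Longrightarrow> arr s0 1 x y = m x y"
    and z: "\<And>x y. arr s0 2 x y = 0" "\<And>x y. arr s0 6 x y = 0"
    and Q: "\<And>s. clk s \<le> clk s0 + solve_time \<Longrightarrow>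
      (var s 0 = 1 \<and> (\<exists>es. fits_seq DD es {U} \<and> (\<forall>t<length es. arr s 0 (2 * t) 0 = vertex_index n (fst (es ! t)) \<and>
          arr s 0 (2 * t + 1) 0 = vertex_index n (snd (es ! t))))) \<or>
      (var s 0 = 0 \<and> (\<forall>Ps. \<not> D_sequence S d Ps)) \<Longrightarrow> Q s"
  shows "WP solve Q s0"
proof -
  let ?St = "{..<n}"
  note St = singletons(1)[OF n_pos]
  have small: "card (hits ?St (part ?St p)) \<le> maxhit" if "p < n" for p using hits_singletons[OF that] by simp
  have reps1: "card (reps ?St (\<lambda>x. x) p) = 1" if "p < n" for p using singletons(3)[OF that] by (simp add: reps_def)
  have e0: "var s0 0 = n" using e by (simp add: env_def)
  have nar: "narrow DD (division (\<lambda>x. x) (\<lambda>x. x))"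
    by (rule narrow_division[OF St valid_id valid_id]) (use reps1 c_pos few_bad[OF St _ small] in auto)
  show ?thesis unfolding solve_def
  proof (rule wp_Seq, rule init_parts_wp[OF e0])
    fix s1 assume s1: "unch {vx, vo} {4, 5} s0 s1" "clk s1 \<le> clk s0 + 70 * n + 20" "var s1 vo = 0"
      "\<And>x. x < n \<Longrightarrow> arr s1 4 x 0 = Suc x \<and> arr s1 5 x 0 = 1"
    have ev: "env s1" by (rule env_unch[OF e s1(1)]) auto
    have ln: "links ?St s1" using s1(4) singletons(2) by (simp add: links_def)
    have lb: "labels ?St s1"
      unfolding labels_def
    proof (intro ballI allI impI)
      fix p x assume p: "p \<in> ?St" and x: "x < n"
      have a: "arr s1 1 y p = m y p" if "y < n" for y using s1(1) m that p by (simp add: unch_def)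
      have "m x p < SS" using entry_less[OF x, of p] p by (simp add: SS_def)
      then show "arr s1 1 x p < SS \<and> (\<forall>y<n. arr s1 1 x p = arr s1 1 y p \<longleftrightarrow> row (part ?St p) x = row (part ?St p) y)"
        using a x p singletons(3)[of p] by (simp add: row_eq_iff)
    qed
    have ct: "counted ?St s1" using z s1(1) by (simp add: counted_def unch_def)
    show "WP (init_cands ;; main_loop ;; Ifte (Eq (V vp) (N 0)) (finish ;; Set 0 (N 1)) (Set 0 (N 0))) Q s1"
    proof (rule wp_Seq, rule init_cands_wp[OF ev ln lb ct])
      fix s2 let ?U = "{vp, vc, vg, vx, vi, vss, vcnt}"
      assume s2: "unch ?U {2, 3, 6} s1 s2" "clk s2 \<le> clk s1 + n * (300 * n + 200) + 20" "cands ?St {} s2"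
      have stt: "state ?St DD (\<lambda>x. x) [] s2"
      proof -
        have "nreps (\<lambda>x. x) = n" by (simp add: nreps_def)
        then show ?thesis using s2(1) s1(3,4) fits_seq_Nil[OF nar] valid_id by (auto simp: state_def out_def unch_def)
      qed
      have inv: "main_inv ?St (\<lambda>x. x) [] s2"
        unfolding main_inv_def
      proof (intro conjI ballI)
        show "env s2" by (rule env_unch[OF ev s2(1)]) auto
        show "links ?St s2" by (rule links_unch[OF ln s2(1)]) auto
        show "labels ?St s2" by (rule labels_unch[OF lb s2(1)]) auto
      qed (use St stt reps1 c_pos small s2(3) in auto)
      show "WP (main_loop ;; Ifte (Eq (V vp) (N 0)) (finish ;; Set 0 (N 1)) (Set 0 (N 0))) Q s2"
      proof (rule wp_Seq, rule main_loop_wp[OF inv])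
        fix s St f es
        assume I: "main_inv St f es s" and ck: "clk s \<le> clk s2 + n * (step_time + 70 * n + 120) + 70 * n + 150"
          and vp: "var s vp \<in> St" "nxt St (var s vp) = n"
          and stuck: "\<And>j. j \<in> St \<Longrightarrow> nxt St j < n \<Longrightarrow> maxhit < card (hits St (pair St j))"
        have St: "starts St" and v0: "var s 0 = n" and st: "state St DD f es s" using I by (auto simp: main_inv_def env_def)
        have ck': "clk s + 150 * n + 100 \<le> clk s0 + solve_time"
          using ck s2(2) s1(2) by (simp add: solve_time_def algebra_simps)
        have okc: "okC SS Bd (Eq (V vp) (N 0)) s" by (simp add: TB_def)
        have cc: "ccost (Eq (V vp) (N 0)) + 1 = 5" by simp
        show "WP (Ifte (Eq (V vp) (N 0)) (finish ;; Set 0 (N 1)) (Set 0 (N 0))) Q s"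
        proof (rule wp_Ifte[OF okc], unfold cc)
          assume "holds (Eq (V vp) (N 0)) s"
          then have z: "var s vp = 0" by simp
          then have "part St 0 = {0..<n}" using vp by (simp add: part_def)
          then have "{x. x < n \<and> f x = x} = reps St f 0" by (auto simp: reps_def)
          then have "nreps f \<le> c" using I z vp(1) unfolding nreps_def main_inv_def by simp
          moreover have "2 * c \<le> DD" by simp
          ultimately have D: "2 * nreps f \<le> DD" by linarith
          show "WP (finish ;; Set 0 (N 1)) Q (tick 5 s)"
          proof (rule wp_Seq, rule finish_wp[where f = f and St = St and D = DD and es = es])
            show "var (tick 5 s) 0 = n" using v0 by simp
            show "state St DD f es (tick 5 s)" using st by (simp add: state_def out_def)
            show "2 * nreps f \<le> DD" by (rule D)
            fix s' :: st and es' assume "clk s' \<le> clk (tick 5 s) + 150 * n + 60" "fits_seq DD es' {U}"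
              "\<And>t. t < length es' \<Longrightarrow> arr s' 0 (2 * t) 0 = vertex_index n (fst (es' ! t)) \<and> arr s' 0 (2 * t + 1) 0 = vertex_index n (snd (es' ! t))"
            then show "WP (Set 0 (N 1)) Q s'"
              using n_le_Bd ck' by (intro wp_Set Q) (auto simp: TB_def SR_def)
          qed
        next
          assume "\<not> holds (Eq (V vp) (N 0)) s"
          \<comment> \<open>\<open>vp\<close> is the last part, so a nonzero value means that at
            least two parts are left, none of which can be merged.\<close>
          then have "0 < var s vp" by simp
          then have "nxt St 0 \<le> var s vp" using nxt_props(4)[OF St, of 0 "var s vp"] St vp(1) by (simp add: starts_def)
          moreover have "var s vp < n" using St vp(1) by (auto simp: starts_def)
          ultimately have "nxt St 0 < n" by simp
          from stuck_no_D_sequence[OF St this] stuck have "\<not> D_sequence S d Ps" for Ps unfolding pair_def by blast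
          then show "WP (Set 0 (N 0)) Q (tick 5 s)"
            using ck' by (intro wp_Set Q) (auto simp: TB_def SR_def)
        qed
      qed
    qed
  qed
qed

end

section \<open>Bounds\<close>

text \<open>For d > 0 this is 2c(b + 1) with c = \<open>class_bound\<close> and b =
  \<open>maxhit\<close>, written out because it has to be a function of k and d alone. For d = 0 it
  is the same expression with c = 1 and b = 0.\<close>

definition seq_degree :: "nat \<Rightarrow> nat \<Rightarrow> nat" where
  "seq_degree k d = (if d = 0 then 2 else
     2 * (k ^ (k ^ (d + 1) + 1) + (k ^ (d + 1) + 1)) ^ (2 * (8 * d * (d + 1) + 5) + 1) * (8 * d * (d + 1) + 5 + 1))"

text \<open>Up to the factor k + 2, the logarithm of \<open>big\<close> is at most
  \<open>thr\<close>, hence exponential in d. Raising \<open>big\<close> to a power quadratic in d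
  multiplies this logarithm by a polynomial, which the inner exponential absorbs. The fourth power
  of d serves as a common bound of 1, d and d^2.\<close>

lemma seq_degree_le:
  assumes "1 \<le> d"
  shows "real (seq_degree k d) \<le> exp (exp ((3 * real k + 66) * real d ^ 4))"
proof -
  have le_exp: "x \<le> exp x" for x :: real using exp_ge_add_one_self[of x] by linarith
  define L where "L = real d ^ 4"
  have d1: "1 \<le> real d" using assms by simp
  have L: "1 \<le> L" "real d \<le> L" "real d ^ 2 \<le> L"
    unfolding L_def using d1 power_increasing[of 1 4 "real d"] power_increasing[of 2 4 "real d"] one_le_power[of "real d" 4] by auto
  define thr where "thr = k ^ (d + 1) + 1"
  define big where "big = k ^ thr + thr"
  define h where "h = 8 * d * (d + 1) + 5"
  have thr1: "1 \<le> real thr" by (simp add: thr_def)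
  have two: "2 \<le> exp (1::real)" using exp_ge_add_one_self[of 1] by simp
  have pw: "real k ^ j \<le> exp (real k * real j)" for j
  proof -
    have "real k ^ j \<le> exp (real k) ^ j" by (rule power_mono[OF le_exp]) simp
    then show ?thesis by (simp add: exp_of_nat2_mult)
  qed
  have thr: "real thr \<le> exp ((1 + 2 * real k) * L)"
  proof -
    have "real thr = real k ^ (d + 1) + 1" by (simp add: thr_def)
    moreover have "1 \<le> exp (real k * real (d + 1))" by simp
    ultimately have "real thr \<le> 2 * exp (real k * real (d + 1))" using pw[of "d + 1"] by linarith
    also have "\<dots> \<le> exp 1 * exp (real k * real (d + 1))" using two by (intro mult_right_mono) auto
    also have "\<dots> = exp (1 + real k * real (d + 1))" by (simp add: exp_add)
    also have "1 + real k * real (d + 1) \<le> L + real k * (2 * L)" using L by (intro add_mono mult_left_mono) auto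
    then have "exp (1 + real k * real (d + 1)) \<le> exp ((1 + 2 * real k) * L)" by (simp add: algebra_simps)
    finally show ?thesis .
  qed
  have big: "real big \<le> exp ((real k + 2) * real thr)"
  proof -
    have "real big \<le> exp (real k * real thr) + exp (real thr)" using pw[of thr] le_exp[of "real thr"] by (simp add: big_def)
    also have "\<dots> \<le> exp ((real k + 1) * real thr) + exp ((real k + 1) * real thr)"
      by (intro add_mono) (use thr1 in \<open>auto simp: algebra_simps\<close>)
    also have "\<dots> \<le> exp 1 * exp ((real k + 1) * real thr)" using mult_right_mono[OF two, of "exp ((real k + 1) * real thr)"] by simp
    also have "\<dots> = exp (1 + (real k + 1) * real thr)" by (simp add: exp_add)
    also have "\<dots> \<le> exp ((real k + 2) * real thr)" using thr1 by (simp add: algebra_simps)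
    finally show ?thesis .
  qed
  let ?z = "(real k + 2) * real thr"
  have z1: "1 \<le> ?z"
    using mult_mono[of 1 "real k + 2" 1 "real thr"] thr1 by simp
  have "real (seq_degree k d) = 2 * real big ^ (2 * h + 1) * (real h + 1)"
    unfolding seq_degree_def big_def thr_def h_def using assms by simp
  also have "\<dots> \<le> exp 1 * exp ?z ^ (2 * h + 1) * exp (real h)"
    using two big exp_ge_add_one_self[of "real h"] by (intro mult_mono power_mono) (auto simp: add.commute)
  also have "\<dots> = exp (1 + ?z * real (2 * h + 1) + real h)" by (simp only: exp_add exp_of_nat2_mult)
  also have "\<dots> \<le> exp (?z * real (3 * h + 2))"
  proof -
    have "1 + real h \<le> ?z * (1 + real h)" using mult_right_mono[OF z1, of "1 + real h"] by simp
    then have "1 + ?z * real (2 * h + 1) + real h \<le> ?z * real (3 * h + 2)" by (simp add: algebra_simps)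
    then show ?thesis by simp
  qed
  \<comment> \<open>The constant is a sum of three exponents: k + 1 for the factor k + 2, then 1 +
    2k for \<open>thr\<close>, and 64 for 3h + 2 = 24d^2 + 24d + 17.\<close>
  also have "?z * real (3 * h + 2) \<le> exp ((3 * real k + 66) * L)"
  proof -
    have k2: "real k + 2 \<le> exp (real k + 1)" using exp_ge_add_one_self[of "real k + 1"] by simp
    have h2: "real (3 * h + 2) \<le> exp (64 * L)"
    proof -
      have "real (3 * h + 2) = 24 * real d ^ 2 + 24 * real d + 17" by (simp add: h_def algebra_simps power2_eq_square)
      also have "\<dots> \<le> 64 * L + 1" using L by linarith
      also have "\<dots> \<le> exp (64 * L)" using exp_ge_add_one_self[of "64 * L"] by linarith
      finally show ?thesis .
    qed
    have "?z * real (3 * h + 2) \<le> exp (real k + 1) * exp ((1 + 2 * real k) * L) * exp (64 * L)"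
      using k2 thr h2 by (intro mult_mono) auto
    also have "\<dots> = exp (real k + 1 + (1 + 2 * real k) * L + 64 * L)" by (simp only: exp_add)
    also have "\<dots> \<le> exp ((3 * real k + 66) * L)"
      using mult_left_mono[OF L(1), of "real k + 1"] by (simp add: algebra_simps)
    finally show ?thesis .
  qed
  finally show ?thesis unfolding L_def by simp
qed

context twin_width_input begin

definition class_bound :: nat where "class_bound = big ^ (2 * maxhit + 1)"

lemma seq_degree_eq: "seq_degree k d = (if d = 0 then 2 else 2 * class_bound * (maxhit + 1))"
  by (simp add: seq_degree_def class_bound_def big_def thr_def maxhit_def)

definition total :: nat where
  "total = 4000 + 400 * maxhit + 2 * class_bound * (110 + 600 * class_bound) + 20 * d + 20 * thr"

text \<open>For the second bound: a part with at least \<open>thr\<close> distinct rows contains a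
  mark, so the bad parts are among the hit ones.\<close>

lemma class_bounds_general: "class_bounds n k d m M class_bound maxhit"
proof unfold_locales
  fix St p X
  assume a: "starts St" "p \<in> St" "card (hits St (part St p)) \<le> maxhit" "X \<subseteq> part St p"
    "\<And>x x'. x \<in> X \<Longrightarrow> x' \<in> X \<Longrightarrow> x \<noteq> x' \<Longrightarrow> apart St p x x'"
  show "card X \<le> class_bound"
    unfolding class_bound_def by (rule card_distinguished_reps[OF a(1-4)]) (use a(5) in \<open>auto simp: apart_def\<close>)
next
  fix St i assume a: "starts St" "i \<in> St" "card (hits St (part St i)) \<le> maxhit"
  have "{j \<in> St. thr \<le> rows (part St i) (part St j)} \<subseteq> hits St (part St i)"
    using unhit_rows[OF a(1)] by (auto simp: not_le[symmetric])
  moreover have "finite (hits St (part St i))" by (simp add: hits_def)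
  ultimately show "card {j \<in> St. thr \<le> rows (part St i) (part St j)} \<le> maxhit"
    using a(3) card_mono le_trans by blast
qed

text \<open>Rows of a constant matrix are never apart, so pairwise distinguished rows number at most
  one; and one distinct row per part stays below \<open>thr\<close>.\<close>

lemma class_bounds_constant:
  assumes const: "\<forall>x<n. \<forall>y<n. m x y = m 0 0"
  shows "class_bounds n k d m M 1 0"
proof unfold_locales
  fix St p X
  assume a: "starts St" "p \<in> St" "X \<subseteq> part St p"
    "\<And>x x'. x \<in> X \<Longrightarrow> x' \<in> X \<Longrightarrow> x \<noteq> x' \<Longrightarrow> apart St p x x'"
  have "x = x'" if x: "x \<in> X" "x' \<in> X" for x x'
  proof (rule ccontr)
    assume "x \<noteq> x'"
    from a(4)[OF x this] obtain w where w: "w < n" "m x w \<noteq> m x' w" by (auto simp: apart_def good_cols_def)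
    moreover have "x < n" "x' < n" using x a(3) part_less[OF a(1,2)] by auto
    ultimately have "m x w = m 0 0" "m x' w = m 0 0" using const by blast+
    then show False using w(2) by simp
  qed
  then have "X = {} \<or> (\<exists>x. X = {x})" by blast
  then show "card X \<le> 1" by auto
next
  fix St i assume a: "starts St" "i \<in> St"
  have "rows (part St i) (part St j) < thr" if j: "j \<in> St" for j
  proof -
    have "row (part St i) x = row (part St i) j" if "x \<in> part St j" for x
      unfolding row_eq_iff
    proof
      fix y assume "y \<in> part St i"
      then have y: "y < n" by (rule part_less[OF a])
      have "x < n" "j < n" using that part_less[OF a(1) j] self_in_part[OF a(1) j] by auto
      then have "m x y = m 0 0" "m j y = m 0 0" using const y by blast+
      then show "m x y = m j y" by simp
    qed
    then have "row (part St i) ` part St j \<subseteq> {row (part St i) j}" by blast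
    then have "rows (part St i) (part St j) \<le> card {row (part St i) j}" unfolding rows_def by (rule card_mono[rotated]) simp
    then show ?thesis using thr_ge2 by simp
  qed
  then have "{j \<in> St. thr \<le> rows (part St i) (part St j)} = {}" by (auto simp: not_le)
  then show "card {j \<in> St. thr \<le> rows (part St i) (part St j)} \<le> 0" by (simp only: card.empty)
qed

definition answers :: "nat \<Rightarrow> st \<Rightarrow> bool" where
  "answers D s \<longleftrightarrow>
     var s 0 = 1 \<and> (\<exists>es. fits_seq D es {U} \<and> (\<forall>t<length es. arr s 0 (2 * t) 0 = vertex_index n (fst (es ! t)) \<and>
        arr s 0 (2 * t + 1) 0 = vertex_index n (snd (es ! t)))) \<or>
     var s 0 = 0 \<and> (\<forall>Ps. \<not> D_sequence S d Ps)"

lemma class_bound_pos: "1 \<le> class_bound"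
  using big_bounds(1) thr_ge2 by (simp add: class_bound_def)

text \<open>As n is at least 1, every lower-order term is bounded by its coefficient times n^2.
  There are at most n rounds, each linear in n.\<close>

lemma step_time_le:
  assumes "c \<le> class_bound" "class_bounds n k d m M c b"
  shows "class_bounds.solve_time n d c + n * (80 * n + 30) + 20 * d + 20 * thr + 250 \<le> n * n * total"
proof -
  interpret class_bounds n k d m M c b by (rule assms(2))
  have n1: "1 \<le> n" using n_pos by simp
  have nn: "n \<le> n * n" "1 \<le> n * n" using n1 by auto
  define Z where "Z = 1000 + maxhit * 400 + 2 * c * (60 + 2 * c * 300 + 50) + 1000"
  have Z': "Z \<le> 2000 + 400 * maxhit + 2 * class_bound * (110 + 600 * class_bound)"
  proof -
    have "c * (60 + 2 * c * 300 + 50) \<le> class_bound * (60 + 2 * class_bound * 300 + 50)"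
      using assms(1) by (intro mult_le_mono) auto
    then show ?thesis by (simp add: Z_def algebra_simps)
  qed
  have st: "step_time \<le> n * Z"
  proof -
    have 1: "maxhit * (300 * n + 100) \<le> n * (maxhit * 400)"
    proof -
      have "maxhit * (300 * n + 100) \<le> maxhit * (400 * n)" using n1 by (intro mult_le_mono) auto
      then show ?thesis by (simp add: ac_simps)
    qed
    have "2 * c * (100 * n + 200) \<le> 2 * c * (300 * n)" using n1 by (intro mult_le_mono) auto
    moreover have "n * (60 + 2 * c * 300 + 50) = 60 * n + 2 * c * (300 * n) + 50 * n" by (simp add: algebra_simps)
    ultimately have "60 * n + 2 * c * (100 * n + 200) + 50 \<le> n * (60 + 2 * c * 300 + 50)" using n1 by linarith
    then have "2 * c * (60 * n + 2 * c * (100 * n + 200) + 50) \<le> 2 * c * (n * (60 + 2 * c * 300 + 50))" by (intro mult_le_mono) auto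
    also have "\<dots> = n * (2 * c * (60 + 2 * c * 300 + 50))" by (simp only: ac_simps)
    finally have 2: "2 * c * (60 * n + 2 * c * (100 * n + 200) + 50) \<le> n * (2 * c * (60 + 2 * c * 300 + 50))" .
    have "step_time \<le> n * 1000 + n * (maxhit * 400) + n * (2 * c * (60 + 2 * c * 300 + 50)) + n * 1000"
      unfolding step_time_def using 1 2 n1 by linarith
    then show ?thesis unfolding Z_def by (simp only: distrib_left)
  qed
  have a: "n * step_time \<le> n * n * Z" using st by (simp add: mult.assoc)
  have b: "20 * d + 20 * thr \<le> n * n * (20 * d + 20 * thr)" using nn(2) by simp
  have "solve_time + n * (80 * n + 30) + 20 * d + 20 * thr + 250 =
      n * step_time + 450 * (n * n) + 650 * n + 650 + (20 * d + 20 * thr)"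
    unfolding solve_time_def by (simp add: algebra_simps)
  also have "\<dots> \<le> n * n * Z + 450 * (n * n) + 650 * (n * n) + 650 * (n * n) + n * n * (20 * d + 20 * thr)"
    using a b nn by linarith
  also have "\<dots> = n * n * (Z + 1750 + (20 * d + 20 * thr))" by (simp add: algebra_simps)
  also have "\<dots> \<le> n * n * total" using Z' by (intro mult_le_mono) (auto simp: total_def)
  finally show ?thesis .
qed

lemma whole_wp:
  assumes v: "var s0 0 = n" "var s0 1 = k" "var s0 2 = d"
    and inp: "\<And>x y. x < n \<Longrightarrow> y < n \<Longrightarrow> arr s0 0 (x * n + y) 0 = m x y"
    and z: "\<And>x y. arr s0 2 x y = 0" "\<And>x y. arr s0 6 x y = 0"
  shows "WP whole (\<lambda>s. clk s \<le> clk s0 + n * n * total \<and> answers (seq_degree k d) s) s0"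
  unfolding whole_def
proof (rule wp_Seq, rule params_wp[OF v])
  let ?Q = "\<lambda>s. clk s \<le> clk s0 + n * n * total \<and> answers (seq_degree k d) s"
  let ?const = "\<forall>x<n. \<forall>y<n. m x y = m 0 0"
  fix s1 assume s1: "unch {vx, vy, vthr, vbig, vmax} {} s0 s1" "clk s1 \<le> clk s0 + 20 * d + 20 * thr + 150" "env s1"
  show "WP (copy_input ;; Ifte (Lt (V 2) (V vres)) (Set 0 (N 0)) solve) ?Q s1"
  proof (rule wp_Seq, rule copy_input_wp)
    show "var s1 0 = n" using s1(3) by (simp add: env_def)
    show "arr s1 0 (x * n + y) 0 = m x y" if "x < n" "y < n" for x y using s1(1) inp[OF that] by (simp add: unch_def)
    fix s assume s: "unch {vx, vy, vz, vres} {1} s1 s" "clk s \<le> clk s1 + n * (80 * n + 30) + 20"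
      and m: "\<And>x y. x < n \<Longrightarrow> y < n \<Longrightarrow> arr s 1 x y = m x y"
      and res: "var s vres = 0 \<and> ?const \<or> var s vres = 1 \<and> \<not> ?const"
    have u: "unch {vx, vy, vz, vres, vthr, vbig, vmax} {1} s0 s" using s1(1) s(1) by (auto simp: unch_def)
    have v2: "var s 2 = d" using u v(3) by (simp add: unch_def)
    have ck: "clk s + 70 \<le> clk s0 + (n * (80 * n + 30) + 20 * d + 20 * thr + 250)" using s(2) s1(2) by simp
    have cc: "ccost (Lt (V 2) (V vres)) + 1 = 5" by simp
    have run: "WP solve ?Q (tick 5 s)"
      if cb: "class_bounds n k d m M c b" and c: "c \<le> class_bound" "2 * c * (b + 1) = seq_degree k d" for c b
    proof -
      interpret class_bounds n k d m M c b by (rule cb)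
      show ?thesis
      proof (rule solve_wp)
        have "env s" by (rule env_unch[OF s1(3) s(1)]) auto
        then show "env (tick 5 s)" by (simp add: env_def)
        show "arr (tick 5 s) 1 x y = m x y" if "x < n" "y < n" for x y using m that by simp
        show "arr (tick 5 s) 2 x y = 0" "arr (tick 5 s) 6 x y = 0" for x y using z u by (simp_all add: unch_def)
        fix s' :: st assume "clk s' \<le> clk (tick 5 s) + solve_time" and a: "(var s' 0 = 1 \<and> (\<exists>es. fits_seq (2 * c * (b + 1)) es {U} \<and> (\<forall>t<length es. arr s' 0 (2 * t) 0 = vertex_index n (fst (es ! t)) \<and>
          arr s' 0 (2 * t + 1) 0 = vertex_index n (snd (es ! t))))) \<or>
          (var s' 0 = 0 \<and> (\<forall>Ps. \<not> D_sequence S d Ps))"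
        then have "clk s' \<le> clk s0 + n * n * total" using ck step_time_le[OF c(1) cb] by simp
        then show "?Q s'" using a unfolding c(2) by (simp add: answers_def)
      qed
    qed
    show "WP (Ifte (Lt (V 2) (V vres)) (Set 0 (N 0)) solve) ?Q s"
    proof (rule wp_Ifte, unfold cc)
      show "okC SS Bd (Lt (V 2) (V vres)) s" by (simp add: TB_def)
      assume "holds (Lt (V 2) (V vres)) s"
      then have "d = 0" and nc: "\<not> ?const" using v2 res by auto
      then have no: "\<forall>Ps. \<not> D_sequence S d Ps" using zero_sequence_constant by blast
      have an: "answers (seq_degree k d) (tick a (setv 0 0 (tick 5 s)))" for a unfolding answers_def using no by simp
      have "clk s + 10 \<le> clk s0 + n * n * total"
        using ck step_time_le[OF order_refl class_bounds_general] by linarith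
      then show "WP (Set 0 (N 0)) ?Q (tick 5 s)"
        by (intro wp_Set) (use an in \<open>simp_all add: TB_def SR_def\<close>)
    next
      assume h: "\<not> holds (Lt (V 2) (V vres)) s"
      show "WP solve ?Q (tick 5 s)"
      proof (cases "d = 0")
        case True
        then have "var s vres \<noteq> 1" using h v2 by simp
        then have ?const using res by blast
        then show ?thesis by (rule run[OF class_bounds_constant class_bound_pos]) (unfold seq_degree_eq, use True in simp)
      next
        case False
        then show ?thesis by (intro run[OF class_bounds_general order_refl]) (simp add: seq_degree_eq)
      qed
    qed
  qed
qed

text \<open>The largest words are addresses of order \<open>Bd * SS\<close>. \<open>Bd\<close> is at
  most w(n + 1)^2 and \<open>SS\<close> at most w(n + 1), which explains both the square of w here
  and the cubic power of n + 1 in the bound on words.\<close>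

definition word_bound :: nat where
  "word_bound = (let w = k + big + maxhit + 60 in 8 * (w * w + w) + 8)"

lemma fits_word_bound:
  assumes "W = real word_bound * (real n + 1) ^ 3"
  shows "fits SS Bd W" "real Bd \<le> W"
proof -
  define w where "w = k + big + maxhit + 60"
  have w: "word_bound = 8 * (w * w + w) + 8" by (simp add: word_bound_def w_def Let_def)
  have W: "W = real (word_bound * (n + 1) ^ 3)" by (simp add: assms add.commute)
  have p: "(n + 1) ^ 2 \<le> (n + 1) ^ 3" "n + 1 \<le> (n + 1) ^ 3" "1 \<le> (n + 1) ^ 3"
    using power_increasing[of 2 3 "n + 1"] power_increasing[of 1 3 "n + 1"] by auto
  have b: "Bd \<le> w * (n + 1) ^ 2"
  proof -
    define v where "v = k + big + maxhit + 50"
    have "Bd = n * n + 10 * n + v" by (simp add: Bd_def v_def)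
    also have "\<dots> \<le> (10 + v) * (n * n + 2 * n + 1)" by (simp add: algebra_simps)
    also have "\<dots> = w * (n + 1) ^ 2" by (simp add: w_def v_def power2_eq_square algebra_simps)
    finally show ?thesis .
  qed
  have s: "SS \<le> w * (n + 1)"
  proof -
    have "SS \<le> n + w" by (simp add: SS_def w_def)
    also have "\<dots> \<le> w * (n + 1)" by (simp add: w_def)
    finally show ?thesis .
  qed
  have "Bd * SS \<le> (w * (n + 1) ^ 2) * (w * (n + 1))" using b s by (rule mult_le_mono)
  also have "\<dots> = w * w * (n + 1) ^ 3" by (simp only: power2_eq_square power3_eq_cube ac_simps)
  finally have bs: "Bd * SS \<le> w * w * (n + 1) ^ 3" .
  have s3: "SS \<le> w * (n + 1) ^ 3" using s mult_le_mono2[OF p(2), of w] by linarith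
  have eq: "word_bound * (n + 1) ^ 3 = 8 * (w * w * (n + 1) ^ 3 + w * (n + 1) ^ 3) + 8 * (n + 1) ^ 3"
    unfolding w by (simp only: distrib_right mult.assoc)
  have le: "8 * (Bd * SS + SS) + 8 \<le> word_bound * (n + 1) ^ 3" unfolding eq
    by (intro add_le_mono mult_le_mono2 bs s3) (use p(3) in simp)
  have "Bd \<le> w * (n + 1) ^ 3" using b mult_le_mono2[OF p(1), of w] by linarith
  moreover have "x \<le> 8 * (y + x) + z" for x y z :: nat by simp
  ultimately have le2: "Bd \<le> word_bound * (n + 1) ^ 3" unfolding eq by (rule le_trans)
  show "real Bd \<le> W" unfolding W using le2 by (simp only: of_nat_le_iff)
  then show "fits SS Bd W" unfolding fits_def using le W by (metis of_nat_le_iff)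
qed

end

section \<open>The machine\<close>

text \<open>A negative parameter is rejected before the structured program starts.\<close>

definition machine :: program where
  "machine = [Add SR 0 1, Jump_less 2 4 (csize whole + 3)] @ compC whole 2 @ [Jump (csize whole + 4), Const 0 0]"

lemma machine_code:
  "length machine = csize whole + 4" "code_at machine 0 (Add SR 0 1 # Jump_less 2 4 (csize whole + 3) # [])"
  "code_at machine 2 (compC whole 2)" "code_at machine (csize whole + 2) (Jump (csize whole + 4) # Const 0 0 # [])"
proof -
  show "length machine = csize whole + 4" by (simp add: machine_def)
  have "code_at machine 0 machine" unfolding code_at_def by (intro exI[of _ "[]"]) simp
  then have "code_at machine 0 ([Add SR 0 1, Jump_less 2 4 (csize whole + 3)] @ compC whole 2 @ [Jump (csize whole + 4), Const 0 0])"
    by (subst (asm) (2) machine_def)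
  then show "code_at machine 0 (Add SR 0 1 # Jump_less 2 4 (csize whole + 3) # [])"
    "code_at machine 2 (compC whole 2)" "code_at machine (csize whole + 2) (Jump (csize whole + 4) # Const 0 0 # [])"
    by (auto simp del: append_Cons append_Nil simp: numeral_2_eq_2 add.commute)
qed

text \<open>The first instruction computes the row length n + k. Register 4 still has its initial
  value 0, so the second one tests d < 0 and in that case jumps to the final \<open>Const\<close>,
  which writes the report that the twin-width is larger.\<close>

lemma machine_start:
  assumes "words_bounded W (input_config k code M d)" "M \<in> carrier_mat n n" "real n + real k \<le> W"
  obtains c where "reach machine W 2 (input_config k code M d) c" "pc c = (if d < 0 then csize whole + 3 else 2)"
    "mem c = mem (input_config k code M d)" "reg c = (reg (input_config k code M d))(SR := int n + int k)"
proof -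
  let ?c0 = "input_config k code M d"
  let ?c1 = "?c0\<lparr>pc := 1, reg := (reg ?c0)(SR := int n + int k)\<rparr>"
  let ?c2 = "?c1\<lparr>pc := if d < 0 then csize whole + 3 else 2\<rparr>"
  note cd = machine_code(2)[unfolded code_at_Cons]
  have w1: "words_bounded W ?c1" by (rule words_bounded_reg[OF assms(1)]) (use assms(3) in simp)
  have r: "reg ?c0 0 = int n" "reg ?c0 1 = int k" "reg ?c0 2 = d" "reg ?c0 4 = 0" "pc ?c0 = 0"
    using assms(2) by (auto simp: input_config_def)
  have 1: "reach machine W (Suc 0) ?c0 ?c1"
    by (rule reach_Suc[OF reach_refl[OF assms(1)] _ _ w1]) (use cd r in auto)
  have "reach machine W (Suc (Suc 0)) ?c0 ?c2"
    by (rule reach_Suc[OF 1]) (use cd r w1 in \<open>auto simp: SR_def words_bounded_def\<close>)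
  then show thesis by (intro that[of ?c2]) (auto simp: numeral_2_eq_2)
qed

lemma machine_negative:
  assumes "words_bounded W (input_config k code M d)" "M \<in> carrier_mat n n" "real n + real k \<le> W" "d < 0"
  shows "\<exists>c. reach machine W 3 (input_config k code M d) c \<and> halted machine c \<and> reports_larger c"
proof -
  obtain c where c: "reach machine W 2 (input_config k code M d) c" "pc c = csize whole + 3"
    by (rule machine_start[OF assms(1-3)]) (use assms(4) in auto)
  have cd: "code_at machine (pc c) (Const 0 0 # [])" using machine_code(4) c(2) by (simp add: code_at_Cons numeral_3_eq_3 numeral_2_eq_2)
  have "0 \<le> W" using assms(3) by (smt (verit) of_nat_0_le_iff)
  then obtain c' where c': "reach machine W (Suc 2) (input_config k code M d) c'" "c' = c\<lparr>pc := pc c + 1, reg := (reg c)(0 := 0)\<rparr>"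
    using reach_instr[OF c(1) cd, of 0 0] by auto
  show ?thesis using c' c(2) machine_code(1) by (intro exI[of _ c']) (auto simp: halted_def reports_larger_def numeral_3_eq_3 numeral_2_eq_2)
qed

context twin_width_input begin

lemma machine_nonnegative:
  assumes code: "\<And>x y. x < n \<Longrightarrow> y < n \<Longrightarrow> m x y = code (M $$ (x, y))"
    and W: "W = real word_bound * (real n + 1) ^ 3"
  shows "\<exists>t c. t \<le> n * n * total + 3 \<and> reach machine W t (input_config k code M (int d)) c \<and> halted machine c \<and>
    (reports_larger c \<and> d < twin_width S \<or> (\<exists>Ps. outputs_sequence M c Ps \<and> D_sequence S (seq_degree k d) Ps))"
proof -
  let ?c0 = "input_config k code M (int d)"
  note fw = fits_word_bound[OF W]
  have entry: "code (M $$ (a div n, a mod n)) < k" "m (a div n) (a mod n) = code (M $$ (a div n, a mod n))" if "a < n * n" for a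
  proof -
    have "a div n < n" "a mod n < n" using that n_pos by (auto simp: less_mult_imp_div_less)
    then show "code (M $$ (a div n, a mod n)) < k" "m (a div n) (a mod n) = code (M $$ (a div n, a mod n))"
      using code entry_less by metis+
  qed
  have small: "n + k \<le> Bd" "d \<le> Bd" using SS_le_Bd by (auto simp: SS_def Bd_def maxhit_def)
  have lW: "real x \<le> W" if "x \<le> Bd" for x using fw(2) that by (meson le_trans of_nat_le_iff order_trans)
  have wb: "words_bounded W ?c0"
    unfolding words_bounded_def
  proof (intro conjI allI)
    show "real_of_int \<bar>reg ?c0 r\<bar> \<le> W" for r using lW[of n] lW[of k] lW[of d] lW[of 0] small by (simp add: input_config_def)
    fix a
    show "real_of_int \<bar>mem ?c0 a\<bar> \<le> W"
    proof (cases "0 \<le> a \<and> a < int (n * n)")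
      case True
      then have "nat a < n * n" by (simp add: nat_less_iff)
      then have "code (M $$ (nat a div n, nat a mod n)) \<le> Bd" using entry(1)[of "nat a"] small by linarith
      then show ?thesis using True lW by (simp add: input_config_def)
    next
      case False
      then have "mem ?c0 a = 0" by (auto simp: input_config_def simp del: of_nat_mult)
      then show ?thesis using lW[of 0] by simp
    qed
  qed
  obtain c2 where c2: "reach machine W 2 ?c0 c2" "pc c2 = 2" "mem c2 = mem ?c0" "reg c2 = (reg ?c0)(SR := int n + int k)"
    by (rule machine_start[OF wb carrier]) (use lW[OF small(1)] in auto)
  define s0 :: st where "s0 = \<lparr>var = (\<lambda>v. if v = 0 then n else if v = 1 then k else if v = 2 then d else if v = SR then SS else 0),
     arr = (\<lambda>a i j. if a = 0 \<and> i < n * n then code (M $$ (i div n, i mod n)) else 0), clk = 0\<rparr>"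
  have sim: "simst SS W s0 c2"
    unfolding simst_def
  proof (intro conjI allI impI)
    show "words_bounded W c2" by (rule reach_wb[OF c2(1)])
    show "reg c2 v = int (var s0 v)" if "v < TB" for v
      unfolding c2(4) by (auto simp: input_config_def s0_def SR_def SS_def)
    show "reg c2 SR = int SS" by (simp add: c2(4) SS_def)
    fix a i j assume a: "a < 8" and j: "j < width SS a"
    show "mem c2 (addr SS a i j) = int (arr s0 a i j)"
    proof (cases "a = 0")
      case True
      then show ?thesis unfolding c2(3) by (auto simp: input_config_def s0_def addr_def simp del: of_nat_mult)
    next
      case False
      define X where "X = int i * int SS + int j"
      have "0 \<le> X" "0 < int a" using False by (simp_all add: X_def)
      moreover have "addr SS a i j = X * (-8) + - int a" using False by (simp add: addr_def X_def)
      ultimately have "addr SS a i j < 0" by linarith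
      then show ?thesis using False unfolding c2(3) by (simp add: input_config_def s0_def)
    qed
  qed
  have "WP whole (\<lambda>s. clk s \<le> clk s0 + n * n * total \<and> answers (seq_degree k d) s) s0"
  proof (rule whole_wp)
    fix x y assume x: "x < n" and y: "y < n"
    have "x * n + n \<le> n * n" using x by (metis Suc_leI add.commute mult_Suc mult_le_mono1)
    then have "x * n + y < n * n" using y by simp
    then show "arr s0 0 (x * n + y) 0 = m x y" using x y code by (simp add: s0_def)
  qed (auto simp: s0_def SR_def)
  then obtain s where s: "exec SS Bd whole s0 s" "clk s \<le> n * n * total" "answers (seq_degree k d) s"
    by (auto simp: wp_def s0_def)
  obtain t c where c: "reach machine W t c2 c" "simst SS W s c" "pc c = 2 + csize whole" "t \<le> clk s"
    using compC_sim[OF s(1) sim fw(1), of machine] machine_code(3) c2(2) by auto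
  have "code_at machine (pc c) (Jump (csize whole + 4) # Const 0 0 # [])" using machine_code(4) c(3) by (simp add: add.commute)
  then obtain c' where c': "reach machine W (Suc (2 + t)) ?c0 c'" "simst SS W s c'" "pc c' = csize whole + 4"
    by (rule reach_jump[OF reach_trans[OF c2(1) c(1)] c(2)]) auto
  have r0: "reg c' 0 = int (var s 0)" using c'(2) by (simp add: simst_def TB_def)
  have mm: "mem c' (int i) = int (arr s 0 i 0)" for i
  proof -
    have "mem c' (addr SS 0 i 0) = int (arr s 0 i 0)" using c'(2) unfolding simst_def by (simp add: width_def)
    then show ?thesis by (simp add: addr_def)
  qed
  have "reports_larger c' \<and> d < twin_width S \<or> (\<exists>Ps. outputs_sequence M c' Ps \<and> D_sequence S (seq_degree k d) Ps)"
    using s(3) unfolding answers_def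
  proof (elim disjE conjE exE)
    assume "var s 0 = 0" "\<forall>Ps. \<not> D_sequence S d Ps"
    then show ?thesis using r0 twin_width_greater by (auto simp: reports_larger_def)
  next
    fix es assume 1: "var s 0 = 1" and es: "fits_seq (seq_degree k d) es {U}"
      and ar: "\<forall>t<length es. arr s 0 (2 * t) 0 = vertex_index n (fst (es ! t)) \<and> arr s 0 (2 * t + 1) 0 = vertex_index n (snd (es ! t))"
    have "mem c' (2 * int t) = int (vertex_index n (fst (es ! t))) \<and> mem c' (2 * int t + 1) = int (vertex_index n (snd (es ! t)))"
      if "t < length es" for t
      using ar that mm[of "2 * t"] mm[of "2 * t + 1"] by (simp add: add.commute)
    then have "outputs_sequence M c' (merge_sequence ((\<lambda>v. {v}) ` U) es)"
      unfolding outputs_sequence_def using 1 r0 es by (auto simp: fits_seq_def)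
    then show ?thesis using fits_seq_D_sequence[OF es] by blast
  qed
  moreover have "halted machine c'" using c'(3) machine_code(1) by (simp add: halted_def)
  moreover have "Suc (2 + t) \<le> n * n * total + 3" using c(4) s(2) by simp
  ultimately show ?thesis using c'(1) by blast
qed

end
theorem theorem11:
  shows "\<exists>(p :: program) (e :: nat) (T :: nat \<Rightarrow> int \<Rightarrow> real) (W :: nat \<Rightarrow> int \<Rightarrow> real)
      (K :: nat \<Rightarrow> real) (D :: nat \<Rightarrow> int \<Rightarrow> nat).
    (\<forall>k d. real (D k d) \<le> exp (exp (exp (K k * real_of_int d ^ 4)))) \<and>
    (\<forall>(A :: nat set) (code :: nat \<Rightarrow> nat) (n :: nat) (M :: nat mat) (d :: int).
       finite A \<longrightarrow> bij_betw code A {..<card A} \<longrightarrow>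
       1 \<le> n \<longrightarrow> M \<in> carrier_mat n n \<longrightarrow> elements_mat M \<subseteq> A \<longrightarrow> transpose_mat M = M \<longrightarrow>
       (\<exists>t :: nat.
          real t \<le> T (card A) d * real n ^ 2 * log 2 (real n + 1) \<and>
          (\<forall>s\<le>t. words_bounded (W (card A) d * (real n + 1) ^ e)
                     (run p s (input_config (card A) code M d))) \<and>
          halted p (run p t (input_config (card A) code M d)) \<and>
          (reports_larger (run p t (input_config (card A) code M d)) \<and>
             d < int (twin_width (matrix_structure M)) \<or>
           (\<exists>Ps. outputs_sequence M (run p t (input_config (card A) code M d)) Ps \<and>
                 D_sequence (matrix_structure M) (D (card A) d) Ps))))"
proof -
  \<comment> \<open>For negative d the answer is always that the twin-width is larger, so no
    sequence has to meet this degree.\<close>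
  let ?D = "\<lambda>k (d::int). if d < 0 then 0 else seq_degree k (nat d)"
  let ?K = "\<lambda>k::nat. 3 * real k + 66"
  let ?T = "\<lambda>k (d::int). if d < 0 then 3 else real (twin_width_input.total k (nat d)) + 3"
  \<comment> \<open>For negative d the words only have to hold the input and the row length n +
    k.\<close>
  let ?W = "\<lambda>k (d::int). if d < 0 then real k + real_of_int \<bar>d\<bar> + 2 else real (twin_width_input.word_bound k (nat d))"
  have degree: "real (?D k d) \<le> exp (exp (exp (?K k * real_of_int d ^ 4)))" for k and d :: int
  proof -
    consider "d < 0" | "d = 0" | "1 \<le> nat d" "d = int (nat d)" by linarith
    then show ?thesis
    proof cases
      \<comment> \<open>At d = 0 the bound is exp(exp 1) for every size of the alphabet.\<close>
      case 2
      have "2 \<le> exp (exp (1::real))"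
        using exp_ge_add_one_self[of "1::real"] exp_ge_add_one_self[of "exp (1::real)"] by linarith
      then show ?thesis using 2 by (simp add: seq_degree_def)
    next
      case 3
      have "real (?D k d) \<le> exp (exp (?K k * real (nat d) ^ 4))" using seq_degree_le[OF 3(1)] 3(2) by simp
      also have "\<dots> \<le> exp (exp (exp (?K k * real (nat d) ^ 4)))"
        by (intro exp_le_cancel_iff[THEN iffD2]) (use exp_ge_add_one_self[of "?K k * real (nat d) ^ 4"] in linarith)
      also have "real (nat d) = real_of_int d" using 3(1) by simp
      finally show ?thesis .
    qed simp
  qed
  show ?thesis
  proof (rule exI[of _ machine], rule exI[of _ 3], rule exI[of _ ?T], rule exI[of _ ?W], rule exI[of _ ?K],
      rule exI[of _ ?D], intro conjI allI impI)
    show "real (?D k d) \<le> exp (exp (exp (?K k * real_of_int d ^ 4)))" for k d by (rule degree)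
    fix A :: "nat set" and code n and M :: "nat mat" and d :: int
    assume A: "finite A" "bij_betw code A {..<card A}" and n: "1 \<le> n" and M: "M \<in> carrier_mat n n"
      "elements_mat M \<subseteq> A" "transpose_mat M = M"
    let ?k = "card A"
    let ?c0 = "input_config ?k code M d"
    have inA: "M $$ (x, y) \<in> A" if "x < n" "y < n" for x y
      using M that by (auto intro: elements_matI)
    have codeA: "code (M $$ (x, y)) < ?k" if "x < n" "y < n" for x y
      using bij_betwE[OF A(2)] inA[OF that] by auto
    have n3: "1 \<le> (real n + 1) ^ 3" "real n \<le> (real n + 1) ^ 3"
      using one_le_power[of "real n + 1" 3] power_increasing[of 1 3 "real n + 1"] by auto
    obtain t c where t: "reach machine (?W ?k d * (real n + 1) ^ 3) t ?c0 c" "halted machine c"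
        "real t \<le> real n ^ 2 * ?T ?k d"
        "reports_larger c \<and> d < int (twin_width (matrix_structure M)) \<or>
          (\<exists>Ps. outputs_sequence M c Ps \<and> D_sequence (matrix_structure M) (?D ?k d) Ps)"
    proof (cases "d < 0")
      case True
      let ?B = "?W ?k d * (real n + 1) ^ 3"
      have B: "real n + real ?k + real_of_int \<bar>d\<bar> \<le> ?B"
      proof -
        define X where "X = (real n + 1) ^ 3"
        define a where "a = real ?k + real_of_int \<bar>d\<bar>"
        have X: "1 \<le> X" "real n \<le> X" using n3 by (simp_all add: X_def)
        have "a * 1 \<le> a * X" using X(1) by (intro mult_left_mono) (auto simp: a_def)
        then have "real n + a \<le> (a + 2) * X" using X by (simp add: distrib_right)
        then show ?thesis using True unfolding a_def X_def by simp
      qed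
      have "words_bounded ?B ?c0"
        unfolding words_bounded_def
      proof (intro conjI allI)
        show "real_of_int \<bar>reg ?c0 r\<bar> \<le> ?B" for r using B M(1) by (auto simp: input_config_def)
        fix a
        show "real_of_int \<bar>mem ?c0 a\<bar> \<le> ?B"
        proof (cases "0 \<le> a \<and> a < int (n * n)")
          case True
          then have "nat a < n * n" by (simp add: nat_less_iff)
          then have "nat a div n < n" "nat a mod n < n" using n by (auto simp: less_mult_imp_div_less)
          from codeA[OF this] have "real (code (M $$ (nat a div n, nat a mod n))) \<le> real ?k" by simp
          then have "real (code (M $$ (nat a div n, nat a mod n))) \<le> ?B" using B by linarith
          moreover have "mem ?c0 a = int (code (M $$ (nat a div n, nat a mod n)))" using True M(1) by (auto simp: input_config_def)
          ultimately show ?thesis by simp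
        next
          case False
          then have "mem ?c0 a = 0" using M(1) by (auto simp: input_config_def simp del: of_nat_mult)
          then show ?thesis using B by linarith
        qed
      qed
      moreover have "real n + real ?k \<le> ?B" using B by linarith
      ultimately obtain c where "reach machine ?B 3 ?c0 c" "halted machine c" "reports_larger c"
        using machine_negative[OF _ M(1) _ True] by blast
      moreover have "1 \<le> real n ^ 2" using n by (simp add: one_le_power)
      ultimately show thesis using True by (intro that[of 3 c]) auto
    next
      case False
      define m where "m x y = code (M $$ (x, y))" for x y
      interpret twin_width_input n ?k "nat d" m M
      proof unfold_locales
        show "0 < n" using n by simp
        show "m x y < ?k" if "x < n" "y < n" for x y using codeA[OF that] by (simp add: m_def)
        show "m x y = m y x" if "x < n" "y < n" for x y
          using index_transpose_mat(1)[of y M x] M that by (simp add: m_def)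
        show "M \<in> carrier_mat n n" by (rule M(1))
        show "(m x y = m x' y') = (M $$ (x, y) = M $$ (x', y'))" if "x < n" "y < n" "x' < n" "y' < n" for x y x' y'
          unfolding m_def by (rule inj_on_eq_iff[OF bij_betw_imp_inj_on[OF A(2)]]) (use inA that in auto)
      qed
      have d: "int (nat d) = d" using False by simp
      obtain t c where t: "t \<le> n * n * total + 3" "reach machine (?W ?k d * (real n + 1) ^ 3) t ?c0 c" "halted machine c"
        and r: "reports_larger c \<and> nat d < twin_width S \<or> (\<exists>Ps. outputs_sequence M c Ps \<and> D_sequence S (seq_degree ?k (nat d)) Ps)"
        using machine_nonnegative[of code "?W ?k d * (real n + 1) ^ 3"] False unfolding d by (auto simp: m_def)
      have "1 \<le> n * n" using n by simp
      then have "t \<le> n * n * (total + 3)" using t(1) unfolding distrib_left by linarith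
      then have "real t \<le> real (n * n * (total + 3))" by (rule of_nat_mono)
      also have "\<dots> = real n ^ 2 * ?T ?k d" using False by (simp add: power2_eq_square)
      finally have "real t \<le> real n ^ 2 * ?T ?k d" .
      then show thesis using t(2,3) r False by (intro that[of t c]) auto
    qed
    \<comment> \<open>The running time is quadratic; since n is at least 1, the logarithmic factor
      is at least 1.\<close>
    have log: "1 \<le> log 2 (real n + 1)" using n by (simp add: le_log_iff)
    have "0 \<le> real n ^ 2 * ?T ?k d" using t(3) by (meson of_nat_0_le_iff order_trans)
    then have "real n ^ 2 * ?T ?k d * 1 \<le> real n ^ 2 * ?T ?k d * log 2 (real n + 1)" using log by (rule mult_left_mono[rotated])
    then have time: "real t \<le> ?T ?k d * real n ^ 2 * log 2 (real n + 1)" using t(3) by (simp add: mult.commute)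
    have rt: "run machine t ?c0 = c" "\<forall>s\<le>t. words_bounded (?W ?k d * (real n + 1) ^ 3) (run machine s ?c0)"
      using t(1) by (auto simp: reach_def)
    show "\<exists>t. real t \<le> ?T ?k d * real n ^ 2 * log 2 (real n + 1) \<and>
        (\<forall>s\<le>t. words_bounded (?W ?k d * (real n + 1) ^ 3) (run machine s ?c0)) \<and> halted machine (run machine t ?c0) \<and>
        (reports_larger (run machine t ?c0) \<and> d < int (twin_width (matrix_structure M)) \<or>
          (\<exists>Ps. outputs_sequence M (run machine t ?c0) Ps \<and> D_sequence (matrix_structure M) (?D ?k d) Ps))"
      using time rt t(2,4) by blast
  qed
qed

end
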